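(* Let $(R,\mathfrak m)$ be a Gorenstein local ring of dimension $d\ge1$ with infinite residue field, let $I$ be an $\mathfrak m$-primary ideal such that the associated graded ring $G_I(R)=\bigoplus_{n\ge0}I^n/I^{n+1}$ is Cohen-Macaulay, and let $M$ be a maximal Cohen-Macaulay $R$-module. Let $x\in I\setminus I^2$ be an $R$-superficial element with respect to $I$. Then $$\Phi^I(M)\ \ge\ \Phi^{I/(x)}(M/xM).$$
   Context: An element $x\in I$ is $R$-superficial with respect to $I$ if there is $c\ge0$ with $(I^{n+1}:_R x)\cap I^c=I^n$ for all $n\ge c$. Convention: $I^j=R$ for $j\le0$. The reduction number $r$ of $I$ is the least integer $r\ge0$ with $I^{r+1}=QI^r$ for a minimal reduction $Q$ of $I$ (independent of $Q$ since $G_I(R)$ is Cohen-Macaulay; in dimension $0$, $Q=0$). Define $$\Phi^I(M)=\sum_{j=0}^{d}\sum_{n=0}^{r-1}\binom{d}{j}\,\ell\left(\operatorname{Ext}^j_R(M,R/I^{\,n+1-j})\right).$$ $\Phi^{I/(x)}(M/xM)$ is defined in the same way over the Gorenstein ring $R/(x)$ of dimension $d-1$ (sum over $0\le j\le d-1$ with binomials $\binom{d-1}{j}$, and the ideal $I/(x)$, whose reduction number is again $r$). *)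

theory Defs
  imports
    "HOL-Algebra.Ideal_Product"
    "HOL-Algebra.QuotRing"
    "HOL-Algebra.Module"
    "HOL-Algebra.Ring_Divisibility"
    "HOL-Library.FuncSet"
    "HOL-Library.Extended_Nat"
begin

section \<open>Modules\<close>

text \<open>
  The record type of modules extends that of rings, so every module carries the fields
  \<open>mult\<close> and \<open>one\<close>. They have no meaning for modules and are filled arbitrarily below.
\<close>

definition module_hom ::
  "('a, 'r) ring_scheme \<Rightarrow> ('a, 'b, 'm) module_scheme \<Rightarrow> ('a, 'c, 'n) module_scheme \<Rightarrow> ('b \<Rightarrow> 'c) set"
  where "module_hom R M N =
    {f \<in> carrier M \<rightarrow> carrier N.
      (\<forall>u\<in>carrier M. \<forall>v\<in>carrier M. f (u \<oplus>\<^bsub>M\<^esub> v) = f u \<oplus>\<^bsub>N\<^esub> f v) \<and>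
      (\<forall>a\<in>carrier R. \<forall>v\<in>carrier M. f (a \<odot>\<^bsub>M\<^esub> v) = a \<odot>\<^bsub>N\<^esub> f v)}"

definition module_span :: "('a, 'r) ring_scheme \<Rightarrow> ('a, 'b, 'm) module_scheme \<Rightarrow> 'b set \<Rightarrow> 'b set"
  where "module_span R M S = \<Inter>{N. submodule N R M \<and> S \<subseteq> N}"

definition finitely_generated :: "('a, 'r) ring_scheme \<Rightarrow> ('a, 'b, 'm) module_scheme \<Rightarrow> bool"
  where "finitely_generated R M \<longleftrightarrow>
    (\<exists>A. finite A \<and> A \<subseteq> carrier M \<and> module_span R M A = carrier M)"

definition regular_module :: "('a, 'r) ring_scheme \<Rightarrow> ('a, 'a) module"
  where "regular_module R =
    \<lparr>carrier = carrier R, monoid.mult = monoid.mult R, one = one R, zero = zero R, add = add R,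
     smult = monoid.mult R\<rparr>"

definition quotient_module ::
  "('a, 'r) ring_scheme \<Rightarrow> ('a, 'b, 'm) module_scheme \<Rightarrow> 'b set \<Rightarrow> ('a, 'b set) module"
  where "quotient_module R M N =
    \<lparr>carrier = a_rcosets\<^bsub>M\<^esub> N, monoid.mult = (\<lambda>X Y. N), one = N, zero = N, add = set_add M,
     smult = (\<lambda>a X. \<Union>v\<in>X. N +>\<^bsub>M\<^esub> (a \<odot>\<^bsub>M\<^esub> v))\<rparr>"

text \<open>The submodule \<open>JM\<close> of \<open>M\<close>, for an ideal \<open>J\<close>.\<close>

definition ideal_smult ::
  "('a, 'r) ring_scheme \<Rightarrow> 'a set \<Rightarrow> ('a, 'b, 'm) module_scheme \<Rightarrow> 'b set"
  where "ideal_smult R J M = module_span R M {a \<odot>\<^bsub>M\<^esub> v | a v. a \<in> J \<and> v \<in> carrier M}"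

text \<open>\<open>M/JM\<close> as a module over the ring \<open>R/J\<close> (not over \<open>R\<close>).\<close>

definition reduced_module ::
  "('a, 'r) ring_scheme \<Rightarrow> 'a set \<Rightarrow> ('a, 'b, 'm) module_scheme \<Rightarrow> ('a set, 'b set) module"
  where "reduced_module R J M = (let N = ideal_smult R J M in
    \<lparr>carrier = a_rcosets\<^bsub>M\<^esub> N, monoid.mult = (\<lambda>X Y. N), one = N, zero = N, add = set_add M,
     smult = (\<lambda>A X. \<Union>a\<in>A. \<Union>v\<in>X. N +>\<^bsub>M\<^esub> (a \<odot>\<^bsub>M\<^esub> v))\<rparr>)"

definition module_length :: "('a, 'r) ring_scheme \<Rightarrow> ('a, 'b, 'm) module_scheme \<Rightarrow> enat"
  where "module_length R M = Sup {enat n | n. \<exists>N.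
    (\<forall>i\<le>n. submodule (N i) R M) \<and> (\<forall>i<n. N i \<subset> N (Suc i))}"


section \<open>Ext\<close>

text \<open>Homomorphisms are made extensional, so that equal maps are equal elements of Hom.\<close>

definition Hom_module ::
  "('a, 'r) ring_scheme \<Rightarrow> ('a, 'b, 'm) module_scheme \<Rightarrow> ('a, 'c, 'n) module_scheme
    \<Rightarrow> ('a, 'b \<Rightarrow> 'c) module"
  where "Hom_module R M N =
    \<lparr>carrier = module_hom R M N \<inter> extensional (carrier M),
     monoid.mult = (\<lambda>f g. f), one = (\<lambda>v\<in>carrier M. \<zero>\<^bsub>N\<^esub>),
     zero = (\<lambda>v\<in>carrier M. \<zero>\<^bsub>N\<^esub>),
     add = (\<lambda>f g. \<lambda>v\<in>carrier M. f v \<oplus>\<^bsub>N\<^esub> g v),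
     smult = (\<lambda>a f. \<lambda>v\<in>carrier M. a \<odot>\<^bsub>N\<^esub> f v)\<rparr>"

definition free_module :: "('a, 'r) ring_scheme \<Rightarrow> nat \<Rightarrow> ('a, nat \<Rightarrow> 'a) module"
  where "free_module R n =
    \<lparr>carrier = {..<n} \<rightarrow>\<^sub>E carrier R,
     monoid.mult = (\<lambda>u v. u), one = (\<lambda>i\<in>{..<n}. \<zero>\<^bsub>R\<^esub>),
     zero = (\<lambda>i\<in>{..<n}. \<zero>\<^bsub>R\<^esub>),
     add = (\<lambda>u v. \<lambda>i\<in>{..<n}. u i \<oplus>\<^bsub>R\<^esub> v i),
     smult = (\<lambda>a u. \<lambda>i\<in>{..<n}. a \<otimes>\<^bsub>R\<^esub> u i)\<rparr>"

text \<open>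
  A resolution \<open>\<dots> \<rightarrow> R\<^sup>b\<^sup>2 \<rightarrow> R\<^sup>b\<^sup>1 \<rightarrow> R\<^sup>b\<^sup>0 \<rightarrow> M \<rightarrow> 0\<close> by free modules of finite rank, with differentials
  \<open>D i : R\<^sup>b\<^sup>(\<^sup>i\<^sup>+\<^sup>1\<^sup>) \<rightarrow> R\<^sup>b\<^sup>i\<close> and augmentation \<open>e\<close>. One exists for every finitely generated module
  over a Noetherian ring.
\<close>

definition free_resolution ::
  "('a, 'r) ring_scheme \<Rightarrow> ('a, 'b, 'm) module_scheme
    \<Rightarrow> (nat \<Rightarrow> nat) \<Rightarrow> (nat \<Rightarrow> (nat \<Rightarrow> 'a) \<Rightarrow> (nat \<Rightarrow> 'a)) \<Rightarrow> ((nat \<Rightarrow> 'a) \<Rightarrow> 'b) \<Rightarrow> bool"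
  where "free_resolution R M b D e \<longleftrightarrow>
    (let F = (\<lambda>i. free_module R (b i)) in
      e \<in> module_hom R (F 0) M \<and>
      (\<forall>i. D i \<in> module_hom R (F (Suc i)) (F i)) \<and>
      e ` carrier (F 0) = carrier M \<and>
      D 0 ` carrier (F 1) = a_kernel (F 0) M e \<and>
      (\<forall>i. D (Suc i) ` carrier (F (Suc (Suc i))) = a_kernel (F (Suc i)) (F i) (D i)))"

text \<open>The \<open>j\<close>-th cohomology module of the complex obtained by applying \<open>Hom(_, N)\<close>.\<close>

definition cocycles ::
  "('a, 'r) ring_scheme \<Rightarrow> (nat \<Rightarrow> nat) \<Rightarrow> (nat \<Rightarrow> (nat \<Rightarrow> 'a) \<Rightarrow> (nat \<Rightarrow> 'a))
    \<Rightarrow> ('a, 'c, 'n) module_scheme \<Rightarrow> nat \<Rightarrow> ((nat \<Rightarrow> 'a) \<Rightarrow> 'c) set"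
  where "cocycles R b D N j =
    {f \<in> carrier (Hom_module R (free_module R (b j)) N).
      \<forall>v\<in>carrier (free_module R (b (Suc j))). f (D j v) = \<zero>\<^bsub>N\<^esub>}"

primrec coboundaries ::
  "('a, 'r) ring_scheme \<Rightarrow> (nat \<Rightarrow> nat) \<Rightarrow> (nat \<Rightarrow> (nat \<Rightarrow> 'a) \<Rightarrow> (nat \<Rightarrow> 'a))
    \<Rightarrow> ('a, 'c, 'n) module_scheme \<Rightarrow> nat \<Rightarrow> ((nat \<Rightarrow> 'a) \<Rightarrow> 'c) set"
  where
    "coboundaries R b D N 0 = {\<zero>\<^bsub>Hom_module R (free_module R (b 0)) N\<^esub>}"
  | "coboundaries R b D N (Suc j) =
      (\<lambda>f. \<lambda>v\<in>carrier (free_module R (b (Suc j))). f (D j v)) `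
        carrier (Hom_module R (free_module R (b j)) N)"

definition cohomology_module ::
  "('a, 'r) ring_scheme \<Rightarrow> (nat \<Rightarrow> nat) \<Rightarrow> (nat \<Rightarrow> (nat \<Rightarrow> 'a) \<Rightarrow> (nat \<Rightarrow> 'a))
    \<Rightarrow> ('a, 'c, 'n) module_scheme \<Rightarrow> nat \<Rightarrow> ('a, ((nat \<Rightarrow> 'a) \<Rightarrow> 'c) set) module"
  where "cohomology_module R b D N j =
    quotient_module R
      (Hom_module R (free_module R (b j)) N \<lparr>carrier := cocycles R b D N j\<rparr>)
      (coboundaries R b D N j)"

text \<open>
  \<open>Ext\<^sup>j(M, N)\<close> for a finitely generated module \<open>M\<close> over a Noetherian ring, computed from some
  resolution; up to isomorphism it does not depend on the choice.
\<close>

definition Ext ::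
  "('a, 'r) ring_scheme \<Rightarrow> nat \<Rightarrow> ('a, 'b, 'm) module_scheme \<Rightarrow> ('a, 'c, 'n) module_scheme
    \<Rightarrow> ('a, ((nat \<Rightarrow> 'a) \<Rightarrow> 'c) set) module"
  where "Ext R j M N =
    (let (b, D, e) = (SOME (b, D, e). free_resolution R M b D e) in cohomology_module R b D N j)"


section \<open>Local rings, dimension and depth\<close>

definition local_ring :: "('a, 'r) ring_scheme \<Rightarrow> bool"
  where "local_ring R \<longleftrightarrow> cring R \<and> (\<exists>!\<mm>. maximalideal \<mm> R)"

definition max_ideal :: "('a, 'r) ring_scheme \<Rightarrow> 'a set"
  where "max_ideal R = (THE \<mm>. maximalideal \<mm> R)"

definition krull_dim :: "('a, 'r) ring_scheme \<Rightarrow> enat"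
  where "krull_dim R = Sup {enat n | n. \<exists>P.
    (\<forall>i\<le>n. primeideal (P i) R) \<and> (\<forall>i<n. P i \<subset> P (Suc i))}"

definition annihilator :: "('a, 'r) ring_scheme \<Rightarrow> ('a, 'b, 'm) module_scheme \<Rightarrow> 'a set"
  where "annihilator R M = {a \<in> carrier R. \<forall>v\<in>carrier M. a \<odot>\<^bsub>M\<^esub> v = \<zero>\<^bsub>M\<^esub>}"

definition module_dim :: "('a, 'r) ring_scheme \<Rightarrow> ('a, 'b, 'm) module_scheme \<Rightarrow> enat"
  where "module_dim R M = krull_dim (R Quot annihilator R M)"

text \<open>
  Each \<open>x\<^sub>i\<close> is a nonzerodivisor on \<open>M/(x\<^sub>1,\<dots>,x\<^sub>i\<^sub>-\<^sub>1)M\<close> (spelled out on representatives), and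
  \<open>M/(x\<^sub>1,\<dots>,x\<^sub>k)M\<close> is nonzero.
\<close>

definition regular_sequence ::
  "('a, 'r) ring_scheme \<Rightarrow> ('a, 'b, 'm) module_scheme \<Rightarrow> 'a list \<Rightarrow> bool"
  where "regular_sequence R M xs \<longleftrightarrow>
    set xs \<subseteq> carrier R \<and>
    (\<forall>i<length xs. let N = ideal_smult R (Idl\<^bsub>R\<^esub> (set (take i xs))) M in
      \<forall>v\<in>carrier M. (xs ! i) \<odot>\<^bsub>M\<^esub> v \<in> N \<longrightarrow> v \<in> N) \<and>
    ideal_smult R (Idl\<^bsub>R\<^esub> (set xs)) M \<noteq> carrier M"

definition module_depth :: "('a, 'r) ring_scheme \<Rightarrow> ('a, 'b, 'm) module_scheme \<Rightarrow> enat"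
  where "module_depth R M =
    Sup {enat (length xs) | xs. set xs \<subseteq> max_ideal R \<and> regular_sequence R M xs}"


section \<open>Cohen--Macaulay modules and rings\<close>

text \<open>For modules over Noetherian local rings; the zero module is excluded.\<close>

definition cohen_macaulay_module :: "('a, 'r) ring_scheme \<Rightarrow> ('a, 'b, 'm) module_scheme \<Rightarrow> bool"
  where "cohen_macaulay_module R M \<longleftrightarrow>
    module R M \<and> finitely_generated R M \<and> carrier M \<noteq> {\<zero>\<^bsub>M\<^esub>} \<and>
    module_depth R M = module_dim R M"

definition maximal_cohen_macaulay_module ::
  "('a, 'r) ring_scheme \<Rightarrow> ('a, 'b, 'm) module_scheme \<Rightarrow> bool"
  where "maximal_cohen_macaulay_module R M \<longleftrightarrow>
    cohen_macaulay_module R M \<and> module_dim R M = krull_dim R"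

text \<open>\<open>fraction R S a s\<close> is the element \<open>a/s\<close> of the localization of \<open>R\<close> at \<open>S\<close>.\<close>

definition fraction :: "('a, 'r) ring_scheme \<Rightarrow> 'a set \<Rightarrow> 'a \<Rightarrow> 'a \<Rightarrow> ('a \<times> 'a) set"
  where "fraction R S a s =
    {(b, t). b \<in> carrier R \<and> t \<in> S \<and>
      (\<exists>u\<in>S. u \<otimes>\<^bsub>R\<^esub> (a \<otimes>\<^bsub>R\<^esub> t \<ominus>\<^bsub>R\<^esub> b \<otimes>\<^bsub>R\<^esub> s) = \<zero>\<^bsub>R\<^esub>)}"

definition localization :: "('a, 'r) ring_scheme \<Rightarrow> 'a set \<Rightarrow> ('a \<times> 'a) set ring"
  where "localization R S =
    \<lparr>carrier = {fraction R S a s | a s. a \<in> carrier R \<and> s \<in> S},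
     monoid.mult = (\<lambda>X Y. \<Union>(a, s)\<in>X. \<Union>(b, t)\<in>Y. fraction R S (a \<otimes>\<^bsub>R\<^esub> b) (s \<otimes>\<^bsub>R\<^esub> t)),
     one = fraction R S \<one>\<^bsub>R\<^esub> \<one>\<^bsub>R\<^esub>,
     zero = fraction R S \<zero>\<^bsub>R\<^esub> \<one>\<^bsub>R\<^esub>,
     add = (\<lambda>X Y. \<Union>(a, s)\<in>X. \<Union>(b, t)\<in>Y.
       fraction R S (a \<otimes>\<^bsub>R\<^esub> t \<oplus>\<^bsub>R\<^esub> b \<otimes>\<^bsub>R\<^esub> s) (s \<otimes>\<^bsub>R\<^esub> t))\<rparr>"

text \<open>A Noetherian ring, not necessarily local, all of whose localizations at maximal ideals are
  Cohen--Macaulay.\<close>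

definition cohen_macaulay_ring :: "('a, 'r) ring_scheme \<Rightarrow> bool"
  where "cohen_macaulay_ring R \<longleftrightarrow>
    cring R \<and> noetherian_ring R \<and>
    (\<forall>\<mm>. maximalideal \<mm> R \<longrightarrow>
      (let R\<mm> = localization R (carrier R - \<mm>)
       in cohen_macaulay_module R\<mm> (regular_module R\<mm>)))"


section \<open>Gorenstein local rings\<close>

text \<open>
  Injectivity is the lifting property along monomorphisms \<open>f : A \<rightarrow> B\<close>, where \<open>A\<close>, \<open>B\<close> range over
  the modules on the type of \<open>E\<close>. It is used below for modules on \<open>nat \<Rightarrow> 'a\<close> over a ring on
  \<open>'a\<close>. All ideals of \<open>R\<close>, and \<open>R\<close> itself, have copies there, so by Baer's criterion this is
  injectivity with respect to arbitrary modules.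
\<close>

definition injective_module :: "('a, 'r) ring_scheme \<Rightarrow> ('a, 'u) module \<Rightarrow> bool"
  where "injective_module R E \<longleftrightarrow>
    module R E \<and>
    (\<forall>(A :: ('a, 'u) module) (B :: ('a, 'u) module) f g.
      module R A \<and> module R B \<and>
      f \<in> module_hom R A B \<and> inj_on f (carrier A) \<and> g \<in> module_hom R A E \<longrightarrow>
      (\<exists>h\<in>module_hom R B E. \<forall>v\<in>carrier A. h (f v) = g v))"

text \<open>
  The ring has a finite injective resolution
  \<open>0 \<rightarrow> R \<rightarrow> E\<^sub>0 \<rightarrow> E\<^sub>1 \<rightarrow> \<dots> \<rightarrow> E\<^sub>n \<rightarrow> 0\<close> as a module over itself.
  The type \<open>nat \<Rightarrow> 'a\<close> is large enough: over a nonzero Noetherian ring \<open>R\<close> each term of the minimal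
  injective resolution of \<open>R\<close> has cardinality at most the maximum of the cardinality of \<open>R\<close> and
  that of the natural numbers.
\<close>

definition finite_injective_dimension :: "('a, 'r) ring_scheme \<Rightarrow> bool"
  where "finite_injective_dimension R \<longleftrightarrow>
    (\<exists>(E :: nat \<Rightarrow> ('a, nat \<Rightarrow> 'a) module) \<eta> D n.
      (\<forall>i. injective_module R (E i)) \<and>
      (\<forall>i>n. carrier (E i) = {\<zero>\<^bsub>E i\<^esub>}) \<and>
      \<eta> \<in> module_hom R (regular_module R) (E 0) \<and>
      inj_on \<eta> (carrier R) \<and>
      (\<forall>i. D i \<in> module_hom R (E i) (E (Suc i))) \<and>
      \<eta> ` carrier R = a_kernel (E 0) (E 1) (D 0) \<and>
      (\<forall>i. D i ` carrier (E i) = a_kernel (E (Suc i)) (E (Suc (Suc i))) (D (Suc i))))"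

definition gorenstein_local_ring :: "('a, 'r) ring_scheme \<Rightarrow> bool"
  where "gorenstein_local_ring R \<longleftrightarrow>
    local_ring R \<and> noetherian_ring R \<and> finite_injective_dimension R"


section \<open>Powers, associated graded ring, superficial elements, reductions\<close>

text \<open>In particular, the zeroth power is the unit ideal \<open>carrier R\<close>.\<close>

abbreviation ideal_power :: "('a, 'r) ring_scheme \<Rightarrow> 'a set \<Rightarrow> nat \<Rightarrow> 'a set"
  where "ideal_power R I n \<equiv> I [^]\<^bsub>ideals_set R\<^esub> n"

definition radical :: "('a, 'r) ring_scheme \<Rightarrow> 'a set \<Rightarrow> 'a set"
  where "radical R I = {a \<in> carrier R. \<exists>n::nat. a [^]\<^bsub>R\<^esub> n \<in> I}"

definition primary_ideal :: "('a, 'r) ring_scheme \<Rightarrow> 'a set \<Rightarrow> bool"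
  where "primary_ideal R I \<longleftrightarrow>
    ideal I R \<and> I \<noteq> carrier R \<and>
    (\<forall>a\<in>carrier R. \<forall>b\<in>carrier R. a \<otimes>\<^bsub>R\<^esub> b \<in> I \<longrightarrow> a \<in> I \<or> b \<in> radical R I)"

text \<open>
  Elements are the finitely supported families \<open>f\<close> with \<open>f n \<in> I\<^sup>n/I\<^sup>n\<^sup>+\<^sup>1\<close>, i.e. \<open>f n\<close> is a coset of
  \<open>I\<^sup>n\<^sup>+\<^sup>1\<close> contained in \<open>I\<^sup>n\<close>. The product is computed on representatives and is independent of
  their choice.
\<close>

definition associated_graded :: "('a, 'r) ring_scheme \<Rightarrow> 'a set \<Rightarrow> (nat \<Rightarrow> 'a set) ring"
  where "associated_graded R I =
    \<lparr>carrier = {f. (\<forall>n. \<exists>a\<in>ideal_power R I n. f n = ideal_power R I (Suc n) +>\<^bsub>R\<^esub> a) \<and>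
                   finite {n. f n \<noteq> ideal_power R I (Suc n)}},
     monoid.mult = (\<lambda>f g n. ideal_power R I (Suc n) +>\<^bsub>R\<^esub>
       (\<Oplus>\<^bsub>R\<^esub>i\<in>{..n}. (SOME a. a \<in> f i) \<otimes>\<^bsub>R\<^esub> (SOME b. b \<in> g (n - i)))),
     one = (\<lambda>n. ideal_power R I (Suc n) +>\<^bsub>R\<^esub> (if n = 0 then \<one>\<^bsub>R\<^esub> else \<zero>\<^bsub>R\<^esub>)),
     zero = (\<lambda>n. ideal_power R I (Suc n)),
     add = (\<lambda>f g n. f n <+>\<^bsub>R\<^esub> g n)\<rparr>"

definition superficial :: "('a, 'r) ring_scheme \<Rightarrow> 'a set \<Rightarrow> 'a \<Rightarrow> bool"
  where "superficial R I x \<longleftrightarrow>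
    x \<in> I \<and>
    (\<exists>c. \<forall>n\<ge>c. {a \<in> carrier R. a \<otimes>\<^bsub>R\<^esub> x \<in> ideal_power R I (n + 1)} \<inter> ideal_power R I c
      = ideal_power R I n)"

definition reduction :: "('a, 'r) ring_scheme \<Rightarrow> 'a set \<Rightarrow> 'a set \<Rightarrow> bool"
  where "reduction R I Q \<longleftrightarrow>
    ideal Q R \<and> Q \<subseteq> I \<and>
    (\<exists>n. ideal_power R I (n + 1) = ideal_prod R Q (ideal_power R I n))"

definition minimal_reduction :: "('a, 'r) ring_scheme \<Rightarrow> 'a set \<Rightarrow> 'a set \<Rightarrow> bool"
  where "minimal_reduction R I Q \<longleftrightarrow>
    reduction R I Q \<and> (\<forall>Q'. reduction R I Q' \<and> Q' \<subseteq> Q \<longrightarrow> Q' = Q)"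

definition reduction_number :: "('a, 'r) ring_scheme \<Rightarrow> 'a set \<Rightarrow> nat"
  where "reduction_number R I = (LEAST r.
    \<exists>Q. minimal_reduction R I Q \<and>
      ideal_power R I (r + 1) = ideal_prod R Q (ideal_power R I r))"


section \<open>The invariant \<open>\<Phi>\<close>\<close>

text \<open>
  Truncated subtraction in the exponent implements the convention \<open>I\<^sup>j = R\<close> for \<open>j \<le> 0\<close>.
\<close>

definition Phi :: "('a, 'r) ring_scheme \<Rightarrow> 'a set \<Rightarrow> ('a, 'b, 'm) module_scheme \<Rightarrow> enat"
  where "Phi R I M =
    (let d = the_enat (krull_dim R); r = reduction_number R I in
      \<Sum>j\<in>{0..d}. \<Sum>n\<in>{0..<r}. of_nat (d choose j) *
        module_length R
          (Ext R j M (quotient_module R (regular_module R) (ideal_power R I (n + 1 - j)))))"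

definition image_ideal :: "('a, 'r) ring_scheme \<Rightarrow> 'a set \<Rightarrow> 'a set \<Rightarrow> 'a set set"
  where "image_ideal R J I = (\<lambda>a. J +>\<^bsub>R\<^esub> a) ` I"

end

theory Submission
  imports Defs
begin

text \<open>
  Write \<open>A = R/(x)\<close>. Since the associated graded ring is
  Cohen--Macaulay, the initial form of a superficial \<open>x\<close> is regular on it, so \<open>I\<^sup>k : x = I\<^sup>k\<^sup>-\<^sup>1\<close> for
  all \<open>k\<close>. Hence \<open>x\<close> is regular on \<open>R\<close>, and multiplication by \<open>x\<close> gives an exact sequence
  \<open>0 \<rightarrow> R/I\<^sup>k\<^sup>-\<^sup>1 \<rightarrow> R/I\<^sup>k \<rightarrow> A/(I A)\<^sup>k \<rightarrow> 0\<close>. A regular element is also regular on the maximal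
  Cohen--Macaulay module \<open>M\<close>: every prime that annihilates a nonzero element of \<open>M\<close> starts a chain of
  \<open>d\<close> strict inclusions, so it cannot properly contain another prime. Reducing a free resolution of \<open>M\<close> modulo \<open>x\<close>
  therefore resolves \<open>M/xM\<close> over \<open>A\<close>, whence \<open>Ext\<^sub>A(M/xM, W) = Ext\<^sub>R(M, W)\<close> for \<open>A\<close>-modules \<open>W\<close>, and
  the long exact sequence bounds the length of \<open>Ext\<^sub>A\<^sup>j(M/xM, A/(I A)\<^sup>k)\<close> by the sum of the lengths of
  \<open>Ext\<^sub>R\<^sup>j(M, R/I\<^sup>k)\<close> and \<open>Ext\<^sub>R\<^sup>j\<^sup>+\<^sup>1(M, R/I\<^sup>k\<^sup>-\<^sup>1)\<close>. Pascal's rule turns these bounds into the inequality,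
  given only that \<open>dim A \<le> d - 1\<close> and that the reduction number does not increase.

  For the statements about the graded ring \<open>G\<close>, depth is replaced by an exchange argument in the
  localization of \<open>G\<close> at its maximal homogeneous ideal: if a regular sequence of length \<open>s + 1\<close> ends
  in a socle element, then any regular element starts another one of the same length, with the socle element
  in the same degree. This gives regularity of generic elements (those avoiding the non-maximal
  associated primes), and it transports the top degree that computes the
  reduction number between different minimal reductions.
\<close>

section \<open>Ideals and associated primes\<close>

context cring begin

text \<open>Three features of the definitions shape the proof. \<open>Ext\<close> is computed from
  an unspecified resolution and lengths may be infinite, so nothing is ever subtracted: every
  comparison of lengths is a comparison of chains of submodules, and independence of the resolution
  is proved in this form. \<open>reduction_number\<close> is a \<open>LEAST\<close> over all minimal
  reductions, so their existence has to be established, and for the quotient it is enough to exhibit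
  one minimal reduction that reaches the exponent of \<open>R\<close>. The Cohen-Macaulay hypothesis
  speaks of localizations of the graded ring, where the grading is lost; it is recovered because an
  element outside the maximal homogeneous ideal has a unit as its degree 0 part and can be cancelled
  from homogeneous ideals.

  Minimality of a reduction has one purpose: generic elements drawn from it already generate a
  reduction, hence all of it. So a minimal reduction is generated by elements whose forms are a
  regular sequence, and the exchange argument applies to it.\<close>

lemma ideal_memD:
  assumes "ideal J R"
  shows "a \<in> J \<Longrightarrow> a \<in> carrier R" "\<zero> \<in> J" "a \<in> J \<Longrightarrow> b \<in> J \<Longrightarrow> a \<oplus> b \<in> J"
    "a \<in> J \<Longrightarrow> \<ominus> a \<in> J" "a \<in> J \<Longrightarrow> b \<in> J \<Longrightarrow> a \<ominus> b \<in> J"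
    "a \<in> J \<Longrightarrow> c \<in> carrier R \<Longrightarrow> c \<otimes> a \<in> J" "a \<in> J \<Longrightarrow> c \<in> carrier R \<Longrightarrow> a \<otimes> c \<in> J"
proof -
  interpret ideal J R by fact
  show "a \<in> J \<Longrightarrow> a \<in> carrier R" by (rule Icarr)
  show "\<zero> \<in> J" "a \<in> J \<Longrightarrow> b \<in> J \<Longrightarrow> a \<oplus> b \<in> J"
    "a \<in> J \<Longrightarrow> \<ominus> a \<in> J" "a \<in> J \<Longrightarrow> b \<in> J \<Longrightarrow> a \<ominus> b \<in> J"
    "a \<in> J \<Longrightarrow> c \<in> carrier R \<Longrightarrow> c \<otimes> a \<in> J" "a \<in> J \<Longrightarrow> c \<in> carrier R \<Longrightarrow> a \<otimes> c \<in> J"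
    by (auto simp: minus_eq I_l_closed I_r_closed)
qed

lemma ideal_add_cancel:
  assumes "ideal J R" "a \<in> J" "b \<in> carrier R" "a \<oplus> b \<in> J" shows "b \<in> J"
proof -
  have "b = (a \<oplus> b) \<ominus> a" using assms(3) ideal_memD(1)[OF assms(1,2)] by algebra
  then show ?thesis using ideal_memD(5)[OF assms(1) assms(4,2)] by simp
qed

lemma idealI':
  assumes "J \<subseteq> carrier R" "\<zero> \<in> J" "\<And>a b. a \<in> J \<Longrightarrow> b \<in> J \<Longrightarrow> a \<oplus> b \<in> J"
    "\<And>a c. a \<in> J \<Longrightarrow> c \<in> carrier R \<Longrightarrow> c \<otimes> a \<in> J"
  shows "ideal J R"
proof (rule idealI)
  show "ring R" by (rule ring_axioms)
  show "subgroup J (add_monoid R)"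
  proof (rule add.subgroupI)
    show "\<ominus> a \<in> J" if "a \<in> J" for a
      using assms(4)[OF that, of "\<ominus> \<one>"] that assms(1) by (simp add: l_minus subset_eq)
  qed (use assms in auto)
  show "x \<otimes> a \<in> J" "a \<otimes> x \<in> J" if "a \<in> J" "x \<in> carrier R" for a x
    using assms(4)[OF that] that assms(1) m_comm[of a x] by auto
qed

lemma mem_Idl_insert:
  assumes "y \<in> carrier R" "A \<subseteq> carrier R"
  shows "b \<in> Idl (insert y A) \<longleftrightarrow> (\<exists>c\<in>carrier R. \<exists>j\<in>Idl A. b = c \<otimes> y \<oplus> j)"
proof -
  let ?K = "{c \<otimes> y \<oplus> j | c j. c \<in> carrier R \<and> j \<in> Idl A}"
  note A = genideal_ideal[OF assms(2)]
  note iA = ideal_memD[OF A]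
  have K: "ideal ?K R"
  proof (rule idealI')
    show "?K \<subseteq> carrier R" using assms iA by auto
    show "\<zero> \<in> ?K" using assms iA(2) by (force intro: exI[of _ \<zero>])
    fix a b assume "a \<in> ?K" "b \<in> ?K"
    then obtain c j c' j' where e: "c \<in> carrier R" "j \<in> Idl A" "a = c \<otimes> y \<oplus> j"
      "c' \<in> carrier R" "j' \<in> Idl A" "b = c' \<otimes> y \<oplus> j'" by auto
    have "a \<oplus> b = (c \<oplus> c') \<otimes> y \<oplus> (j \<oplus> j')" using e assms iA(1)[OF e(2)] iA(1)[OF e(5)] by (simp only:) algebra
    then show "a \<oplus> b \<in> ?K" using e iA(3) by blast
  next
    fix a d assume "a \<in> ?K" and d: "d \<in> carrier R"
    then obtain c j where e: "c \<in> carrier R" "j \<in> Idl A" "a = c \<otimes> y \<oplus> j" by auto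
    have "d \<otimes> a = (d \<otimes> c) \<otimes> y \<oplus> (d \<otimes> j)" using d e assms iA(1)[OF e(2)] by (simp only:) algebra
    then show "d \<otimes> a \<in> ?K" using d e iA(6) by blast
  qed
  have "insert y A \<subseteq> ?K"
  proof
    fix a assume "a \<in> insert y A"
    then consider "a = y" | "a \<in> A" by auto
    then show "a \<in> ?K"
    proof cases
      case 1 then show ?thesis using assms iA(2) by (force intro: exI[of _ \<one>])
    next
      case 2 then have "a \<in> Idl A" using genideal_self[OF assms(2)] by auto
      moreover have "a = \<zero> \<otimes> y \<oplus> a" using assms 2 by auto
      ultimately show ?thesis by blast
    qed
  qed
  then have 1: "Idl (insert y A) \<subseteq> ?K" by (rule genideal_minimal[OF K])
  have ins: "insert y A \<subseteq> carrier R" using assms by auto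
  note B = ideal_memD[OF genideal_ideal[OF ins]]
  have "Idl A \<subseteq> Idl (insert y A)" using subset_Idl_subset[OF ins] by auto
  moreover have "y \<in> Idl (insert y A)" using genideal_self[OF ins] by auto
  ultimately have "?K \<subseteq> Idl (insert y A)" using B(3,6) by blast
  with 1 show ?thesis by blast
qed

definition colon :: "'a set \<Rightarrow> 'a \<Rightarrow> 'a set" where
  "colon J b = {a \<in> carrier R. a \<otimes> b \<in> J}"

lemma colon_ideal: "ideal J R \<Longrightarrow> b \<in> carrier R \<Longrightarrow> ideal (colon J b) R"
  unfolding colon_def by (rule idealI') (auto simp: l_distr m_assoc ideal_memD)

lemma subset_colon: "ideal J R \<Longrightarrow> b \<in> carrier R \<Longrightarrow> J \<subseteq> colon J b"
  unfolding colon_def by (auto simp: ideal_memD)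

definition assoc_prime :: "'a set \<Rightarrow> 'a set \<Rightarrow> bool" where
  "assoc_prime J P \<longleftrightarrow> primeideal P R \<and> (\<exists>a\<in>carrier R. P = colon J a)"

lemma primeideal_memD:
  assumes "primeideal P R"
  shows "ideal P R" "\<one> \<notin> P" "a \<in> carrier R \<Longrightarrow> b \<in> carrier R \<Longrightarrow> a \<otimes> b \<in> P \<Longrightarrow> a \<in> P \<or> b \<in> P"
  using assms primeideal.I_prime[OF assms] primeideal.I_notcarr[OF assms]
    ideal.one_imp_carrier[of P R] by (auto simp: primeideal_def)

lemma primeideal_pow: "primeideal P R \<Longrightarrow> a \<in> carrier R \<Longrightarrow> a [^] (n::nat) \<in> P \<Longrightarrow> a \<in> P"
proof (induction n)
  case 0 then show ?case using primeideal_memD(2) by auto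
next
  case (Suc n) then show ?case using primeideal_memD(3)[of P "a [^] n" a] by auto
qed

lemma primeidealI':
  assumes "ideal P R" "\<one> \<notin> P" "\<And>a b. a \<in> carrier R \<Longrightarrow> b \<in> carrier R \<Longrightarrow> a \<otimes> b \<in> P \<Longrightarrow> a \<in> P \<or> b \<in> P"
  shows "primeideal P R"
  using assms by (intro primeidealI) (auto intro: is_cring)

end

locale noetherian_cring = cring R + noetherian_ring R for R (structure)
begin

lemma ideal_maximal_element:
  assumes "\<S> \<noteq> {}" "\<And>J. J \<in> \<S> \<Longrightarrow> ideal J R"
  shows "\<exists>K\<in>\<S>. \<forall>J\<in>\<S>. K \<subseteq> J \<longrightarrow> J = K"
proof (rule subset_Zorn_nonempty[OF assms(1)])
  fix C assume C: "C \<noteq> {}" "subset.chain \<S> C"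
  then have "C \<subseteq> \<S>" by (auto simp: subset.chain_def)
  moreover have "subset.chain {I. ideal I R} C" using C assms(2) by (auto simp: subset.chain_def)
  then have "\<Union>C \<in> C" by (rule ideal_chain_is_trivial[OF C(1)])
  ultimately show "\<Union>C \<in> \<S>" by auto
qed

lemma ideal_noetherian_induct [consumes 1, case_names step]:
  assumes "ideal J R" "\<And>J. ideal J R \<Longrightarrow> (\<And>K. ideal K R \<Longrightarrow> J \<subset> K \<Longrightarrow> P K) \<Longrightarrow> P J"
  shows "P J"
proof (rule ccontr)
  assume "\<not> P J"
  then have "{J. ideal J R \<and> \<not> P J} \<noteq> {}" using assms(1) by auto
  from ideal_maximal_element[OF this] obtain K where K: "ideal K R" "\<not> P K"
    "\<And>J. ideal J R \<Longrightarrow> \<not> P J \<Longrightarrow> K \<subseteq> J \<Longrightarrow> J = K" by auto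
  have "P K" by (rule assms(2)[OF K(1)]) (use K(3) in blast)
  with K(2) show False by simp
qed

text \<open>Maximality among the colon ideals of elements of \<open>S\<close> forces primeness. For
  a product \<open>c \<otimes> e\<close> in \<open>colon J a\<close>, hypothesis
  \<open>closed\<close> offers two ways: \<open>e \<otimes> a\<close> stays in \<open>S\<close>, and
  its colon ideal contains \<open>c\<close> but cannot have grown; or a multiplier \<open>d\<close>
  keeps \<open>d \<otimes> a\<close> in \<open>S\<close>, and the same reasoning applies to
  \<open>e\<close>.\<close>

lemma colon_maximal_prime:
  assumes J: "ideal J R" and S: "S \<subseteq> carrier R - J" "b \<in> S"
    and closed: "\<And>a c. a \<in> S \<Longrightarrow> c \<in> carrier R \<Longrightarrow> (\<exists>d\<in>carrier R. d \<otimes> (c \<otimes> a) \<in> J \<and> d \<otimes> a \<in> S) \<or> c \<otimes> a \<in> S"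
  shows "\<exists>a\<in>S. assoc_prime J (colon J a) \<and> colon J b \<subseteq> colon J a"
proof -
  let ?F = "{colon J a | a. a \<in> S \<and> colon J b \<subseteq> colon J a}"
  have "?F \<noteq> {}" using S(2) by auto
  moreover have "\<And>K. K \<in> ?F \<Longrightarrow> ideal K R" using colon_ideal[OF J] S(1) by auto
  ultimately have "\<exists>K\<in>?F. \<forall>K'\<in>?F. K \<subseteq> K' \<longrightarrow> K' = K" by (rule ideal_maximal_element)
  then obtain K where K: "K \<in> ?F" and Kmax: "\<forall>K'\<in>?F. K \<subseteq> K' \<longrightarrow> K' = K" by (elim bexE)
  from K obtain a where a: "a \<in> S" "colon J b \<subseteq> colon J a" and Ka: "K = colon J a" by auto
  have max: "colon J a' = colon J a" if "a' \<in> S" "colon J a \<subseteq> colon J a'" for a'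
  proof -
    have "colon J a' \<in> ?F" using that a(2) by auto
    with Kmax that(2) Ka show ?thesis by simp
  qed
  have ac: "a \<in> carrier R" "a \<notin> J" using a S by auto
  have "primeideal (colon J a) R"
  proof (rule primeidealI')
    show "ideal (colon J a) R" by (rule colon_ideal[OF J ac(1)])
    show "\<one> \<notin> colon J a" using ac by (auto simp: colon_def)
    fix c e assume ce: "c \<in> carrier R" "e \<in> carrier R" "c \<otimes> e \<in> colon J a"
    from closed[OF a(1) ce(2)] show "c \<in> colon J a \<or> e \<in> colon J a"
    proof
      assume "\<exists>d\<in>carrier R. d \<otimes> (e \<otimes> a) \<in> J \<and> d \<otimes> a \<in> S"
      then obtain d where d: "d \<in> carrier R" "d \<otimes> (e \<otimes> a) \<in> J" "d \<otimes> a \<in> S" by auto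
      have "colon J a \<subseteq> colon J (d \<otimes> a)"
      proof
        fix t assume t: "t \<in> colon J a"
        have "t \<otimes> (d \<otimes> a) = d \<otimes> (t \<otimes> a)" using t d ac by (auto simp: colon_def m_ac)
        then show "t \<in> colon J (d \<otimes> a)" using t d ideal_memD[OF J] by (auto simp: colon_def)
      qed
      from max[OF d(3) this] have "colon J (d \<otimes> a) = colon J a" .
      moreover have "e \<in> colon J (d \<otimes> a)" using d ce ac by (auto simp: colon_def m_lcomm)
      ultimately show ?thesis by simp
    next
      assume s: "e \<otimes> a \<in> S"
      have "colon J a \<subseteq> colon J (e \<otimes> a)"
      proof
        fix t assume t: "t \<in> colon J a"
        have "t \<otimes> (e \<otimes> a) = e \<otimes> (t \<otimes> a)" using t ce ac by (auto simp: colon_def m_ac)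
        then show "t \<in> colon J (e \<otimes> a)" using t ce ideal_memD[OF J] by (auto simp: colon_def)
      qed
      from max[OF s this] have "colon J (e \<otimes> a) = colon J a" .
      moreover have "c \<in> colon J (e \<otimes> a)" using ce ac by (auto simp: colon_def m_assoc)
      ultimately show ?thesis by simp
    qed
  qed
  then show ?thesis using a ac unfolding assoc_prime_def by blast
qed

text \<open>With \<open>S\<close> the complement of \<open>J\<close>, the multiplier in
  \<open>closed\<close> can be \<open>\<one>\<close> whenever \<open>c \<otimes> a\<close> falls
  into \<open>J\<close>.\<close>

lemma assoc_prime_above_colon:
  assumes "ideal J R" "b \<in> carrier R" "b \<notin> J"
  shows "\<exists>P. assoc_prime J P \<and> colon J b \<subseteq> P"
proof -
  have "\<exists>a\<in>carrier R - J. assoc_prime J (colon J a) \<and> colon J b \<subseteq> colon J a"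
  proof (rule colon_maximal_prime[OF assms(1)])
    fix a c assume a: "a \<in> carrier R - J" "c \<in> carrier R"
    show "(\<exists>d\<in>carrier R. d \<otimes> (c \<otimes> a) \<in> J \<and> d \<otimes> a \<in> carrier R - J) \<or> c \<otimes> a \<in> carrier R - J"
    proof (cases "c \<otimes> a \<in> J")
      case True
      then have "\<one> \<otimes> (c \<otimes> a) \<in> J \<and> \<one> \<otimes> a \<in> carrier R - J" using a by auto
      then show ?thesis by blast
    qed (use a in auto)
  qed (use assms in auto)
  then show ?thesis by blast
qed

text \<open>The witness maximises \<open>colon J a\<close> among those contained in the prime.\<close>

lemma assoc_prime_below_prime:
  assumes J: "ideal J R" and Q: "primeideal Q R" "J \<subseteq> Q"
  shows "\<exists>P. assoc_prime J P \<and> P \<subseteq> Q"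
proof -
  note Qi = primeideal_memD[OF Q(1)]
  let ?S = "{a \<in> carrier R. colon J a \<subseteq> Q}"
  have "\<exists>a\<in>?S. assoc_prime J (colon J a) \<and> colon J \<one> \<subseteq> colon J a"
  proof (rule colon_maximal_prime[OF J])
    show "?S \<subseteq> carrier R - J"
    proof (safe)
      fix a assume "a \<in> carrier R" "colon J a \<subseteq> Q" "a \<in> J"
      then have "\<one> \<in> Q" by (auto simp: colon_def)
      then show False using Qi(2) by simp
    qed
    show "\<one> \<in> ?S" using Q(2) by (auto simp: colon_def)
    fix a c assume a: "a \<in> ?S" and c: "c \<in> carrier R"
    show "(\<exists>d\<in>carrier R. d \<otimes> (c \<otimes> a) \<in> J \<and> d \<otimes> a \<in> ?S) \<or> c \<otimes> a \<in> ?S"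
    proof (cases "colon J (c \<otimes> a) \<subseteq> Q")
      case False
      \<comment> \<open>Since \<open>Q\<close> is prime and omits \<open>d\<close>, passing from
        \<open>a\<close> to \<open>d \<otimes> a\<close> keeps the colon ideal inside
        \<open>Q\<close>.\<close>
      then obtain d where d: "d \<in> carrier R" "d \<otimes> (c \<otimes> a) \<in> J" "d \<notin> Q" by (auto simp: colon_def)
      have "colon J (d \<otimes> a) \<subseteq> Q"
      proof
        fix t assume t: "t \<in> colon J (d \<otimes> a)"
        then have "t \<otimes> d \<in> colon J a" using a d by (auto simp: colon_def m_assoc)
        then have "t \<otimes> d \<in> Q" using a by auto
        then show "t \<in> Q" using Qi(3)[of t d] d t by (auto simp: colon_def)
      qed
      then show ?thesis using d a by auto
    qed (use a c in auto)
  qed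
  then show ?thesis by blast
qed

text \<open>Noetherian induction from \<open>J\<close> to \<open>J1\<close>, which arises by adding
  an \<open>a\<close> with prime colon ideal: \<open>J1\<close> modulo \<open>J\<close> is then a
  copy of a domain, so it contributes the single prime \<open>colon J a\<close>.\<close>

lemma finite_assoc_primes:
  assumes "ideal J R" shows "finite {P. assoc_prime J P}"
  using assms
proof (induction rule: ideal_noetherian_induct)
  case (step J)
  note iJ = ideal_memD[OF step.hyps]
  show ?case
  proof (cases "J = carrier R")
    case True
    then have "\<not> assoc_prime J P" for P
      using primeideal_memD(2) by (fastforce simp: assoc_prime_def colon_def)
    then show ?thesis by simp
  next
    case False
    then have "\<one> \<notin> J" using ideal.one_imp_carrier[OF step.hyps] by auto
    from assoc_prime_above_colon[OF step.hyps one_closed this] obtain a where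
      a: "a \<in> carrier R" "primeideal (colon J a) R" by (auto simp: assoc_prime_def)
    have aJ: "a \<notin> J" using primeideal_memD(2)[OF a(2)] a(1) by (auto simp: colon_def)
    define J1 where "J1 = Idl (insert a J)"
    have sub: "insert a J \<subseteq> carrier R" using a iJ by auto
    have J1: "ideal J1 R" unfolding J1_def by (rule genideal_ideal[OF sub])
    have "insert a J \<subseteq> J1" unfolding J1_def by (rule genideal_self[OF sub])
    then have ss: "J \<subset> J1" using aJ by auto
    have IJ: "Idl J = J" using genideal_minimal[OF step.hyps, of J] genideal_self[of J] iJ by auto
    have mem: "b \<in> J1 \<longleftrightarrow> (\<exists>c\<in>carrier R. \<exists>j\<in>J. b = c \<otimes> a \<oplus> j)" for b
      using mem_Idl_insert[OF a(1), of J b] iJ(1) IJ unfolding J1_def by auto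
    have "{P. assoc_prime J P} \<subseteq> insert (colon J a) {P. assoc_prime J1 P}"
    proof
      fix Q assume "Q \<in> {P. assoc_prime J P}"
      then obtain b where b: "b \<in> carrier R" "Q = colon J b" and Q: "primeideal Q R"
        by (auto simp: assoc_prime_def)
      note Qi = primeideal_memD[OF Q]
      show "Q \<in> insert (colon J a) {P. assoc_prime J1 P}"
      \<comment> \<open>If some multiple of \<open>b\<close> is a nonzero class of \<open>J1\<close>
        modulo \<open>J\<close>, its annihilator is \<open>colon J a\<close>, and primeness of
        \<open>Q\<close> makes it equal to that of \<open>b\<close>. Otherwise \<open>b\<close> has
        the same colon ideal over \<open>J1\<close> as over \<open>J\<close>.\<close>
      proof (cases "\<exists>c\<in>carrier R. c \<otimes> b \<in> J1 - J")
        case True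
        then obtain c e j where c: "c \<in> carrier R" "c \<otimes> b \<notin> J" "e \<in> carrier R" "j \<in> J" "c \<otimes> b = e \<otimes> a \<oplus> j"
          by (auto simp: mem)
        have jc: "j \<in> carrier R" using c iJ by auto
        have "c \<notin> Q" using c b by (auto simp: colon_def)
        have "e \<notin> colon J a" using c iJ by (auto simp: colon_def)
        have "t \<in> Q \<longleftrightarrow> t \<in> colon J a" if t: "t \<in> carrier R" for t
        proof -
          have "t \<in> Q \<longleftrightarrow> t \<otimes> c \<in> Q" using Qi(3)[of t c] \<open>c \<notin> Q\<close> t c ideal_memD(7)[OF Qi(1)] by blast
          also have "\<dots> \<longleftrightarrow> t \<otimes> (c \<otimes> b) \<in> J" using t c b by (auto simp: colon_def m_assoc)
          also have "\<dots> \<longleftrightarrow> t \<otimes> (e \<otimes> a) \<oplus> t \<otimes> j \<in> J" using t c a jc by (auto simp: r_distr)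
          also have "\<dots> \<longleftrightarrow> t \<otimes> (e \<otimes> a) \<in> J"
            using ideal_add_cancel[OF step.hyps, of "t \<otimes> j" "t \<otimes> (e \<otimes> a)"] iJ(3,6) t c a jc
            by (auto simp: a_comm)
          also have "\<dots> \<longleftrightarrow> t \<otimes> e \<in> colon J a" using t c a by (auto simp: colon_def m_assoc)
          also have "\<dots> \<longleftrightarrow> t \<in> colon J a" using primeideal_memD(3)[OF a(2), of t e] \<open>e \<notin> _\<close> t c
              ideal_memD(7)[OF primeideal_memD(1)[OF a(2)]] by blast
          finally show ?thesis .
        qed
        then have "Q = colon J a" using b by (auto simp: colon_def)
        then show ?thesis by simp
      next
        case False
        then have "Q = colon J1 b" using b ss by (auto simp: colon_def)
        then show ?thesis using Q b by (auto simp: assoc_prime_def)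
      qed
    qed
    then show ?thesis using step.IH[OF J1 ss] by (auto intro: finite_subset)
  qed
qed

text \<open>\<open>?K\<close> is the saturation of \<open>J\<close> by the powers of
  \<open>a\<close>. Modulo \<open>?K\<close> multiplication by \<open>a\<close> is injective, so an
  associated prime of \<open>?K\<close> omits \<open>a\<close>; one exists because \<open>?K\<close>
  is proper.\<close>

lemma exists_prime_avoiding_powers:
  assumes J: "ideal J R" and a: "a \<in> carrier R" and pow: "\<And>n::nat. a [^] n \<notin> J"
  shows "\<exists>P. primeideal P R \<and> J \<subseteq> P \<and> a \<notin> P"
proof -
  let ?K = "{b \<in> carrier R. \<exists>n::nat. a [^] n \<otimes> b \<in> J}"
  note iJ = ideal_memD[OF J]
  have K: "ideal ?K R"
  proof (rule idealI')
    show "\<zero> \<in> ?K" using iJ(2) a by (auto intro: exI[of _ 0])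
    fix b c assume "b \<in> ?K" "c \<in> ?K"
    then obtain n m :: nat where h: "a [^] n \<otimes> b \<in> J" "a [^] m \<otimes> c \<in> J" "b \<in> carrier R" "c \<in> carrier R" by auto
    have "a [^] (n + m) \<otimes> (b \<oplus> c) = a [^] m \<otimes> (a [^] n \<otimes> b) \<oplus> a [^] n \<otimes> (a [^] m \<otimes> c)"
      using h a by (simp add: nat_pow_mult[symmetric] r_distr m_ac)
    then have "a [^] (n + m) \<otimes> (b \<oplus> c) \<in> J" using h a iJ by auto
    then show "b \<oplus> c \<in> ?K" using h by blast
  next
    fix b c assume "b \<in> ?K" and c: "c \<in> carrier R"
    then obtain n :: nat where h: "a [^] n \<otimes> b \<in> J" "b \<in> carrier R" by auto
    have "a [^] n \<otimes> (c \<otimes> b) = c \<otimes> (a [^] n \<otimes> b)" using a c h by (simp add: m_lcomm)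
    then have "a [^] n \<otimes> (c \<otimes> b) \<in> J" using h c iJ by auto
    then show "c \<otimes> b \<in> ?K" using h c by auto
  qed auto
  have "\<one> \<notin> ?K" using pow a by auto
  from assoc_prime_above_colon[OF K one_closed this] obtain b where
    b: "b \<in> carrier R" "primeideal (colon ?K b) R" by (auto simp: assoc_prime_def)
  have "J \<subseteq> ?K" using iJ a by (auto intro: exI[of _ 0])
  then have 1: "J \<subseteq> colon ?K b" using subset_colon[OF K b(1)] by auto
  have 2: "a \<notin> colon ?K b"
  proof
    assume "a \<in> colon ?K b"
    then obtain n :: nat where "a [^] n \<otimes> (a \<otimes> b) \<in> J" by (auto simp: colon_def)
    then have "a [^] Suc n \<otimes> b \<in> J" using a b by (simp add: m_assoc)
    then have "b \<in> ?K" using b by blast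
    then have "\<one> \<in> colon ?K b" using b by (auto simp: colon_def)
    then show False using primeideal_memD(2)[OF b(2)] by simp
  qed
  from b(2) 1 2 show ?thesis by blast
qed

end

section \<open>Generic and regular elements of a local ring\<close>

context cring begin

definition regular_mod :: "'a set \<Rightarrow> 'a \<Rightarrow> bool" where
  "regular_mod J y \<longleftrightarrow> (\<forall>b\<in>carrier R. y \<otimes> b \<in> J \<longrightarrow> b \<in> J)"

text \<open>\<open>A\<close> collects what has been divided out so far. The notion is weaker than
  \<open>regular_sequence\<close>: the final quotient may be zero.\<close>

primrec regular_list :: "'a set \<Rightarrow> 'a list \<Rightarrow> bool" where
  "regular_list A [] \<longleftrightarrow> True"
| "regular_list A (z # zs) \<longleftrightarrow> regular_mod (Idl A) z \<and> regular_list (insert z A) zs"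

lemma regular_modD: "regular_mod J y \<Longrightarrow> b \<in> carrier R \<Longrightarrow> y \<otimes> b \<in> J \<Longrightarrow> b \<in> J"
  unfolding regular_mod_def by blast

lemma regular_mod_pow:
  assumes "regular_mod J y" "y \<in> carrier R" "y [^] (n::nat) \<in> J"
  shows "\<one> \<in> J"
  using assms(3)
proof (induction n)
  case (Suc n)
  have "y \<otimes> y [^] n \<in> J" using Suc.prems assms(2) by (simp add: m_comm)
  then have "y [^] n \<in> J" by (rule regular_modD[OF assms(1) nat_pow_closed[OF assms(2)]])
  then show ?case by (rule Suc.IH)
qed simp

text \<open>A relation \<open>y \<otimes> b = c \<otimes> w\<close> modulo \<open>A\<close> forces
  \<open>c\<close> into \<open>(y, A)\<close>, and then a common factor \<open>y\<close> cancels.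
  This is one half of the exchange of two neighbours in a regular sequence.\<close>

lemma regular_mod_swap:
  assumes A: "A \<subseteq> carrier R" and y: "y \<in> carrier R" and w: "w \<in> carrier R"
    and ry: "regular_mod (Idl A) y" and rw: "regular_mod (Idl (insert y A)) w"
  shows "regular_mod (Idl (insert w A)) y"
  unfolding regular_mod_def
proof (intro ballI impI)
  fix b assume b: "b \<in> carrier R" and "y \<otimes> b \<in> Idl (insert w A)"
  then obtain c j where c: "c \<in> carrier R" "j \<in> Idl A" "y \<otimes> b = c \<otimes> w \<oplus> j"
    using mem_Idl_insert[OF w A] by auto
  note iA = ideal_memD[OF genideal_ideal[OF A]]
  have jc: "j \<in> carrier R" using c iA by auto
  have "w \<otimes> c = (y \<otimes> b) \<ominus> j" unfolding c(3) using c(1) jc w by algebra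
  also have "\<dots> = b \<otimes> y \<oplus> (\<ominus> j)" using y b jc by algebra
  finally have "w \<otimes> c \<in> Idl (insert y A)" using mem_Idl_insert[OF y A] b iA(4)[OF c(2)] by auto
  then have "c \<in> Idl (insert y A)" using regular_modD[OF rw c(1)] by simp
  then obtain c' j' where c': "c' \<in> carrier R" "j' \<in> Idl A" "c = c' \<otimes> y \<oplus> j'"
    using mem_Idl_insert[OF y A] by auto
  have j'c: "j' \<in> carrier R" using c' iA by auto
  have "y \<otimes> (b \<ominus> c' \<otimes> w) = y \<otimes> b \<ominus> y \<otimes> c' \<otimes> w" using y b c' w by algebra
  also have "\<dots> = j' \<otimes> w \<oplus> j" unfolding c(3) c'(3) using y w c'(1) jc j'c by algebra
  finally have "y \<otimes> (b \<ominus> c' \<otimes> w) \<in> Idl A" using iA(3)[OF iA(7)[OF c'(2) w] c(2)] by simp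
  then have k: "b \<ominus> c' \<otimes> w \<in> Idl A" using regular_modD[OF ry] b c' w by auto
  have "b = c' \<otimes> w \<oplus> (b \<ominus> c' \<otimes> w)" using b c' w by algebra
  then show "b \<in> Idl (insert w A)" using mem_Idl_insert[OF w A] k c'(1) by blast
qed

end

text \<open>Locality is expressed by inverses outside \<open>\<mm>\<close>: this is the form in
  which Nakayama's lemma uses it and in which it can be checked directly for a localization.\<close>

locale noetherian_local = noetherian_cring +
  fixes \<mm> :: "'a set"
  assumes mm_ideal: "ideal \<mm> R" and one_notin_mm: "\<one> \<notin> \<mm>"
    and unit_outside: "a \<in> carrier R \<Longrightarrow> a \<notin> \<mm> \<Longrightarrow> \<exists>b\<in>carrier R. b \<otimes> a = \<one>"
begin

lemma proper_ideal_subset_mm: "ideal J R \<Longrightarrow> \<one> \<notin> J \<Longrightarrow> J \<subseteq> \<mm>"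
  using unit_outside ideal_memD(1,6)[of J] by (metis subsetI)

lemma prime_subset_mm: "primeideal P R \<Longrightarrow> P \<subseteq> \<mm>"
  using proper_ideal_subset_mm primeideal_memD by blast

lemma mm_prime: "primeideal \<mm> R"
proof (rule primeidealI'[OF mm_ideal one_notin_mm])
  fix a b assume ab: "a \<in> carrier R" "b \<in> carrier R" "a \<otimes> b \<in> \<mm>"
  show "a \<in> \<mm> \<or> b \<in> \<mm>"
  proof (rule ccontr)
    assume "\<not> (a \<in> \<mm> \<or> b \<in> \<mm>)"
    then obtain c where c: "c \<in> carrier R" "c \<otimes> a = \<one>" and "b \<notin> \<mm>" using unit_outside[OF ab(1)] by auto
    have "b = c \<otimes> (a \<otimes> b)" using c ab by (simp add: m_assoc[symmetric])
    then show False using \<open>b \<notin> \<mm>\<close> ideal_memD(6)[OF mm_ideal ab(3) c(1)] by simp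
  qed
qed

definition socle_elem :: "'a set \<Rightarrow> 'a \<Rightarrow> bool" where
  "socle_elem J n \<longleftrightarrow> n \<in> carrier R \<and> n \<notin> J \<and> (\<forall>c\<in>\<mm>. c \<otimes> n \<in> J)"

lemma nilpotent_mod:
  assumes "ideal J R" "\<And>P. primeideal P R \<Longrightarrow> J \<subseteq> P \<Longrightarrow> P = \<mm>" "a \<in> \<mm>"
  shows "\<exists>n::nat. a [^] n \<in> J"
  using exists_prime_avoiding_powers[OF assms(1), of a] assms(2,3) ideal_memD(1)[OF mm_ideal assms(3)] by metis

text \<open>Zero divisors modulo \<open>J\<close> lie in associated primes, and \<open>\<mm>\<close>
  is associated to \<open>J\<close> only if there is a socle element.\<close>

lemma regular_mod_if_avoids:
  assumes J: "ideal J R" and soc: "\<And>n. \<not> socle_elem J n" and w: "w \<in> carrier R"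
    and av: "\<And>P. assoc_prime J P \<Longrightarrow> P \<noteq> \<mm> \<Longrightarrow> w \<notin> P"
  shows "regular_mod J w"
  unfolding regular_mod_def
proof (intro ballI impI, rule ccontr)
  fix b assume b: "b \<in> carrier R" "w \<otimes> b \<in> J" "b \<notin> J"
  from assoc_prime_above_colon[OF J b(1,3)] obtain P where P: "assoc_prime J P" "colon J b \<subseteq> P" by auto
  have "w \<in> P" using P b w by (auto simp: colon_def)
  then have "P = \<mm>" using av P by auto
  then obtain a where a: "a \<in> carrier R" "\<mm> = colon J a" using P by (auto simp: assoc_prime_def)
  have "a \<notin> J" using one_notin_mm a by (auto simp: colon_def)
  then have "socle_elem J a" unfolding socle_elem_def using a by (auto simp: colon_def)
  then show False using soc by simp
qed

lemma no_socle_if_regular: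
  assumes "regular_mod J y" "y \<in> \<mm>" shows "\<not> socle_elem J n"
  using assms by (auto simp: socle_elem_def regular_mod_def)

end

text \<open>The set \<open>U\<close> plays the part of the (infinite) residue field.\<close>

locale infinite_residue = noetherian_local +
  fixes U :: "'a set"
  assumes U_carrier: "U \<subseteq> carrier R" and U_infinite: "infinite U"
    and U_diff: "u \<in> U \<Longrightarrow> v \<in> U \<Longrightarrow> u \<noteq> v \<Longrightarrow> u \<ominus> v \<notin> \<mm>"
begin

text \<open>In the graded application \<open>Y\<close> consists of forms of degree 1, so it is not
  an ideal. The closure conditions are those of avoidance by \<open>U\<close>-combinations; the last
  condition says that \<open>Y\<close> generates an ideal with radical \<open>\<mm>\<close>.\<close>

definition spanning :: "'a set \<Rightarrow> bool" where
  "spanning Y \<longleftrightarrow> Y \<subseteq> \<mm> \<and> Y \<noteq> {} \<and> (\<forall>a\<in>Y. \<forall>b\<in>Y. a \<oplus> b \<in> Y) \<and> (\<forall>u\<in>U. \<forall>a\<in>Y. u \<otimes> a \<in> Y) \<and>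
    (\<forall>P. primeideal P R \<longrightarrow> Y \<subseteq> P \<longrightarrow> P = \<mm>)"

lemma spanning_carrier: "spanning Y \<Longrightarrow> Y \<subseteq> carrier R"
  using ideal_memD(1)[OF mm_ideal] by (auto simp: spanning_def)

text \<open>Counting on a line: among the elements \<open>b \<oplus> u \<otimes> y\<close> with
  \<open>u\<close> in \<open>U\<close>, each ideal that omits \<open>y\<close> contains at most one,
  while \<open>U\<close> is infinite.\<close>

lemma avoid_finite:
  assumes Y: "Y \<subseteq> carrier R" "Y \<noteq> {}" "\<And>a b. a \<in> Y \<Longrightarrow> b \<in> Y \<Longrightarrow> a \<oplus> b \<in> Y" "\<And>u a. u \<in> U \<Longrightarrow> a \<in> Y \<Longrightarrow> u \<otimes> a \<in> Y"
    and "finite S" "\<And>P. P \<in> S \<Longrightarrow> ideal P R \<and> \<not> Y \<subseteq> P"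
  shows "\<exists>y\<in>Y. \<forall>P\<in>S. y \<notin> P"
  using assms(5,6)
proof (induction S rule: finite_induct)
  case (insert P S)
  then obtain y where y: "y \<in> Y" "\<forall>P\<in>S. y \<notin> P" by auto
  show ?case
  proof (cases "y \<in> P")
    case True
    have P: "ideal P R" and "\<not> Y \<subseteq> P" using insert.prems by auto
    then obtain b where b: "b \<in> Y" "b \<notin> P" by auto
    have bc: "b \<in> carrier R" "y \<in> carrier R" using b y Y by auto
    define f where "f = (\<lambda>u. b \<oplus> u \<otimes> y)"
    have f: "f u \<in> Y" "f u \<notin> P" if u: "u \<in> U" for u
    proof -
      show "f u \<in> Y" unfolding f_def using Y b y u by auto
      have "u \<otimes> y \<in> P" using ideal_memD(6)[OF P True] u U_carrier by auto
      then show "f u \<notin> P" unfolding f_def using ideal_add_cancel[OF P, of "u \<otimes> y" b] b bc u U_carrier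
        by (auto simp: a_comm)
    qed
    \<comment> \<open>Two parameters in \<open>U\<close> differ by a unit, so two values in
      \<open>K\<close> would put \<open>y\<close> itself into \<open>K\<close>.\<close>
    have fin: "finite {u \<in> U. f u \<in> K}" if K: "K \<in> S" for K
    proof (rule ccontr)
      assume "infinite {u \<in> U. f u \<in> K}"
      then obtain u where u: "u \<in> U" "f u \<in> K" using infinite_imp_nonempty by blast
      have "infinite ({u \<in> U. f u \<in> K} - {u})" using \<open>infinite {u \<in> U. f u \<in> K}\<close> by simp
      then obtain v where v: "v \<in> U" "f v \<in> K" "u \<noteq> v" using infinite_imp_nonempty by blast
      have uv: "u \<in> carrier R" "v \<in> carrier R" using u v U_carrier by auto
      have K': "ideal K R" using insert.prems K by auto
      have "f u \<ominus> f v = (u \<ominus> v) \<otimes> y" unfolding f_def using uv bc by algebra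
      then have m: "(u \<ominus> v) \<otimes> y \<in> K" using ideal_memD(5)[OF K' u(2) v(2)] by simp
      obtain c where c: "c \<in> carrier R" "c \<otimes> (u \<ominus> v) = \<one>"
        using unit_outside[of "u \<ominus> v"] U_diff[OF u(1) v(1,3)] uv by auto
      have "y = c \<otimes> ((u \<ominus> v) \<otimes> y)" using c uv bc by (simp add: m_assoc[symmetric])
      then have "y \<in> K" using ideal_memD(6)[OF K' m c(1)] by simp
      then show False using y K by auto
    qed
    have "finite (\<Union>K\<in>S. {u \<in> U. f u \<in> K})" using insert.hyps fin by auto
    then have "\<not> U \<subseteq> (\<Union>K\<in>S. {u \<in> U. f u \<in> K})" using U_infinite finite_subset by blast
    then obtain u where "u \<in> U" "\<forall>K\<in>S. f u \<notin> K" by blast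
    then show ?thesis using f by auto
  qed (use y in auto)
qed (use Y in auto)

lemma generic_element:
  assumes Y: "spanning Y" and "finite \<J>" "\<And>J. J \<in> \<J> \<Longrightarrow> ideal J R"
  shows "\<exists>w\<in>Y. \<forall>J\<in>\<J>. \<forall>P. assoc_prime J P \<longrightarrow> P \<noteq> \<mm> \<longrightarrow> w \<notin> P"
proof -
  let ?S = "(\<Union>J\<in>\<J>. {P. assoc_prime J P}) - {\<mm>}"
  have "finite ?S" using assms finite_assoc_primes by auto
  moreover have "ideal P R \<and> \<not> Y \<subseteq> P" if "P \<in> ?S" for P
    using that Y primeideal_memD(1) unfolding spanning_def assoc_prime_def by blast
  ultimately have "\<exists>y\<in>Y. \<forall>P\<in>?S. y \<notin> P"
    using Y spanning_carrier[OF Y] by (intro avoid_finite) (auto simp: spanning_def)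
  then show ?thesis by blast
qed

text \<open>
  \<open>Y\<close> is a set of allowed parameters and \<open>T\<close> a set of allowed socle elements. In the two applications
  these are \<open>\<mm>\<close> and the whole ring, respectively the initial forms of degree 1 and
  of some fixed degree \<open>r\<close>.
\<close>

definition admissible :: "'a set \<Rightarrow> 'a set \<Rightarrow> bool" where
  "admissible Y T \<longleftrightarrow> spanning Y \<and> T \<subseteq> carrier R \<and>
    (\<forall>A\<subseteq>Y. \<forall>y\<in>Y. \<forall>z\<in>Y. \<forall>n\<in>T. finite A \<longrightarrow> y \<otimes> n \<in> Idl (insert z A) \<longrightarrow>
      (\<exists>n'\<in>T. y \<otimes> n \<ominus> z \<otimes> n' \<in> Idl A))"

lemma admissibleD:
  assumes "admissible Y T" "finite A" "A \<subseteq> Y" "y \<in> Y" "z \<in> Y" "n \<in> T" "y \<otimes> n \<in> Idl (insert z A)"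
  shows "\<exists>n'\<in>T. y \<otimes> n \<ominus> z \<otimes> n' \<in> Idl A"
proof -
  have "\<forall>A\<subseteq>Y. \<forall>y\<in>Y. \<forall>z\<in>Y. \<forall>n\<in>T. finite A \<longrightarrow> y \<otimes> n \<in> Idl (insert z A) \<longrightarrow>
      (\<exists>n'\<in>T. y \<otimes> n \<ominus> z \<otimes> n' \<in> Idl A)"
    using assms(1) unfolding admissible_def by (elim conjE)
  from this[rule_format, OF assms(3-6,2,7)] show ?thesis .
qed

lemma admissible_mm: "admissible \<mm> (carrier R)"
  unfolding admissible_def
proof (intro conjI allI ballI impI)
  have "primeideal P R \<Longrightarrow> \<mm> \<subseteq> P \<Longrightarrow> P = \<mm>" for P using prime_subset_mm by blast
  then show "spanning \<mm>" unfolding spanning_def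
    using ideal_memD(2,3,6)[OF mm_ideal] U_carrier by (auto dest: subsetD)
  fix A y z n
  assume a: "A \<subseteq> \<mm>" "y \<in> \<mm>" "z \<in> \<mm>" "n \<in> carrier R" "y \<otimes> n \<in> Idl (insert z A)"
  note m = ideal_memD(1)[OF mm_ideal]
  have A: "A \<subseteq> carrier R" "z \<in> carrier R" "y \<in> carrier R" using a m by auto
  then obtain c j where c: "c \<in> carrier R" "j \<in> Idl A" "y \<otimes> n = c \<otimes> z \<oplus> j"
    using a(5) mem_Idl_insert by blast
  have "j \<in> carrier R" using c ideal_memD(1)[OF genideal_ideal[OF A(1)]] by auto
  then have "y \<otimes> n \<ominus> z \<otimes> c = j" unfolding c(3) using c(1) A by algebra
  then have "y \<otimes> n \<ominus> z \<otimes> c \<in> Idl A" using c(2) by simp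
  then show "\<exists>n'\<in>carrier R. y \<otimes> n \<ominus> z \<otimes> n' \<in> Idl A" using c(1) by blast
qed auto

text \<open>Stands for the statement that the depth modulo \<open>A\<close> is exactly
  \<open>s\<close>, but witnessed by a single sequence; \<open>exact_depth_exchange\<close> makes
  the value independent of the witness. The socle is taken with respect to \<open>Y\<close> only,
  and \<open>T\<close> restricts the kind of socle element.\<close>

primrec exact_depth :: "'a set \<Rightarrow> 'a set \<Rightarrow> 'a set \<Rightarrow> nat \<Rightarrow> bool" where
  "exact_depth Y T A 0 \<longleftrightarrow> (\<exists>n\<in>T. n \<notin> Idl A \<and> (\<forall>c\<in>Y. c \<otimes> n \<in> Idl A))"
| "exact_depth Y T A (Suc s) \<longleftrightarrow> (\<exists>y\<in>Y. regular_mod (Idl A) y \<and> exact_depth Y T (insert y A) s)"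

text \<open>The classical identification of the socles modulo \<open>(y, A)\<close> and modulo
  \<open>(z, A)\<close>: the classes \<open>n\<close> and \<open>n'\<close> correspond when
  \<open>z \<otimes> n = y \<otimes> n'\<close> modulo \<open>A\<close>, and both factors can be
  cancelled. \<open>C\<close> is a parameter because the lemma serves for \<open>Y\<close> as well
  as for \<open>\<mm>\<close>.\<close>

lemma socle_exchange:
  assumes A: "A \<subseteq> carrier R" and y: "y \<in> carrier R" and z: "z \<in> carrier R"
    and ry: "regular_mod (Idl A) y" and rz: "regular_mod (Idl A) z"
    and n: "n \<in> carrier R" "n \<notin> Idl (insert y A)" and n': "n' \<in> carrier R" "z \<otimes> n \<ominus> y \<otimes> n' \<in> Idl A"
    and C: "C \<subseteq> carrier R" "\<forall>c\<in>C. c \<otimes> n \<in> Idl (insert y A)"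
  shows "n' \<notin> Idl (insert z A)" "\<forall>c\<in>C. c \<otimes> n' \<in> Idl (insert z A)"
proof -
  note iA = ideal_memD[OF genideal_ideal[OF A]]
  define j0 where "j0 = z \<otimes> n \<ominus> y \<otimes> n'"
  have j0: "j0 \<in> Idl A" "j0 \<in> carrier R" using n' iA by (auto simp: j0_def)
  have e: "z \<otimes> n = y \<otimes> n' \<oplus> j0" unfolding j0_def using y z n n' by algebra
  show "n' \<notin> Idl (insert z A)"
  proof
    assume "n' \<in> Idl (insert z A)"
    then obtain c j where c: "c \<in> carrier R" "j \<in> Idl A" "n' = c \<otimes> z \<oplus> j"
      using mem_Idl_insert[OF z A] by auto
    have jc: "j \<in> carrier R" using c iA by auto
    have "z \<otimes> (n \<ominus> c \<otimes> y) = z \<otimes> n \<ominus> z \<otimes> c \<otimes> y" using z n y c by algebra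
    also have "\<dots> = y \<otimes> j \<oplus> j0" unfolding e c(3) using y z c(1) jc j0 by algebra
    finally have "z \<otimes> (n \<ominus> c \<otimes> y) \<in> Idl A" using iA(3)[OF iA(6)[OF c(2) y] j0(1)] by simp
    then have k: "n \<ominus> c \<otimes> y \<in> Idl A" using regular_modD[OF rz] n c y by auto
    have "n = c \<otimes> y \<oplus> (n \<ominus> c \<otimes> y)" using n c y by algebra
    then show False using n(2) mem_Idl_insert[OF y A] k c(1) by blast
  qed
  show "\<forall>c\<in>C. c \<otimes> n' \<in> Idl (insert z A)"
  proof
    fix u assume u: "u \<in> C"
    then have uc: "u \<in> carrier R" using C by auto
    from C(2) u obtain c j where c: "c \<in> carrier R" "j \<in> Idl A" "u \<otimes> n = c \<otimes> y \<oplus> j"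
      using mem_Idl_insert[OF y A] by auto
    have jc: "j \<in> carrier R" using c iA by auto
    have "y \<otimes> (u \<otimes> n' \<ominus> c \<otimes> z) = u \<otimes> (y \<otimes> n' \<oplus> j0) \<ominus> u \<otimes> j0 \<ominus> z \<otimes> c \<otimes> y" using z n' y c(1) uc j0(2) by algebra
    also have "\<dots> = u \<otimes> (z \<otimes> n) \<ominus> u \<otimes> j0 \<ominus> z \<otimes> c \<otimes> y" unfolding e ..
    also have "\<dots> = z \<otimes> (u \<otimes> n) \<ominus> u \<otimes> j0 \<ominus> z \<otimes> c \<otimes> y" using z uc n(1) by (simp add: m_lcomm)
    also have "\<dots> = z \<otimes> j \<ominus> u \<otimes> j0" unfolding c(3) using y z c(1) jc j0(2) uc by algebra
    finally have "y \<otimes> (u \<otimes> n' \<ominus> c \<otimes> z) \<in> Idl A" using iA(5)[OF iA(6)[OF c(2) z] iA(6)[OF j0(1) uc]] by simp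
    then have k: "u \<otimes> n' \<ominus> c \<otimes> z \<in> Idl A" using regular_modD[OF ry] n' uc c z by auto
    have "u \<otimes> n' = c \<otimes> z \<oplus> (u \<otimes> n' \<ominus> c \<otimes> z)" using n' uc c z by algebra
    then show "u \<otimes> n' \<in> Idl (insert z A)" using mem_Idl_insert[OF z A] k c(1) by blast
  qed
qed

text \<open>For length 1 this is \<open>socle_exchange\<close>. For longer sequences
  \<open>y\<close> and \<open>z\<close> cannot be compared directly, since neither has to be regular
  modulo the other; a third element \<open>w\<close>, generic for \<open>A\<close>,
  \<open>(y, A)\<close> and \<open>(z, A)\<close>, links them.\<close>

lemma exact_depth_exchange:
  assumes adm: "admissible Y T"
  shows "finite A \<Longrightarrow> A \<subseteq> Y \<Longrightarrow> exact_depth Y T A (Suc s) \<Longrightarrow> z \<in> Y \<Longrightarrow> regular_mod (Idl A) z \<Longrightarrow>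
    exact_depth Y T (insert z A) s"
proof (induction s arbitrary: A z)
  case 0
  have sp: "spanning Y" and T: "T \<subseteq> carrier R" using adm by (auto simp: admissible_def)
  note Yc = spanning_carrier[OF sp]
  from 0 obtain y n where y: "y \<in> Y" "regular_mod (Idl A) y" and n: "n \<in> T" "n \<notin> Idl (insert y A)"
    "\<forall>c\<in>Y. c \<otimes> n \<in> Idl (insert y A)" by auto
  have "z \<otimes> n \<in> Idl (insert y A)" using n 0 by auto
  then obtain n' where n': "n' \<in> T" "z \<otimes> n \<ominus> y \<otimes> n' \<in> Idl A"
    using admissibleD[OF adm 0(1,2) 0(4) y(1) n(1)] by blast
  have "n' \<notin> Idl (insert z A)" "\<forall>c\<in>Y. c \<otimes> n' \<in> Idl (insert z A)"
    using socle_exchange[of A y z n n' Y] 0 y n n' Yc T by blast+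
  then show ?case using n' by auto
next
  case (Suc s)
  have sp: "spanning Y" and T: "T \<subseteq> carrier R" using adm by (auto simp: admissible_def)
  note Yc = spanning_carrier[OF sp]
  have Ym: "Y \<subseteq> \<mm>" using sp by (auto simp: spanning_def)
  from Suc.prems obtain y where y: "y \<in> Y" "regular_mod (Idl A) y" "exact_depth Y T (insert y A) (Suc s)" by auto
  then obtain y' where y': "y' \<in> Y" "regular_mod (Idl (insert y A)) y'" by auto
  have Ac: "A \<subseteq> carrier R" and yc: "y \<in> carrier R" and zc: "z \<in> carrier R" using Suc.prems y Yc by auto
  have ideals: "ideal (Idl A) R" "ideal (Idl (insert y A)) R" "ideal (Idl (insert z A)) R"
    using Ac yc zc by (auto intro: genideal_ideal)
  have s1: "\<not> socle_elem (Idl (insert y A)) n" for n using no_socle_if_regular y' Ym by blast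
  have s0: "\<not> socle_elem (Idl A) n" for n using no_socle_if_regular y Ym by blast
  \<comment> \<open>A socle element modulo \<open>(z, A)\<close> would be carried to one modulo
    \<open>(y, A)\<close>. The pair \<open>\<mm>\<close>, \<open>carrier R\<close> is used here,
    because genericity refers to the full socle.\<close>
  have s2: "\<not> socle_elem (Idl (insert z A)) n" for n
  proof
    assume n: "socle_elem (Idl (insert z A)) n"
    then have nc: "n \<in> carrier R" "n \<notin> Idl (insert z A)" "\<forall>c\<in>\<mm>. c \<otimes> n \<in> Idl (insert z A)" by (auto simp: socle_elem_def)
    have "y \<otimes> n \<in> Idl (insert z A)" using nc y Ym by auto
    then obtain n' where n': "n' \<in> carrier R" "y \<otimes> n \<ominus> z \<otimes> n' \<in> Idl A"
      using admissibleD[OF admissible_mm, of A y z n] Suc.prems(1,2,4) y(1) nc(1) Ym by blast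
    have "n' \<notin> Idl (insert y A)" "\<forall>c\<in>\<mm>. c \<otimes> n' \<in> Idl (insert y A)"
      using socle_exchange[OF Ac zc yc Suc.prems(5) y(2) nc(1,2) n' _ nc(3)] ideal_memD(1)[OF mm_ideal] by blast+
    then have "socle_elem (Idl (insert y A)) n'" using n' by (auto simp: socle_elem_def)
    then show False using s1 by simp
  qed
  have "\<exists>w\<in>Y. \<forall>J\<in>{Idl A, Idl (insert y A), Idl (insert z A)}. \<forall>P. assoc_prime J P \<longrightarrow> P \<noteq> \<mm> \<longrightarrow> w \<notin> P"
    using ideals by (intro generic_element[OF sp]) auto
  then obtain w where w: "w \<in> Y" and wav: "\<forall>J\<in>{Idl A, Idl (insert y A), Idl (insert z A)}.
      \<forall>P. assoc_prime J P \<longrightarrow> P \<noteq> \<mm> \<longrightarrow> w \<notin> P" by (elim bexE)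
  have wc: "w \<in> carrier R" using w Yc by auto
  have rw: "regular_mod (Idl A) w" "regular_mod (Idl (insert y A)) w" "regular_mod (Idl (insert z A)) w"
    using regular_mod_if_avoids[OF ideals(1) s0 wc] regular_mod_if_avoids[OF ideals(2) s1 wc]
      regular_mod_if_avoids[OF ideals(3) s2 wc] wav by auto
  have ryw: "regular_mod (Idl (insert w A)) y" by (rule regular_mod_swap[OF Ac yc wc y(2) rw(2)])
  have rzw: "regular_mod (Idl (insert w A)) z" by (rule regular_mod_swap[OF Ac zc wc Suc.prems(5) rw(3)])
  \<comment> \<open>Modulo \<open>(y, A)\<close> the induction hypothesis lets the sequence continue
    with \<open>w\<close>. The start \<open>y, w\<close> is read as \<open>w, y\<close>, the
    induction hypothesis modulo \<open>(w, A)\<close> changes it to \<open>w, z\<close>, and this is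
    read as \<open>z, w\<close>.\<close>
  have "exact_depth Y T (insert w (insert y A)) s"
    by (rule Suc.IH) (use Suc.prems y w rw in auto)
  then have "exact_depth Y T (insert w A) (Suc s)" using y ryw by (auto simp: insert_commute)
  then have "exact_depth Y T (insert z (insert w A)) s"
    by (intro Suc.IH) (use Suc.prems w rzw in auto)
  then show ?case using w rw by (auto simp: insert_commute)
qed

text \<open>The first conjunct ends the list as soon as \<open>\<mm>\<close> is the only prime over
  \<open>A\<close>; this bounds the length of the list by that of a chain of primes.\<close>

primrec generic_list :: "'a set \<Rightarrow> 'a list \<Rightarrow> bool" where
  "generic_list A [] \<longleftrightarrow> True"
| "generic_list A (z # zs) \<longleftrightarrow> (\<exists>P. primeideal P R \<and> Idl A \<subseteq> P \<and> P \<noteq> \<mm>) \<and>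
     (\<forall>P. assoc_prime (Idl A) P \<longrightarrow> P \<noteq> \<mm> \<longrightarrow> z \<notin> P) \<and> generic_list (insert z A) zs"

lemma generic_list_exists:
  assumes Y: "spanning Y" and "A \<subseteq> carrier R"
  shows "\<exists>zs. set zs \<subseteq> Y \<and> generic_list A zs \<and> (\<forall>P. primeideal P R \<longrightarrow> Idl (A \<union> set zs) \<subseteq> P \<longrightarrow> P = \<mm>)"
proof -
  have "A \<subseteq> carrier R \<Longrightarrow> Idl A = J \<Longrightarrow> ?thesis" if "ideal J R" for J
    using that
  proof (induction arbitrary: A rule: ideal_noetherian_induct)
    case (step J)
    show ?case
    proof (cases "\<forall>P. primeideal P R \<longrightarrow> J \<subseteq> P \<longrightarrow> P = \<mm>")
      case True
      then show ?thesis using step.prems by (intro exI[of _ "[]"]) auto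
    next
      case False
      then obtain Q where Q: "primeideal Q R" "J \<subseteq> Q" "Q \<noteq> \<mm>" by auto
      obtain z where z: "z \<in> Y" "\<forall>P. assoc_prime J P \<longrightarrow> P \<noteq> \<mm> \<longrightarrow> z \<notin> P"
        using generic_element[OF Y, of "{J}"] step.hyps by auto
      have zc: "z \<in> carrier R" using z spanning_carrier[OF Y] by auto
      \<comment> \<open>An associated prime below \<open>Q\<close> differs from \<open>\<mm>\<close>
        and is avoided by \<open>z\<close>, so \<open>J\<close> really grows and the induction
        hypothesis applies.\<close>
      obtain P where P: "assoc_prime J P" "P \<subseteq> Q" using assoc_prime_below_prime[OF step.hyps Q(1,2)] by auto
      have "P \<noteq> \<mm>" using P Q prime_subset_mm[OF Q(1)] by auto
      then have "z \<notin> P" using z P by auto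
      moreover have "J \<subseteq> P" using P subset_colon[OF step.hyps] by (auto simp: assoc_prime_def)
      ultimately have "z \<notin> J" by auto
      have ins: "insert z A \<subseteq> carrier R" using zc step.prems by auto
      have "J \<subset> Idl (insert z A)"
        using \<open>z \<notin> J\<close> genideal_self[OF ins] subset_Idl_subset[OF ins, of A] step.prems by blast
      from step.IH[OF genideal_ideal[OF ins] this ins refl] obtain zs where zs: "set zs \<subseteq> Y"
        "generic_list (insert z A) zs" "\<forall>P. primeideal P R \<longrightarrow> Idl (insert z A \<union> set zs) \<subseteq> P \<longrightarrow> P = \<mm>" by auto
      then show ?thesis using z Q step.prems by (intro exI[of _ "z # zs"]) auto
    qed
  qed
  then show ?thesis using assms genideal_ideal by auto
qed

text \<open>The chain is built downwards from the end of the list: below a prime over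
  \<open>(z, A)\<close> there is an associated prime of \<open>A\<close>, which omits
  \<open>z\<close> and is therefore strictly smaller.\<close>

lemma generic_list_prime_chain:
  assumes "A \<subseteq> \<mm>" "set zs \<subseteq> \<mm>" "generic_list A zs"
  shows "\<exists>P. (\<forall>i\<le>length zs. primeideal (P i) R) \<and> (\<forall>i<length zs. P i \<subset> P (Suc i)) \<and> Idl A \<subseteq> P 0"
  using assms
proof (induction zs arbitrary: A)
  case Nil
  have "Idl A \<subseteq> \<mm>" using Nil genideal_minimal[OF mm_ideal] by auto
  then show ?case using mm_prime by (intro exI[of _ "\<lambda>_. \<mm>"]) auto
next
  case (Cons z zs)
  note m = ideal_memD(1)[OF mm_ideal]
  from Cons.IH[of "insert z A"] Cons.prems obtain P where P: "\<forall>i\<le>length zs. primeideal (P i) R"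
    "\<forall>i<length zs. P i \<subset> P (Suc i)" "Idl (insert z A) \<subseteq> P 0" by auto
  have c: "insert z A \<subseteq> carrier R" using Cons.prems m by auto
  have sub: "Idl A \<subseteq> P 0" "z \<in> P 0" using P(3) subset_Idl_subset[OF c, of A] genideal_self[OF c] by auto
  have A: "ideal (Idl A) R" using c by (auto intro: genideal_ideal)
  have "\<exists>Q. primeideal Q R \<and> Q \<subset> P 0 \<and> Idl A \<subseteq> Q"
  \<comment> \<open>Below \<open>\<mm>\<close> the associated prime could be \<open>\<mm>\<close>
    again; in this case the first conjunct of \<open>generic_list\<close> supplies the smaller
    prime.\<close>
  proof (cases "P 0 = \<mm>")
    case True
    obtain Q where "primeideal Q R" "Idl A \<subseteq> Q" "Q \<noteq> \<mm>" using Cons.prems by auto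
    moreover from this have "Q \<subset> P 0" using True prime_subset_mm by blast
    ultimately show ?thesis by blast
  next
    case False
    obtain Q where Q: "assoc_prime (Idl A) Q" "Q \<subseteq> P 0" using assoc_prime_below_prime[OF A _ sub(1)] P(1) by auto
    have "Q \<noteq> \<mm>" using False Q prime_subset_mm[of "P 0"] P(1) by auto
    then have "z \<notin> Q" using Cons.prems Q by auto
    moreover have "Idl A \<subseteq> Q" using Q subset_colon[OF A] by (auto simp: assoc_prime_def)
    ultimately show ?thesis using Q sub by (auto simp: assoc_prime_def)
  qed
  then obtain Q where Q: "primeideal Q R" "Q \<subset> P 0" "Idl A \<subseteq> Q" by auto
  have "(\<forall>i\<le>length (z # zs). primeideal (case_nat Q P i) R) \<and>
    (\<forall>i<length (z # zs). case_nat Q P i \<subset> case_nat Q P (Suc i)) \<and> Idl A \<subseteq> case_nat Q P 0"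
    using P Q by (auto split: nat.split)
  then show ?case by (intro exI[of _ "case_nat Q P"])
qed

text \<open>Noetherian induction on the ideal: in the absence of a socle element a generic element
  of \<open>\<mm>\<close> is regular, and adding it enlarges the ideal.\<close>

lemma exact_depth_total:
  assumes "A \<subseteq> \<mm>" shows "\<exists>s. exact_depth \<mm> (carrier R) A s"
proof -
  have m: "\<mm> \<subseteq> carrier R" using ideal_memD(1)[OF mm_ideal] by auto
  have "A \<subseteq> \<mm> \<Longrightarrow> Idl A = J \<Longrightarrow> ?thesis" if "ideal J R" for J
    using that
  proof (induction arbitrary: A rule: ideal_noetherian_induct)
    case (step J)
    have Ac: "A \<subseteq> carrier R" using step.prems m by auto
    show ?case
    proof (cases "\<exists>n. socle_elem J n")
      case True
      then have "exact_depth \<mm> (carrier R) A 0" using step.prems by (auto simp: socle_elem_def)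
      then show ?thesis by blast
    next
      case False
      have sp: "spanning \<mm>" using admissible_mm by (auto simp: admissible_def)
      obtain w where w: "w \<in> \<mm>" "\<forall>P. assoc_prime J P \<longrightarrow> P \<noteq> \<mm> \<longrightarrow> w \<notin> P"
        using generic_element[OF sp, of "{J}"] step.hyps by auto
      have rw: "regular_mod J w" using regular_mod_if_avoids[OF step.hyps] False w m by auto
      have "w \<notin> J"
      proof
        assume "w \<in> J"
        then have "w \<otimes> \<one> \<in> J" using w m by auto
        then have "\<one> \<in> J" using rw by (auto simp: regular_mod_def)
        then show False using step.prems genideal_minimal[OF mm_ideal step.prems(1)] one_notin_mm by auto
      qed
      have ins: "insert w A \<subseteq> carrier R" using Ac w m by auto
      have "J \<subset> Idl (insert w A)"
        using \<open>w \<notin> J\<close> genideal_self[OF ins] subset_Idl_subset[OF ins, of A] step.prems by blast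
      from step.IH[OF genideal_ideal[OF ins] this _ refl]
      obtain s where "exact_depth \<mm> (carrier R) (insert w A) s" using step.prems w by auto
      then have "exact_depth \<mm> (carrier R) A (Suc s)" using w rw step.prems by auto
      then show ?thesis by blast
    qed
  qed
  then show ?thesis using assms m genideal_ideal by blast
qed

lemma exact_depth_ge_regular_list:
  assumes "A \<subseteq> \<mm>" "set zs \<subseteq> \<mm>" "regular_list A zs"
  shows "\<exists>s\<ge>length zs. exact_depth \<mm> (carrier R) A s"
  using assms
proof (induction zs arbitrary: A)
  case Nil then show ?case using exact_depth_total by auto
next
  case (Cons z zs)
  then have "insert z A \<subseteq> \<mm>" "set zs \<subseteq> \<mm>" "regular_list (insert z A) zs" by auto
  from Cons.IH[OF this] obtain s where "s \<ge> length zs" "exact_depth \<mm> (carrier R) (insert z A) s" by auto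
  then show ?case using Cons.prems by (intro exI[of _ "Suc s"]) auto
qed

text \<open>Positive exact depth excludes socle elements, so the next generic element is regular,
  and the exchange lemma then lowers the depth by exactly one.\<close>

lemma generic_list_regular:
  assumes "finite A" "A \<subseteq> \<mm>" "set zs \<subseteq> \<mm>" "generic_list A zs" "exact_depth \<mm> (carrier R) A s" "length zs \<le> s"
  shows "regular_list A zs"
  using assms
proof (induction zs arbitrary: A s)
  case (Cons z zs)
  have m: "\<mm> \<subseteq> carrier R" using ideal_memD(1)[OF mm_ideal] by auto
  obtain s' where s: "s = Suc s'" using Cons.prems by (cases s) auto
  then obtain y where "y \<in> \<mm>" "regular_mod (Idl A) y" using Cons.prems by auto
  then have "\<not> socle_elem (Idl A) n" for n using no_socle_if_regular by blast
  then have rz: "regular_mod (Idl A) z"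
    using regular_mod_if_avoids[of "Idl A" z] genideal_ideal[of A] Cons.prems m by auto
  have "exact_depth \<mm> (carrier R) (insert z A) s'"
    by (rule exact_depth_exchange[OF admissible_mm]) (use Cons.prems rz s in auto)
  then show ?case using rz Cons.prems Cons.IH[of "insert z A" s'] s by auto
qed simp

text \<open>The exchange is carried out along all of \<open>zs\<close>. The depth runs out exactly
  with the list, since the list is regular and ends where every element of \<open>\<mm>\<close> is
  nilpotent; what survives at the end is a socle element of the kind \<open>T\<close>.\<close>

lemma exact_depth_terminal:
  assumes "admissible Y T" "finite A" "A \<subseteq> Y" "set zs \<subseteq> Y" "regular_list A zs" "exact_depth Y T A s"
    "\<And>P. primeideal P R \<Longrightarrow> Idl (A \<union> set zs) \<subseteq> P \<Longrightarrow> P = \<mm>"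
  shows "\<exists>n\<in>T. n \<notin> Idl (A \<union> set zs)"
  using assms
proof (induction zs arbitrary: A s)
  case Nil
  have Y: "spanning Y" using Nil.prems(1) by (auto simp: admissible_def)
  have "A \<subseteq> \<mm>" using Nil.prems(3) Y by (auto simp: spanning_def)
  moreover have "A \<subseteq> carrier R" using Nil.prems(3) spanning_carrier[OF Y] by auto
  ultimately have A: "ideal (Idl A) R" "A \<subseteq> \<mm>" using genideal_ideal by auto
  show ?case
  proof (cases s)
    case 0 then show ?thesis using Nil by auto
  next
    \<comment> \<open>Depth left over at the end is impossible: a regular element would be
      nilpotent, and the quotient would vanish.\<close>
    case (Suc s')
    then obtain y where y: "y \<in> Y" "regular_mod (Idl A) y" using Nil by auto
    have ym: "y \<in> \<mm>" using y Y by (auto simp: spanning_def)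
    have "\<exists>n::nat. y [^] n \<in> Idl A" by (rule nilpotent_mod[OF A(1) _ ym]) (use Nil in auto)
    then have "\<one> \<in> Idl A" using regular_mod_pow[OF y(2)] ym ideal_memD(1)[OF mm_ideal] by blast
    then show ?thesis using genideal_minimal[OF mm_ideal A(2)] one_notin_mm by auto
  qed
next
  case (Cons z zs)
  show ?case
  proof (cases s)
    \<comment> \<open>Depth exhausted too early: \<open>z\<close> would kill a nonzero class
      although it is regular.\<close>
    case 0
    from 0 Cons.prems(4,6) obtain n where "n \<in> T" "n \<notin> Idl A" "z \<otimes> n \<in> Idl A" by auto
    then show ?thesis using Cons.prems(1,5) by (auto simp: admissible_def regular_mod_def)
  next
    case (Suc s')
    have "exact_depth Y T (insert z A) s'"
      by (rule exact_depth_exchange[OF Cons.prems(1)]) (use Cons.prems(2-6) Suc in auto)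
    then show ?thesis using Cons.IH[of "insert z A" s'] Cons.prems by auto
  qed
qed

end

section \<open>Localization at a prime ideal\<close>

text \<open>\<open>B_cring\<close> is an assumption because it comes with the Cohen-Macaulay
  hypothesis: the regular module of the localization is a module over a commutative ring.\<close>

locale prime_localization = cring G + P: primeideal P G for G (structure) and P +
  fixes S and B
  assumes S_def: "S = carrier G - P" and B_def: "B = localization G S" and B_cring: "cring B"
begin

sublocale B: cring B by (rule B_cring)

lemma S_carrier: "s \<in> S \<Longrightarrow> s \<in> carrier G" by (simp add: S_def)
lemma S_one: "\<one> \<in> S" using primeideal_memD(2)[OF P.primeideal_axioms] by (simp add: S_def)
lemma S_mult: "s \<in> S \<Longrightarrow> t \<in> S \<Longrightarrow> s \<otimes> t \<in> S"
  using primeideal_memD(3)[OF P.primeideal_axioms] by (auto simp: S_def)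

abbreviation frac where "frac a s \<equiv> fraction G S a s"

lemma diff_zero_iff: "a \<in> carrier G \<Longrightarrow> b \<in> carrier G \<Longrightarrow> a \<ominus> b = \<zero> \<longleftrightarrow> a = b"
  by (metis minus_eq r_neg minus_equality add.inv_closed minus_minus l_neg)

lemma cross_iff:
  assumes "u \<in> carrier G" "a \<in> carrier G" "s \<in> carrier G" "b \<in> carrier G" "t \<in> carrier G"
  shows "u \<otimes> (a \<otimes> t \<ominus> b \<otimes> s) = \<zero> \<longleftrightarrow> u \<otimes> (a \<otimes> t) = u \<otimes> (b \<otimes> s)"
proof -
  have "u \<otimes> (a \<otimes> t \<ominus> b \<otimes> s) = u \<otimes> (a \<otimes> t) \<ominus> u \<otimes> (b \<otimes> s)" using assms by algebra
  then show ?thesis using diff_zero_iff assms by simp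
qed

lemma frac_mem_iff:
  assumes "a \<in> carrier G" "s \<in> S"
  shows "(b, t) \<in> frac a s \<longleftrightarrow> b \<in> carrier G \<and> t \<in> S \<and> (\<exists>u\<in>S. u \<otimes> (a \<otimes> t) = u \<otimes> (b \<otimes> s))"
  using assms cross_iff S_carrier by (auto simp: fraction_def)

lemma frac_self: "a \<in> carrier G \<Longrightarrow> s \<in> S \<Longrightarrow> (a, s) \<in> frac a s"
  using frac_mem_iff S_one by blast

lemma frac_subset:
  assumes "a \<in> carrier G" "s \<in> S" "b \<in> carrier G" "t \<in> S" "u \<in> S" "u \<otimes> (a \<otimes> t) = u \<otimes> (b \<otimes> s)"
  shows "frac a s \<subseteq> frac b t"
proof (rule subrelI)
  fix c w assume "(c, w) \<in> frac a s"
  then obtain v where v: "v \<in> S" "v \<otimes> (a \<otimes> w) = v \<otimes> (c \<otimes> s)" and c: "c \<in> carrier G" "w \<in> S"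
    using frac_mem_iff[OF assms(1,2)] by auto
  note cs = assms(1,3) c(1) S_carrier[OF assms(2)] S_carrier[OF assms(4)] S_carrier[OF assms(5)]
    S_carrier[OF v(1)] S_carrier[OF c(2)]
  have "(u \<otimes> v \<otimes> s) \<otimes> (b \<otimes> w) = v \<otimes> w \<otimes> (u \<otimes> (b \<otimes> s))" using cs by (simp add: m_ac)
  also have "\<dots> = u \<otimes> t \<otimes> (v \<otimes> (a \<otimes> w))" unfolding assms(6)[symmetric] using cs by (simp add: m_ac)
  also have "\<dots> = (u \<otimes> v \<otimes> s) \<otimes> (c \<otimes> t)" unfolding v(2) using cs by (simp add: m_ac)
  finally show "(c, w) \<in> frac b t"
    using frac_mem_iff[OF assms(3,4)] c S_mult[OF S_mult[OF assms(5) v(1)] assms(2)] by blast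
qed

lemma frac_eq_iff:
  assumes "a \<in> carrier G" "s \<in> S" "b \<in> carrier G" "t \<in> S"
  shows "frac a s = frac b t \<longleftrightarrow> (\<exists>u\<in>S. u \<otimes> (a \<otimes> t) = u \<otimes> (b \<otimes> s))"
proof
  assume "frac a s = frac b t"
  then have "(b, t) \<in> frac a s" using frac_self[OF assms(3,4)] by simp
  then show "\<exists>u\<in>S. u \<otimes> (a \<otimes> t) = u \<otimes> (b \<otimes> s)" using frac_mem_iff[OF assms(1,2)] by simp
next
  assume "\<exists>u\<in>S. u \<otimes> (a \<otimes> t) = u \<otimes> (b \<otimes> s)"
  then obtain u where u: "u \<in> S" "u \<otimes> (a \<otimes> t) = u \<otimes> (b \<otimes> s)" by auto
  show "frac a s = frac b t" using frac_subset[OF assms u] frac_subset[OF assms(3,4,1,2) u(1) u(2)[symmetric]] by auto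
qed

lemma B_carrier: "X \<in> carrier B \<longleftrightarrow> (\<exists>a\<in>carrier G. \<exists>s\<in>S. X = frac a s)"
  by (auto simp: B_def localization_def)

lemma frac_closed: "a \<in> carrier G \<Longrightarrow> s \<in> S \<Longrightarrow> frac a s \<in> carrier B"
  using B_carrier by blast

lemma frac_mem_eq:
  assumes "a \<in> carrier G" "s \<in> S" "(b, t) \<in> frac a s"
  shows "b \<in> carrier G" "t \<in> S" "frac b t = frac a s"
proof -
  show b: "b \<in> carrier G" "t \<in> S" using assms(3) frac_mem_iff[OF assms(1,2)] by auto
  show "frac b t = frac a s" using assms(3) frac_mem_iff[OF assms(1,2)] frac_eq_iff[OF assms(1,2) b] by auto
qed

text \<open>The operations of the localization are unions over all representatives; independence of
  the choice makes all members of such a union equal.\<close>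

lemma frac_mult:
  assumes a: "a \<in> carrier G" "s \<in> S" and b: "b \<in> carrier G" "t \<in> S"
  shows "frac a s \<otimes>\<^bsub>B\<^esub> frac b t = frac (a \<otimes> b) (s \<otimes> t)"
proof -
  have "frac (a' \<otimes> b') (s' \<otimes> t') = frac (a \<otimes> b) (s \<otimes> t)"
    if h: "(a', s') \<in> frac a s" "(b', t') \<in> frac b t" for a' s' b' t'
  proof -
    note h1 = frac_mem_eq[OF a h(1)] and h2 = frac_mem_eq[OF b h(2)]
    obtain u where u: "u \<in> S" "u \<otimes> (a' \<otimes> s) = u \<otimes> (a \<otimes> s')" using h1 frac_eq_iff[OF h1(1,2) a] by auto
    obtain v where v: "v \<in> S" "v \<otimes> (b' \<otimes> t) = v \<otimes> (b \<otimes> t')" using h2 frac_eq_iff[OF h2(1,2) b] by auto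
    note cs = a(1) b(1) h1(1) h2(1) S_carrier[OF a(2)] S_carrier[OF b(2)] S_carrier[OF h1(2)] S_carrier[OF h2(2)]
      S_carrier[OF u(1)] S_carrier[OF v(1)]
    have "(u \<otimes> v) \<otimes> (a' \<otimes> b' \<otimes> (s \<otimes> t)) = (u \<otimes> (a' \<otimes> s)) \<otimes> (v \<otimes> (b' \<otimes> t))" using cs by (simp add: m_ac)
    also have "\<dots> = (u \<otimes> v) \<otimes> (a \<otimes> b \<otimes> (s' \<otimes> t'))" unfolding u(2) v(2) using cs by (simp add: m_ac)
    finally show ?thesis using frac_eq_iff[of "a' \<otimes> b'" "s' \<otimes> t'" "a \<otimes> b" "s \<otimes> t"] S_mult u v a b h1 h2 by blast
  qed
  then have "(\<Union>(a', s')\<in>frac a s. \<Union>(b', t')\<in>frac b t. frac (a' \<otimes> b') (s' \<otimes> t')) = frac (a \<otimes> b) (s \<otimes> t)"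
    using frac_self[OF a] frac_self[OF b] by fast
  then show ?thesis by (simp add: B_def localization_def)
qed

lemma frac_add:
  assumes a: "a \<in> carrier G" "s \<in> S" and b: "b \<in> carrier G" "t \<in> S"
  shows "frac a s \<oplus>\<^bsub>B\<^esub> frac b t = frac (a \<otimes> t \<oplus> b \<otimes> s) (s \<otimes> t)"
proof -
  have "frac (a' \<otimes> t' \<oplus> b' \<otimes> s') (s' \<otimes> t') = frac (a \<otimes> t \<oplus> b \<otimes> s) (s \<otimes> t)"
    if h: "(a', s') \<in> frac a s" "(b', t') \<in> frac b t" for a' s' b' t'
  proof -
    note h1 = frac_mem_eq[OF a h(1)] and h2 = frac_mem_eq[OF b h(2)]
    obtain u where u: "u \<in> S" "u \<otimes> (a' \<otimes> s) = u \<otimes> (a \<otimes> s')" using h1 frac_eq_iff[OF h1(1,2) a] by auto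
    obtain v where v: "v \<in> S" "v \<otimes> (b' \<otimes> t) = v \<otimes> (b \<otimes> t')" using h2 frac_eq_iff[OF h2(1,2) b] by auto
    note cs = a(1) b(1) h1(1) h2(1) S_carrier[OF a(2)] S_carrier[OF b(2)] S_carrier[OF h1(2)] S_carrier[OF h2(2)]
      S_carrier[OF u(1)] S_carrier[OF v(1)]
    have "(u \<otimes> v) \<otimes> ((a' \<otimes> t' \<oplus> b' \<otimes> s') \<otimes> (s \<otimes> t)) =
        (u \<otimes> (a' \<otimes> s)) \<otimes> (v \<otimes> t \<otimes> t') \<oplus> (v \<otimes> (b' \<otimes> t)) \<otimes> (u \<otimes> s \<otimes> s')" using cs by (simp add: m_ac r_distr l_distr)
    also have "\<dots> = (u \<otimes> v) \<otimes> ((a \<otimes> t \<oplus> b \<otimes> s) \<otimes> (s' \<otimes> t'))" unfolding u(2) v(2) using cs by (simp add: m_ac r_distr l_distr)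
    finally show ?thesis using frac_eq_iff[of "a' \<otimes> t' \<oplus> b' \<otimes> s'" "s' \<otimes> t'" "a \<otimes> t \<oplus> b \<otimes> s" "s \<otimes> t"] S_mult u v a b h1 h2
      S_carrier by blast
  qed
  then have "(\<Union>(a', s')\<in>frac a s. \<Union>(b', t')\<in>frac b t. frac (a' \<otimes> t' \<oplus> b' \<otimes> s') (s' \<otimes> t')) = frac (a \<otimes> t \<oplus> b \<otimes> s) (s \<otimes> t)"
    using frac_self[OF a] frac_self[OF b] by fast
  then show ?thesis by (simp add: B_def localization_def)
qed

lemma B_one: "\<one>\<^bsub>B\<^esub> = frac \<one> \<one>" and B_zero: "\<zero>\<^bsub>B\<^esub> = frac \<zero> \<one>"
  by (simp_all add: B_def localization_def)

definition \<iota> where "\<iota> a = frac a \<one>"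

lemma iota_closed: "a \<in> carrier G \<Longrightarrow> \<iota> a \<in> carrier B"
  unfolding \<iota>_def using S_one by (simp add: frac_closed)

lemma iota_mult: "a \<in> carrier G \<Longrightarrow> b \<in> carrier G \<Longrightarrow> \<iota> (a \<otimes> b) = \<iota> a \<otimes>\<^bsub>B\<^esub> \<iota> b"
  unfolding \<iota>_def using S_one by (simp add: frac_mult)

lemma iota_add: "a \<in> carrier G \<Longrightarrow> b \<in> carrier G \<Longrightarrow> \<iota> (a \<oplus> b) = \<iota> a \<oplus>\<^bsub>B\<^esub> \<iota> b"
  unfolding \<iota>_def using S_one by (simp add: frac_add)

lemma iota_hom: "ring_hom_ring G B \<iota>"
  using iota_closed iota_mult iota_add by (intro ring_hom_ringI) (auto simp: B_one \<iota>_def ring_axioms B.ring_axioms)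

lemma frac_cancel: "a \<in> carrier G \<Longrightarrow> s \<in> S \<Longrightarrow> \<iota> s \<otimes>\<^bsub>B\<^esub> frac a s = \<iota> a"
  unfolding \<iota>_def using S_one S_carrier frac_mult[of s \<one> a s] frac_eq_iff[of "s \<otimes> a" "\<one> \<otimes> s" a \<one>]
  by (auto simp: m_comm S_mult intro!: bexI[of _ \<one>])

lemma frac_iota: "a \<in> carrier G \<Longrightarrow> s \<in> S \<Longrightarrow> frac a s = frac \<one> s \<otimes>\<^bsub>B\<^esub> \<iota> a"
  unfolding \<iota>_def using S_one S_carrier frac_mult[of \<one> s a \<one>] by auto

definition N where "N = {frac a s | a s. a \<in> P \<and> s \<in> S}"

text \<open>Clearing denominators puts a multiple of \<open>a\<close> by an element of
  \<open>S\<close> into \<open>J\<close>, and \<open>sat\<close> cancels that factor. So a saturated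
  ideal is recovered from its extension.\<close>

lemma frac_in_extension:
  assumes J: "ideal J G" and sat: "\<And>s a. s \<in> S \<Longrightarrow> a \<in> carrier G \<Longrightarrow> s \<otimes> a \<in> J \<Longrightarrow> a \<in> J"
    and a: "a \<in> carrier G" "s \<in> S"
  shows "frac a s \<in> {frac a s | a s. a \<in> J \<and> s \<in> S} \<longleftrightarrow> a \<in> J"
proof
  assume "frac a s \<in> {frac a s | a s. a \<in> J \<and> s \<in> S}"
  then obtain b t where b: "b \<in> J" "t \<in> S" "frac a s = frac b t" by auto
  have bc: "b \<in> carrier G" using ideal_memD(1)[OF J] b by auto
  obtain u where u: "u \<in> S" "u \<otimes> (a \<otimes> t) = u \<otimes> (b \<otimes> s)" using frac_eq_iff[OF a bc b(2)] b(3) by auto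
  note cs = S_carrier[OF u(1)] S_carrier[OF a(2)] S_carrier[OF b(2)]
  have "u \<otimes> (b \<otimes> s) \<in> J" using ideal_memD(6,7)[OF J] b cs by auto
  then have "(u \<otimes> t) \<otimes> a \<in> J" using u(2) cs a by (simp add: m_ac)
  then show "a \<in> J" using sat[OF S_mult[OF u(1) b(2)] a(1)] by simp
qed (use a in auto)

lemma extension_ideal:
  assumes J: "ideal J G"
  shows "ideal {frac a s | a s. a \<in> J \<and> s \<in> S} B"
proof (rule B.idealI')
  note i = ideal_memD[OF J]
  show "{frac a s |a s. a \<in> J \<and> s \<in> S} \<subseteq> carrier B" using i(1) frac_closed by auto
  show "\<zero>\<^bsub>B\<^esub> \<in> {frac a s |a s. a \<in> J \<and> s \<in> S}" using i(2) S_one B_zero by auto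
  fix X Y assume "X \<in> {frac a s |a s. a \<in> J \<and> s \<in> S}" "Y \<in> {frac a s |a s. a \<in> J \<and> s \<in> S}"
  then obtain a s b t where h: "a \<in> J" "s \<in> S" "b \<in> J" "t \<in> S" "X = frac a s" "Y = frac b t" by auto
  have "a \<otimes> t \<oplus> b \<otimes> s \<in> J" using h i S_carrier by auto
  moreover have "X \<oplus>\<^bsub>B\<^esub> Y = frac (a \<otimes> t \<oplus> b \<otimes> s) (s \<otimes> t)" using h frac_add[of a s b t] i(1) by simp
  ultimately show "X \<oplus>\<^bsub>B\<^esub> Y \<in> {frac a s |a s. a \<in> J \<and> s \<in> S}" using S_mult[OF h(2,4)] by blast
next
  note i = ideal_memD[OF J]
  fix X Y assume "X \<in> {frac a s |a s. a \<in> J \<and> s \<in> S}" "Y \<in> carrier B"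
  then obtain a s b t where h: "a \<in> J" "s \<in> S" "b \<in> carrier G" "t \<in> S" "X = frac a s" "Y = frac b t" using B_carrier by auto
  have "b \<otimes> a \<in> J" using h i by auto
  moreover have "Y \<otimes>\<^bsub>B\<^esub> X = frac (b \<otimes> a) (t \<otimes> s)" using h frac_mult[of b t a s] i(1) by simp
  ultimately show "Y \<otimes>\<^bsub>B\<^esub> X \<in> {frac a s |a s. a \<in> J \<and> s \<in> S}" using S_mult[OF h(4,2)] by blast
qed

lemma contraction_ideal: "ideal J B \<Longrightarrow> ideal {a \<in> carrier G. \<iota> a \<in> J} G"
  by (rule ring_hom_ring.ideal_vimage[OF iota_hom])

lemma P_saturated: "s \<in> S \<Longrightarrow> a \<in> carrier G \<Longrightarrow> s \<otimes> a \<in> P \<Longrightarrow> a \<in> P"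
  using primeideal_memD(3)[OF P.primeideal_axioms] by (auto simp: S_def)

lemma frac_N_iff: "a \<in> carrier G \<Longrightarrow> s \<in> S \<Longrightarrow> frac a s \<in> N \<longleftrightarrow> a \<in> P"
  unfolding N_def by (rule frac_in_extension[OF P.is_ideal P_saturated])

lemma iota_N_iff: "a \<in> carrier G \<Longrightarrow> \<iota> a \<in> N \<longleftrightarrow> a \<in> P"
  unfolding \<iota>_def by (rule frac_N_iff[OF _ S_one])

lemma B_noetherian:
  assumes "noetherian_ring G" shows "noetherian_ring B"
proof (rule B.noetherian_ringI)
  fix J assume J: "ideal J B"
  from noetherian_ring.finetely_gen[OF assms contraction_ideal[OF J]] obtain A where
    A: "A \<subseteq> carrier G" "finite A" "{a \<in> carrier G. \<iota> a \<in> J} = Idl A" by auto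
  have AJ: "\<iota> ` A \<subseteq> J" using A genideal_self[OF A(1)] by auto
  have ic: "\<iota> ` A \<subseteq> carrier B" using A iota_closed by auto
  have K: "ideal (Idl\<^bsub>B\<^esub> (\<iota> ` A)) B" by (rule B.genideal_ideal[OF ic])
  have "J \<subseteq> Idl\<^bsub>B\<^esub> (\<iota> ` A)"
  proof
    fix X assume X: "X \<in> J"
    then obtain a s where a: "a \<in> carrier G" "s \<in> S" "X = frac a s"
      using B_carrier B.ideal_memD(1)[OF J] by blast
    have "\<iota> a \<in> J" using frac_cancel[OF a(1,2)] B.ideal_memD(6)[OF J X, of "\<iota> s"] a iota_closed S_carrier by auto
    then have "a \<in> Idl A" using a A by auto
    moreover have "Idl A \<subseteq> {a \<in> carrier G. \<iota> a \<in> Idl\<^bsub>B\<^esub> (\<iota> ` A)}"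
      using A(1) B.genideal_self[OF ic] by (intro genideal_minimal[OF contraction_ideal[OF K]]) auto
    ultimately have "\<iota> a \<in> Idl\<^bsub>B\<^esub> (\<iota> ` A)" by auto
    then show "X \<in> Idl\<^bsub>B\<^esub> (\<iota> ` A)" using frac_iota[OF a(1,2)] a B.ideal_memD(6)[OF K] frac_closed one_closed by auto
  qed
  moreover have "Idl\<^bsub>B\<^esub> (\<iota> ` A) \<subseteq> J" using B.genideal_minimal[OF J AJ] .
  ultimately show "\<exists>A\<subseteq>carrier B. finite A \<and> J = Idl\<^bsub>B\<^esub> A" using A(2) ic by (intro exI[of _ "\<iota> ` A"]) auto
qed

lemma B_noetherian_local:
  assumes "noetherian_ring G" shows "noetherian_local B N"
proof -
  have nc: "noetherian_cring B" using B_noetherian[OF assms] B_cring by (simp add: noetherian_cring_def)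
  show ?thesis
  proof (rule noetherian_local.intro[OF nc], rule noetherian_local_axioms.intro)
    show "ideal N B" unfolding N_def by (rule extension_ideal[OF P.is_ideal])
    show "\<one>\<^bsub>B\<^esub> \<notin> N" unfolding B_one using frac_N_iff[OF one_closed S_one] S_one by (auto simp: S_def)
    fix X assume "X \<in> carrier B" "X \<notin> N"
    then obtain a s where a: "a \<in> carrier G" "s \<in> S" "X = frac a s" "a \<notin> P" using B_carrier frac_N_iff by auto
    have aS: "a \<in> S" using a by (auto simp: S_def)
    have "frac s a \<otimes>\<^bsub>B\<^esub> X = \<one>\<^bsub>B\<^esub>"
      unfolding a(3) B_one frac_mult[OF S_carrier[OF a(2)] aS a(1,2)]
      using frac_eq_iff[of "s \<otimes> a" "a \<otimes> s" \<one> \<one>] a aS S_mult S_carrier S_one m_comm by (auto intro!: bexI[of _ \<one>])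
    then show "\<exists>b\<in>carrier B. b \<otimes>\<^bsub>B\<^esub> X = \<one>\<^bsub>B\<^esub>" using frac_closed[OF S_carrier[OF a(2)] aS] by blast
  qed
qed

end

context noetherian_local begin

lemma mm_maximal: "maximalideal \<mm> R"
proof (rule maximalidealI[OF mm_ideal])
  show "carrier R \<noteq> \<mm>" using one_notin_mm by auto
  fix J assume J: "ideal J R" "\<mm> \<subseteq> J" "J \<subseteq> carrier R"
  show "J = \<mm> \<or> J = carrier R"
    using proper_ideal_subset_mm[OF J(1)] ideal.one_imp_carrier[OF J(1)] J(2) by blast
qed

lemma max_ideal_eq: "max_ideal R = \<mm>"
  unfolding max_ideal_def
proof (rule the_equality, rule mm_maximal)
  fix J assume J: "maximalideal J R"
  then have "primeideal J R" by (rule maximalideal_prime)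
  then have s: "J \<subseteq> \<mm>" by (rule prime_subset_mm)
  from maximalideal.I_maximal[OF J mm_ideal s] show "J = \<mm>"
    using ideal_memD(1)[OF mm_ideal] one_notin_mm by auto
qed

end

text \<open>If \<open>a\<close> has no inverse, an ideal maximal among those that contain
  \<open>a\<close> and omit \<open>\<one>\<close> is a maximal ideal, and uniqueness identifies it
  with \<open>max_ideal R\<close>.\<close>

lemma noetherian_localI:
  assumes "local_ring R" "noetherian_ring R"
  shows "noetherian_local R (max_ideal R)"
proof -
  interpret cring R using assms by (simp add: local_ring_def)
  interpret noetherian_ring R by fact
  interpret noetherian_cring R ..
  have ex: "\<exists>!\<mm>. maximalideal \<mm> R" using assms by (simp add: local_ring_def)
  then have m: "maximalideal (max_ideal R) R" unfolding max_ideal_def by (rule theI')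
  interpret m: maximalideal "max_ideal R" R by (rule m)
  show ?thesis
  proof (rule noetherian_local.intro[OF noetherian_cring_axioms], rule noetherian_local_axioms.intro, rule m.is_ideal)
    show "\<one>\<^bsub>R\<^esub> \<notin> max_ideal R" using m.I_notcarr m.one_imp_carrier by auto
    fix a assume a: "a \<in> carrier R" "a \<notin> max_ideal R"
    show "\<exists>b\<in>carrier R. b \<otimes>\<^bsub>R\<^esub> a = \<one>\<^bsub>R\<^esub>"
    proof (rule ccontr)
      assume n: "\<not> ?thesis"
      let ?F = "{J. ideal J R \<and> a \<in> J \<and> \<one>\<^bsub>R\<^esub> \<notin> J}"
      have "PIdl\<^bsub>R\<^esub> a \<in> ?F" using a n cgenideal_ideal cgenideal_self by (auto simp: cgenideal_def)
      then obtain K where K: "K \<in> ?F" "\<forall>J\<in>?F. K \<subseteq> J \<longrightarrow> J = K"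
        using ideal_maximal_element[of ?F] by (metis (no_types, lifting) empty_iff mem_Collect_eq)
      have "maximalideal K R"
      proof (rule maximalidealI)
        show "ideal K R" "carrier R \<noteq> K" using K by auto
        fix J assume "ideal J R" "K \<subseteq> J" "J \<subseteq> carrier R"
        then show "J = K \<or> J = carrier R" using K ideal.one_imp_carrier[of J R] by auto
      qed
      then have "K = max_ideal R" using ex m by blast
      then show False using K a by auto
    qed
  qed
qed

section \<open>The associated graded ring\<close>

text \<open>Ideal powers are instances of \<open>[^]\<close> in the monoid of ideals; their
  recursion is applied only by name, so that exponents stay visible as degrees.\<close>

declare Group.nat_pow_Suc [simp del] Group.nat_pow_0 [simp del]

context cring begin

lemma ideal_power_ideal: "ideal I R \<Longrightarrow> ideal (ideal_power R I n) R"
  by (induction n) (auto simp: Group.nat_pow_0 Group.nat_pow_Suc ideals_set_def oneideal intro: ideal_prod_is_ideal)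

lemma ideal_power_0: "ideal_power R I 0 = carrier R"
  by (simp add: Group.nat_pow_0 ideals_set_def)

lemma ideal_power_Suc: "ideal_power R I (Suc n) = ideal_power R I n \<cdot> I"
  by (simp add: Group.nat_pow_Suc ideals_set_def)

lemma ideal_power_1: "ideal I R \<Longrightarrow> ideal_power R I (Suc 0) = I"
  using ideal_prod_one[of I] ideal_prod_commute[OF oneideal] by (simp add: ideal_power_Suc ideal_power_0)

lemma ideal_power_Suc2: "ideal I R \<Longrightarrow> ideal_power R I (Suc n) = I \<cdot> ideal_power R I n"
  unfolding ideal_power_Suc by (rule ideal_prod_commute[OF ideal_power_ideal])

lemma ideal_prod_subset:
  assumes "ideal K R" "\<And>a b. a \<in> I \<Longrightarrow> b \<in> J \<Longrightarrow> a \<otimes> b \<in> K" shows "I \<cdot> J \<subseteq> K"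
proof
  fix s assume "s \<in> I \<cdot> J"
  then show "s \<in> K" by induction (use assms ideal_memD in auto)
qed

lemma ideal_prod_mono: "I \<subseteq> I' \<Longrightarrow> J \<subseteq> J' \<Longrightarrow> I \<cdot> J \<subseteq> I' \<cdot> J'"
proof
  fix s assume h: "I \<subseteq> I'" "J \<subseteq> J'" "s \<in> I \<cdot> J"
  from h(3) show "s \<in> I' \<cdot> J'"
    by induction (use h(1,2) in \<open>auto intro: ideal_prod.intros\<close>)
qed

lemma colon_set_ideal:
  assumes "ideal K R" "c \<in> carrier R" shows "ideal {a \<in> carrier R. c \<otimes> a \<in> K} R"
  by (rule idealI') (use assms in \<open>auto simp: r_distr ideal_memD m_lcomm\<close>)

lemma ideal_power_mult:
  assumes "ideal I R" "a \<in> ideal_power R I n" "b \<in> ideal_power R I m"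
  shows "a \<otimes> b \<in> ideal_power R I (n + m)"
  using assms(3)
proof (induction m arbitrary: b)
  case 0
  then show ?case using ideal_memD(7)[OF ideal_power_ideal[OF assms(1)] assms(2)] by (simp add: ideal_power_0)
next
  case (Suc m)
  have ac: "a \<in> carrier R" using ideal_memD(1)[OF ideal_power_ideal[OF assms(1)] assms(2)] .
  have "ideal_power R I m \<cdot> I \<subseteq> {c \<in> carrier R. a \<otimes> c \<in> ideal_power R I (n + Suc m)}"
  proof (rule ideal_prod_subset[OF colon_set_ideal[OF ideal_power_ideal[OF assms(1)] ac]])
    fix c e assume c: "c \<in> ideal_power R I m" "e \<in> I"
    then have cc: "c \<in> carrier R" "e \<in> carrier R"
      using ideal_memD(1)[OF ideal_power_ideal[OF assms(1)]] ideal_memD(1)[OF assms(1)] by auto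
    have "(a \<otimes> c) \<otimes> e \<in> ideal_power R I (n + m) \<cdot> I" using Suc.IH[OF c(1)] c(2) by (rule ideal_prod.prod)
    then show "c \<otimes> e \<in> {c \<in> carrier R. a \<otimes> c \<in> ideal_power R I (n + Suc m)}"
      using cc ac by (simp add: m_assoc ideal_power_Suc)
  qed
  then show ?case using Suc.prems unfolding ideal_power_Suc by auto
qed

lemma ideal_power_Suc_subset: "ideal I R \<Longrightarrow> ideal_power R I (Suc n) \<subseteq> ideal_power R I n"
  using ideal_prod_inter[OF ideal_power_ideal, of I I n] unfolding ideal_power_Suc by auto

lemma ideal_power_antimono: "ideal I R \<Longrightarrow> m \<le> n \<Longrightarrow> ideal_power R I n \<subseteq> ideal_power R I m"
proof -
  assume "ideal I R" "m \<le> n"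
  from this(2) show ?thesis
    by (induction n rule: dec_induct) (use ideal_power_Suc_subset[OF \<open>ideal I R\<close>] in blast)+
qed

lemma pow_mem_ideal_power: "ideal I R \<Longrightarrow> a \<in> I \<Longrightarrow> a [^] (n::nat) \<in> ideal_power R I n"
  by (induction n) (auto simp: ideal_power_0 ideal_power_Suc intro: ideal_prod.prod)

lemma coset_mem_iff:
  assumes "ideal J R" "a \<in> carrier R"
  shows "b \<in> J +> a \<longleftrightarrow> b \<in> carrier R \<and> b \<ominus> a \<in> J"
proof
  assume "b \<in> J +> a"
  then obtain j where j: "j \<in> J" "b = j \<oplus> a" by (auto simp: a_r_coset_def')
  have jc: "j \<in> carrier R" using j ideal_memD[OF assms(1)] by auto
  have "b \<ominus> a = j" unfolding j(2) using jc assms(2) by algebra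
  then show "b \<in> carrier R \<and> b \<ominus> a \<in> J" using j jc assms by auto
next
  assume b: "b \<in> carrier R \<and> b \<ominus> a \<in> J"
  then have "b = (b \<ominus> a) \<oplus> a" using assms(2) by algebra
  then show "b \<in> J +> a" using b by (auto simp: a_r_coset_def')
qed

lemma coset_eq_iff:
  "ideal J R \<Longrightarrow> a \<in> carrier R \<Longrightarrow> b \<in> carrier R \<Longrightarrow> J +> a = J +> b \<longleftrightarrow> a \<ominus> b \<in> J"
  using quotient_eq_iff_same_a_r_cos by simp

lemma coset_self: "ideal J R \<Longrightarrow> a \<in> carrier R \<Longrightarrow> a \<in> J +> a"
  using coset_mem_iff ideal_memD(2) by (simp add: r_neg minus_eq)

lemma finsum_ideal:
  assumes "ideal J R" "finite A" "\<And>i. i \<in> A \<Longrightarrow> f i \<in> J" shows "finsum R f A \<in> J"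
  using assms(2,3)
proof (induction A rule: finite_induct)
  case (insert i A)
  have "f \<in> A \<rightarrow> carrier R" "f i \<in> carrier R" using insert ideal_memD(1)[OF assms(1)] by auto
  then show ?case using insert ideal_memD(3)[OF assms(1)] by (simp add: finsum_insert)
qed (use ideal_memD(2)[OF assms(1)] in simp)

lemma finsum_diff_ideal:
  assumes "ideal J R" "finite A" "\<And>i. i \<in> A \<Longrightarrow> f i \<in> carrier R" "\<And>i. i \<in> A \<Longrightarrow> g i \<in> carrier R"
    "\<And>i. i \<in> A \<Longrightarrow> f i \<ominus> g i \<in> J"
  shows "finsum R f A \<ominus> finsum R g A \<in> J"
  using assms(2-5)
proof (induction A rule: finite_induct)
  case (insert i A)
  have c: "f i \<in> carrier R" "g i \<in> carrier R" "finsum R f A \<in> carrier R" "finsum R g A \<in> carrier R"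
    using insert by (auto intro!: finsum_closed)
  have e: "finsum R f (insert i A) = f i \<oplus> finsum R f A" "finsum R g (insert i A) = g i \<oplus> finsum R g A"
    using insert by (auto intro!: finsum_insert)
  have "finsum R f (insert i A) \<ominus> finsum R g (insert i A) = (f i \<ominus> g i) \<oplus> (finsum R f A \<ominus> finsum R g A)"
    unfolding e using c by algebra
  then show ?case using insert ideal_memD(3)[OF assms(1)] by auto
qed (use ideal_memD(2)[OF assms(1)] in \<open>simp add: minus_eq\<close>)

end

text \<open>Together \<open>I_mm\<close> and \<open>I_pow\<close> say that \<open>I\<close> has
  radical \<open>\<mm>\<close>. \<open>G_cring\<close> is an assumption because the Cohen-Macaulay
  hypothesis on the associated graded ring includes it.\<close>

locale graded_ring = noetherian_local +
  fixes I and G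
  defines "G \<equiv> associated_graded R I"
  assumes I_ideal: "ideal I R" and I_mm: "I \<subseteq> \<mm>" and I_pow: "a \<in> \<mm> \<Longrightarrow> \<exists>n::nat. a [^] n \<in> I"
    and G_cring: "cring G"
begin

sublocale G: cring G by (rule G_cring)

abbreviation pow where "pow n \<equiv> ideal_power R I n"

lemma pow_ideal: "ideal (pow n) R" by (rule ideal_power_ideal[OF I_ideal])
lemmas powD = ideal_memD[OF pow_ideal]

lemma pow_coset_zero: "pow n +> \<zero> = pow n"
  using powD(1) by (intro a_coset_add_zero) auto

lemma G_carrier: "f \<in> carrier G \<longleftrightarrow> (\<forall>n. \<exists>a\<in>pow n. f n = pow (Suc n) +> a) \<and> finite {n. f n \<noteq> pow (Suc n)}"
  by (simp add: G_def associated_graded_def)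

lemma G_mem:
  assumes "f \<in> carrier G" "a \<in> f n" shows "a \<in> pow n" "f n = pow (Suc n) +> a"
proof -
  from assms(1) have "\<exists>b\<in>pow n. f n = pow (Suc n) +> b" unfolding G_carrier by blast
  then obtain b where b: "b \<in> pow n" "f n = pow (Suc n) +> b" by blast
  have bc: "b \<in> carrier R" using powD(1)[OF b(1)] .
  have a: "a \<in> carrier R" "a \<ominus> b \<in> pow (Suc n)" using assms(2) unfolding b(2) coset_mem_iff[OF pow_ideal bc] by auto
  then have "a \<ominus> b \<in> pow n" using ideal_power_Suc_subset[OF I_ideal] by blast
  moreover have "a = (a \<ominus> b) \<oplus> b" using a bc by algebra
  ultimately show "a \<in> pow n" using powD(3)[OF _ b(1)] by metis
  show "f n = pow (Suc n) +> a" unfolding b(2) using coset_eq_iff[OF pow_ideal a(1) bc] a by auto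
qed

lemma G_mem_iff:
  assumes "f \<in> carrier G" "a \<in> f n" shows "b \<in> f n \<longleftrightarrow> b \<in> carrier R \<and> b \<ominus> a \<in> pow (Suc n)"
  unfolding G_mem(2)[OF assms] by (rule coset_mem_iff[OF pow_ideal powD(1)[OF G_mem(1)[OF assms]]])

lemma G_ex: "f \<in> carrier G \<Longrightarrow> \<exists>a. a \<in> f n"
  using G_carrier powD(1) coset_self[OF pow_ideal] by metis

definition rep where "rep f n = (SOME a. a \<in> f n)"

lemma rep_mem: "f \<in> carrier G \<Longrightarrow> rep f n \<in> f n"
  unfolding rep_def using G_ex by (rule someI_ex)

lemma rep_pow: "f \<in> carrier G \<Longrightarrow> rep f n \<in> pow n" using rep_mem G_mem(1) by blast
lemma rep_carrier: "f \<in> carrier G \<Longrightarrow> rep f n \<in> carrier R" using rep_pow powD(1) by blast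

lemma G_eqI:
  assumes "f \<in> carrier G" "g \<in> carrier G" "\<And>n. \<exists>a. a \<in> f n \<and> a \<in> g n" shows "f = g"
  using G_mem(2)[OF assms(1)] G_mem(2)[OF assms(2)] assms(3) by (metis ext)

lemma G_add_mem: "a \<in> f n \<Longrightarrow> b \<in> g n \<Longrightarrow> a \<oplus> b \<in> (f \<oplus>\<^bsub>G\<^esub> g) n"
  by (auto simp: G_def associated_graded_def set_add_def')

text \<open>The product is defined on representatives picked by \<open>SOME\<close>. Other
  representatives change each summand by an element of \<open>pow (Suc n)\<close>, so any choice
  computes the same coset.\<close>

lemma G_mult_mem:
  assumes f: "f \<in> carrier G" and g: "g \<in> carrier G" and ab: "\<And>i. i \<le> n \<Longrightarrow> a i \<in> f i" "\<And>i. i \<le> n \<Longrightarrow> b i \<in> g i"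
  shows "(\<Oplus>i\<in>{..n}. a i \<otimes> b (n - i)) \<in> (f \<otimes>\<^bsub>G\<^esub> g) n"
proof -
  have e: "(f \<otimes>\<^bsub>G\<^esub> g) n = pow (Suc n) +> (\<Oplus>i\<in>{..n}. rep f i \<otimes> rep g (n - i))"
    by (simp add: G_def associated_graded_def rep_def)
  have ac: "a i \<in> pow i" "b i \<in> pow i" if "i \<le> n" for i using ab[OF that] G_mem(1) f g by auto
  have ac': "a i \<in> carrier R" "b i \<in> carrier R" if "i \<le> n" for i using ac[OF that] powD(1) by auto
  note fc = rep_carrier[OF f] and gc = rep_carrier[OF g]
  have "(\<Oplus>i\<in>{..n}. a i \<otimes> b (n - i)) \<ominus> (\<Oplus>i\<in>{..n}. rep f i \<otimes> rep g (n - i)) \<in> pow (Suc n)"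
  proof (rule finsum_diff_ideal[OF pow_ideal])
    fix i assume i: "i \<in> {..n}"
    then have l: "i \<le> n" "n - i \<le> n" by auto
    have d1: "a i \<ominus> rep f i \<in> pow (Suc i)" using G_mem_iff[OF f rep_mem[OF f]] ab(1)[OF l(1)] by blast
    have d2: "b (n - i) \<ominus> rep g (n - i) \<in> pow (Suc (n - i))" using G_mem_iff[OF g rep_mem[OF g]] ab(2)[OF l(2)] by blast
    have "a i \<otimes> b (n - i) \<ominus> rep f i \<otimes> rep g (n - i) =
      (a i \<ominus> rep f i) \<otimes> b (n - i) \<oplus> rep f i \<otimes> (b (n - i) \<ominus> rep g (n - i))"
      using ac'(1)[OF l(1)] ac'(2)[OF l(2)] fc gc by algebra
    moreover have "(a i \<ominus> rep f i) \<otimes> b (n - i) \<in> pow (Suc n)"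
      using ideal_power_mult[OF I_ideal d1 ac(2)[OF l(2)]] l by (simp)
    moreover have "rep f i \<otimes> (b (n - i) \<ominus> rep g (n - i)) \<in> pow (Suc n)"
      using ideal_power_mult[OF I_ideal rep_pow[OF f, of i] d2] l by (simp)
    ultimately show "a i \<otimes> b (n - i) \<ominus> rep f i \<otimes> rep g (n - i) \<in> pow (Suc n)" using powD(3) by (simp)
  qed (use ac' fc gc in auto)
  then show ?thesis unfolding e using ac' fc gc by (subst coset_mem_iff[OF pow_ideal]) (auto intro!: finsum_closed)
qed

text \<open>This is the initial form of \<open>a\<close> only if the order of \<open>a\<close> is
  exactly \<open>n\<close>. For higher order it is zero, which makes the map additive on
  \<open>pow n\<close>.\<close>

definition hform where "hform n a = (\<lambda>k. if k = n then pow (Suc n) +> a else pow (Suc k))"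

lemma hform_closed: "a \<in> pow n \<Longrightarrow> hform n a \<in> carrier G"
  unfolding G_carrier
proof (intro conjI allI)
  assume a: "a \<in> pow n"
  show "\<exists>b\<in>pow k. hform n a k = pow (Suc k) +> b" for k
  proof (cases "k = n")
    case False
    then show ?thesis using powD(2)[of k]
      by (intro bexI[of _ \<zero>]) (auto simp: hform_def pow_coset_zero)
  qed (use a in \<open>auto simp: hform_def\<close>)
  show "finite {k. hform n a k \<noteq> pow (Suc k)}"
    by (rule finite_subset[of _ "{n}"]) (auto simp: hform_def)
qed

lemma hform_mem: "a \<in> pow n \<Longrightarrow> (if k = n then a else \<zero>) \<in> hform n a k"
  using coset_self[OF pow_ideal powD(1)] powD(2) by (auto simp: hform_def)

lemma hform_add: "a \<in> pow n \<Longrightarrow> b \<in> pow n \<Longrightarrow> hform n (a \<oplus> b) = hform n a \<oplus>\<^bsub>G\<^esub> hform n b"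
proof (rule G_eqI)
  assume ab: "a \<in> pow n" "b \<in> pow n"
  have ab': "a \<oplus> b \<in> pow n" using powD(3) ab by auto
  have c: "a \<in> carrier R" "b \<in> carrier R" using ab powD(1) by auto
  fix k
  have "(if k = n then a else \<zero>) \<oplus> (if k = n then b else \<zero>) \<in> (hform n a \<oplus>\<^bsub>G\<^esub> hform n b) k"
    by (intro G_add_mem hform_mem ab)
  then show "\<exists>c. c \<in> hform n (a \<oplus> b) k \<and> c \<in> (hform n a \<oplus>\<^bsub>G\<^esub> hform n b) k"
    using hform_mem[OF ab', of k] c by (cases "k = n") auto
qed (use powD(3) in \<open>auto intro: hform_closed\<close>)

lemma hform_mult:
  assumes ab: "a \<in> pow n" "b \<in> pow m"
  shows "hform (n + m) (a \<otimes> b) = hform n a \<otimes>\<^bsub>G\<^esub> hform m b"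
proof (rule G_eqI)
  have p: "a \<otimes> b \<in> pow (n + m)" by (rule ideal_power_mult[OF I_ideal ab])
  have c: "a \<in> carrier R" "b \<in> carrier R" using ab powD(1) by auto
  show "hform (n + m) (a \<otimes> b) \<in> carrier G" "hform n a \<otimes>\<^bsub>G\<^esub> hform m b \<in> carrier G" using p ab by (auto intro: hform_closed)
  show "\<exists>c. c \<in> hform (n + m) (a \<otimes> b) k \<and> c \<in> (hform n a \<otimes>\<^bsub>G\<^esub> hform m b) k" for k
  proof -
    let ?t = "\<lambda>i. (if i = n then a else \<zero>) \<otimes> (if k - i = m then b else \<zero>)"
    have 1: "(\<Oplus>i\<in>{..k}. ?t i) \<in> (hform n a \<otimes>\<^bsub>G\<^esub> hform m b) k"
      by (rule G_mult_mem[OF hform_closed[OF ab(1)] hform_closed[OF ab(2)] hform_mem[OF ab(1)] hform_mem[OF ab(2)]])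
    have "(\<Oplus>i\<in>{..k}. ?t i) = (\<Oplus>i\<in>{..k}. if n = i then (if k - n = m then a \<otimes> b else \<zero>) else \<zero>)"
      using c by (intro finsum_cong') auto
    also have "\<dots> = (if k = n + m then a \<otimes> b else \<zero>)"
    proof (cases "n \<le> k")
      case True
      then show ?thesis using c finsum_singleton[of n "{..k}" "\<lambda>_. if k - n = m then a \<otimes> b else \<zero>"] by auto
    next
      case False
      then have "(\<Oplus>i\<in>{..k}. if n = i then (if k - n = m then a \<otimes> b else \<zero>) else \<zero>) = (\<Oplus>i\<in>{..k}. \<zero>)"
        using c by (intro finsum_cong') auto
      then show ?thesis using False by auto
    qed
    finally show ?thesis using 1 hform_mem[OF p, of k] by auto
  qed
qed

lemma hform_one: "hform 0 \<one> = \<one>\<^bsub>G\<^esub>"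
proof (rule ext)
  fix n
  have "pow (Suc n) \<subseteq> carrier R" using powD(1) by auto
  then have "pow (Suc n) +> \<zero> = pow (Suc n)" by (rule a_coset_add_zero)
  then show "hform 0 \<one> n = \<one>\<^bsub>G\<^esub> n" by (auto simp: hform_def G_def associated_graded_def)
qed

lemma hform_zero: "a \<in> pow (Suc n) \<Longrightarrow> hform n a = \<zero>\<^bsub>G\<^esub>"
  using a_rcos_zero[OF pow_ideal] by (auto simp: hform_def G_def associated_graded_def fun_eq_iff)

text \<open>Encodes a homogeneous ideal of \<open>G\<close> by ideals of \<open>R\<close>; its
  degree \<open>n\<close> part is the image of \<open>K n \<inter> pow n\<close>. \<open>K n\<close>
  may exceed \<open>pow n\<close>, which permits simple choices such as
  \<open>carrier R\<close>.\<close>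

definition graded_family where
  "graded_family K \<longleftrightarrow> (\<forall>n. ideal (K n) R \<and> pow (Suc n) \<subseteq> K n) \<and>
    (\<forall>i j. \<forall>a\<in>pow i. \<forall>b\<in>K j. a \<otimes> b \<in> K (i + j))"

definition hom_ideal where "hom_ideal K = {f \<in> carrier G. \<forall>n. f n \<subseteq> K n}"

lemma graded_family_subset_iff:
  assumes "graded_family K" "f \<in> carrier G" "a \<in> f n" shows "f n \<subseteq> K n \<longleftrightarrow> a \<in> K n"
proof
  assume a: "a \<in> K n"
  have K: "ideal (K n) R" "pow (Suc n) \<subseteq> K n" using assms(1) by (auto simp: graded_family_def)
  show "f n \<subseteq> K n"
  proof
    fix b assume "b \<in> f n"
    then have b: "b \<in> carrier R" "b \<ominus> a \<in> K n" using G_mem_iff[OF assms(2,3)] K(2) by (auto)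
    have "b = (b \<ominus> a) \<oplus> a" using b(1) ideal_memD(1)[OF K(1) a] by algebra
    then show "b \<in> K n" using ideal_memD(3)[OF K(1) b(2) a] by simp
  qed
qed (use assms in auto)

lemma hom_idealI: "graded_family K \<Longrightarrow> f \<in> carrier G \<Longrightarrow> (\<And>n. \<exists>a\<in>f n. a \<in> K n) \<Longrightarrow> f \<in> hom_ideal K"
  unfolding hom_ideal_def using graded_family_subset_iff by blast

lemma graded_familyD:
  assumes "graded_family K"
  shows "ideal (K n) R" "pow (Suc n) \<subseteq> K n" "a \<in> pow i \<Longrightarrow> b \<in> K j \<Longrightarrow> a \<otimes> b \<in> K (i + j)"
  using assms by (auto simp: graded_family_def)

lemma hom_ideal_ideal:
  assumes K: "graded_family K" shows "ideal (hom_ideal K) G"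
proof (rule G.idealI')
  note Ki = ideal_memD[OF graded_familyD(1)[OF K]]
  show "hom_ideal K \<subseteq> carrier G" by (auto simp: hom_ideal_def)
  show "\<zero>\<^bsub>G\<^esub> \<in> hom_ideal K" using graded_familyD(2)[OF K] G.zero_closed
    by (auto simp: hom_ideal_def) (auto simp: G_def associated_graded_def)
  fix f g assume f: "f \<in> hom_ideal K" and g: "g \<in> hom_ideal K"
  then have c: "f \<in> carrier G" "g \<in> carrier G" by (auto simp: hom_ideal_def)
  show "f \<oplus>\<^bsub>G\<^esub> g \<in> hom_ideal K"
  proof (rule hom_idealI[OF K])
    fix n
    have "rep f n \<oplus> rep g n \<in> (f \<oplus>\<^bsub>G\<^esub> g) n" by (intro G_add_mem rep_mem c)
    moreover have "rep f n \<in> K n" "rep g n \<in> K n" using f g rep_mem[OF c(1), of n] rep_mem[OF c(2), of n] unfolding hom_ideal_def by blast+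
    ultimately show "\<exists>a\<in>(f \<oplus>\<^bsub>G\<^esub> g) n. a \<in> K n" using Ki(3) by blast
  qed (use c in auto)
next
  note Ki = ideal_memD[OF graded_familyD(1)[OF K]]
  fix f g assume f: "f \<in> hom_ideal K" and g: "g \<in> carrier G"
  then have c: "f \<in> carrier G" by (auto simp: hom_ideal_def)
  show "g \<otimes>\<^bsub>G\<^esub> f \<in> hom_ideal K"
  proof (rule hom_idealI[OF K])
    fix n
    have "(\<Oplus>i\<in>{..n}. rep g i \<otimes> rep f (n - i)) \<in> (g \<otimes>\<^bsub>G\<^esub> f) n"
      by (rule G_mult_mem[OF g c rep_mem[OF g] rep_mem[OF c]])
    moreover have "(\<Oplus>i\<in>{..n}. rep g i \<otimes> rep f (n - i)) \<in> K n"
    proof (rule finsum_ideal[OF graded_familyD(1)[OF K]])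
      fix i assume "i \<in> {..n}"
      have "rep f (n - i) \<in> K (n - i)" using rep_mem[OF c, of "n - i"] f by (auto simp: hom_ideal_def)
      from graded_familyD(3)[OF K rep_pow[OF g, of i] this] show "rep g i \<otimes> rep f (n - i) \<in> K n" using \<open>i \<in> {..n}\<close> by simp
    qed auto
    ultimately show "\<exists>a\<in>(g \<otimes>\<^bsub>G\<^esub> f) n. a \<in> K n" by blast
  qed (use c g in auto)
qed

definition M where "M = {f \<in> carrier G. f 0 \<subseteq> \<mm>}"

lemma M_eq: "M = hom_ideal (\<lambda>n. if n = 0 then \<mm> else carrier R)"
  by (auto simp: M_def hom_ideal_def) (metis G_mem(1) powD(1) subsetD)

lemma M_family: "graded_family (\<lambda>n. if n = 0 then \<mm> else carrier R)"
  using mm_ideal oneideal ideal_memD[OF mm_ideal] I_mm powD(1)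
  by (auto simp: graded_family_def ideal_power_1[OF I_ideal])

lemma M_ideal: "ideal M G" unfolding M_eq by (rule hom_ideal_ideal[OF M_family])

lemma M_iff: "f \<in> carrier G \<Longrightarrow> a \<in> f 0 \<Longrightarrow> f \<in> M \<longleftrightarrow> a \<in> \<mm>"
  using graded_family_subset_iff[OF M_family, of f a 0] by (auto simp: M_def)

lemma mult_0: "f \<in> carrier G \<Longrightarrow> g \<in> carrier G \<Longrightarrow> a \<in> f 0 \<Longrightarrow> b \<in> g 0 \<Longrightarrow> a \<otimes> b \<in> (f \<otimes>\<^bsub>G\<^esub> g) 0"
proof -
  assume h: "f \<in> carrier G" "g \<in> carrier G" "a \<in> f 0" "b \<in> g 0"
  have "(\<Oplus>i\<in>{..0::nat}. a \<otimes> b) \<in> (f \<otimes>\<^bsub>G\<^esub> g) 0"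
    using h G_mult_mem[of f g 0 "\<lambda>_. a" "\<lambda>_. b"] by auto
  moreover have "(\<Oplus>i\<in>{..0::nat}. a \<otimes> b) = a \<otimes> b"
    using powD(1)[OF G_mem(1)[OF h(1,3)]] powD(1)[OF G_mem(1)[OF h(2,4)]] by (subst finsum_0) auto
  ultimately show ?thesis by simp
qed

lemma one_notin_M: "\<one>\<^bsub>G\<^esub> \<notin> M"
  using M_iff[OF G.one_closed, of \<one>] one_notin_mm hform_mem[of \<one> 0 0] by (auto simp: hform_one ideal_power_0)

lemma M_prime: "primeideal M G"
proof (rule G.primeidealI'[OF M_ideal one_notin_M])
  fix f g assume fg: "f \<in> carrier G" "g \<in> carrier G" "f \<otimes>\<^bsub>G\<^esub> g \<in> M"
  have "rep f 0 \<otimes> rep g 0 \<in> (f \<otimes>\<^bsub>G\<^esub> g) 0" by (intro mult_0 rep_mem fg)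
  then have "rep f 0 \<otimes> rep g 0 \<in> \<mm>" using M_iff fg by blast
  then have "rep f 0 \<in> \<mm> \<or> rep g 0 \<in> \<mm>" using primeideal_memD(3)[OF mm_prime] rep_carrier fg by auto
  then show "f \<in> M \<or> g \<in> M" using M_iff rep_mem fg by auto
qed

text \<open>An element outside \<open>M\<close> has a unit of \<open>R\<close> in degree 0;
  multiplied by the inverse of this unit it becomes \<open>\<one>\<close> up to an element of
  \<open>M\<close>.\<close>

lemma M_maximal: "maximalideal M G"
proof (rule maximalidealI[OF M_ideal])
  show "carrier G \<noteq> M" using one_notin_M by auto
  fix J assume J: "ideal J G" "M \<subseteq> J" "J \<subseteq> carrier G"
  show "J = M \<or> J = carrier G"
  proof (rule ccontr)
    assume n: "\<not> (J = M \<or> J = carrier G)"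
    then obtain f where f: "f \<in> J" "f \<notin> M" using J by auto
    have fc: "f \<in> carrier G" using f J by auto
    have "rep f 0 \<notin> \<mm>" using M_iff[OF fc rep_mem[OF fc]] f by auto
    then obtain b where b: "b \<in> carrier R" "b \<otimes> rep f 0 = \<one>" using unit_outside rep_carrier[OF fc] by auto
    have h: "hform 0 b \<in> carrier G" using b by (intro hform_closed) (simp add: ideal_power_0)
    have hb: "b \<in> hform 0 b 0" using hform_mem[of b 0 0] b by (simp add: ideal_power_0)
    let ?p = "hform 0 b \<otimes>\<^bsub>G\<^esub> f"
    have p: "?p \<in> carrier G" "?p \<in> J" using h f fc G.ideal_memD(6)[OF J(1)] by auto
    have 1: "\<one> \<in> ?p 0" using mult_0[OF h fc hb rep_mem[OF fc]] b by auto
    have "\<ominus>\<^bsub>G\<^esub> \<one>\<^bsub>G\<^esub> = hform 0 (\<ominus> \<one>)"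
    proof (rule G.minus_equality)
      show "hform 0 (\<ominus> \<one>) \<oplus>\<^bsub>G\<^esub> \<one>\<^bsub>G\<^esub> = \<zero>\<^bsub>G\<^esub>" unfolding hform_one[symmetric]
        using hform_add[of "\<ominus> \<one>" 0 \<one>] hform_zero[of \<zero> 0] powD(2)[of "Suc 0"] by (auto simp: ideal_power_0 l_neg)
    qed (auto intro: hform_closed simp: ideal_power_0)
    then have "\<ominus> \<one> \<in> (\<ominus>\<^bsub>G\<^esub> \<one>\<^bsub>G\<^esub>) 0" using hform_mem[of "\<ominus> \<one>" 0 0] by (simp add: ideal_power_0)
    with 1 have "\<one> \<oplus> \<ominus> \<one> \<in> (?p \<oplus>\<^bsub>G\<^esub> (\<ominus>\<^bsub>G\<^esub> \<one>\<^bsub>G\<^esub>)) 0" by (rule G_add_mem)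
    then have "?p \<oplus>\<^bsub>G\<^esub> (\<ominus>\<^bsub>G\<^esub> \<one>\<^bsub>G\<^esub>) \<in> M"
      using M_iff[of "?p \<oplus>\<^bsub>G\<^esub> (\<ominus>\<^bsub>G\<^esub> \<one>\<^bsub>G\<^esub>)" \<zero>] p ideal_memD(2)[OF mm_ideal] by (auto simp: r_neg)
    then have "\<ominus>\<^bsub>G\<^esub> \<one>\<^bsub>G\<^esub> \<in> J" using G.ideal_add_cancel[OF J(1) p(2)] J(2) by auto
    then have "\<one>\<^bsub>G\<^esub> \<in> J" using G.ideal_memD(4)[OF J(1)] by force
    then show False using ideal.one_imp_carrier[OF J(1)] n by auto
  qed
qed

text \<open>The bridge between \<open>G\<close> and its localization. The degree 0 part of
  \<open>s\<close> is a unit, so the degree \<open>n\<close> part of the product determines that of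
  \<open>f\<close> up to terms that involve lower degrees of \<open>f\<close>, which are in
  \<open>K\<close> by induction.\<close>

lemma hom_ideal_saturated:
  assumes K: "graded_family K" and s: "s \<in> carrier G" "s \<notin> M" and f: "f \<in> carrier G" and sf: "s \<otimes>\<^bsub>G\<^esub> f \<in> hom_ideal K"
  shows "f \<in> hom_ideal K"
proof -
  note Ki = graded_familyD(1)[OF K]
  have "rep s 0 \<notin> \<mm>" using M_iff[OF s(1) rep_mem[OF s(1)]] s by auto
  then obtain b where b: "b \<in> carrier R" "b \<otimes> rep s 0 = \<one>" using unit_outside rep_carrier[OF s(1)] by auto
  have "rep f n \<in> K n" for n
  proof (induction n rule: less_induct)
    case (less n)
    let ?t = "\<lambda>i. rep s i \<otimes> rep f (n - i)"
    have tc: "?t i \<in> carrier R" for i using rep_carrier s f by auto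
    have "(\<Oplus>i\<in>{..n}. ?t i) \<in> (s \<otimes>\<^bsub>G\<^esub> f) n" by (rule G_mult_mem[OF s(1) f rep_mem[OF s(1)] rep_mem[OF f]])
    then have "(\<Oplus>i\<in>{..n}. ?t i) \<in> K n" using sf by (auto simp: hom_ideal_def)
    moreover have "(\<Oplus>i\<in>insert 0 {1..n}. ?t i) = ?t 0 \<oplus> (\<Oplus>i\<in>{1..n}. ?t i)"
      by (rule finsum_insert) (use rep_carrier s f in auto)
    moreover have "{..n} = insert 0 {1..n}" by auto
    moreover have "(\<Oplus>i\<in>{1..n}. ?t i) \<in> K n"
    proof (rule finsum_ideal[OF Ki])
      fix i assume i: "i \<in> {1..n}"
      from graded_familyD(3)[OF K rep_pow[OF s(1), of i] less[of "n - i"]] show "?t i \<in> K n" using i by auto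
    qed auto
    ultimately have "?t 0 \<in> K n" using ideal_add_cancel[OF Ki, of "(\<Oplus>i\<in>{1..n}. ?t i)" n "?t 0"] tc tc[of 0]
      by (auto simp: a_comm finsum_closed)
    then have "b \<otimes> (rep s 0 \<otimes> rep f n) \<in> K n" using ideal_memD(6)[OF Ki _ b(1)] by auto
    then show "rep f n \<in> K n" using b rep_carrier s f by (simp add: m_assoc[symmetric])
  qed
  then show ?thesis using hom_idealI[OF K f] rep_mem[OF f] by blast
qed

end

text \<open>The bound \<open>t \<ge> 1\<close> excludes the empty set, whose supremum in
  \<open>enat\<close> is 0. A finite lower bound of the supremum is then reached by a member, even
  if the supremum is infinite.\<close>

lemma Sup_enat_attained:
  assumes "enat t \<le> Sup {enat n | n. Q n}" "t \<ge> 1"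
  shows "\<exists>n\<ge>t. Q n"
proof (rule ccontr)
  assume "\<not> ?thesis"
  then have "\<And>n. Q n \<Longrightarrow> n \<le> t - 1" by (metis Suc_diff_1 assms(2) less_Suc_eq_le less_le_trans not_le zero_less_one)
  then have "Sup {enat n | n. Q n} \<le> enat (t - 1)" by (intro Sup_least) auto
  with assms(1) have "enat t \<le> enat (t - 1)" by (rule order_trans)
  then show False using assms(2) by simp
qed

section \<open>Primes of quotient rings and the regular module\<close>

context cring begin

lemma Idl_ideal: "ideal J R \<Longrightarrow> Idl J = J"
  using genideal_minimal[of J J] genideal_self[of J] ideal_memD(1)[of J] by blast

lemma mem_Idl_insert_ideal:
  assumes "ideal J R" "a \<in> carrier R"
  shows "b \<in> Idl (insert a J) \<longleftrightarrow> (\<exists>c\<in>carrier R. \<exists>j\<in>J. b = c \<otimes> a \<oplus> j)"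
  using mem_Idl_insert[OF assms(2), of J b] ideal_memD(1)[OF assms(1)] Idl_ideal[OF assms(1)] by blast

lemma quotient_mem_image:
  assumes "ideal J R" "ideal P R" "J \<subseteq> P" "a \<in> carrier R"
  shows "J +> a \<in> (+>) J ` P \<longleftrightarrow> a \<in> P"
proof
  assume "J +> a \<in> (+>) J ` P"
  then obtain p where p: "p \<in> P" "J +> a = J +> p" by auto
  have pc: "p \<in> carrier R" using ideal_memD(1)[OF assms(2)] p by auto
  have "a \<ominus> p \<in> P" using coset_eq_iff[OF assms(1,4) pc] p assms(3) by auto
  moreover have "a = (a \<ominus> p) \<oplus> p" using assms(4) pc by algebra
  ultimately show "a \<in> P" using ideal_memD(3)[OF assms(2)] p by metis
qed auto

lemma quotient_carrier: "carrier (R Quot J) = (+>) J ` carrier R"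
  by (auto simp: FactRing_def A_RCOSETS_def')

lemma quotient_prime:
  assumes J: "ideal J R" and P: "primeideal P R" "J \<subseteq> P"
  shows "primeideal ((+>) J ` P) (R Quot J)"
proof -
  note Pi = primeideal_memD[OF P(1)]
  interpret Q: cring "R Quot J" by (rule ideal.quotient_is_cring[OF J is_cring])
  note mem = quotient_mem_image[OF J Pi(1) P(2)]
  show ?thesis
  proof (rule Q.primeidealI')
    show "ideal ((+>) J ` P) (R Quot J)" by (rule ring_ideal_imp_quot_ideal[OF J Pi(1)])
    show "\<one>\<^bsub>R Quot J\<^esub> \<notin> (+>) J ` P" using mem[OF one_closed] Pi(2) by (simp add: FactRing_def)
    fix X Y assume h: "X \<in> carrier (R Quot J)" "Y \<in> carrier (R Quot J)" "X \<otimes>\<^bsub>R Quot J\<^esub> Y \<in> (+>) J ` P"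
    then obtain a b where ab: "a \<in> carrier R" "b \<in> carrier R" "X = J +> a" "Y = J +> b"
      by (auto simp: quotient_carrier)
    have "X \<otimes>\<^bsub>R Quot J\<^esub> Y = J +> (a \<otimes> b)" using ideal.rcoset_mult_add[OF J ab(1,2)] ab by (simp add: FactRing_def)
    then have "a \<otimes> b \<in> P" using h mem[of "a \<otimes> b"] ab by auto
    then show "X \<in> (+>) J ` P \<or> Y \<in> (+>) J ` P" using Pi(3) ab by auto
  qed
qed

lemma regular_list_iff:
  "regular_list A zs \<longleftrightarrow> (\<forall>i<length zs. regular_mod (Idl (A \<union> set (take i zs))) (zs ! i))"
proof (induction zs arbitrary: A)
  case (Cons z zs)
  have "(\<forall>i<length (z # zs). Q i) \<longleftrightarrow> Q 0 \<and> (\<forall>i<length zs. Q (Suc i))" for Q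
    by (metis Suc_less_eq gr0_conv_Suc length_Cons list.size(4) not_gr_zero zero_less_Suc)
  then show ?case using Cons.IH[of "insert z A"] by simp
qed simp

lemma regular_module_simps:
  "carrier (regular_module R) = carrier R" "add (regular_module R) = add R"
  "zero (regular_module R) = zero R" "smult (regular_module R) = monoid.mult R"
  "a_inv (regular_module R) = a_inv R"
  by (simp_all add: regular_module_def a_inv_def fun_eq_iff m_inv_def)

lemma regular_module_module: "module R (regular_module R)"
proof (rule moduleI)
  show "abelian_group (regular_module R)"
    by (rule abelian_groupI) (auto simp: regular_module_simps a_ac intro: bexI[OF _ a_inv_closed] l_neg)
qed (auto simp: regular_module_simps l_distr r_distr m_assoc is_cring)

lemma regular_submodule_iff: "submodule J R (regular_module R) \<longleftrightarrow> ideal J R"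
proof
  interpret M: module R "regular_module R" by (rule regular_module_module)
  assume J: "submodule J R (regular_module R)"
  have "subgroup J (add_monoid (regular_module R))" using J by (simp add: submodule_def)
  then have "\<zero> \<in> J" using subgroup.one_closed by (fastforce simp: regular_module_simps)
  then show "ideal J R" using M.submoduleE[OF J] by (intro idealI') (auto simp: regular_module_simps)
next
  interpret M: module R "regular_module R" by (rule regular_module_module)
  assume J: "ideal J R"
  show "submodule J R (regular_module R)"
    by (rule M.submoduleI) (use ideal_memD[OF J] in \<open>auto simp: regular_module_simps\<close>)
qed

lemma regular_ideal_smult:
  assumes "ideal J R" shows "ideal_smult R J (regular_module R) = J"
proof -
  have e: "module_span R (regular_module R) S = Idl S" for S
    by (simp add: module_span_def genideal_def regular_submodule_iff)
  have "{a \<otimes> v | a v. a \<in> J \<and> v \<in> carrier R} = J"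
    using ideal_memD(1,7)[OF assms] by (auto) (metis r_one one_closed)
  then show ?thesis unfolding ideal_smult_def e
    using genideal_minimal[OF assms, of J] genideal_self[of J] ideal_memD(1)[OF assms]
    by (auto simp: regular_module_simps)
qed

end

section \<open>Nilpotence in Noetherian rings and Nakayama's lemma\<close>

context noetherian_cring begin

text \<open>Noetherian induction: for \<open>a\<close> in \<open>\<aa>\<close> outside
  \<open>J\<close>, both \<open>colon J a\<close> and \<open>(a, J)\<close> are strictly larger than
  \<open>J\<close>, and their product lies in \<open>J\<close>, so the two exponents add up.\<close>

lemma ideal_power_subset_if_nil:
  assumes "ideal J R" "ideal \<aa> R" "\<And>a. a \<in> \<aa> \<Longrightarrow> \<exists>k::nat. a [^] k \<in> J"
  shows "\<exists>k. ideal_power R \<aa> k \<subseteq> J"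
  using assms(1,3)
proof (induction rule: ideal_noetherian_induct)
  case (step J)
  note iJ = ideal_memD[OF step.hyps] and ia = ideal_memD[OF assms(2)]
  show ?case
  proof (cases "\<aa> \<subseteq> J")
    case True then show ?thesis using ideal_power_1[OF assms(2)] by metis
  next
    case False
    then obtain a where a: "a \<in> \<aa>" "a \<notin> J" by auto
    have ac: "a \<in> carrier R" using a ia by auto
    \<comment> \<open>The least exponent gives an element \<open>a [^] (k - 1)\<close> of
      \<open>colon J a\<close> outside \<open>J\<close>, so that inclusion is strict.\<close>
    obtain k :: nat where k: "a [^] k \<in> J" "\<And>i. i < k \<Longrightarrow> a [^] i \<notin> J"
      using step.prems[OF a(1)] exists_least_iff[of "\<lambda>k. a [^] k \<in> J"] by auto
    have "k \<noteq> 0" 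
    proof
      assume "k = 0"
      then have "\<one> \<in> J" using k by simp
      then have "\<one> \<otimes> a \<in> J" using iJ(7)[OF _ ac] by auto
      then show False using a ac by simp
    qed
    then obtain m where m: "k = Suc m" by (cases k) auto
    have c1: "ideal (colon J a) R" by (rule colon_ideal[OF step.hyps ac])
    have "a [^] m \<in> colon J a" using k(1) ac unfolding m colon_def by auto
    moreover have "a [^] m \<notin> J" using k(2) m by auto
    ultimately have s1: "J \<subset> colon J a" using subset_colon[OF step.hyps ac] by auto
    have ins: "insert a J \<subseteq> carrier R" using ac iJ by auto
    have c2: "ideal (Idl (insert a J)) R" by (rule genideal_ideal[OF ins])
    have s2: "J \<subset> Idl (insert a J)" using genideal_self[OF ins] a by auto
    obtain p where p: "ideal_power R \<aa> p \<subseteq> colon J a" using step.IH[OF c1 s1] step.prems s1 by blast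
    obtain q where q: "ideal_power R \<aa> q \<subseteq> Idl (insert a J)" using step.IH[OF c2 s2] step.prems s2 by blast
    have pr: "e \<otimes> e' \<in> J" if e: "e \<in> ideal_power R \<aa> q" "e' \<in> ideal_power R \<aa> p" for e e'
    proof -
      obtain c j where c: "c \<in> carrier R" "j \<in> J" "e = c \<otimes> a \<oplus> j"
        using q e mem_Idl_insert_ideal[OF step.hyps ac, of e] by blast
      have e': "e' \<in> carrier R" "e' \<otimes> a \<in> J" using p e by (auto simp: colon_def)
      have "e \<otimes> e' = c \<otimes> (e' \<otimes> a) \<oplus> j \<otimes> e'" unfolding c(3) using c(1) ac e'(1) iJ(1)[OF c(2)] by algebra
      then show ?thesis using iJ(3)[OF iJ(6)[OF e'(2) c(1)] iJ(7)[OF c(2) e'(1)]] by simp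
    qed
    have "ideal_power R \<aa> (q + n) \<subseteq> ideal_power R \<aa> q \<cdot> ideal_power R \<aa> n" for n
    proof (induction n)
      case 0
      then show ?case using ideal_prod_one[OF ideal_power_ideal[OF assms(2)]] by (simp add: ideal_power_0)
    next
      case (Suc n)
      have "ideal_power R \<aa> (q + Suc n) = ideal_power R \<aa> (q + n) \<cdot> \<aa>" by (simp add: ideal_power_Suc)
      also have "\<dots> \<subseteq> (ideal_power R \<aa> q \<cdot> ideal_power R \<aa> n) \<cdot> \<aa>" by (rule ideal_prod_mono[OF Suc]) simp
      also have "\<dots> = ideal_power R \<aa> q \<cdot> ideal_power R \<aa> (Suc n)"
        using ideal_prod_assoc[OF ideal_power_ideal[OF assms(2)] ideal_power_ideal[OF assms(2)] assms(2)]
        by (simp add: ideal_power_Suc)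
      finally show ?case .
    qed
    then have "ideal_power R \<aa> (q + p) \<subseteq> J" using ideal_prod_subset[OF step.hyps pr] by blast
    then show ?thesis by blast
  qed
qed

end

context noetherian_local begin

text \<open>If the claim fails, take \<open>K \<supseteq> L\<close> maximal among the ideals that do
  not contain \<open>J\<close>. Then \<open>\<mm> \<cdot> J \<subseteq> K\<close>: adding a product
  \<open>c \<otimes> a\<close> to \<open>K\<close> would capture \<open>a\<close> itself, and
  \<open>\<one> \<ominus> d \<otimes> c\<close> is a unit.\<close>

lemma nakayama:
  assumes J: "ideal J R" and L: "ideal L R" and sub: "J \<subseteq> L <+> (\<mm> \<cdot> J)"
  shows "J \<subseteq> L"
proof (rule ccontr)
  assume "\<not> J \<subseteq> L"
  let ?S = "{K. ideal K R \<and> L \<subseteq> K \<and> \<not> J \<subseteq> K}"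
  have "?S \<noteq> {}" using \<open>\<not> J \<subseteq> L\<close> L by auto
  then have "\<exists>K\<in>?S. \<forall>K'\<in>?S. K \<subseteq> K' \<longrightarrow> K' = K" by (rule ideal_maximal_element) auto
  then obtain K where K: "ideal K R" "L \<subseteq> K" "\<not> J \<subseteq> K"
    and max: "\<And>K'. ideal K' R \<Longrightarrow> K \<subseteq> K' \<Longrightarrow> \<not> J \<subseteq> K' \<Longrightarrow> K' = K" by (smt (verit) mem_Collect_eq order_trans)
  note iK = ideal_memD[OF K(1)] and iJ = ideal_memD[OF J] and im = ideal_memD[OF mm_ideal]
  have "c \<otimes> a \<in> K" if c: "c \<in> \<mm>" and a: "a \<in> J" for c a
  proof (rule ccontr)
    assume n: "c \<otimes> a \<notin> K"
    have cc: "c \<in> carrier R" "a \<in> carrier R" using c a im iJ by auto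
    have ins: "insert (c \<otimes> a) K \<subseteq> carrier R" using cc iK by auto
    have "K \<subseteq> Idl (insert (c \<otimes> a) K)" "c \<otimes> a \<in> Idl (insert (c \<otimes> a) K)" using genideal_self[OF ins] by auto
    then have "J \<subseteq> Idl (insert (c \<otimes> a) K)" using max[OF genideal_ideal[OF ins]] n by blast
    then obtain d k where d: "d \<in> carrier R" "k \<in> K" "a = d \<otimes> (c \<otimes> a) \<oplus> k"
      using mem_Idl_insert_ideal[OF K(1), of "c \<otimes> a" a] a cc by blast
    have kc: "k \<in> carrier R" using d iK by auto
    have "(\<one> \<ominus> d \<otimes> c) \<otimes> a = a \<ominus> d \<otimes> (c \<otimes> a)" using cc d by algebra
    also have "\<dots> = (d \<otimes> (c \<otimes> a) \<oplus> k) \<ominus> d \<otimes> (c \<otimes> a)" using d(3) by simp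
    also have "\<dots> = k" using cc d(1) kc by algebra
    finally have e: "(\<one> \<ominus> d \<otimes> c) \<otimes> a = k" .
    have "\<one> \<ominus> d \<otimes> c \<notin> \<mm>"
    proof
      assume "\<one> \<ominus> d \<otimes> c \<in> \<mm>"
      then have "(\<one> \<ominus> d \<otimes> c) \<oplus> d \<otimes> c \<in> \<mm>" using im(3,6) c d by auto
      moreover have "(\<one> \<ominus> d \<otimes> c) \<oplus> d \<otimes> c = \<one>" using cc d(1) by algebra
      ultimately show False using one_notin_mm by simp
    qed
    then obtain u where u: "u \<in> carrier R" "u \<otimes> (\<one> \<ominus> d \<otimes> c) = \<one>" using unit_outside[of "\<one> \<ominus> d \<otimes> c"] cc d by auto
    have "a = u \<otimes> ((\<one> \<ominus> d \<otimes> c) \<otimes> a)" using u cc d(1) by (simp add: m_assoc[symmetric])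
    then have "a \<in> K" unfolding e using iK(6)[OF d(2) u(1)] by simp
    then have "c \<otimes> a \<in> K" using iK(6) cc by simp
    then show False using n by simp
  qed
  then have "\<mm> \<cdot> J \<subseteq> K" by (intro ideal_prod_subset[OF K(1)])
  then have "L <+> (\<mm> \<cdot> J) \<subseteq> K" using K(2) iK(3) by (auto simp: set_add_def' subset_eq)
  then show False using sub K(3) by auto
qed

end

locale graded_local = graded_ring +
  fixes B
  defines "B \<equiv> localization G (carrier G - M)"
  assumes G_noetherian: "noetherian_ring G" and B_ring: "cring B"
    and residue_infinite: "infinite (carrier (R Quot \<mm>))"
begin

lemma localization_at_M: "prime_localization G M (carrier G - M) B"
  by (intro prime_localization.intro prime_localization_axioms.intro G_cring M_prime B_ring) (simp_all add: B_def)

sublocale L: prime_localization G M "carrier G - M" B by (rule localization_at_M)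

text \<open>Forms are viewed in the local ring, where regularity and depth are available. The degree
  \<open>n\<close> is prescribed instead of being the order of \<open>a\<close>, so
  \<open>\<tau> n\<close> is additive on \<open>pow n\<close>.\<close>

definition \<tau> where "\<tau> n a = L.\<iota> (hform n a)"

end

section \<open>Initial forms\<close>

context graded_local begin

lemma tau_closed: "a \<in> pow n \<Longrightarrow> \<tau> n a \<in> carrier B"
  unfolding \<tau>_def by (intro L.iota_closed hform_closed)

lemma tau_add: "a \<in> pow n \<Longrightarrow> b \<in> pow n \<Longrightarrow> \<tau> n (a \<oplus> b) = \<tau> n a \<oplus>\<^bsub>B\<^esub> \<tau> n b"
  unfolding \<tau>_def by (simp add: hform_add L.iota_add hform_closed)

lemma tau_mult: "a \<in> pow n \<Longrightarrow> b \<in> pow m \<Longrightarrow> \<tau> (n + m) (a \<otimes> b) = \<tau> n a \<otimes>\<^bsub>B\<^esub> \<tau> m b"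
  unfolding \<tau>_def by (simp add: hform_mult L.iota_mult hform_closed)

lemma tau_one: "\<tau> 0 \<one> = \<one>\<^bsub>B\<^esub>"
  by (simp add: \<tau>_def hform_one L.\<iota>_def L.B_one)

lemma tau_zero: "a \<in> pow (Suc n) \<Longrightarrow> \<tau> n a = \<zero>\<^bsub>B\<^esub>"
  by (simp add: \<tau>_def hform_zero L.\<iota>_def L.B_zero)

lemma tau_minus: "a \<in> pow n \<Longrightarrow> b \<in> pow n \<Longrightarrow> \<tau> n (a \<ominus> b) = \<tau> n a \<ominus>\<^bsub>B\<^esub> \<tau> n b"
proof -
  assume ab: "a \<in> pow n" "b \<in> pow n"
  have c: "a \<in> carrier R" "b \<in> carrier R" "a \<ominus> b \<in> pow n" using ab powD by auto
  have "a = (a \<ominus> b) \<oplus> b" using c by algebra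
  then have "\<tau> n a = \<tau> n (a \<ominus> b) \<oplus>\<^bsub>B\<^esub> \<tau> n b" using tau_add[OF c(3) ab(2)] by simp
  moreover have "X = (X \<oplus>\<^bsub>B\<^esub> Y) \<ominus>\<^bsub>B\<^esub> Y" if "X \<in> carrier B" "Y \<in> carrier B" for X Y
    using that by (simp add: L.B.minus_eq L.B.a_assoc L.B.r_neg)
  ultimately show ?thesis using tau_closed c(3) ab by metis
qed

lemma tau_pow: "a \<in> I \<Longrightarrow> \<tau> k (a [^] k) = \<tau> (Suc 0) a [^]\<^bsub>B\<^esub> k"
proof (induction k)
  case (Suc k)
  have "a \<in> pow (Suc 0)" using Suc.prems ideal_power_1[OF I_ideal] by simp
  with tau_mult[OF pow_mem_ideal_power[OF I_ideal Suc.prems, of k] this] Suc show ?case by simp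
qed (use ideal_memD(1)[OF I_ideal] in \<open>simp add: tau_one\<close>)

lemma tau_0_pow: "a \<in> carrier R \<Longrightarrow> \<tau> 0 (a [^] (k::nat)) = \<tau> 0 a [^]\<^bsub>B\<^esub> k"
proof (induction k)
  case (Suc k)
  then show ?case using tau_mult[of "a [^] k" 0 a 0] by (simp add: ideal_power_0)
qed (simp add: tau_one)

lemma tau_N: "0 < n \<Longrightarrow> a \<in> pow n \<Longrightarrow> \<tau> n a \<in> L.N"
  unfolding \<tau>_def using L.iota_N_iff[OF hform_closed] M_iff[OF hform_closed, of a n \<zero>] hform_mem[of a n 0]
    ideal_memD(2)[OF mm_ideal] by auto

lemma tau_0_N: "a \<in> carrier R \<Longrightarrow> \<tau> 0 a \<in> L.N \<longleftrightarrow> a \<in> \<mm>"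
  unfolding \<tau>_def using L.iota_N_iff[OF hform_closed] M_iff[OF hform_closed, of a 0 a] hform_mem[of a 0 0]
  by (auto simp: ideal_power_0)

definition residue_reps where "residue_reps = (\<lambda>X. SOME a. a \<in> X) ` carrier (R Quot \<mm>)"

lemma residue_reps:
  "residue_reps \<subseteq> carrier R" "infinite residue_reps"
  "u \<in> residue_reps \<Longrightarrow> v \<in> residue_reps \<Longrightarrow> u \<noteq> v \<Longrightarrow> u \<ominus> v \<notin> \<mm>"
proof -
  let ?f = "\<lambda>X. SOME a. a \<in> X"
  have 1: "?f X \<in> carrier R \<and> X = \<mm> +> ?f X" if X: "X \<in> carrier (R Quot \<mm>)" for X
  proof -
    obtain a where a: "a \<in> carrier R" "X = \<mm> +> a" using X by (auto simp: quotient_carrier)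
    have "?f X \<in> X" using coset_self[OF mm_ideal a(1)] a(2) by (metis someI)
    then have f: "?f X \<in> carrier R" "?f X \<ominus> a \<in> \<mm>" using coset_mem_iff[OF mm_ideal a(1), of "?f X"] a(2) by blast+
    then have "\<mm> +> ?f X = \<mm> +> a" using coset_eq_iff[OF mm_ideal f(1) a(1)] by blast
    then show ?thesis using f(1) a(2) by simp
  qed
  then show "residue_reps \<subseteq> carrier R" by (auto simp: residue_reps_def)
  have "inj_on ?f (carrier (R Quot \<mm>))" using 1 by (intro inj_onI) metis
  then show "infinite residue_reps" using residue_infinite finite_imageD by (auto simp: residue_reps_def)
  assume uv: "u \<in> residue_reps" "v \<in> residue_reps" "u \<noteq> v"
  then obtain X Y where XY: "X \<in> carrier (R Quot \<mm>)" "Y \<in> carrier (R Quot \<mm>)" "u = ?f X" "v = ?f Y"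
    by (auto simp: residue_reps_def)
  show "u \<ominus> v \<notin> \<mm>"
  proof
    assume "u \<ominus> v \<in> \<mm>"
    then have "\<mm> +> u = \<mm> +> v" using coset_eq_iff[OF mm_ideal] 1 XY by metis
    then have "X = Y" using 1 XY by metis
    then show False using uv(3) XY by simp
  qed
qed

definition U where "U = \<tau> 0 ` residue_reps"

lemma B_infinite_residue: "infinite_residue B L.N U"
proof (rule infinite_residue.intro[OF L.B_noetherian_local[OF G_noetherian]], rule infinite_residue_axioms.intro)
  have rr: "a \<in> pow 0" if "a \<in> residue_reps" for a using residue_reps(1) that by (auto simp: ideal_power_0)
  then show "U \<subseteq> carrier B" by (auto simp: U_def intro: tau_closed)
  have d: "\<tau> 0 u \<ominus>\<^bsub>B\<^esub> \<tau> 0 v \<notin> L.N" if uv: "u \<in> residue_reps" "v \<in> residue_reps" "u \<noteq> v" for u v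
    using residue_reps(3)[OF uv] residue_reps(1) tau_minus[OF rr rr] tau_0_N[of "u \<ominus> v"] uv by auto
  have "inj_on (\<tau> 0) residue_reps"
  proof (rule inj_onI, rule ccontr)
    fix u v assume uv: "u \<in> residue_reps" "v \<in> residue_reps" "\<tau> 0 u = \<tau> 0 v" "u \<noteq> v"
    have "\<tau> 0 u \<ominus>\<^bsub>B\<^esub> \<tau> 0 v = \<zero>\<^bsub>B\<^esub>" using tau_closed[OF rr[OF uv(2)]] uv(3) by (simp add: L.B.minus_eq L.B.r_neg)
    moreover have "\<zero>\<^bsub>B\<^esub> \<in> L.N" using L.B_noetherian_local[OF G_noetherian] L.B.ideal_memD(2) noetherian_local.mm_ideal by blast
    ultimately show False using d[OF uv(1,2,4)] by simp
  qed
  then show "infinite U" unfolding U_def using residue_reps(2) finite_imageD by blast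
  fix X Y assume "X \<in> U" "Y \<in> U" "X \<noteq> Y"
  then show "X \<ominus>\<^bsub>B\<^esub> Y \<notin> L.N" unfolding U_def using d by auto
qed

sublocale BL: infinite_residue B L.N U by (rule B_infinite_residue)

lemma pow_1: "pow (Suc 0) = I" by (rule ideal_power_1[OF I_ideal])

text \<open>The degree \<open>n\<close> part of the ideal of the associated graded ring generated by the initial forms of \<open>W\<close>.\<close>

definition linK where
  "linK W n = (case n of 0 \<Rightarrow> I | Suc k \<Rightarrow> ((Idl W) \<cdot> pow k) <+> pow (Suc (Suc k)))"

lemma sum_mem: "b \<in> H <+> K \<longleftrightarrow> (\<exists>h\<in>H. \<exists>k\<in>K. b = h \<oplus> k)"
  by (auto simp: set_add_def')

lemma linK_family:
  assumes W: "W \<subseteq> I" shows "graded_family (linK W)"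
  unfolding graded_family_def
proof (intro conjI allI ballI)
  have Wc: "W \<subseteq> carrier R" using W ideal_memD(1)[OF I_ideal] by auto
  have IW: "ideal (Idl W) R" by (rule genideal_ideal[OF Wc])
  have WI: "Idl W \<subseteq> I" by (rule genideal_minimal[OF I_ideal W])
  have pi: "ideal ((Idl W) \<cdot> pow k) R" for k by (rule ideal_prod_is_ideal[OF IW pow_ideal])
  show Ki: "ideal (linK W n) R" for n unfolding linK_def
    by (cases n) (auto simp: I_ideal intro!: add_ideals pi pow_ideal)
  show sub: "pow (Suc n) \<subseteq> linK W n" for n
    using ideal_memD(2)[OF pi] powD(1) by (cases n) (force simp: linK_def pow_1 sum_mem)+
  fix i j a b assume a: "a \<in> pow i" and b: "b \<in> linK W j"
  have ac: "a \<in> carrier R" using a powD by auto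
  show "a \<otimes> b \<in> linK W (i + j)"
  proof (cases j)
    case 0
    then have "b \<in> pow (Suc 0)" using b by (simp add: linK_def pow_1)
    then have "a \<otimes> b \<in> pow (Suc i)" using ideal_power_mult[OF I_ideal a] by force
    then show ?thesis using sub[of i] 0 by auto
  next
    case (Suc k)
    then obtain u v where uv: "u \<in> (Idl W) \<cdot> pow k" "v \<in> pow (Suc (Suc k))" "b = u \<oplus> v" using b by (auto simp: linK_def sum_mem)
    have "(Idl W) \<cdot> pow k \<subseteq> {u \<in> carrier R. a \<otimes> u \<in> (Idl W) \<cdot> pow (i + k)}"
    proof (rule ideal_prod_subset[OF colon_set_ideal[OF pi ac]])
      fix c e assume c: "c \<in> Idl W" "e \<in> pow k"
      then have cc: "c \<in> carrier R" "e \<in> carrier R" using ideal_memD(1)[OF IW] powD by auto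
      have "c \<otimes> (a \<otimes> e) \<in> (Idl W) \<cdot> pow (i + k)" by (rule ideal_prod.prod[OF c(1) ideal_power_mult[OF I_ideal a c(2)]])
      then show "c \<otimes> e \<in> {u \<in> carrier R. a \<otimes> u \<in> (Idl W) \<cdot> pow (i + k)}" using cc ac by (simp add: m_lcomm)
    qed
    then have "a \<otimes> u \<in> (Idl W) \<cdot> pow (i + k)" "u \<in> carrier R" using uv by auto
    moreover have "a \<otimes> v \<in> pow (Suc (Suc (i + k)))" using ideal_power_mult[OF I_ideal a uv(2)] by simp
    moreover have "v \<in> carrier R" using uv powD by auto
    ultimately show ?thesis using Suc ac uv(3) by (auto simp: linK_def sum_mem r_distr)
  qed
qed

text \<open>Translates membership in \<open>B\<close> into a statement about ideals of
  \<open>R\<close>. From left to right, the homogeneous ideal given by \<open>linK W\<close> is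
  saturated, so it is recovered from its extension to \<open>B\<close>, which contains the
  generators; the converse expands elements of \<open>Idl W \<cdot> pow k\<close> into products of
  forms.\<close>

lemma tau_mem_iff:
  assumes W: "W \<subseteq> I" and a: "a \<in> pow n"
  shows "\<tau> n a \<in> Idl\<^bsub>B\<^esub> (\<tau> (Suc 0) ` W) \<longleftrightarrow> a \<in> linK W n"
proof
  note K = linK_family[OF W]
  have Wc: "W \<subseteq> carrier R" using W ideal_memD(1)[OF I_ideal] by auto
  have W1: "W \<subseteq> pow (Suc 0)" using W pow_1 by simp
  let ?E = "{L.frac a s | a s. a \<in> hom_ideal (linK W) \<and> s \<in> carrier G - M}"
  have E: "ideal ?E B" by (rule L.extension_ideal[OF hom_ideal_ideal[OF K]])
  have Ei: "L.\<iota> f \<in> ?E \<longleftrightarrow> f \<in> hom_ideal (linK W)" if "f \<in> carrier G" for f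
    unfolding L.\<iota>_def
    by (rule L.frac_in_extension[OF hom_ideal_ideal[OF K] _ that L.S_one]) (use hom_ideal_saturated[OF K] in auto)
  have hf: "hform n b \<in> hom_ideal (linK W) \<longleftrightarrow> b \<in> linK W n" if b: "b \<in> pow n" for n b
  proof
    assume "hform n b \<in> hom_ideal (linK W)"
    then show "b \<in> linK W n" using hform_mem[OF b, of n] by (auto simp: hom_ideal_def)
  next
    assume "b \<in> linK W n"
    then show "hform n b \<in> hom_ideal (linK W)"
      using hom_idealI[OF K hform_closed[OF b]] hform_mem[OF b] ideal_memD(2)[OF graded_familyD(1)[OF K]] by metis
  qed
  have IW: "ideal (Idl W) R" by (rule genideal_ideal[OF Wc])
  have WI: "Idl W \<subseteq> I" by (rule genideal_minimal[OF I_ideal W])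
  have tc: "\<tau> (Suc 0) ` W \<subseteq> carrier B" using W1 tau_closed by auto
  have J: "ideal (Idl\<^bsub>B\<^esub> (\<tau> (Suc 0) ` W)) B" by (rule L.B.genideal_ideal[OF tc])
  note iJ = L.B.ideal_memD[OF J]
  {
    assume "\<tau> n a \<in> Idl\<^bsub>B\<^esub> (\<tau> (Suc 0) ` W)"
    moreover have "\<tau> (Suc 0) ` W \<subseteq> ?E"
    proof
      fix X assume "X \<in> \<tau> (Suc 0) ` W"
      then obtain w where w: "w \<in> W" "X = \<tau> (Suc 0) w" by auto
      have "w \<in> Idl W" using w genideal_self[OF Wc] by auto
      then have "w \<otimes> \<one> \<in> (Idl W) \<cdot> pow 0" by (intro ideal_prod.prod) (auto simp: ideal_power_0)
      then have "w \<in> linK W (Suc 0)" using w Wc powD(2) unfolding linK_def by (force simp: sum_mem)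
      then show "X \<in> ?E" using w W1 hf[of w "Suc 0"] Ei[OF hform_closed, of w "Suc 0"] unfolding \<tau>_def by blast
    qed
    then have "Idl\<^bsub>B\<^esub> (\<tau> (Suc 0) ` W) \<subseteq> ?E" by (rule L.B.genideal_minimal[OF E])
    ultimately have "\<tau> n a \<in> ?E" by blast
    then show "a \<in> linK W n" unfolding \<tau>_def using Ei[OF hform_closed[OF a]] hf[OF a] by blast
  next
    assume a': "a \<in> linK W n"
    show "\<tau> n a \<in> Idl\<^bsub>B\<^esub> (\<tau> (Suc 0) ` W)"
    proof (cases n)
      case 0
      then have "\<tau> n a = \<zero>\<^bsub>B\<^esub>" using tau_zero[of a 0] a' by (simp add: linK_def pow_1)
      then show ?thesis using iJ(2) by simp
    next
      case (Suc k)
      obtain u v where uv: "u \<in> (Idl W) \<cdot> pow k" "v \<in> pow (Suc (Suc k))" "a = u \<oplus> v" using a' Suc by (auto simp: linK_def sum_mem)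
      have lin: "\<tau> (Suc 0) c \<in> Idl\<^bsub>B\<^esub> (\<tau> (Suc 0) ` W)" if c: "c \<in> Idl W" for c
      proof -
        have "ideal {c \<in> I. \<tau> (Suc 0) c \<in> Idl\<^bsub>B\<^esub> (\<tau> (Suc 0) ` W)} R"
        proof (rule idealI')
          show "\<zero> \<in> {c \<in> I. \<tau> (Suc 0) c \<in> Idl\<^bsub>B\<^esub> (\<tau> (Suc 0) ` W)}"
            using ideal_memD(2)[OF I_ideal] tau_zero[OF powD(2)] iJ(2) by auto
          fix c d assume "c \<in> {c \<in> I. \<tau> (Suc 0) c \<in> Idl\<^bsub>B\<^esub> (\<tau> (Suc 0) ` W)}" "d \<in> {c \<in> I. \<tau> (Suc 0) c \<in> Idl\<^bsub>B\<^esub> (\<tau> (Suc 0) ` W)}"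
          then show "c \<oplus> d \<in> {c \<in> I. \<tau> (Suc 0) c \<in> Idl\<^bsub>B\<^esub> (\<tau> (Suc 0) ` W)}"
            using ideal_memD(3)[OF I_ideal] tau_add[of c "Suc 0" d] iJ(3) by (auto simp: pow_1)
        next
          fix c d assume c: "c \<in> {c \<in> I. \<tau> (Suc 0) c \<in> Idl\<^bsub>B\<^esub> (\<tau> (Suc 0) ` W)}" and d: "d \<in> carrier R"
          have "\<tau> (Suc 0) (d \<otimes> c) = \<tau> 0 d \<otimes>\<^bsub>B\<^esub> \<tau> (Suc 0) c"
            using tau_mult[of d 0 c "Suc 0"] c d by (simp add: ideal_power_0 pow_1)
          then show "d \<otimes> c \<in> {c \<in> I. \<tau> (Suc 0) c \<in> Idl\<^bsub>B\<^esub> (\<tau> (Suc 0) ` W)}"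
            using c d iJ(6) tau_closed[of d 0] ideal_memD(6)[OF I_ideal] by (auto simp: ideal_power_0)
        qed (use ideal_memD(1)[OF I_ideal] in auto)
        moreover have "W \<subseteq> {c \<in> I. \<tau> (Suc 0) c \<in> Idl\<^bsub>B\<^esub> (\<tau> (Suc 0) ` W)}" using W L.B.genideal_self[OF tc] by auto
        ultimately show ?thesis using genideal_minimal c by blast
      qed
      have "u \<in> pow (Suc k) \<and> \<tau> (Suc k) u \<in> Idl\<^bsub>B\<^esub> (\<tau> (Suc 0) ` W)" using uv(1)
      proof induction
        case (prod c e)
        have c1: "c \<in> pow (Suc 0)" using prod WI pow_1 by auto
        show ?case using ideal_power_mult[OF I_ideal c1 prod(2)] tau_mult[OF c1 prod(2)]
            iJ(7)[OF lin[OF prod(1)] tau_closed[OF prod(2)]] by simp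
      next
        case (sum s1 s2)
        then show ?case using powD(3) tau_add iJ(3) by auto
      qed
      moreover have "v \<in> pow (Suc k)" using uv(2) ideal_power_Suc_subset[OF I_ideal] by blast
      ultimately show ?thesis using tau_add[of u "Suc k" v] tau_zero[OF uv(2)] tau_closed[of u "Suc k"] uv(3) Suc by simp
    qed
  }
qed

text \<open>Induction on the number of nonzero components, which is finite by the definition of the
  carrier.\<close>

lemma G_homogeneous_induct:
  assumes zero: "Q \<zero>\<^bsub>G\<^esub>" and step: "\<And>n a g. a \<in> pow n \<Longrightarrow> g \<in> carrier G \<Longrightarrow> Q g \<Longrightarrow> Q (hform n a \<oplus>\<^bsub>G\<^esub> g)"
    and f: "f \<in> carrier G"
  shows "Q f"
  using f
proof (induction "card {n. f n \<noteq> pow (Suc n)}" arbitrary: f)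
  case 0
  then have "finite {n. f n \<noteq> pow (Suc n)}" unfolding G_carrier by blast
  then have "{n. f n \<noteq> pow (Suc n)} = {}" using 0(1) by (metis card_0_eq)
  then have "f = \<zero>\<^bsub>G\<^esub>" by (auto simp: G_def associated_graded_def)
  then show ?case using zero by simp
next
  case (Suc k)
  note f = Suc(3)
  have fin: "finite {n. f n \<noteq> pow (Suc n)}" using f unfolding G_carrier by blast
  have "{n. f n \<noteq> pow (Suc n)} \<noteq> {}" using Suc(2) by (metis card.empty nat.distinct(1))
  then obtain n where n: "f n \<noteq> pow (Suc n)" by blast
  have rc: "rep f m \<in> pow m" "rep f m \<in> carrier R" for m using rep_pow rep_carrier f by auto
  define g where "g = (\<lambda>m. if m = n then pow (Suc n) else f m)"
  have gc: "g \<in> carrier G" unfolding G_carrier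
  proof (intro conjI allI)
    show "\<exists>a\<in>pow m. g m = pow (Suc m) +> a" for m
    proof (cases "m = n")
      case True
      then show ?thesis using powD(2)[of n] by (intro bexI[of _ \<zero>]) (auto simp: g_def pow_coset_zero)
    next
      case False
      then show ?thesis using f unfolding G_carrier g_def by simp
    qed
    show "finite {m. g m \<noteq> pow (Suc m)}" by (rule finite_subset[OF _ fin]) (auto simp: g_def)
  qed
  have g0: "(if m = n then \<zero> else rep f m) \<in> g m" for m using rep_mem[OF f] powD(2) by (auto simp: g_def)
  have fe: "f = hform n (rep f n) \<oplus>\<^bsub>G\<^esub> g"
  proof (rule G_eqI[OF f])
    show "hform n (rep f n) \<oplus>\<^bsub>G\<^esub> g \<in> carrier G" using hform_closed[OF rc(1)] gc by auto
    fix m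
    have "(if m = n then rep f n else \<zero>) \<oplus> (if m = n then \<zero> else rep f m) \<in> (hform n (rep f n) \<oplus>\<^bsub>G\<^esub> g) m"
      by (intro G_add_mem hform_mem rc g0)
    then show "\<exists>a. a \<in> f m \<and> a \<in> (hform n (rep f n) \<oplus>\<^bsub>G\<^esub> g) m" using rep_mem[OF f, of m] rc by (cases "m = n") auto
  qed
  have "{m. g m \<noteq> pow (Suc m)} = {m. f m \<noteq> pow (Suc m)} - {n}" by (auto simp: g_def)
  then have "card {m. g m \<noteq> pow (Suc m)} = k" using fin n Suc(2) by simp
  then have "Q g" using Suc(1) gc by blast
  from step[OF rc(1) gc this] show ?case using fe by metis
qed

text \<open>Forms of positive degree are sums of products with a factor from \<open>I\<close>. A
  form of degree 0 with entry in \<open>\<mm>\<close> is nilpotent, as a power of the entry lies in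
  \<open>I\<close>. So \<open>P\<close> contains everything that comes from
  \<open>M\<close>.\<close>

lemma B_prime_eq_N:
  assumes P: "primeideal P B" "\<tau> (Suc 0) ` I \<subseteq> P" shows "P = L.N"
proof
  note Pi = L.B.primeideal_memD[OF P(1)] note iP = L.B.ideal_memD[OF Pi(1)]
  show "P \<subseteq> L.N" by (rule BL.prime_subset_mm[OF P(1)])
  have t: "\<tau> n a \<in> P" if a: "a \<in> pow n" and h: "0 < n \<or> a \<in> \<mm>" for n a
  proof (cases n)
    case 0
    then have am: "a \<in> \<mm>" using h by simp
    then have ac: "a \<in> carrier R" using ideal_memD(1)[OF mm_ideal] by auto
    obtain k :: nat where "a [^] k \<in> I" using I_pow[OF am] by auto
    then have "\<tau> 0 (a [^] k) = \<zero>\<^bsub>B\<^esub>" using tau_zero[of "a [^] k" 0] by (simp add: pow_1)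
    then have "\<tau> 0 a [^]\<^bsub>B\<^esub> k \<in> P" using iP(2) tau_0_pow[OF ac] by simp
    then show ?thesis using L.B.primeideal_pow[OF P(1)] tau_closed[of a 0] ac 0 by (auto simp: ideal_power_0)
  next
    case (Suc k)
    then have "a \<in> I \<cdot> pow k" using a ideal_power_Suc2[OF I_ideal] by simp
    then have "a \<in> pow (Suc k) \<and> \<tau> (Suc k) a \<in> P"
    proof induction
      case (prod c e)
      have c1: "c \<in> pow (Suc 0)" using prod pow_1 by auto
      show ?case using ideal_power_mult[OF I_ideal c1 prod(2)] tau_mult[OF c1 prod(2)]
          iP(7)[OF _ tau_closed[OF prod(2)]] P(2) prod(1) by auto
    next
      case (sum s1 s2)
      then show ?case using powD(3) tau_add iP(3) by auto
    qed
    then show ?thesis using Suc by simp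
  qed
  \<comment> \<open>Modulo \<open>P\<close> every element of \<open>G\<close> is congruent to its
    degree 0 component.\<close>
  have d: "\<exists>b\<in>f 0. L.\<iota> f \<ominus>\<^bsub>B\<^esub> \<tau> 0 b \<in> P" if "f \<in> carrier G" for f
  proof (rule G_homogeneous_induct[OF _ _ that])
    have "\<zero> \<in> \<zero>\<^bsub>G\<^esub> 0" using powD(2)[of "Suc 0"] by (simp add: G_def associated_graded_def)
    moreover have "L.\<iota> \<zero>\<^bsub>G\<^esub> \<ominus>\<^bsub>B\<^esub> \<tau> 0 \<zero> \<in> P"
      using iP(2) tau_zero[OF powD(2)] by (simp add: L.\<iota>_def L.B.minus_eq flip: L.B_zero)
    ultimately show "\<exists>b\<in>\<zero>\<^bsub>G\<^esub> 0. L.\<iota> \<zero>\<^bsub>G\<^esub> \<ominus>\<^bsub>B\<^esub> \<tau> 0 b \<in> P" by blast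
    fix n a g assume a: "a \<in> pow n" and g: "g \<in> carrier G" and "\<exists>b\<in>g 0. L.\<iota> g \<ominus>\<^bsub>B\<^esub> \<tau> 0 b \<in> P"
    then obtain b where b: "b \<in> g 0" "L.\<iota> g \<ominus>\<^bsub>B\<^esub> \<tau> 0 b \<in> P" by blast
    have b0: "b \<in> pow 0" by (rule G_mem(1)[OF g b(1)])
    have c: "\<tau> n a \<in> carrier B" "L.\<iota> g \<in> carrier B" "\<tau> 0 b \<in> carrier B"
      using tau_closed a b0 L.iota_closed g by auto
    have e: "L.\<iota> (hform n a \<oplus>\<^bsub>G\<^esub> g) = \<tau> n a \<oplus>\<^bsub>B\<^esub> L.\<iota> g"
      using L.iota_add[OF hform_closed[OF a] g] by (simp add: \<tau>_def)
    let ?a = "if 0 = n then a else \<zero>"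
    have m: "?a \<oplus> b \<in> (hform n a \<oplus>\<^bsub>G\<^esub> g) 0" by (intro G_add_mem hform_mem a b)
    have "L.\<iota> (hform n a \<oplus>\<^bsub>G\<^esub> g) \<ominus>\<^bsub>B\<^esub> \<tau> 0 (?a \<oplus> b) \<in> P"
    proof (cases "n = 0")
      case True
      have "\<tau> n a \<oplus>\<^bsub>B\<^esub> L.\<iota> g \<ominus>\<^bsub>B\<^esub> (\<tau> n a \<oplus>\<^bsub>B\<^esub> \<tau> 0 b) = L.\<iota> g \<ominus>\<^bsub>B\<^esub> \<tau> 0 b" using c by (algebra)
      then show ?thesis using e tau_add[of a 0 b] a b0 b(2) True by simp
    next
      case False
      have "\<tau> n a \<oplus>\<^bsub>B\<^esub> L.\<iota> g \<ominus>\<^bsub>B\<^esub> \<tau> 0 b = \<tau> n a \<oplus>\<^bsub>B\<^esub> (L.\<iota> g \<ominus>\<^bsub>B\<^esub> \<tau> 0 b)" using c by (algebra)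
      then show ?thesis using e iP(3)[OF t[OF a] b(2)] False b0 powD(1)[OF b0] by simp
    qed
    with m show "\<exists>c\<in>(hform n a \<oplus>\<^bsub>G\<^esub> g) 0. L.\<iota> (hform n a \<oplus>\<^bsub>G\<^esub> g) \<ominus>\<^bsub>B\<^esub> \<tau> 0 c \<in> P" by blast
  qed
  have i0: "L.\<iota> f \<in> P" if f: "f \<in> carrier G" "f \<in> M" for f
  proof -
    obtain b where b: "b \<in> f 0" "L.\<iota> f \<ominus>\<^bsub>B\<^esub> \<tau> 0 b \<in> P" using d[OF f(1)] by blast
    have b0: "b \<in> pow 0" "b \<in> \<mm>" using G_mem(1)[OF f(1) b(1)] M_iff[OF f(1) b(1)] f(2) by auto
    have c: "L.\<iota> f \<in> carrier B" "\<tau> 0 b \<in> carrier B" using tau_closed b0 L.iota_closed f by auto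
    have "L.\<iota> f = (L.\<iota> f \<ominus>\<^bsub>B\<^esub> \<tau> 0 b) \<oplus>\<^bsub>B\<^esub> \<tau> 0 b" using c by (algebra)
    then show ?thesis using iP(3)[OF b(2) t[OF b0(1)]] b0(2) by simp
  qed
  show "L.N \<subseteq> P"
  proof
    fix X assume "X \<in> L.N"
    then obtain f s where f: "f \<in> M" "s \<in> carrier G - M" "X = L.frac f s" unfolding L.N_def by auto
    have fc: "f \<in> carrier G" by (rule G.ideal_memD(1)[OF M_ideal f(1)])
    show "X \<in> P" unfolding f(3) L.frac_iota[OF fc f(2)] by (intro iP(6) i0 fc f(1) L.frac_closed f(2)) simp
  qed
qed

end

section \<open>Reductions and superficial elements seen in the graded ring\<close>

context graded_local begin

text \<open>For \<open>a\<close> in \<open>I\<close> the power \<open>a [^] Suc n\<close> lies in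
  \<open>Q \<cdot> pow n\<close>, so the form of \<open>a\<close> is nilpotent modulo the forms of
  \<open>Q\<close>, and a prime over the latter contains all forms of degree 1.\<close>

lemma spanning_reduction:
  assumes Q: "ideal Q R" "Q \<subseteq> I" "pow (Suc n) \<subseteq> Q \<cdot> pow n"
  shows "BL.spanning (\<tau> (Suc 0) ` Q)"
  unfolding BL.spanning_def
proof (intro conjI ballI allI impI)
  note iQ = ideal_memD[OF Q(1)]
  have Q1: "a \<in> pow (Suc 0)" if "a \<in> Q" for a using that Q(2) pow_1 by auto
  show "\<tau> (Suc 0) ` Q \<subseteq> L.N" using Q1 tau_N by auto
  show "\<tau> (Suc 0) ` Q \<noteq> {}" using iQ(2) by auto
  fix X Y assume "X \<in> \<tau> (Suc 0) ` Q" "Y \<in> \<tau> (Suc 0) ` Q"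
  then obtain a b where ab: "a \<in> Q" "b \<in> Q" "X = \<tau> (Suc 0) a" "Y = \<tau> (Suc 0) b" by auto
  have "X \<oplus>\<^bsub>B\<^esub> Y = \<tau> (Suc 0) (a \<oplus> b)" using tau_add[OF Q1 Q1] ab by simp
  then show "X \<oplus>\<^bsub>B\<^esub> Y \<in> \<tau> (Suc 0) ` Q" using iQ(3)[OF ab(1,2)] by blast
next
  note iQ = ideal_memD[OF Q(1)]
  have Q1: "a \<in> pow (Suc 0)" if "a \<in> Q" for a using that Q(2) pow_1 by auto
  fix X Y assume "X \<in> U" "Y \<in> \<tau> (Suc 0) ` Q"
  then obtain u q where u: "u \<in> carrier R" "X = \<tau> 0 u" "q \<in> Q" "Y = \<tau> (Suc 0) q"
    using residue_reps(1) by (auto simp: U_def)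
  have "X \<otimes>\<^bsub>B\<^esub> Y = \<tau> (Suc 0) (u \<otimes> q)" using tau_mult[of u 0 q "Suc 0"] Q1 u by (simp add: ideal_power_0)
  then show "X \<otimes>\<^bsub>B\<^esub> Y \<in> \<tau> (Suc 0) ` Q" using iQ(6) u by auto
next
  fix P assume P: "primeideal P B" "\<tau> (Suc 0) ` Q \<subseteq> P"
  note Pi = L.B.primeideal_memD[OF P(1)] note iP = L.B.ideal_memD[OF Pi(1)]
  have Q1: "a \<in> pow (Suc 0)" if "a \<in> Q" for a using that Q(2) pow_1 by auto
  have t: "b \<in> pow (Suc n) \<and> \<tau> (Suc n) b \<in> P" if "b \<in> Q \<cdot> pow n" for b
    using that
  proof induction
    case (prod c e)
    show ?case using ideal_power_mult[OF I_ideal Q1[OF prod(1)] prod(2)] tau_mult[OF Q1[OF prod(1)] prod(2)]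
        iP(7)[OF _ tau_closed[OF prod(2)]] P(2) prod(1) by auto
  next
    case (sum s1 s2)
    then show ?case using powD(3) tau_add iP(3) by auto
  qed
  have "\<tau> (Suc 0) ` I \<subseteq> P"
  proof
    fix X assume "X \<in> \<tau> (Suc 0) ` I"
    then obtain a where a: "a \<in> I" "X = \<tau> (Suc 0) a" by auto
    have "\<tau> (Suc n) (a [^] Suc n) \<in> P" using t Q(3) pow_mem_ideal_power[OF I_ideal a(1), of "Suc n"] by blast
    then have "X [^]\<^bsub>B\<^esub> Suc n \<in> P" unfolding tau_pow[OF a(1)] a(2) .
    moreover have "X \<in> carrier B" using tau_closed[of a "Suc 0"] a pow_1 by simp
    ultimately show "X \<in> P" using L.B.primeideal_pow[OF P(1)] by blast
  qed
  then show "P = L.N" by (rule B_prime_eq_N[OF P(1)])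
qed

lemma spanning_I: "BL.spanning (\<tau> (Suc 0) ` I)"
  by (rule spanning_reduction[OF I_ideal subset_refl, of 0]) (simp add: ideal_power_Suc2[OF I_ideal])

text \<open>The point is that the cofactor of \<open>z\<close> lies in \<open>pow r\<close>: this is
  the control of degrees behind \<open>admissible_tau\<close>.\<close>

lemma linK_insert:
  assumes W: "W \<subseteq> I" and z: "z \<in> I" and b: "b \<in> linK (insert z W) (Suc r)"
  shows "\<exists>a\<in>pow r. \<exists>c\<in>linK W (Suc r). b = z \<otimes> a \<oplus> c"
proof -
  have Wc: "W \<subseteq> carrier R" "z \<in> carrier R" using W z ideal_memD(1)[OF I_ideal] by auto
  note IW = genideal_ideal[OF Wc(1)]
  note ip = ideal_prod_is_ideal[OF IW pow_ideal]
  obtain u v where uv: "u \<in> (Idl (insert z W)) \<cdot> pow r" "v \<in> pow (Suc (Suc r))" "b = u \<oplus> v"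
    using b by (auto simp: linK_def sum_mem)
  from uv(1) have "\<exists>a\<in>pow r. \<exists>c\<in>(Idl W) \<cdot> pow r. u = z \<otimes> a \<oplus> c"
  proof induction
    case (prod c e)
    obtain d j where d: "d \<in> carrier R" "j \<in> Idl W" "c = d \<otimes> z \<oplus> j" using prod mem_Idl_insert[OF Wc(2,1)] by auto
    have cc: "j \<in> carrier R" "e \<in> carrier R" using d ideal_memD(1)[OF IW] powD(1)[OF prod(2)] by auto
    have "c \<otimes> e = z \<otimes> (d \<otimes> e) \<oplus> j \<otimes> e" unfolding d(3) using cc d(1) Wc by algebra
    then show ?case using ideal_prod.prod[OF d(2) prod(2)] powD(6)[OF prod(2) d(1)] by blast
  next
    case (sum s1 s2)
    then obtain a c a' c' where h: "a \<in> pow r" "c \<in> (Idl W) \<cdot> pow r" "s1 = z \<otimes> a \<oplus> c"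
      "a' \<in> pow r" "c' \<in> (Idl W) \<cdot> pow r" "s2 = z \<otimes> a' \<oplus> c'" by auto
    have cc: "a \<in> carrier R" "c \<in> carrier R" "a' \<in> carrier R" "c' \<in> carrier R" using h powD(1) ideal_memD(1)[OF ip] by auto
    have "s1 \<oplus> s2 = z \<otimes> (a \<oplus> a') \<oplus> (c \<oplus> c')" unfolding h using cc Wc by algebra
    then show ?case using powD(3)[OF h(1,4)] ideal_memD(3)[OF ip h(2,5)] by blast
  qed
  then obtain a c where a: "a \<in> pow r" "c \<in> (Idl W) \<cdot> pow r" "u = z \<otimes> a \<oplus> c" by auto
  have cc: "a \<in> carrier R" "c \<in> carrier R" "v \<in> carrier R" using a uv powD(1) ideal_memD(1)[OF ip] by auto
  have "b = z \<otimes> a \<oplus> (c \<oplus> v)" unfolding uv(3) a(3) using cc Wc by algebra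
  moreover have "c \<oplus> v \<in> linK W (Suc r)" using a uv by (auto simp: linK_def sum_mem)
  ultimately show ?thesis using a by blast
qed

lemma linK_pow: "W \<subseteq> I \<Longrightarrow> b \<in> linK W (Suc r) \<Longrightarrow> b \<in> pow (Suc r)"
proof -
  assume W: "W \<subseteq> I" and b: "b \<in> linK W (Suc r)"
  obtain u v where uv: "u \<in> (Idl W) \<cdot> pow r" "v \<in> pow (Suc (Suc r))" "b = u \<oplus> v" using b by (auto simp: linK_def sum_mem)
  have "(Idl W) \<cdot> pow r \<subseteq> I \<cdot> pow r" by (rule ideal_prod_mono[OF genideal_minimal[OF I_ideal W]]) simp
  then have "u \<in> pow (Suc r)" using uv ideal_power_Suc2[OF I_ideal] by auto
  moreover have "v \<in> pow (Suc r)" using uv ideal_power_Suc_subset[OF I_ideal] by blast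
  ultimately show ?thesis using powD(3) uv by auto
qed

text \<open>All parameters have degree 1, so in \<open>y \<otimes> n = z \<otimes> n'\<close>, taken
  modulo forms, both cofactors have the same degree. This is what keeps the degree \<open>r\<close>
  of the socle element fixed during the exchange.\<close>

lemma admissible_tau: "BL.admissible (\<tau> (Suc 0) ` I) (\<tau> r ` pow r)"
  unfolding BL.admissible_def
proof (intro conjI spanning_I allI ballI impI)
  show "\<tau> r ` pow r \<subseteq> carrier B" using tau_closed by auto
  fix A Y Z X assume h: "A \<subseteq> \<tau> (Suc 0) ` I" "Y \<in> \<tau> (Suc 0) ` I" "Z \<in> \<tau> (Suc 0) ` I" "X \<in> \<tau> r ` pow r"
    and m: "Y \<otimes>\<^bsub>B\<^esub> X \<in> Idl\<^bsub>B\<^esub> (insert Z A)"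
  obtain W where W: "W \<subseteq> I" "A = \<tau> (Suc 0) ` W" using h(1) by (auto simp: subset_image_iff)
  obtain y z a where y: "y \<in> I" "Y = \<tau> (Suc 0) y" and z: "z \<in> I" "Z = \<tau> (Suc 0) z" and a: "a \<in> pow r" "X = \<tau> r a" using h by auto
  have y1: "y \<in> pow (Suc 0)" and z1: "z \<in> pow (Suc 0)" using y z pow_1 by auto
  have zW: "insert z W \<subseteq> I" using z W by auto
  have ya: "y \<otimes> a \<in> pow (Suc r)" using ideal_power_mult[OF I_ideal y1 a(1)] by simp
  have e: "Y \<otimes>\<^bsub>B\<^esub> X = \<tau> (Suc r) (y \<otimes> a)" using tau_mult[OF y1 a(1)] y a by simp
  have "insert Z A = \<tau> (Suc 0) ` insert z W" using W z by auto
  then have "y \<otimes> a \<in> linK (insert z W) (Suc r)" using m unfolding e using tau_mem_iff[OF zW ya] by simp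
  from linK_insert[OF W(1) z(1) this] obtain a' c where a': "a' \<in> pow r" "c \<in> linK W (Suc r)" "y \<otimes> a = z \<otimes> a' \<oplus> c" by auto
  have c1: "c \<in> pow (Suc r)" by (rule linK_pow[OF W(1) a'(2)])
  have za: "z \<otimes> a' \<in> pow (Suc r)" using ideal_power_mult[OF I_ideal z1 a'(1)] by simp
  have "\<tau> (Suc r) (y \<otimes> a) = Z \<otimes>\<^bsub>B\<^esub> \<tau> r a' \<oplus>\<^bsub>B\<^esub> \<tau> (Suc r) c"
    unfolding a'(3) using tau_add[OF za c1] tau_mult[OF z1 a'(1)] z by simp
  moreover have "(S \<oplus>\<^bsub>B\<^esub> T) \<ominus>\<^bsub>B\<^esub> S = T" if "S \<in> carrier B" "T \<in> carrier B" for S T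
    using that by (algebra)
  ultimately have "Y \<otimes>\<^bsub>B\<^esub> X \<ominus>\<^bsub>B\<^esub> Z \<otimes>\<^bsub>B\<^esub> \<tau> r a' = \<tau> (Suc r) c"
    using e tau_closed[OF z1] tau_closed[OF a'(1)] tau_closed[OF c1] z by simp
  moreover have "\<tau> (Suc r) c \<in> Idl\<^bsub>B\<^esub> A" using tau_mem_iff[OF W(1) c1] a'(2) W by simp
  ultimately show "\<exists>n'\<in>\<tau> r ` pow r. Y \<otimes>\<^bsub>B\<^esub> X \<ominus>\<^bsub>B\<^esub> Z \<otimes>\<^bsub>B\<^esub> n' \<in> Idl\<^bsub>B\<^esub> A" using a'(1) by (intro bexI[of _ "\<tau> r a'"]) simp_all
qed

text \<open>Nakayama's lemma removes the summand \<open>pow (Suc (Suc n))\<close>, which lies in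
  \<open>\<mm> \<cdot> pow (Suc n)\<close>.\<close>

lemma pow_subset_if_linK:
  assumes W: "W \<subseteq> I" and "pow (Suc n) \<subseteq> linK W (Suc n)"
  shows "pow (Suc n) \<subseteq> (Idl W) \<cdot> pow n"
proof (rule nakayama[OF pow_ideal])
  have Wc: "W \<subseteq> carrier R" using W ideal_memD(1)[OF I_ideal] by auto
  show "ideal ((Idl W) \<cdot> pow n) R" by (rule ideal_prod_is_ideal[OF genideal_ideal[OF Wc] pow_ideal])
  have "pow (Suc (Suc n)) \<subseteq> \<mm> \<cdot> pow (Suc n)" unfolding ideal_power_Suc2[OF I_ideal, of "Suc n"]
    by (rule ideal_prod_mono[OF I_mm]) simp
  then show "pow (Suc n) \<subseteq> ((Idl W) \<cdot> pow n) <+> (\<mm> \<cdot> pow (Suc n))"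
    using assms(2) by (force simp: linK_def sum_mem)
qed

text \<open>If \<open>L.N\<close> is the only prime over the forms of \<open>W\<close>, the ideal
  they generate contains the \<open>k\<close>-th power of \<open>L.N\<close> for some
  \<open>k\<close>. Forms of degree \<open>n\<close> lie in the \<open>n\<close>-th power of
  \<open>L.N\<close>, so the forms of \<open>W\<close> generate everything in degree
  \<open>Suc k\<close>.\<close>

lemma reduction_if_primes:
  assumes W: "W \<subseteq> I" and all: "\<And>P. primeideal P B \<Longrightarrow> Idl\<^bsub>B\<^esub> (\<tau> (Suc 0) ` W) \<subseteq> P \<Longrightarrow> P = L.N"
  shows "\<exists>n. pow (Suc n) \<subseteq> (Idl W) \<cdot> pow n"
proof -
  let ?J = "Idl\<^bsub>B\<^esub> (\<tau> (Suc 0) ` W)"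
  have "\<tau> (Suc 0) ` W \<subseteq> carrier B" using W tau_closed pow_1 by auto
  then have J: "ideal ?J B" by (rule L.B.genideal_ideal)
  obtain k where k: "ideal_power B L.N k \<subseteq> ?J"
    using BL.ideal_power_subset_if_nil[OF J BL.mm_ideal] BL.nilpotent_mod[OF J all] by blast
  have t: "\<tau> n a \<in> ideal_power B L.N n" if "a \<in> pow n" for n a
    using that
  proof (induction n arbitrary: a)
    case 0 then show ?case using tau_closed by (simp add: L.B.ideal_power_0)
  next
    case (Suc n)
    have "a \<in> pow n \<cdot> I" using Suc.prems by (simp add: ideal_power_Suc)
    then have "a \<in> pow (Suc n) \<and> \<tau> (Suc n) a \<in> ideal_power B L.N (Suc n)"
    proof induction
      case (prod c e)
      have e1: "e \<in> pow (Suc 0)" using prod pow_1 by auto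
      have "\<tau> n c \<otimes>\<^bsub>B\<^esub> \<tau> (Suc 0) e \<in> ideal_power B L.N (Suc n)"
        unfolding L.B.ideal_power_Suc using Suc.IH[OF prod(1)] tau_N[OF _ e1] by (intro ideal_prod.prod) auto
      then show ?case using tau_mult[OF prod(1) e1] ideal_power_mult[OF I_ideal prod(1) e1] by simp
    next
      case (sum s1 s2)
      then show ?case using powD(3) tau_add L.B.ideal_memD(3)[OF L.B.ideal_power_ideal[OF BL.mm_ideal]] by auto
    qed
    then show ?case by simp
  qed
  \<comment> \<open>Degree \<open>Suc k\<close> instead of \<open>k\<close>, because
    \<open>linK\<close> has the shape of a product only in positive degrees.\<close>
  have "pow (Suc k) \<subseteq> linK W (Suc k)"
  proof
    fix a assume a: "a \<in> pow (Suc k)"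
    have "\<tau> (Suc k) a \<in> ?J" using t[OF a] k L.B.ideal_power_Suc_subset[OF BL.mm_ideal, of k] by blast
    then show "a \<in> linK W (Suc k)" using tau_mem_iff[OF W a] by simp
  qed
  then show ?thesis using pow_subset_if_linK[OF W] by blast
qed

text \<open>Suppose that \<open>P\<close>, the annihilator of a nonzero class with numerator
  \<open>f\<close>, contains the form of \<open>x\<close>. Representatives of \<open>f\<close>
  multiplied by elements of \<open>pow c\<close> meet the condition \<open>\<inter> pow c\<close> of
  superficiality, which then shows that forms of degree \<open>c\<close> kill \<open>f\<close>. So
  \<open>P\<close> contains a power of every form of degree 1 and must be
  \<open>L.N\<close>.\<close>

lemma superficial_generic:
  assumes x: "superficial R I x" and P: "L.B.assoc_prime (Idl\<^bsub>B\<^esub> {}) P" "P \<noteq> L.N"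
  shows "\<tau> (Suc 0) x \<notin> P"
proof
  assume xP: "\<tau> (Suc 0) x \<in> P"
  obtain c where xI: "x \<in> I" and c: "\<And>n. n \<ge> c \<Longrightarrow> {a \<in> carrier R. a \<otimes> x \<in> pow (n + 1)} \<inter> pow c = pow n"
    using x unfolding superficial_def by blast
  have x1: "x \<in> pow (Suc 0)" and xc: "x \<in> carrier R" using xI pow_1 ideal_memD(1)[OF I_ideal] by auto
  obtain X where X: "X \<in> carrier B" "P = L.B.colon (Idl\<^bsub>B\<^esub> {}) X" "primeideal P B" using P by (auto simp: L.B.assoc_prime_def)
  obtain f s where f: "f \<in> carrier G" "s \<in> carrier G - M" "X = L.frac f s" using X L.B_carrier by blast
  have fe: "X = L.frac \<one>\<^bsub>G\<^esub> s \<otimes>\<^bsub>B\<^esub> L.\<iota> f" "L.\<iota> f = L.\<iota> s \<otimes>\<^bsub>B\<^esub> X" using L.frac_iota[OF f(1,2)] L.frac_cancel[OF f(1,2)] f(3) by auto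
  have fc: "L.frac \<one>\<^bsub>G\<^esub> s \<in> carrier B" "L.\<iota> s \<in> carrier B" "L.\<iota> f \<in> carrier B" using L.frac_closed L.iota_closed f by auto
  have I0: "ideal (Idl\<^bsub>B\<^esub> {}) B" by (rule L.B.genideal_ideal) simp
  note i0 = L.B.ideal_memD[OF I0]
  \<comment> \<open>The denominator \<open>s\<close> becomes a unit in \<open>B\<close>, so the
    fraction \<open>X\<close> may be replaced by its numerator, which has homogeneous
    components.\<close>
  have Pf: "Y \<in> P \<longleftrightarrow> Y \<otimes>\<^bsub>B\<^esub> L.\<iota> f \<in> Idl\<^bsub>B\<^esub> {}" if Y: "Y \<in> carrier B" for Y
  proof -
    have 1: "Y \<otimes>\<^bsub>B\<^esub> L.\<iota> f = L.\<iota> s \<otimes>\<^bsub>B\<^esub> (Y \<otimes>\<^bsub>B\<^esub> X)" unfolding fe(2) using Y X fc by (simp add: L.B.m_lcomm)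
    have 2: "Y \<otimes>\<^bsub>B\<^esub> X = L.frac \<one>\<^bsub>G\<^esub> s \<otimes>\<^bsub>B\<^esub> (Y \<otimes>\<^bsub>B\<^esub> L.\<iota> f)" unfolding fe(1) using Y fc by (simp add: L.B.m_lcomm)
    show ?thesis unfolding X(2) L.B.colon_def using Y i0(6) fc 1 2 by (metis (no_types, lifting) mem_Collect_eq)
  qed
  have K: "graded_family (linK {})" by (rule linK_family) simp
  have ext: "L.\<iota> g \<in> Idl\<^bsub>B\<^esub> {} \<Longrightarrow> a \<in> g n \<Longrightarrow> a \<in> pow (Suc n)" if g: "g \<in> carrier G" for g a n
  proof -
    let ?E = "{L.frac a s | a s. a \<in> hom_ideal (linK {}) \<and> s \<in> carrier G - M}"
    assume "L.\<iota> g \<in> Idl\<^bsub>B\<^esub> {}" and a: "a \<in> g n"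
    moreover have "Idl\<^bsub>B\<^esub> {} \<subseteq> ?E" by (rule L.B.genideal_minimal[OF L.extension_ideal[OF hom_ideal_ideal[OF K]]]) simp
    ultimately have "L.\<iota> g \<in> ?E" by blast
    then have "g \<in> hom_ideal (linK {})" unfolding L.\<iota>_def
      using L.frac_in_extension[OF hom_ideal_ideal[OF K] _ g L.S_one] hom_ideal_saturated[OF K] by auto
    then have "a \<in> linK {} n" using a by (auto simp: hom_ideal_def)
    moreover have "Idl {} = {\<zero>}" using genideal_minimal[OF zeroideal, of "{}"] ideal_memD(2)[OF genideal_ideal[of "{}"]] by auto
    moreover have "{\<zero>} \<cdot> pow k \<subseteq> {\<zero>}" for k using powD(1) by (intro ideal_prod_subset[OF zeroideal]) auto
    ultimately show "a \<in> pow (Suc n)" using powD(1) by (cases n) (force simp: linK_def pow_1 sum_mem)+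
  qed
  have hx: "hform (Suc 0) x \<in> carrier G" by (rule hform_closed[OF x1])
  have xf: "a \<otimes> x \<in> pow (Suc (Suc n))" if a: "a \<in> f n" for a n
  proof -
    have "L.\<iota> (hform (Suc 0) x \<otimes>\<^bsub>G\<^esub> f) \<in> Idl\<^bsub>B\<^esub> {}"
      using xP Pf[OF tau_closed[OF x1]] L.iota_mult[OF hx f(1)] by (simp add: \<tau>_def)
    \<comment> \<open>Only \<open>i = Suc 0\<close> contributes. The test
      \<open>Suc n - i = n\<close> puts the given \<open>a\<close> in place of the chosen
      representative \<open>rep f n\<close>.\<close>
    moreover have "(\<Oplus>i\<in>{..Suc n}. (if i = Suc 0 then x else \<zero>) \<otimes> (if Suc n - i = n then a else rep f (Suc n - i)))
        \<in> (hform (Suc 0) x \<otimes>\<^bsub>G\<^esub> f) (Suc n)"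
      by (rule G_mult_mem[OF hx f(1) hform_mem[OF x1], of "Suc n" "\<lambda>i. if i = n then a else rep f i"])
         (use a rep_mem[OF f(1)] in auto)
    ultimately have 1: "(\<Oplus>i\<in>{..Suc n}. (if i = Suc 0 then x else \<zero>) \<otimes> (if Suc n - i = n then a else rep f (Suc n - i)))
        \<in> pow (Suc (Suc n))" using ext hx f(1) by blast
    have ac: "a \<in> carrier R" using G_mem(1)[OF f(1) a] powD(1) by auto
    have "(\<Oplus>i\<in>{..Suc n}. (if i = Suc 0 then x else \<zero>) \<otimes> (if Suc n - i = n then a else rep f (Suc n - i)))
      = (\<Oplus>i\<in>{..Suc n}. if Suc 0 = i then x \<otimes> a else \<zero>)"
      using ac xc rep_carrier[OF f(1)] by (intro finsum_cong') auto
    also have "\<dots> = x \<otimes> a" using finsum_singleton[of "Suc 0" "{..Suc n}" "\<lambda>_. x \<otimes> a"] ac xc by auto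
    finally show ?thesis using 1 ac xc by (simp add: m_comm)
  qed
  \<comment> \<open>The bound \<open>k \<ge> c\<close> places \<open>e \<otimes> a\<close> in
    \<open>pow c\<close>; superficiality then strips off the factor \<open>x\<close> and yields
    order \<open>k + n + 1\<close> in place of the evident \<open>k + n\<close>.\<close>
  have key: "e \<otimes> a \<in> pow (Suc (k + n))" if e: "e \<in> pow k" "k \<ge> c" and a: "a \<in> f n" for e a k n
  proof -
    have ac: "a \<in> pow n" "a \<in> carrier R" "e \<in> carrier R" using G_mem(1)[OF f(1) a] powD(1) e by auto
    have p: "e \<otimes> a \<in> pow (k + n)" by (rule ideal_power_mult[OF I_ideal e(1) ac(1)])
    then have "e \<otimes> a \<in> pow c" using ideal_power_antimono[OF I_ideal, of c "k + n"] e(2) by auto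
    moreover have "e \<otimes> a \<otimes> x \<in> pow (Suc (k + n) + 1)"
      using ideal_power_mult[OF I_ideal e(1) xf[OF a]] ac xc by (simp add: m_assoc)
    ultimately show ?thesis using c[of "Suc (k + n)"] ac e(2) by auto
  qed
  have "\<tau> (Suc 0) ` I \<subseteq> P"
  proof
    fix Y assume "Y \<in> \<tau> (Suc 0) ` I"
    then obtain a where a: "a \<in> I" "Y = \<tau> (Suc 0) a" by auto
    let ?e = "a [^] c"
    have e: "?e \<in> pow c" by (rule pow_mem_ideal_power[OF I_ideal a(1)])
    have ec: "?e \<in> carrier R" using e powD(1) by auto
    have "hform c ?e \<otimes>\<^bsub>G\<^esub> f = \<zero>\<^bsub>G\<^esub>"
    proof (rule G_eqI)
      show "hform c ?e \<otimes>\<^bsub>G\<^esub> f \<in> carrier G" using hform_closed[OF e] f by auto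
      fix n
      let ?t = "\<lambda>i. (if i = c then ?e else \<zero>) \<otimes> rep f (n - i)"
      have m: "(\<Oplus>i\<in>{..n}. ?t i) \<in> (hform c ?e \<otimes>\<^bsub>G\<^esub> f) n"
        by (rule G_mult_mem[OF hform_closed[OF e] f(1) hform_mem[OF e] rep_mem[OF f(1)]])
      have "(\<Oplus>i\<in>{..n}. ?t i) \<in> pow (Suc n)"
      proof (rule finsum_ideal[OF pow_ideal])
        fix i assume "i \<in> {..n}"
        then show "?t i \<in> pow (Suc n)" using key[OF e order_refl rep_mem[OF f(1), of "n - c"]] rep_carrier[OF f(1)] powD(2) by auto
      qed auto
      then have "(\<Oplus>i\<in>{..n}. ?t i) \<in> \<zero>\<^bsub>G\<^esub> n" by (simp add: G_def associated_graded_def)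
      with m show "\<exists>a. a \<in> (hform c ?e \<otimes>\<^bsub>G\<^esub> f) n \<and> a \<in> \<zero>\<^bsub>G\<^esub> n" by blast
    qed simp
    then have "\<tau> c ?e \<otimes>\<^bsub>B\<^esub> L.\<iota> f = \<zero>\<^bsub>B\<^esub>" using L.iota_mult[OF hform_closed[OF e] f(1)] by (simp add: \<tau>_def L.\<iota>_def L.B_zero)
    then have "\<tau> c ?e \<in> P" using Pf[OF tau_closed[OF e]] i0(2) by simp
    then have "Y [^]\<^bsub>B\<^esub> c \<in> P" using tau_pow[OF a(1)] a by simp
    then show "Y \<in> P" using L.B.primeideal_pow[OF X(3)] tau_closed[of a "Suc 0"] a pow_1 by auto
  qed
  then show False using B_prime_eq_N[OF X(3)] P(2) by simp
qed

end

section \<open>Consequences of the Cohen-Macaulay property of the graded ring\<close>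

lemma krull_dim_ge:
  assumes "\<forall>i\<le>t. primeideal (P i) R" "\<forall>i<t. P i \<subset> P (Suc i)" shows "enat t \<le> krull_dim R"
  unfolding krull_dim_def using assms by (intro Sup_upper CollectI exI[of _ t] exI[of _ P] conjI refl)

lemma module_depth_attained:
  assumes "enat t \<le> module_depth R M" "t \<ge> 1"
  shows "\<exists>xs. length xs \<ge> t \<and> set xs \<subseteq> max_ideal R \<and> regular_sequence R M xs"
proof -
  have "{enat (length xs) | xs. Q xs} = {enat n | n. \<exists>xs. n = length xs \<and> Q xs}" for Q :: "'a list \<Rightarrow> bool" by auto
  with assms have "enat t \<le> Sup {enat n | n. \<exists>xs. n = length xs \<and> set xs \<subseteq> max_ideal R \<and> regular_sequence R M xs}"
    unfolding module_depth_def by simp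
  from Sup_enat_attained[OF this assms(2)] show ?thesis by auto
qed

lemma regular_sequenceD:
  fixes R (structure)
  assumes "regular_sequence R M xs" "i < length xs" "v \<in> carrier M"
    "(xs ! i) \<odot>\<^bsub>M\<^esub> v \<in> ideal_smult R (Idl (set (take i xs))) M"
  shows "v \<in> ideal_smult R (Idl (set (take i xs))) M"
  using assms unfolding regular_sequence_def Let_def by blast

text \<open>\<open>not_nil\<close> carries the positive dimension of \<open>R\<close> over to the
  graded ring: it yields a prime of \<open>B\<close> other than \<open>L.N\<close>, so that the form
  of a superficial element can start a generic list.\<close>

locale graded_cm = graded_local +
  assumes CM: "module_depth B (regular_module B) = module_dim B (regular_module B)"
    and not_nil: "\<not> pow n \<subseteq> {\<zero>}"
begin

text \<open>The chain bounds the dimension from below, hence by the Cohen-Macaulay property the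
  depth, and a long regular sequence extends to one that ends in a socle element.\<close>

lemma depth_ge_chain:
  assumes P: "\<And>i. i \<le> t \<Longrightarrow> primeideal (P i) B" "\<And>i. i < t \<Longrightarrow> P i \<subset> P (Suc i)"
  shows "\<exists>s\<ge>t. BL.exact_depth L.N (carrier B) {} s"
\<comment> \<open>A supremum of value 0 may belong to the empty set, so for \<open>t = 0\<close> the
  general existence of an exact depth is used.\<close>
proof (cases "t = 0")
  case True
  then show ?thesis using BL.exact_depth_total[of "{}"] by auto
next
  case False
  \<comment> \<open>\<open>module_dim\<close> refers to the quotient by the annihilator, so the
    primes have to be carried over to \<open>B\<close> modulo its zero ideal.\<close>
  have "annihilator B (regular_module B) = {\<zero>\<^bsub>B\<^esub>}"
  proof
    show "annihilator B (regular_module B) \<subseteq> {\<zero>\<^bsub>B\<^esub>}"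
    proof
      fix X assume "X \<in> annihilator B (regular_module B)"
      then have "X \<in> carrier B" "X \<otimes>\<^bsub>B\<^esub> \<one>\<^bsub>B\<^esub> = \<zero>\<^bsub>B\<^esub>" unfolding annihilator_def L.B.regular_module_simps by blast+
      then show "X \<in> {\<zero>\<^bsub>B\<^esub>}" by simp
    qed
    show "{\<zero>\<^bsub>B\<^esub>} \<subseteq> annihilator B (regular_module B)" unfolding annihilator_def L.B.regular_module_simps by simp
  qed
  then have dim: "module_dim B (regular_module B) = krull_dim (B Quot {\<zero>\<^bsub>B\<^esub>})" by (simp add: module_dim_def)
  note Z = L.B.zeroideal
  let ?q = "(+>\<^bsub>B\<^esub>) {\<zero>\<^bsub>B\<^esub>}"
  have ZP: "{\<zero>\<^bsub>B\<^esub>} \<subseteq> P i" if "i \<le> t" for i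
    using L.B.ideal_memD(2)[OF L.B.primeideal_memD(1)[OF P(1)[OF that]]] by auto
  have "(\<forall>i\<le>t. primeideal (?q ` P i) (B Quot {\<zero>\<^bsub>B\<^esub>})) \<and> (\<forall>i<t. ?q ` P i \<subset> ?q ` P (Suc i))"
  proof (intro conjI allI impI)
    fix i assume "i \<le> t"
    then show "primeideal (?q ` P i) (B Quot {\<zero>\<^bsub>B\<^esub>})" using L.B.quotient_prime[OF Z P(1) ZP] by auto
  next
    fix i assume i: "i < t"
    obtain a where a: "a \<in> P (Suc i)" "a \<notin> P i" using P(2)[OF i] by auto
    have ac: "a \<in> carrier B" using a L.B.ideal_memD(1)[OF L.B.primeideal_memD(1)[OF P(1)]] i by (meson Suc_leI)
    have "?q a \<notin> ?q ` P i"
      using L.B.quotient_mem_image[OF Z L.B.primeideal_memD(1)[OF P(1)] ZP ac, of i] a i by auto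
    then show "?q ` P i \<subset> ?q ` P (Suc i)" using a P(2)[OF i] by blast
  qed
  then have "enat t \<le> krull_dim (B Quot {\<zero>\<^bsub>B\<^esub>})" 
    by (elim conjE) (rule krull_dim_ge)
  then have "enat t \<le> module_depth B (regular_module B)" using CM dim by simp
  then obtain xs where
    xs: "length xs \<ge> t" "set xs \<subseteq> max_ideal B" "regular_sequence B (regular_module B) xs"
    using module_depth_attained False by (metis One_nat_def Suc_leI not_gr_zero)
  have xsN: "set xs \<subseteq> L.N" using xs BL.max_ideal_eq by simp
  have "L.B.regular_list {} xs" unfolding L.B.regular_list_iff
  proof (intro allI impI)
    fix i assume i: "i < length xs"
    have "set (take i xs) \<subseteq> carrier B" using xs(3) set_take_subset[of i xs] unfolding regular_sequence_def by blast
    then have e: "ideal_smult B (Idl\<^bsub>B\<^esub> (set (take i xs))) (regular_module B) = Idl\<^bsub>B\<^esub> (set (take i xs))"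
      by (intro L.B.regular_ideal_smult L.B.genideal_ideal)
    show "L.B.regular_mod (Idl\<^bsub>B\<^esub> ({} \<union> set (take i xs))) (xs ! i)"
      using regular_sequenceD[OF xs(3) i, unfolded e L.B.regular_module_simps] unfolding L.B.regular_mod_def by simp
  qed
  from BL.exact_depth_ge_regular_list[OF _ xsN this] xs(1) show ?thesis by (meson empty_subsetI order_trans)
qed

text \<open>A generic list comes with a chain of primes of the same length, so the depth is at least
  this length, and genericity turns into regularity.\<close>

lemma generic_regular:
  assumes "set zs \<subseteq> L.N" "BL.generic_list {} zs"
  shows "L.B.regular_list {} zs"
proof -
  obtain P where "\<forall>i\<le>length zs. primeideal (P i) B" "\<forall>i<length zs. P i \<subset> P (Suc i)"
    using BL.generic_list_prime_chain[OF _ assms] by auto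
  then obtain s where "s \<ge> length zs" "BL.exact_depth L.N (carrier B) {} s" using depth_ge_chain[of "length zs" P] by auto
  then show ?thesis using BL.generic_list_regular[of "{}" zs s] assms by auto
qed

text \<open>Otherwise the empty set of forms would already give a reduction, that is,
  \<open>I\<close> would be nilpotent.\<close>

lemma exists_non_maximal_prime: "\<exists>P. primeideal P B \<and> Idl\<^bsub>B\<^esub> {} \<subseteq> P \<and> P \<noteq> L.N"
proof (rule ccontr)
  assume "\<not> ?thesis"
  then have "\<And>P. primeideal P B \<Longrightarrow> Idl\<^bsub>B\<^esub> (\<tau> (Suc 0) ` {}) \<subseteq> P \<Longrightarrow> P = L.N" by auto
  from reduction_if_primes[OF _ this] obtain n where n: "pow (Suc n) \<subseteq> (Idl {}) \<cdot> pow n" by blast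
  have "Idl {} \<subseteq> {\<zero>}" using genideal_minimal[OF zeroideal, of "{}"] by auto
  then have "(Idl {}) \<cdot> pow n \<subseteq> {\<zero>}" using powD(1) by (intro ideal_prod_subset[OF zeroideal]) auto
  then show False using n not_nil[of "Suc n"] by blast
qed

lemma superficial_generic_list:
  assumes x: "superficial R I x" shows "BL.generic_list {} (\<tau> (Suc 0) x # zs) \<longleftrightarrow> BL.generic_list {\<tau> (Suc 0) x} zs"
  using exists_non_maximal_prime superficial_generic[OF x] by auto

text \<open>Regularity of the form of \<open>x\<close> removes the restriction to large exponents:
  as long as \<open>a\<close> is in \<open>pow k\<close> with \<open>k < n\<close>, the product of
  the forms of \<open>x\<close> and \<open>a\<close> vanishes in degree \<open>Suc k\<close>, so
  \<open>a\<close> moves up to \<open>pow (Suc k)\<close>.\<close>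

lemma superficial_regular:
  assumes x: "superficial R I x" and a: "a \<in> carrier R" "a \<otimes> x \<in> pow (Suc n)"
  shows "a \<in> pow n"
proof -
  have xI: "x \<in> I" using x by (auto simp: superficial_def)
  then have x1: "x \<in> pow (Suc 0)" and xc: "x \<in> carrier R" using pow_1 ideal_memD(1)[OF I_ideal] by auto
  have "BL.generic_list {} [\<tau> (Suc 0) x]" unfolding superficial_generic_list[OF x] by simp
  then have reg: "L.B.regular_mod (Idl\<^bsub>B\<^esub> {}) (\<tau> (Suc 0) x)" using generic_regular[of "[\<tau> (Suc 0) x]"] tau_N[OF _ x1] by auto
  have "k \<le> n \<Longrightarrow> a \<in> pow k" for k
  proof (induction k)
    case 0 then show ?case using a by (simp add: ideal_power_0)
  next
    case (Suc k)
    then have ak: "a \<in> pow k" by simp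
    have "x \<otimes> a \<in> pow (Suc (Suc k))" using a(2) Suc.prems ideal_power_antimono[OF I_ideal, of "Suc (Suc k)" "Suc n"] a xc
      by (auto simp: m_comm)
    then have "\<tau> (Suc 0) x \<otimes>\<^bsub>B\<^esub> \<tau> k a = \<zero>\<^bsub>B\<^esub>" using tau_mult[OF x1 ak] tau_zero[of "x \<otimes> a" "Suc k"] by simp
    then have "\<tau> k a \<in> Idl\<^bsub>B\<^esub> (\<tau> (Suc 0) ` {})"
      using L.B.regular_modD[OF reg tau_closed[OF ak]] L.B.ideal_memD(2)[OF L.B.genideal_ideal[of "{}"]] by simp
    then have "a \<in> linK {} k" using tau_mem_iff[OF _ ak, of "{}"] by blast
    moreover have "Idl {} \<subseteq> {\<zero>}" using genideal_minimal[OF zeroideal, of "{}"] by auto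
    then have "(Idl {}) \<cdot> pow m \<subseteq> {\<zero>}" for m using powD(1) by (intro ideal_prod_subset[OF zeroideal]) auto
    ultimately show ?case using powD(1) by (cases k) (force simp: linK_def pow_1 sum_mem)+
  qed
  then show ?thesis by simp
qed

lemma exact_depth_regular_list:
  "set zs \<subseteq> Y \<Longrightarrow> L.B.regular_list A zs \<Longrightarrow> BL.exact_depth Y T (A \<union> set zs) 0 \<Longrightarrow> BL.exact_depth Y T A (length zs)"
proof (induction zs arbitrary: A)
  case (Cons z zs)
  then have "BL.exact_depth Y T (insert z A) (length zs)" by simp
  then show ?case using Cons.prems by auto
qed simp

text \<open>The forms of a reduction are a spanning set, so generic elements can be drawn from
  \<open>Q\<close> itself until, together with \<open>W\<close>, they generate a reduction. When
  \<open>Q\<close> is minimal, this recovers generators of \<open>Q\<close>.\<close>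

lemma generic_reduction:
  assumes Q: "ideal Q R" "Q \<subseteq> I" "pow (Suc n) \<subseteq> Q \<cdot> pow n" and W: "W \<subseteq> I"
  shows "\<exists>qs. set qs \<subseteq> Q \<and> BL.generic_list (\<tau> (Suc 0) ` W) (map (\<tau> (Suc 0)) qs) \<and>
    (\<forall>P. primeideal P B \<longrightarrow> Idl\<^bsub>B\<^esub> (\<tau> (Suc 0) ` (W \<union> set qs)) \<subseteq> P \<longrightarrow> P = L.N) \<and>
    (\<exists>m. pow (Suc m) \<subseteq> (Idl (W \<union> set qs)) \<cdot> pow m)"
proof -
  have c: "\<tau> (Suc 0) ` W \<subseteq> carrier B" using W tau_closed pow_1 by auto
  obtain zs where zs: "set zs \<subseteq> \<tau> (Suc 0) ` Q" "BL.generic_list (\<tau> (Suc 0) ` W) zs"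
    "\<forall>P. primeideal P B \<longrightarrow> Idl\<^bsub>B\<^esub> (\<tau> (Suc 0) ` W \<union> set zs) \<subseteq> P \<longrightarrow> P = L.N"
    using BL.generic_list_exists[OF spanning_reduction[OF Q] c] by blast
  have "\<exists>qs. set qs \<subseteq> Q \<and> map (\<tau> (Suc 0)) qs = zs" using zs(1)
  proof (induction zs)
    case (Cons z zs)
    then obtain qs q where "set qs \<subseteq> Q" "map (\<tau> (Suc 0)) qs = zs" "q \<in> Q" "z = \<tau> (Suc 0) q" by auto
    then show ?case by (intro exI[of _ "q # qs"]) auto
  qed simp
  then obtain qs where qs: "set qs \<subseteq> Q" "map (\<tau> (Suc 0)) qs = zs" by auto
  have "\<tau> (Suc 0) ` W \<union> set zs = \<tau> (Suc 0) ` (W \<union> set qs)" unfolding qs(2)[symmetric] by (simp add: image_Un)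
  with zs(3) have all: "\<forall>P. primeideal P B \<longrightarrow> Idl\<^bsub>B\<^esub> (\<tau> (Suc 0) ` (W \<union> set qs)) \<subseteq> P \<longrightarrow> P = L.N" by simp
  have "W \<union> set qs \<subseteq> I" using W qs Q by auto
  from reduction_if_primes[OF this] all have "\<exists>m. pow (Suc m) \<subseteq> (Idl (W \<union> set qs)) \<cdot> pow m" by blast
  with qs zs(2) all show ?thesis by blast
qed

text \<open>By minimality \<open>Q\<close> and \<open>Q'\<close> are generated by elements with
  generic, hence regular, forms. If the claim fails, the last nonzero degree \<open>r'\<close> of
  \<open>G\<close> modulo the forms of \<open>Q'\<close> exceeds \<open>r\<close>, and a nonzero
  class there is a socle element. The exchange carries it to a nonzero class of degree
  \<open>r'\<close> modulo the forms of \<open>Q\<close>, against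
  \<open>pow r' \<subseteq> Q \<cdot> pow (r' - 1)\<close>.\<close>

lemma reduction_number_transfer:
  assumes x: "superficial R I x"
    and Q: "ideal Q R" "Q \<subseteq> I" "pow (Suc r) \<subseteq> Q \<cdot> pow r"
    and Q_min: "\<And>L n. ideal L R \<Longrightarrow> L \<subseteq> Q \<Longrightarrow> pow (Suc n) \<subseteq> L \<cdot> pow n \<Longrightarrow> L = Q"
    and Q': "ideal Q' R" "x \<in> Q'" "Q' \<subseteq> I" "pow (Suc n) \<subseteq> (Q' \<cdot> pow n) <+> (PIdl x)"
    and Q'_min: "\<And>L n. ideal L R \<Longrightarrow> x \<in> L \<Longrightarrow> L \<subseteq> Q' \<Longrightarrow> pow (Suc n) \<subseteq> L \<cdot> pow n \<Longrightarrow> L = Q'"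
  shows "pow (Suc r) \<subseteq> Q' \<cdot> pow r"
proof (rule ccontr)
  assume contr: "\<not> ?thesis"
  have xI: "x \<in> I" using Q' by auto
  have xc: "x \<in> carrier R" using xI ideal_memD(1)[OF I_ideal] by auto
  note ip' = ideal_prod_is_ideal[OF Q'(1) pow_ideal]
  \<comment> \<open>A reduction modulo \<open>x\<close> lifts: the multiple of \<open>x\<close> that
    is left over lies in \<open>pow (Suc n)\<close>, so its cofactor lies in \<open>pow n\<close> by
    \<open>superficial_regular\<close>, and \<open>x\<close> belongs to \<open>Q'\<close>.\<close>
  have Q'n: "pow (Suc n) \<subseteq> Q' \<cdot> pow n"
  proof
    fix a assume a: "a \<in> pow (Suc n)"
    then have "a \<in> (Q' \<cdot> pow n) <+> (PIdl x)" using Q'(4) by blast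
    then obtain u c where u: "u \<in> Q' \<cdot> pow n" "c \<in> carrier R" "a = u \<oplus> c \<otimes> x"
      unfolding sum_mem cgenideal_def by blast
    have uc: "u \<in> carrier R" using u ideal_memD(1)[OF ip'] by auto
    have "Q' \<cdot> pow n \<subseteq> I \<cdot> pow n" by (rule ideal_prod_mono[OF Q'(3)]) simp
    then have "u \<in> pow (Suc n)" using u ideal_power_Suc2[OF I_ideal] by auto
    then have "c \<otimes> x \<in> pow (Suc n)" using ideal_add_cancel[OF pow_ideal, of u "Suc n" "c \<otimes> x"] a u xc by auto
    then have "c \<in> pow n" by (rule superficial_regular[OF x u(2)])
    then have "x \<otimes> c \<in> Q' \<cdot> pow n" using Q'(2) by (intro ideal_prod.prod)
    then show "a \<in> Q' \<cdot> pow n" unfolding u(3) using ideal_memD(3)[OF ip' u(1)] xc u(2) by (simp add: m_comm)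
  qed
  obtain qs where qs: "set qs \<subseteq> Q" "BL.generic_list {} (map (\<tau> (Suc 0)) qs)"
    "\<And>P. primeideal P B \<Longrightarrow> Idl\<^bsub>B\<^esub> (\<tau> (Suc 0) ` set qs) \<subseteq> P \<Longrightarrow> P = L.N" "\<exists>m. pow (Suc m) \<subseteq> (Idl (set qs)) \<cdot> pow m"
    using generic_reduction[OF Q, of "{}"] by auto
  have qsI: "set qs \<subseteq> I" using qs Q by auto
  have Qe: "Idl (set qs) = Q"
    using Q_min[of "Idl (set qs)"] qs genideal_minimal[OF Q(1) qs(1)] genideal_ideal[of "set qs"] ideal_memD(1)[OF Q(1)] by blast
  \<comment> \<open>Starting from \<open>{x}\<close> keeps the form of \<open>x\<close> at the head
    of the list, where superficiality provides genericity.\<close>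
  obtain qs' where qs': "set qs' \<subseteq> Q'" "BL.generic_list {\<tau> (Suc 0) x} (map (\<tau> (Suc 0)) qs')"
    "\<exists>m. pow (Suc m) \<subseteq> (Idl (insert x (set qs'))) \<cdot> pow m"
    using generic_reduction[OF Q'(1,3) Q'n, of "{x}"] xI by auto
  have sub': "insert x (set qs') \<subseteq> Q'" using qs' Q' by auto
  have c': "insert x (set qs') \<subseteq> carrier R" using sub' ideal_memD(1)[OF Q'(1)] by auto
  have Qe': "Idl (insert x (set qs')) = Q'"
    using Q'_min[of "Idl (insert x (set qs'))"] qs'(3) genideal_minimal[OF Q'(1) sub'] genideal_ideal[OF c'] genideal_self[OF c'] by blast
  let ?W = "insert x (set qs')"
  have WI: "?W \<subseteq> I" using sub' Q' by auto
  have regs: "L.B.regular_list {} (map (\<tau> (Suc 0)) qs)"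
    by (rule generic_regular[OF _ qs(2)]) (use tau_N qsI pow_1 in auto)
  have regs': "L.B.regular_list {} (map (\<tau> (Suc 0)) (x # qs'))"
    by (rule generic_regular) (use tau_N WI pow_1 superficial_generic_list[OF x] qs'(2) in \<open>auto simp del: BL.generic_list.simps\<close>)
  \<comment> \<open>\<open>E m\<close> expresses that \<open>G\<close> modulo the forms of
    \<open>?W\<close> vanishes in degree \<open>m\<close>.\<close>
  define E where "E m \<longleftrightarrow> pow m \<subseteq> linK ?W m" for m
  have Wc: "Idl ?W = Q'" by (rule Qe')
  have lin: "Q' \<cdot> pow k \<subseteq> linK ?W (Suc k)" for k using Wc powD(2) ideal_memD(1)[OF ideal_prod_is_ideal[OF Q'(1) pow_ideal]]
    by (force simp: linK_def sum_mem)
  have big: "pow (Suc (n + k)) \<subseteq> Q' \<cdot> pow (n + k)" for k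
  proof (induction k)
    case (Suc k)
    have "pow (Suc (n + Suc k)) = pow (Suc (n + k)) \<cdot> I" by (simp add: ideal_power_Suc[of I "Suc (n + k)"])
    also have "\<dots> \<subseteq> (Q' \<cdot> pow (n + k)) \<cdot> I" by (rule ideal_prod_mono[OF Suc]) simp
    also have "\<dots> = Q' \<cdot> pow (n + Suc k)" by (simp add: ideal_prod_assoc[OF Q'(1) pow_ideal I_ideal] ideal_power_Suc)
    finally show ?case .
  qed (use Q'n in simp)
  have nE: "\<not> E (Suc r)"
  proof
    assume "E (Suc r)"
    then have "pow (Suc r) \<subseteq> Q' \<cdot> pow r" using pow_subset_if_linK[OF WI] Wc by (simp add: E_def)
    then show False using contr by simp
  qed
  have fin: "E m" if "m > n + r" for m
  proof -
    have "\<exists>k. m = Suc (n + k)" using that by (intro exI[of _ "m - Suc n"]) auto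
    then obtain k where "m = Suc (n + k)" by blast
    then show ?thesis using big[of k] lin[of "n + k"] by (auto simp: E_def)
  qed
  let ?S = "{m. \<not> E m}"
  have fS: "finite ?S" by (rule finite_subset[of _ "{..n + r}"]) (use fin in \<open>auto intro: leI\<close>)
  \<comment> \<open>The last nonzero degree. The set is finite because all degrees beyond
    \<open>n\<close> vanish by \<open>big\<close>, and nonempty because of
    \<open>nE\<close>.\<close>
  define r' where "r' = Max ?S"
  have r': "\<not> E r'" "r' \<ge> Suc r" "E (Suc r')"
  proof -
    show "\<not> E r'" using Max_in[OF fS] nE unfolding r'_def by auto
    show "r' \<ge> Suc r" using Max_ge[OF fS] nE unfolding r'_def by auto
    show "E (Suc r')"
    proof (rule ccontr)
      assume "\<not> E (Suc r')"
      then have "Suc r' \<le> r'" using Max_ge[OF fS, of "Suc r'"] unfolding r'_def by auto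
      then show False by simp
    qed
  qed
  obtain g where g: "g \<in> pow r'" "g \<notin> linK ?W r'" using r'(1) by (auto simp: E_def)
  let ?Y = "\<tau> (Suc 0) ` I" and ?T = "\<tau> r' ` pow r'"
  have "BL.exact_depth ?Y ?T ({} \<union> set (map (\<tau> (Suc 0)) (x # qs'))) 0"
  proof -
    have e: "{} \<union> set (map (\<tau> (Suc 0)) (x # qs')) = \<tau> (Suc 0) ` ?W" by simp
    have "\<tau> r' g \<notin> Idl\<^bsub>B\<^esub> (\<tau> (Suc 0) ` ?W)" using tau_mem_iff[OF WI g(1)] g(2) by simp
    moreover have "C \<otimes>\<^bsub>B\<^esub> \<tau> r' g \<in> Idl\<^bsub>B\<^esub> (\<tau> (Suc 0) ` ?W)" if "C \<in> ?Y" for C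
    proof -
      obtain c where c: "c \<in> I" "C = \<tau> (Suc 0) c" using \<open>C \<in> ?Y\<close> by auto
      have c1: "c \<in> pow (Suc 0)" using c pow_1 by simp
      have cg: "c \<otimes> g \<in> pow (Suc r')" using ideal_power_mult[OF I_ideal c1 g(1)] by simp
      then have "\<tau> (Suc r') (c \<otimes> g) \<in> Idl\<^bsub>B\<^esub> (\<tau> (Suc 0) ` ?W)" using tau_mem_iff[OF WI cg] r'(3) by (auto simp: E_def)
      then show ?thesis using tau_mult[OF c1 g(1)] c by simp
    qed
    ultimately show ?thesis unfolding e BL.exact_depth.simps using g(1) by blast
  qed
  from exact_depth_regular_list[OF _ regs' this] WI
  have dep: "BL.exact_depth ?Y ?T {} (length (map (\<tau> (Suc 0)) (x # qs')))" by auto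
  have "\<exists>n\<in>?T. n \<notin> Idl\<^bsub>B\<^esub> ({} \<union> set (map (\<tau> (Suc 0)) qs))"
    by (rule BL.exact_depth_terminal[OF admissible_tau _ _ _ regs dep]) (use qsI qs(3) in auto)
  then obtain a where a: "a \<in> pow r'" "\<tau> r' a \<notin> Idl\<^bsub>B\<^esub> (\<tau> (Suc 0) ` set qs)" by auto
  obtain k where k: "r' = Suc (r + k)" using r'(2) by (metis add_Suc le_Suc_ex)
  have "pow (Suc (r + k)) \<subseteq> Q \<cdot> pow (r + k)" for k
  proof (induction k)
    case (Suc k)
    have "pow (Suc (r + Suc k)) = pow (Suc (r + k)) \<cdot> I" by (simp add: ideal_power_Suc[of I "Suc (r + k)"])
    also have "\<dots> \<subseteq> (Q \<cdot> pow (r + k)) \<cdot> I" by (rule ideal_prod_mono[OF Suc]) simp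
    also have "\<dots> = Q \<cdot> pow (r + Suc k)" by (simp add: ideal_prod_assoc[OF Q(1) pow_ideal I_ideal] ideal_power_Suc)
    finally show ?case .
  qed (use Q in simp)
  then have "a \<in> Q \<cdot> pow (r + k)" using a(1) k by blast
  moreover have "Q \<cdot> pow (r + k) \<subseteq> linK (set qs) (Suc (r + k))" using Qe powD(2) ideal_memD(1)[OF ideal_prod_is_ideal[OF Q(1) pow_ideal]]
    by (force simp: linK_def sum_mem)
  ultimately have "\<tau> r' a \<in> Idl\<^bsub>B\<^esub> (\<tau> (Suc 0) ` set qs)" using tau_mem_iff[OF qsI a(1)] k by auto
  then show False using a(2) by simp
qed

end

section \<open>Existence of minimal reductions\<close>

text \<open>From here on \<open><+>\<close> denotes only the sum of subsets of a ring.\<close>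

no_notation Sum_Type.Plus (infixr \<open><+>\<close> 65)

context noetherian_local begin

lemma in_sum: "(b :: 'a) \<in> H <+> K \<longleftrightarrow> (\<exists>h\<in>H. \<exists>k\<in>K. b = h \<oplus> k)"
  by (auto simp: set_add_def')

lemma subset_sum_left: "ideal H R \<Longrightarrow> ideal K R \<Longrightarrow> H \<subseteq> H <+> K"
  and subset_sum_right: "ideal H R \<Longrightarrow> ideal K R \<Longrightarrow> K \<subseteq> H <+> K"
  using ideal_memD(1,2)[of H] ideal_memD(1,2)[of K] by (force simp: in_sum)+

lemma sum_subset: "ideal L R \<Longrightarrow> H \<subseteq> L \<Longrightarrow> K \<subseteq> L \<Longrightarrow> H <+> K \<subseteq> L"
  using ideal_memD(3)[of L] by (auto simp: in_sum subset_eq)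

lemma unit_inverse: "c \<in> carrier R \<Longrightarrow> c \<notin> \<mm> \<Longrightarrow> a \<in> carrier R \<Longrightarrow> ideal J R \<Longrightarrow> c \<otimes> a \<in> J \<Longrightarrow> a \<in> J"
proof -
  assume c: "c \<in> carrier R" "c \<notin> \<mm>" "a \<in> carrier R" and J: "ideal J R" "c \<otimes> a \<in> J"
  obtain u where u: "u \<in> carrier R" "u \<otimes> c = \<one>" using unit_outside c by auto
  have "a = u \<otimes> (c \<otimes> a)" using u c by (simp add: m_assoc[symmetric])
  then show "a \<in> J" using ideal_memD(6)[OF J u(1)] by simp
qed

text \<open>\<open>K\<close> is the preimage of a reduction of \<open>I/J\<close>.\<close>

definition relative_reduction :: "'a set \<Rightarrow> 'a set \<Rightarrow> 'a set \<Rightarrow> bool" where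
  "relative_reduction J I K \<longleftrightarrow> ideal K R \<and> J \<subseteq> K \<and> K \<subseteq> I \<and>
    (\<exists>n. ideal_power R I (Suc n) \<subseteq> (K \<cdot> ideal_power R I n) <+> J)"

text \<open>Replacing \<open>K\<close> by \<open>L\<close> costs an error term in
  \<open>\<mm> \<cdot> ?p (Suc n)\<close>, which Nakayama's lemma absorbs. So only the classes of
  \<open>K\<close> modulo \<open>\<mm> \<cdot> I\<close> matter.\<close>

lemma relative_reduction_mod_mm:
  fixes I J K L :: "'a set"
  assumes I: "ideal I R" and J: "ideal J R" and K: "relative_reduction J I K"
    and L: "ideal L R" "J \<subseteq> L" "L \<subseteq> I" "K \<subseteq> L <+> (\<mm> \<cdot> I)"
  shows "relative_reduction J I L"
proof -
  let ?p = "ideal_power R I"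
  note pi = ideal_power_ideal[OF I]
  obtain n where n: "?p (Suc n) \<subseteq> (K \<cdot> ?p n) <+> J" using K by (auto simp: relative_reduction_def)
  have Lp: "ideal (L \<cdot> ?p n) R" by (rule ideal_prod_is_ideal[OF L(1) pi])
  have T: "ideal ((L \<cdot> ?p n) <+> J) R" by (rule add_ideals[OF Lp J])
  have mp: "ideal (\<mm> \<cdot> ?p (Suc n)) R" by (rule ideal_prod_is_ideal[OF mm_ideal pi])
  have S: "ideal (((L \<cdot> ?p n) <+> J) <+> (\<mm> \<cdot> ?p (Suc n))) R" by (rule add_ideals[OF T mp])
  have "K \<cdot> ?p n \<subseteq> ((L \<cdot> ?p n) <+> J) <+> (\<mm> \<cdot> ?p (Suc n))"
  proof (rule ideal_prod_subset[OF S])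
    fix c e assume c: "c \<in> K" and e: "e \<in> ?p n"
    have "c \<in> L <+> (\<mm> \<cdot> I)" using c L(4) by blast
    then obtain l u where lu: "l \<in> L" "u \<in> \<mm> \<cdot> I" "c = l \<oplus> u" by (auto simp: in_sum)
    have cc: "l \<in> carrier R" "u \<in> carrier R" "e \<in> carrier R"
      using lu(1,2) e ideal_memD(1)[OF L(1)] ideal_memD(1)[OF ideal_prod_is_ideal[OF mm_ideal I]] ideal_memD(1)[OF pi] by auto
    have "l \<otimes> e \<in> (L \<cdot> ?p n) <+> J" using ideal_prod.prod[OF lu(1) e] subset_sum_left[OF Lp J] by blast
    moreover have "u \<otimes> e \<in> (\<mm> \<cdot> I) \<cdot> ?p n" by (rule ideal_prod.prod[OF lu(2) e])
    then have "u \<otimes> e \<in> \<mm> \<cdot> ?p (Suc n)" by (simp add: ideal_prod_assoc[OF mm_ideal I pi] ideal_power_Suc2[OF I])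
    ultimately show "c \<otimes> e \<in> ((L \<cdot> ?p n) <+> J) <+> (\<mm> \<cdot> ?p (Suc n))"
      unfolding lu(3) l_distr[OF cc] in_sum[of _ "(L \<cdot> ?p n) <+> J"] by blast
  qed
  moreover have "J \<subseteq> ((L \<cdot> ?p n) <+> J) <+> (\<mm> \<cdot> ?p (Suc n))"
    using subset_sum_right[OF Lp J] subset_sum_left[OF T mp] by blast
  ultimately have "?p (Suc n) \<subseteq> ((L \<cdot> ?p n) <+> J) <+> (\<mm> \<cdot> ?p (Suc n))" using n sum_subset[OF S] by blast
  then have "?p (Suc n) \<subseteq> (L \<cdot> ?p n) <+> J" by (rule nakayama[OF pi T])
  then show ?thesis using L by (auto simp: relative_reduction_def)
qed

text \<open>
  The role of \<open>K\<close> minimal in \<open>I/\<mm>I\<close> is taken by a maximal complement \<open>H\<close>, so that no vector space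
  dimension is needed.
\<close>

lemma exists_reduction_minimal_mod_mm:
  assumes I: "ideal I R" and J: "ideal J R" "J \<subseteq> I"
  shows "\<exists>K. relative_reduction J I K \<and> (\<forall>L. relative_reduction J I L \<longrightarrow> L \<subseteq> K \<longrightarrow> K \<subseteq> L <+> (\<mm> \<cdot> I))"
proof -
  let ?mI = "\<mm> \<cdot> I"
  have mI: "ideal ?mI R" by (rule ideal_prod_is_ideal[OF mm_ideal I])
  have mII: "?mI \<subseteq> I" using ideal_prod_inter[OF mm_ideal I] by auto
  \<comment> \<open>\<open>H\<close> meets some relative reduction \<open>K\<close> only trivially
    modulo \<open>?mI\<close>; a large \<open>H\<close> therefore forces a small
    \<open>K\<close>.\<close>
  define \<S> where "\<S> = {H. ideal H R \<and> ?mI \<subseteq> H \<and> (\<exists>K. relative_reduction J I K \<and> (K <+> ?mI) \<inter> H \<subseteq> ?mI)}"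
  have "I \<cdot> ideal_power R I 0 = I" using ideal_prod_one[OF I] by (simp add: ideal_power_0)
  then have "ideal_power R I (Suc 0) \<subseteq> (I \<cdot> ideal_power R I 0) <+> J"
    using ideal_power_1[OF I] subset_sum_left[OF I J(1)] by simp
  then have rI: "relative_reduction J I I" using I J by (auto simp: relative_reduction_def)
  have "?mI \<in> \<S>" unfolding \<S>_def using mI rI by auto
  then have "\<S> \<noteq> {}" by auto
  then have "\<exists>H\<in>\<S>. \<forall>H'\<in>\<S>. H \<subseteq> H' \<longrightarrow> H' = H" by (rule ideal_maximal_element) (auto simp: \<S>_def)
  then obtain H where HS: "H \<in> \<S>" and Hmax: "\<forall>H'\<in>\<S>. H \<subseteq> H' \<longrightarrow> H' = H" by (elim bexE)
  then obtain K where H: "ideal H R" "?mI \<subseteq> H" and K: "relative_reduction J I K" "(K <+> ?mI) \<inter> H \<subseteq> ?mI" by (auto simp: \<S>_def)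
  have Ki: "ideal K R" "K \<subseteq> I" using K by (auto simp: relative_reduction_def)
  have "K \<subseteq> L <+> ?mI" if L: "relative_reduction J I L" "L \<subseteq> K" for L
  proof
    have Li: "ideal L R" using L by (auto simp: relative_reduction_def)
    note iL = ideal_memD[OF Li] and iH = ideal_memD[OF H(1)] and imI = ideal_memD[OF mI]
    have LH: "ideal (L <+> H) R" by (rule add_ideals[OF Li H(1)])
    have "L <+> ?mI \<subseteq> K <+> ?mI" using L(2) unfolding set_add_def' by blast
    then have sub: "(L <+> ?mI) \<inter> H \<subseteq> ?mI" using K(2) by blast
    \<comment> \<open>Maximality of \<open>H\<close>, tested with the smaller reduction
      \<open>L\<close>: an \<open>a\<close> outside \<open>L <+> H\<close> could be added to
      \<open>H\<close> and the intersection would stay in \<open>?mI\<close>, because a unit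
      coefficient of \<open>a\<close> would put \<open>a\<close> into
      \<open>L <+> H\<close>.\<close>
    have IL: "a \<in> L <+> H" if a: "a \<in> I" for a
    proof (rule ccontr)
      assume n: "a \<notin> L <+> H"
      have ac: "a \<in> carrier R" using a ideal_memD(1)[OF I] by auto
      let ?H' = "Idl (insert a H)"
      have ins: "insert a H \<subseteq> carrier R" using ac iH(1) by auto
      have H': "ideal ?H' R" "H \<subseteq> ?H'" "a \<in> ?H'" using genideal_ideal[OF ins] genideal_self[OF ins] by auto
      have "(L <+> ?mI) \<inter> ?H' \<subseteq> ?mI"
      proof
        fix b assume b: "b \<in> (L <+> ?mI) \<inter> ?H'"
        then obtain l u where lu: "l \<in> L" "u \<in> ?mI" "b = l \<oplus> u" by (auto simp: in_sum)
        obtain c h where ch: "c \<in> carrier R" "h \<in> H" "b = c \<otimes> a \<oplus> h" using b mem_Idl_insert_ideal[OF H(1) ac] by blast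
        have cc: "l \<in> carrier R" "u \<in> carrier R" "h \<in> carrier R" using lu(1,2) ch(2) iL(1) imI(1) iH(1) by auto
        have "c \<in> \<mm>"
        proof (rule ccontr)
          assume "c \<notin> \<mm>"
          have "c \<otimes> a = (c \<otimes> a \<oplus> h) \<ominus> h" using ch(1) ac cc by algebra
          also have "\<dots> = (l \<oplus> u) \<ominus> h" using ch(3) lu(3) by simp
          also have "\<dots> = l \<oplus> (u \<ominus> h)" using cc by algebra
          finally have "c \<otimes> a = l \<oplus> (u \<ominus> h)" .
          moreover have "u \<ominus> h \<in> H" using lu(2) ch(2) H(2) iH(5) by auto
          ultimately have "c \<otimes> a \<in> L <+> H" using lu(1) unfolding in_sum by blast
          then show False using unit_inverse[OF ch(1) \<open>c \<notin> \<mm>\<close> ac LH] n by simp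
        qed
        then have "c \<otimes> a \<in> ?mI" using a by (rule ideal_prod.prod)
        then have "b \<in> H" unfolding ch(3) using H(2) ch(2) iH(3) by auto
        then show "b \<in> ?mI" using sub b by auto
      qed
      then have "?H' \<in> \<S>" unfolding \<S>_def using H' H(2) L(1) by auto
      then have "?H' = H" using Hmax H'(2) by auto
      then have "a \<in> H" using H'(3) by simp
      then show False using n subset_sum_right[OF Li H(1)] by auto
    qed
    \<comment> \<open>Modular law: in \<open>k = l \<oplus> h\<close> the part \<open>h\<close> lies
      both in \<open>K\<close> and in \<open>H\<close>, hence in \<open>?mI\<close>.\<close>
    fix k assume k: "k \<in> K"
    then obtain l h where lh: "l \<in> L" "h \<in> H" "k = l \<oplus> h" using IL Ki(2) by (force simp: in_sum)
    have cc: "l \<in> carrier R" "h \<in> carrier R" using lh(1,2) iL(1) iH(1) by auto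
    have "h = k \<ominus> l" unfolding lh(3) using cc by algebra
    then have "h \<in> K" using ideal_memD(5)[OF Ki(1) k] lh(1) L(2) by auto
    then have "h \<in> (K <+> ?mI) \<inter> H" using lh(2) subset_sum_left[OF Ki(1) mI] by auto
    then show "k \<in> L <+> ?mI" using K(2) lh unfolding in_sum[of k] by blast
  qed
  then show ?thesis using K(1) by blast
qed

text \<open>Exchange property of generators over a local ring: either all coefficients on
  \<open>A'\<close> can be taken in \<open>\<mm>\<close>, or some generator occurs with a unit
  coefficient and can be solved for.\<close>

lemma Idl_insert_cases:
  assumes J: "ideal J R" and L: "ideal L R" and "finite A'" "A' \<subseteq> A" "A \<subseteq> L" "b \<in> Idl (J \<union> A')"
  shows "b \<in> (\<mm> \<cdot> L) <+> J \<or>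
    (\<exists>a\<in>A'. \<exists>c\<in>carrier R - \<mm>. \<exists>b'\<in>Idl (J \<union> (A - {a})). b = c \<otimes> a \<oplus> b')"
  using assms(3,4,6)
proof (induction A' arbitrary: b rule: finite_induct)
  case empty
  then have "b \<in> J" using Idl_ideal[OF J] by simp
  then show ?case using subset_sum_right[OF ideal_prod_is_ideal[OF mm_ideal L] J] by auto
next
  case (insert a A')
  have Ac: "A \<subseteq> carrier R" using assms(5) ideal_memD(1)[OF L] by auto
  have JA: "J \<union> X \<subseteq> carrier R" if "X \<subseteq> A" for X using that Ac ideal_memD(1)[OF J] by auto
  have ac: "a \<in> carrier R" "a \<in> L" using insert Ac assms(5) by auto
  have mJ: "ideal ((\<mm> \<cdot> L) <+> J) R" by (rule add_ideals[OF ideal_prod_is_ideal[OF mm_ideal L] J])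
  obtain c b1 where c: "c \<in> carrier R" "b1 \<in> Idl (J \<union> A')" "b = c \<otimes> a \<oplus> b1"
    using insert.prems mem_Idl_insert[OF ac(1), of "J \<union> A'" b] JA[of A'] by auto
  have b1c: "b1 \<in> carrier R" using c(2) ideal_memD(1)[OF genideal_ideal[OF JA[of A']]] insert.prems by auto
  show ?case
  proof (cases "c \<in> \<mm>")
    case False
    have "Idl (J \<union> A') \<subseteq> Idl (J \<union> (A - {a}))"
      using insert by (intro subset_Idl_subset[OF JA]) auto
    then show ?thesis using c False by blast
  next
    case True
    then have ca: "c \<otimes> a \<in> \<mm> \<cdot> L" using ac(2) by (rule ideal_prod.prod)
    then have ca': "c \<otimes> a \<in> (\<mm> \<cdot> L) <+> J" using subset_sum_left[OF ideal_prod_is_ideal[OF mm_ideal L] J] by auto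
    from insert.IH[of b1] insert.prems c consider "b1 \<in> (\<mm> \<cdot> L) <+> J" |
      a' c' b' where "a' \<in> A'" "c' \<in> carrier R - \<mm>" "b' \<in> Idl (J \<union> (A - {a'}))" "b1 = c' \<otimes> a' \<oplus> b'" by auto
    then show ?thesis
    proof cases
      case 1
      then show ?thesis using c ca' ideal_memD(3)[OF mJ] by auto
    next
      case 2
      have B: "ideal (Idl (J \<union> (A - {a'}))) R" by (rule genideal_ideal[OF JA]) auto
      have "a \<in> J \<union> (A - {a'})" using 2 insert by auto
      then have "a \<in> Idl (J \<union> (A - {a'}))" using genideal_self[OF JA[of "A - {a'}"]] by auto
      then have m: "b' \<oplus> c \<otimes> a \<in> Idl (J \<union> (A - {a'}))" using ideal_memD(3,6)[OF B] 2 c by auto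
      have cc: "c' \<in> carrier R" "a' \<in> carrier R" "b' \<in> carrier R" using 2 insert.prems Ac ideal_memD(1)[OF B] by auto
      have "b = c' \<otimes> a' \<oplus> (b' \<oplus> c \<otimes> a)" unfolding c(3) 2(4) using cc ac c(1) by algebra
      then show ?thesis using 2 m by blast
    qed
  qed
qed

text \<open>The argument of Northcott and Rees. Let \<open>L\<close> be generated by
  \<open>J\<close> and a smallest set \<open>A\<close> that yields \<open>K\<close> modulo
  \<open>?mI\<close>. Then an element of \<open>L\<close> in \<open>?mI\<close> already lies in
  \<open>\<mm> \<cdot> L\<close> up to \<open>J\<close>. A reduction \<open>L'\<close> inside
  \<open>L\<close> equals \<open>L\<close> modulo \<open>?mI\<close> by the choice of
  \<open>K\<close>, hence modulo \<open>\<mm> \<cdot> L\<close>, and Nakayama's lemma gives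
  \<open>L' = L\<close>.\<close>

lemma minimal_relative_reduction_exists:
  assumes I: "ideal I R" and J: "ideal J R" "J \<subseteq> I"
  shows "\<exists>L. relative_reduction J I L \<and> (\<forall>L'. relative_reduction J I L' \<longrightarrow> L' \<subseteq> L \<longrightarrow> L' = L)"
proof -
  let ?mI = "\<mm> \<cdot> I"
  have mI: "ideal ?mI R" by (rule ideal_prod_is_ideal[OF mm_ideal I])
  obtain K where K: "relative_reduction J I K"
    and Kmin: "\<And>L. relative_reduction J I L \<Longrightarrow> L \<subseteq> K \<Longrightarrow> K \<subseteq> L <+> ?mI"
    using exists_reduction_minimal_mod_mm[OF assms] by blast
  have Ki: "ideal K R" "J \<subseteq> K" "K \<subseteq> I" using K by (auto simp: relative_reduction_def)
  let ?P = "\<lambda>A. finite A \<and> A \<subseteq> K \<and> K \<subseteq> (Idl (J \<union> A)) <+> ?mI"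
  have JA: "J \<union> A \<subseteq> carrier R" if "A \<subseteq> K" for A using that Ki ideal_memD(1)[OF Ki(1)] by auto
  obtain A0 where "A0 \<subseteq> carrier R" "finite A0" "K = Idl A0" using finetely_gen[OF Ki(1)] by auto
  then have "?P A0" using subset_Idl_subset[OF JA, of A0 A0] genideal_self[of A0]
      subset_sum_left[OF genideal_ideal[OF JA[of A0]] mI] by blast
  then obtain A where A: "?P A" and Amin: "\<And>A'. ?P A' \<Longrightarrow> card A \<le> card A'"
    using ex_has_least_nat[of ?P A0 card] by blast
  define L where "L = Idl (J \<union> A)"
  have AK: "A \<subseteq> K" using A by simp
  have L: "ideal L R" unfolding L_def by (rule genideal_ideal[OF JA[OF AK]])
  have LK: "L \<subseteq> K" unfolding L_def using Ki(2) AK by (intro genideal_minimal[OF Ki(1)]) auto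
  have JL: "J \<subseteq> L" "A \<subseteq> L" unfolding L_def using genideal_self[OF JA[OF AK]] by auto
  have rL: "relative_reduction J I L"
    by (rule relative_reduction_mod_mm[OF I J(1) K L JL(1)]) (use LK Ki A in \<open>auto simp: L_def\<close>)
  \<comment> \<open>Otherwise a generator with a unit coefficient could be dropped from
    \<open>A\<close>, against the least cardinality.\<close>
  have key: "b \<in> (\<mm> \<cdot> L) <+> J" if b: "b \<in> L" "b \<in> ?mI" for b :: 'a
  proof (rule ccontr)
    assume "b \<notin> (\<mm> \<cdot> L) <+> J"
    then obtain a c b' where a: "a \<in> A" "c \<in> carrier R" "c \<notin> \<mm>" "b' \<in> Idl (J \<union> (A - {a}))" "b = c \<otimes> a \<oplus> b'"
      using Idl_insert_cases[OF J(1) L, of A A b] A JL b by (auto simp: L_def)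
    have B: "ideal (Idl (J \<union> (A - {a}))) R" by (rule genideal_ideal[OF JA]) (use AK in auto)
    have S: "ideal ((Idl (J \<union> (A - {a}))) <+> ?mI) R" by (rule add_ideals[OF B mI])
    have cc: "a \<in> carrier R" "b' \<in> carrier R" "b \<in> carrier R"
      using a(1,4) b AK ideal_memD(1)[OF B] ideal_memD(1)[OF Ki(1)] ideal_memD(1)[OF L] by auto
    have "c \<otimes> a = (c \<otimes> a \<oplus> b') \<ominus> b'" using cc(1,2) a(2) by algebra
    also have "\<dots> = \<ominus> b' \<oplus> b" unfolding a(5)[symmetric] using cc by algebra
    finally have "c \<otimes> a \<in> (Idl (J \<union> (A - {a}))) <+> ?mI"
      using ideal_memD(4)[OF B a(4)] b(2) by (auto simp: in_sum)
    then have aS: "a \<in> (Idl (J \<union> (A - {a}))) <+> ?mI" using unit_inverse[OF a(2,3) cc(1) S] by simp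
    have "J \<union> (A - {a}) \<subseteq> (Idl (J \<union> (A - {a}))) <+> ?mI"
      using genideal_self[OF JA[of "A - {a}"]] AK subset_sum_left[OF B mI] by blast
    then have "J \<union> A \<subseteq> (Idl (J \<union> (A - {a}))) <+> ?mI" using aS by auto
    then have "Idl (J \<union> A) \<subseteq> (Idl (J \<union> (A - {a}))) <+> ?mI" by (rule genideal_minimal[OF S])
    then have "K \<subseteq> (Idl (J \<union> (A - {a}))) <+> ?mI"
      using A sum_subset[OF S, of "Idl (J \<union> A)" ?mI] subset_sum_right[OF B mI] by auto
    then have "?P (A - {a})" using A by auto
    from Amin[OF this] have "card A \<le> card (A - {a})" .
    moreover have "card (A - {a}) < card A" using A a(1) by (meson card_Diff1_less)
    ultimately show False by simp
  qed
  have "L' = L" if L': "relative_reduction J I L'" "L' \<subseteq> L" for L'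
  proof
    have Li': "ideal L' R" "J \<subseteq> L'" using L' by (auto simp: relative_reduction_def)
    have KL': "K \<subseteq> L' <+> ?mI" using Kmin[OF L'(1)] L'(2) LK by auto
    have mL: "ideal (\<mm> \<cdot> L) R" by (rule ideal_prod_is_ideal[OF mm_ideal L])
    have "L \<subseteq> L' <+> (\<mm> \<cdot> L)"
    proof
      fix l assume l: "l \<in> L"
      then obtain l' u where u: "l' \<in> L'" "u \<in> ?mI" "l = l' \<oplus> u" using KL' LK in_sum by blast
      have cc: "l' \<in> carrier R" "u \<in> carrier R" using u(1,2) ideal_memD(1)[OF Li'(1)] ideal_memD(1)[OF mI] by auto
      have "u = l \<ominus> l'" unfolding u(3) using cc by algebra
      then have "u \<in> L" using ideal_memD(5)[OF L l] u(1) L'(2) by auto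
      from key[OF this u(2)] obtain v j where v: "v \<in> \<mm> \<cdot> L" "j \<in> J" "u = v \<oplus> j" by (auto simp: in_sum)
      have cv: "v \<in> carrier R" "j \<in> carrier R" using v(1,2) ideal_memD(1)[OF mL] ideal_memD(1)[OF J(1)] by auto
      have "l = (l' \<oplus> j) \<oplus> v" unfolding u(3) v(3) using cc(1) cv by algebra
      moreover have "l' \<oplus> j \<in> L'" using u(1) v(2) Li' ideal_memD(3)[OF Li'(1)] by auto
      ultimately show "l \<in> L' <+> (\<mm> \<cdot> L)" using v(1) by (auto simp: in_sum)
    qed
    then show "L \<subseteq> L'" by (rule nakayama[OF L Li'(1)])
  qed (use L' in auto)
  then show ?thesis using rL by blast
qed

text \<open>\<open>L\<close> is maximal among the ideals over \<open>I \<cdot> ?K\<close> that meet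
  \<open>?K\<close>, the intersection of the powers, inside \<open>I \<cdot> ?K\<close>. Maximality
  puts a power of each element of \<open>I\<close>, hence a power of \<open>I\<close>, into
  \<open>L\<close>. Then \<open>?K \<subseteq> I \<cdot> ?K\<close>, and Nakayama's lemma
  applies.\<close>

theorem krull_intersection:
  assumes I: "ideal I R" "I \<subseteq> \<mm>" and a: "\<And>n. a \<in> ideal_power R I n" shows "a = \<zero>"
proof -
  let ?K = "{a \<in> carrier R. \<forall>n. a \<in> ideal_power R I n}"
  note ip = ideal_memD[OF ideal_power_ideal[OF I(1)]]
  have K: "ideal ?K R" by (rule idealI') (use ip in auto)
  have IK: "ideal (I \<cdot> ?K) R" by (rule ideal_prod_is_ideal[OF I(1) K])
  define \<S> where "\<S> = {L. ideal L R \<and> I \<cdot> ?K \<subseteq> L \<and> L \<inter> ?K \<subseteq> I \<cdot> ?K}"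
  have "I \<cdot> ?K \<in> \<S>" using IK by (auto simp: \<S>_def)
  then have "\<S> \<noteq> {}" by auto
  then have "\<exists>L\<in>\<S>. \<forall>L'\<in>\<S>. L \<subseteq> L' \<longrightarrow> L' = L" by (rule ideal_maximal_element) (auto simp: \<S>_def)
  then obtain L where LS: "L \<in> \<S>" and Lmax: "\<forall>L'\<in>\<S>. L \<subseteq> L' \<longrightarrow> L' = L" by (elim bexE)
  have L: "ideal L R" "I \<cdot> ?K \<subseteq> L" "L \<inter> ?K \<subseteq> I \<cdot> ?K" using LS by (auto simp: \<S>_def)
  note iL = ideal_memD[OF L(1)]
  have nil: "\<exists>n::nat. b [^] n \<in> L" if b: "b \<in> I" for b
  proof -
    have bc: "b \<in> carrier R" using b ideal_memD(1)[OF I(1)] by auto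
    let ?F = "{colon L (b [^] n) | n::nat. True}"
    have "?F \<noteq> {}" by auto
    then have "\<exists>C\<in>?F. \<forall>C'\<in>?F. C \<subseteq> C' \<longrightarrow> C' = C"
      by (rule ideal_maximal_element) (use colon_ideal[OF L(1)] bc in auto)
    then obtain C where "C \<in> ?F" and Cmax: "\<forall>C'\<in>?F. C \<subseteq> C' \<longrightarrow> C' = C" by (elim bexE)
    then obtain n :: nat where n: "C = colon L (b [^] n)" by auto
    have "C \<subseteq> colon L (b [^] Suc n)"
    proof
      fix t assume t: "t \<in> C"
      have "t \<otimes> b [^] Suc n = b \<otimes> (t \<otimes> b [^] n)" using t bc n by (simp add: colon_def m_ac)
      then show "t \<in> colon L (b [^] Suc n)" using t bc n iL(6) by (auto simp: colon_def)
    qed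
    \<comment> \<open>The colon ideals by powers of \<open>b\<close> become stationary; this allows
      \<open>b [^] n\<close> to be added to \<open>L\<close> while the intersection with
      \<open>?K\<close> stays in \<open>I \<cdot> ?K\<close>.\<close>
    then have st: "colon L (b [^] Suc n) = colon L (b [^] n)" using Cmax n by blast
    let ?L' = "Idl (insert (b [^] n) L)"
    have ins: "insert (b [^] n) L \<subseteq> carrier R" using bc iL by auto
    have L': "ideal ?L' R" "L \<subseteq> ?L'" "b [^] n \<in> ?L'" using genideal_ideal[OF ins] genideal_self[OF ins] by auto
    have "?L' \<inter> ?K \<subseteq> I \<cdot> ?K"
    proof
      fix e assume e: "e \<in> ?L' \<inter> ?K"
      then obtain r l where rl: "r \<in> carrier R" "l \<in> L" "e = r \<otimes> b [^] n \<oplus> l"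
        using mem_Idl_insert_ideal[OF L(1), of "b [^] n" e] bc by auto
      have lc: "l \<in> carrier R" using rl iL by auto
      have be: "b \<otimes> e \<in> L" using ideal_prod.prod[OF b, of e ?K R] e L(2) by auto
      have "b \<otimes> l \<oplus> r \<otimes> b [^] Suc n = b \<otimes> e" unfolding rl(3) using bc rl(1) lc
        by (simp add: r_distr m_ac a_ac)
      then have "r \<otimes> b [^] Suc n \<in> L" using ideal_add_cancel[OF L(1) iL(6)[OF rl(2) bc], of "r \<otimes> b [^] Suc n"] be rl(1) bc by auto
      then have "r \<in> colon L (b [^] n)" using st rl(1) by (auto simp: colon_def)
      then have "e \<in> L" unfolding rl(3) using rl(2) iL(3) by (auto simp: colon_def)
      then show "e \<in> I \<cdot> ?K" using L(3) e by auto
    qed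
    then have "?L' \<in> \<S>" using L' L(2) by (auto simp: \<S>_def)
    then have "?L' = L" using Lmax L'(2) by auto
    then show ?thesis using L'(3) by auto
  qed
  obtain k where "ideal_power R I k \<subseteq> L" using ideal_power_subset_if_nil[OF L(1) I(1) nil] by blast
  then have "?K \<subseteq> I \<cdot> ?K" using L(3) by blast
  also have "\<dots> \<subseteq> \<mm> \<cdot> ?K" by (rule ideal_prod_mono[OF I(2)]) simp
  also have "\<dots> \<subseteq> {\<zero>} <+> (\<mm> \<cdot> ?K)" by (rule subset_sum_right[OF zeroideal ideal_prod_is_ideal[OF mm_ideal K]])
  finally have "?K \<subseteq> {\<zero>}" by (rule nakayama[OF K zeroideal])
  then show ?thesis using a ip(1) by blast
qed

end

section \<open>Ideals, products and powers in a quotient ring\<close>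

context cring begin

lemma quot_hom: "ideal J R \<Longrightarrow> ring_hom_ring R (R Quot J) ((+>) J)"
  by (rule ideal.rcos_ring_hom_ring)

lemma quot_add: "ideal J R \<Longrightarrow> a \<in> carrier R \<Longrightarrow> b \<in> carrier R \<Longrightarrow> (J +> a) \<oplus>\<^bsub>R Quot J\<^esub> (J +> b) = J +> (a \<oplus> b)"
  and quot_mult: "ideal J R \<Longrightarrow> a \<in> carrier R \<Longrightarrow> b \<in> carrier R \<Longrightarrow> (J +> a) \<otimes>\<^bsub>R Quot J\<^esub> (J +> b) = J +> (a \<otimes> b)"
  using ring_hom_memE(2,3)[OF ideal.rcos_ring_hom] by metis+

lemma quot_image_subset_iff:
  assumes J: "ideal J R" and Y: "ideal Y R" and X: "X \<subseteq> carrier R"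
  shows "(+>) J ` X \<subseteq> (+>) J ` Y \<longleftrightarrow> X \<subseteq> Y <+> J"
proof -
  have "J +> a \<in> (+>) J ` Y \<longleftrightarrow> a \<in> Y <+> J" if a: "a \<in> carrier R" for a
  proof
    assume "J +> a \<in> (+>) J ` Y"
    then obtain y where y: "y \<in> Y" "J +> a = J +> y" by auto
    have yc: "y \<in> carrier R" using y ideal_memD(1)[OF Y] by auto
    have "a \<ominus> y \<in> J" using coset_eq_iff[OF J a yc] y by simp
    moreover have "a = y \<oplus> (a \<ominus> y)" using a yc by algebra
    ultimately show "a \<in> Y <+> J" using y(1) unfolding set_add_def' by blast
  next
    assume "a \<in> Y <+> J"
    then obtain y j where y: "y \<in> Y" "j \<in> J" "a = y \<oplus> j" by (auto simp: set_add_def')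
    have yc: "y \<in> carrier R" "j \<in> carrier R" using y(1,2) ideal_memD(1)[OF Y] ideal_memD(1)[OF J] by auto
    have "a \<ominus> y = j" unfolding y(3) using yc by algebra
    then have "J +> a = J +> y" using coset_eq_iff[OF J a yc(1)] y(2) by simp
    then show "J +> a \<in> (+>) J ` Y" using y(1) by auto
  qed
  then show ?thesis using X by blast
qed

lemma quot_ideal_prod:
  assumes J: "ideal J R" and X: "X \<subseteq> carrier R" and Y: "Y \<subseteq> carrier R"
  shows "(+>) J ` X \<cdot>\<^bsub>R Quot J\<^esub> (+>) J ` Y = (+>) J ` (X \<cdot> Y)"
proof
  have c: "a \<in> X \<cdot> Y \<Longrightarrow> a \<in> carrier R" for a
    by (induction rule: ideal_prod.induct) (use X Y in auto)
  show "(+>) J ` X \<cdot>\<^bsub>R Quot J\<^esub> (+>) J ` Y \<subseteq> (+>) J ` (X \<cdot> Y)"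
  proof
    fix A assume "A \<in> (+>) J ` X \<cdot>\<^bsub>R Quot J\<^esub> (+>) J ` Y"
    then show "A \<in> (+>) J ` (X \<cdot> Y)"
    proof induction
      case (prod i j)
      then obtain a b where ab: "a \<in> X" "b \<in> Y" "i = J +> a" "j = J +> b" by auto
      then have "i \<otimes>\<^bsub>R Quot J\<^esub> j = J +> (a \<otimes> b)" using quot_mult[OF J] X Y by auto
      then show ?case using ideal_prod.prod[OF ab(1,2), of R] by blast
    next
      case (sum s t)
      then obtain a b where ab: "a \<in> X \<cdot> Y" "b \<in> X \<cdot> Y" "s = J +> a" "t = J +> b" by auto
      then have "s \<oplus>\<^bsub>R Quot J\<^esub> t = J +> (a \<oplus> b)" using quot_add[OF J] c by auto
      then show ?case using ideal_prod.sum[OF ab(1,2)] by blast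
    qed
  qed
  show "(+>) J ` (X \<cdot> Y) \<subseteq> (+>) J ` X \<cdot>\<^bsub>R Quot J\<^esub> (+>) J ` Y"
  proof safe
    fix a assume "a \<in> X \<cdot> Y"
    then show "J +> a \<in> (+>) J ` X \<cdot>\<^bsub>R Quot J\<^esub> (+>) J ` Y"
    proof induction
      case (prod i j)
      then have "J +> (i \<otimes> j) = (J +> i) \<otimes>\<^bsub>R Quot J\<^esub> (J +> j)" using quot_mult[OF J] X Y by auto
      then show ?case using prod by (auto intro: ideal_prod.prod)
    next
      case (sum s t)
      then have "J +> (s \<oplus> t) = (J +> s) \<oplus>\<^bsub>R Quot J\<^esub> (J +> t)" using quot_add[OF J] c by auto
      then show ?case using sum by (auto intro: ideal_prod.sum)
    qed
  qed
qed

lemma quot_ideal_power: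
  assumes J: "ideal J R" and I: "ideal I R"
  shows "ideal_power (R Quot J) ((+>) J ` I) n = (+>) J ` ideal_power R I n"
proof (induction n)
  case 0
  interpret Q: cring "R Quot J" by (rule ideal.quotient_is_cring[OF J is_cring])
  show ?case by (simp add: ideal_power_0 Q.ideal_power_0 quotient_carrier)
next
  case (Suc n)
  interpret Q: cring "R Quot J" by (rule ideal.quotient_is_cring[OF J is_cring])
  show ?case unfolding ideal_power_Suc Q.ideal_power_Suc Suc
    using ideal_memD(1)[OF I] ideal_memD(1)[OF ideal_power_ideal[OF I]] by (intro quot_ideal_prod[OF J]) auto
qed

lemma quot_ideal_preimage:
  assumes J: "ideal J R" and K: "ideal K (R Quot J)"
  shows "\<exists>L. ideal L R \<and> J \<subseteq> L \<and> K = (+>) J ` L"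
proof -
  have "K \<in> (\<lambda>J'. (+>) J ` J') ` {J'. ideal J' R \<and> J \<subseteq> J'}"
    using quot_ideal_correspondence[OF J] K unfolding bij_betw_def by auto
  then show ?thesis by auto
qed

end

section \<open>Reduction modulo a superficial element\<close>

lemma graded_cmI:
  fixes R (structure)
  assumes gor: "gorenstein_local_ring R" and d: "krull_dim R = enat d" "d \<ge> 1"
    and inf: "infinite (carrier (R Quot max_ideal R))"
    and I: "primary_ideal R I" "radical R I = max_ideal R"
    and cm: "cohen_macaulay_ring (associated_graded R I)"
  shows "graded_cm R (max_ideal R) I"
proof -
  interpret noetherian_local R "max_ideal R"
    by (rule noetherian_localI) (use gor in \<open>auto simp: gorenstein_local_ring_def\<close>)
  let ?G = "associated_graded R I"
  have Ii: "ideal I R" using I by (simp add: primary_ideal_def)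
  have Im: "I \<subseteq> max_ideal R" unfolding I(2)[symmetric] radical_def
    using ideal_memD(1)[OF Ii] by (auto intro!: exI[of _ "1::nat"])
  interpret graded_ring R "max_ideal R" I ?G
  proof (intro graded_ring.intro graded_ring_axioms.intro noetherian_local_axioms)
    show "cring ?G" using cm by (simp add: cohen_macaulay_ring_def)
    fix a assume "a \<in> max_ideal R"
    then show "\<exists>n::nat. a [^] n \<in> I" unfolding I(2)[symmetric] radical_def by auto
  qed (use Ii Im in auto)
  have B: "cohen_macaulay_module (localization ?G (carrier ?G - M)) (regular_module (localization ?G (carrier ?G - M)))"
    using cm M_maximal by (auto simp: cohen_macaulay_ring_def Let_def)
  show ?thesis
  proof (intro graded_cm.intro graded_local.intro graded_ring_axioms graded_local_axioms.intro graded_cm_axioms.intro)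
    show "noetherian_ring ?G" using cm by (simp add: cohen_macaulay_ring_def)
    show "cring (localization ?G (carrier ?G - M))"
      using B by (auto simp: cohen_macaulay_module_def module_def)
    show "module_depth (localization ?G (carrier ?G - M)) (regular_module (localization ?G (carrier ?G - M))) =
      module_dim (localization ?G (carrier ?G - M)) (regular_module (localization ?G (carrier ?G - M)))"
      using B by (simp add: cohen_macaulay_module_def)
    fix n
    show "\<not> pow n \<subseteq> {\<zero>}"
    proof
      \<comment> \<open>With \<open>I\<close> nilpotent, \<open>max_ideal R\<close> would be the
        only prime, against a chain of primes of length at least \<open>d \<ge> 1\<close>.\<close>
      assume nil: "pow n \<subseteq> {\<zero>}"
      have all: "P = max_ideal R" if P: "primeideal P R" for P
      proof
        note Pi = primeideal_memD[OF P]
        show "P \<subseteq> max_ideal R" by (rule prime_subset_mm[OF P])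
        have "I \<subseteq> P"
        proof
          fix a assume a: "a \<in> I"
          then have "a [^] n \<in> P" using nil pow_mem_ideal_power[OF Ii a, of n] ideal_memD(2)[OF Pi(1)] by auto
          then show "a \<in> P" using primeideal_pow[OF P] ideal_memD(1)[OF Ii a] by auto
        qed
        then show "max_ideal R \<subseteq> P" unfolding I(2)[symmetric] radical_def using primeideal_pow[OF P] by auto
      qed
      have "enat d \<le> Sup {enat n | n. \<exists>P. (\<forall>i\<le>n. primeideal (P i) R) \<and> (\<forall>i<n. P i \<subset> P (Suc i))}"
        using d(1) by (simp add: krull_dim_def)
      from Sup_enat_attained[OF this d(2)] obtain m P where m: "m \<ge> d"
        "\<forall>i\<le>m. primeideal (P i) R" "\<forall>i<m. P i \<subset> P (Suc i)" by blast
      then have "primeideal (P 0) R" "primeideal (P (Suc 0)) R" "P 0 \<subset> P (Suc 0)" using d(2) by auto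
      then show False using all[of "P 0"] all[of "P (Suc 0)"] by auto
    qed
  qed (use inf in auto)
qed

context graded_cm begin

text \<open>A zero product lies in every power of \<open>I\<close>, so \<open>a\<close> lies in
  every power too, and Krull's intersection theorem applies.\<close>

lemma superficial_nonzerodivisor:
  assumes "superficial R I x" "a \<in> carrier R" "x \<otimes> a = \<zero>" shows "a = \<zero>"
proof (rule krull_intersection[OF I_ideal I_mm])
  fix n
  have "x \<in> carrier R" using assms(1) ideal_memD(1)[OF I_ideal] by (auto simp: superficial_def)
  then have "a \<otimes> x \<in> pow (Suc n)" using assms powD(2) by (simp add: m_comm)
  then show "a \<in> pow n" by (rule superficial_regular[OF assms(1,2)])
qed

text \<open>A chain of primes over \<open>x\<close> can be prolonged downwards: below its first
  member there is an associated prime of zero, which omits the nonzerodivisor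
  \<open>x\<close>.\<close>

lemma krull_dim_quotient_superficial:
  assumes x: "superficial R I x" and d: "krull_dim R = enat d"
  shows "krull_dim (R Quot (PIdl x)) \<le> enat (d - 1)"
  unfolding krull_dim_def
proof (rule Sup_least, clarify)
  fix n P assume P: "\<forall>i\<le>n. primeideal (P i) (R Quot (PIdl x))" "\<forall>i<n. P i \<subset> P (Suc i)"
  have xc: "x \<in> carrier R" using x ideal_memD(1)[OF I_ideal] by (auto simp: superficial_def)
  have J: "ideal (PIdl x) R" by (rule cgenideal_ideal[OF xc])
  interpret Q: cring "R Quot (PIdl x)" by (rule ideal.quotient_is_cring[OF J is_cring])
  let ?q = "(+>) (PIdl x)"
  have carr: "X \<in> carrier (R Quot (PIdl x)) \<longleftrightarrow> (\<exists>a\<in>carrier R. X = ?q a)" for X by (auto simp: quotient_carrier)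
  define P' where "P' i = {a \<in> carrier R. ?q a \<in> P i}" for i
  have Pp: "primeideal (P' i) R" if "i \<le> n" for i
  proof (rule primeidealI')
    have Pi: "primeideal (P i) (R Quot (PIdl x))" using P that by auto
    note p = Q.primeideal_memD[OF Pi]
    show "ideal (P' i) R" unfolding P'_def by (rule ring_hom_ring.ideal_vimage[OF quot_hom[OF J] p(1)])
    show "\<one> \<notin> P' i" using p(2) by (simp add: P'_def FactRing_def)
    fix a b assume "a \<in> carrier R" "b \<in> carrier R" "a \<otimes> b \<in> P' i"
    then show "a \<in> P' i \<or> b \<in> P' i" using p(3)[of "?q a" "?q b"] quot_mult[OF J, of a b] carr by (auto simp: P'_def)
  qed
  have Ps: "P' i \<subset> P' (Suc i)" if i: "i < n" for i
  proof -
    obtain X where X: "X \<in> P (Suc i)" "X \<notin> P i" using P i by blast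
    have "primeideal (P (Suc i)) (R Quot (PIdl x))" using P i by auto
    then have "X \<in> carrier (R Quot (PIdl x))" using Q.ideal_memD(1)[OF Q.primeideal_memD(1)] X by blast
    then obtain a where "a \<in> carrier R" "X = ?q a" using carr by blast
    then have "a \<in> P' (Suc i) - P' i" using X by (simp add: P'_def)
    moreover have "P' i \<subseteq> P' (Suc i)" using P i by (auto simp: P'_def)
    ultimately show ?thesis by blast
  qed
  have x0: "x \<in> P' 0"
  proof -
    have p: "primeideal (P 0) (R Quot (PIdl x))" using P by auto
    have "?q x = \<zero>\<^bsub>R Quot (PIdl x)\<^esub>" using a_rcos_zero[OF J cgenideal_self[OF xc]] by (simp add: FactRing_def)
    then show ?thesis using Q.ideal_memD(2)[OF Q.primeideal_memD(1)[OF p]] xc by (simp add: P'_def)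
  qed
  have "{\<zero>} \<subseteq> P' 0" using ideal_memD(2)[OF primeideal_memD(1)[OF Pp[of 0]]] by auto
  from assoc_prime_below_prime[OF zeroideal Pp[of 0] this] obtain p where p: "assoc_prime {\<zero>} p" "p \<subseteq> P' 0" by auto
  then obtain a where a: "a \<in> carrier R" "p = colon {\<zero>} a" "primeideal p R" by (auto simp: assoc_prime_def)
  have "x \<notin> p"
  proof
    assume "x \<in> p"
    then have "a = \<zero>" using superficial_nonzerodivisor[OF x a(1)] a by (auto simp: colon_def)
    then have "\<one> \<in> p" using a by (auto simp: colon_def)
    then show False using primeideal_memD(2)[OF a(3)] by simp
  qed
  then have "p \<subset> P' 0" using x0 p by auto
  then have "\<forall>i\<le>Suc n. primeideal (case_nat p P' i) R" "\<forall>i<Suc n. case_nat p P' i \<subset> case_nat p P' (Suc i)"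
    using a(3) Pp Ps by (auto split: nat.split)
  then have "enat (Suc n) \<le> krull_dim R" by (rule krull_dim_ge)
  then show "enat n \<le> enat (d - 1)" using d by auto
qed

text \<open>Makes the existence theorem for relative reductions available for reductions of
  \<open>I\<close> itself.\<close>

lemma relative_reduction_zero_iff:
  "relative_reduction {\<zero>} I K \<longleftrightarrow> reduction R I K"
proof
  assume K: "relative_reduction {\<zero>} I K"
  then have Ki: "ideal K R" "K \<subseteq> I" by (auto simp: relative_reduction_def)
  from K obtain n where n: "pow (Suc n) \<subseteq> (K \<cdot> pow n) <+> {\<zero>}" by (auto simp: relative_reduction_def)
  have kp: "ideal (K \<cdot> pow n) R" by (rule ideal_prod_is_ideal[OF Ki(1) pow_ideal])
  have "(K \<cdot> pow n) <+> {\<zero>} \<subseteq> K \<cdot> pow n" by (rule sum_subset[OF kp]) (use ideal_memD(2)[OF kp] in auto)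
  moreover have "K \<cdot> pow n \<subseteq> I \<cdot> pow n" by (rule ideal_prod_mono[OF Ki(2)]) simp
  ultimately have "pow (n + 1) = K \<cdot> pow n" using n ideal_power_Suc2[OF I_ideal, of n] by auto
  then show "reduction R I K" using Ki by (auto simp: reduction_def)
next
  assume K: "reduction R I K"
  then obtain n where Ki: "ideal K R" "K \<subseteq> I" "pow (Suc n) = K \<cdot> pow n" by (auto simp: reduction_def)
  have "K \<cdot> pow n \<subseteq> (K \<cdot> pow n) <+> {\<zero>}"
    by (rule subset_sum_left[OF ideal_prod_is_ideal[OF Ki(1) pow_ideal] zeroideal])
  then show "relative_reduction {\<zero>} I K" using Ki ideal_memD(2)[OF Ki(1)] unfolding relative_reduction_def by auto
qed

lemma quotient_reduction_step_iff:
  assumes J: "ideal J R" and K: "ideal K R" "J \<subseteq> K" "K \<subseteq> I"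
  shows "ideal_power (R Quot J) (image_ideal R J I) (n + 1) =
      ideal_prod (R Quot J) ((+>) J ` K) (ideal_power (R Quot J) (image_ideal R J I) n) \<longleftrightarrow>
    pow (Suc n) \<subseteq> (K \<cdot> pow n) <+> J"
proof -
  have kp: "ideal (K \<cdot> pow n) R" by (rule ideal_prod_is_ideal[OF K(1) pow_ideal])
  have c: "pow m \<subseteq> carrier R" "K \<subseteq> carrier R" for m using powD(1) ideal_memD(1)[OF K(1)] by auto
  have le: "(+>) J ` (K \<cdot> pow n) \<subseteq> (+>) J ` pow (Suc n)"
    unfolding ideal_power_Suc2[OF I_ideal] by (intro image_mono ideal_prod_mono K(3)) simp
  have e: "ideal_power (R Quot J) (image_ideal R J I) (n + 1) = (+>) J ` pow (Suc n)"
    "ideal_prod (R Quot J) ((+>) J ` K) (ideal_power (R Quot J) (image_ideal R J I) n) = (+>) J ` (K \<cdot> pow n)"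
    unfolding image_ideal_def quot_ideal_power[OF J I_ideal] quot_ideal_prod[OF J c(2,1)] by simp_all
  show ?thesis unfolding e using le quot_image_subset_iff[OF J kp c(1), of "Suc n"] by (metis order_antisym order_refl)
qed

lemma relative_reduction_iff:
  assumes J: "ideal J R" and K: "ideal K R" "J \<subseteq> K" and JI: "J \<subseteq> I"
  shows "relative_reduction J I K \<longleftrightarrow> reduction (R Quot J) (image_ideal R J I) ((+>) J ` K)"
proof -
  have "(+>) J ` K \<subseteq> (+>) J ` I \<longleftrightarrow> K \<subseteq> I <+> J"
    by (rule quot_image_subset_iff[OF J I_ideal]) (use ideal_memD(1)[OF K(1)] in auto)
  also have "I <+> J = I" using sum_subset[OF I_ideal subset_refl JI] subset_sum_left[OF I_ideal J] by auto
  finally have 1: "(+>) J ` K \<subseteq> image_ideal R J I \<longleftrightarrow> K \<subseteq> I" by (simp add: image_ideal_def)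
  show ?thesis unfolding relative_reduction_def reduction_def 1
    using quotient_reduction_step_iff[OF J K] ring_ideal_imp_quot_ideal[OF J K(1)] K by blast
qed

text \<open>The image of a minimal relative reduction \<open>Q'\<close> over \<open>(x)\<close> is a
  minimal reduction of the image of \<open>I\<close>. The exponent of the quotient is the least over
  all minimal reductions, so it suffices that this one satisfies the equation with the exponent of
  \<open>I\<close>.\<close>

lemma reduction_number_quotient_le:
  assumes x: "superficial R I x"
  shows "reduction_number (R Quot (PIdl x)) (image_ideal R (PIdl x) I) \<le> reduction_number R I"
proof -
  let ?A = "R Quot (PIdl x)" and ?I = "image_ideal R (PIdl x) I" and ?q = "(+>) (PIdl x)"
  have xI: "x \<in> I" using x by (auto simp: superficial_def)
  have xc: "x \<in> carrier R" using xI ideal_memD(1)[OF I_ideal] by auto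
  have J: "ideal (PIdl x) R" by (rule cgenideal_ideal[OF xc])
  have JI: "PIdl x \<subseteq> I" by (rule cgenideal_minimal[OF I_ideal xI])
  have zI: "{\<zero>} \<subseteq> I" using ideal_memD(2)[OF I_ideal] by auto
  let ?P = "\<lambda>r. \<exists>Q. minimal_reduction R I Q \<and> pow (r + 1) = Q \<cdot> pow r"
  \<comment> \<open>\<open>LeastI\<close> presupposes that some minimal reduction exists; otherwise
    \<open>reduction_number\<close> would be a \<open>LEAST\<close> over an empty predicate.\<close>
  obtain Q0 where Q0: "relative_reduction {\<zero>} I Q0" "\<forall>L. relative_reduction {\<zero>} I L \<longrightarrow> L \<subseteq> Q0 \<longrightarrow> L = Q0"
    using minimal_relative_reduction_exists[OF I_ideal zeroideal zI] by blast
  then have "minimal_reduction R I Q0" by (auto simp: minimal_reduction_def relative_reduction_zero_iff)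
  moreover then obtain n where "pow (n + 1) = Q0 \<cdot> pow n" by (auto simp: minimal_reduction_def reduction_def)
  ultimately have "?P n" by blast
  then have "?P (reduction_number R I)" unfolding reduction_number_def by (rule LeastI)
  then obtain Q where Q: "minimal_reduction R I Q" "pow (reduction_number R I + 1) = Q \<cdot> pow (reduction_number R I)" by blast
  let ?r = "reduction_number R I"
  have Qr: "reduction R I Q" and Qm: "\<And>L. reduction R I L \<Longrightarrow> L \<subseteq> Q \<Longrightarrow> L = Q"
    using Q(1) by (auto simp: minimal_reduction_def)
  have Qi: "ideal Q R" "Q \<subseteq> I" using Qr by (auto simp: reduction_def)
  have red: "reduction R I L" if L: "ideal L R" "L \<subseteq> I" "pow (Suc n) \<subseteq> L \<cdot> pow n" for L n
  proof -
    have "L \<cdot> pow n \<subseteq> I \<cdot> pow n" by (rule ideal_prod_mono[OF L(2)]) simp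
    then have "pow (n + 1) = L \<cdot> pow n" using L(3) ideal_power_Suc2[OF I_ideal, of n] by auto
    then show ?thesis using L by (auto simp: reduction_def)
  qed
  obtain Q' where Q': "relative_reduction (PIdl x) I Q'"
    "\<And>L. relative_reduction (PIdl x) I L \<Longrightarrow> L \<subseteq> Q' \<Longrightarrow> L = Q'"
    using minimal_relative_reduction_exists[OF I_ideal J JI] by blast
  then obtain n where Qi': "ideal Q' R" "PIdl x \<subseteq> Q'" "Q' \<subseteq> I" "pow (Suc n) \<subseteq> (Q' \<cdot> pow n) <+> (PIdl x)"
    by (auto simp: relative_reduction_def)
  have "pow (Suc ?r) \<subseteq> Q' \<cdot> pow ?r"
  proof (rule reduction_number_transfer[OF x Qi _ _ Qi'(1) _ Qi'(3,4)])
    show "pow (Suc ?r) \<subseteq> Q \<cdot> pow ?r" using Q(2) by simp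
    show "L = Q" if "ideal L R" "L \<subseteq> Q" "pow (Suc n) \<subseteq> L \<cdot> pow n" for L n
      using Qm red[of L n] that Qi by auto
    show "x \<in> Q'" using Qi'(2) cgenideal_self[OF xc] by auto
    fix L n assume L: "ideal L R" "x \<in> L" "L \<subseteq> Q'" "pow (Suc n) \<subseteq> L \<cdot> pow n"
    have "L \<cdot> pow n \<subseteq> (L \<cdot> pow n) <+> (PIdl x)" by (rule subset_sum_left[OF ideal_prod_is_ideal[OF L(1) pow_ideal] J])
    then have "relative_reduction (PIdl x) I L" unfolding relative_reduction_def
      using L Qi'(3) cgenideal_minimal[OF L(1,2)] by blast
    then show "L = Q'" using Q'(2) L(3) by blast
  qed
  also have "\<dots> \<subseteq> (Q' \<cdot> pow ?r) <+> (PIdl x)" by (rule subset_sum_left[OF ideal_prod_is_ideal[OF Qi'(1) pow_ideal] J])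
  finally have step: "ideal_power ?A ?I (?r + 1) = ideal_prod ?A (?q ` Q') (ideal_power ?A ?I ?r)"
    using quotient_reduction_step_iff[OF J Qi'(1-3)] by blast
  have "minimal_reduction ?A ?I (?q ` Q')" unfolding minimal_reduction_def
  proof (intro conjI allI impI)
    show "reduction ?A ?I (?q ` Q')" using relative_reduction_iff[OF J Qi'(1,2) JI] Q'(1) by blast
    fix K assume K: "reduction ?A ?I K \<and> K \<subseteq> ?q ` Q'"
    then obtain L where L: "ideal L R" "PIdl x \<subseteq> L" "K = ?q ` L"
      using quot_ideal_preimage[OF J, of K] by (auto simp: reduction_def)
    have rL: "relative_reduction (PIdl x) I L" using relative_reduction_iff[OF J L(1,2) JI] K L(3) by blast
    have "L \<subseteq> Q' <+> (PIdl x)" using quot_image_subset_iff[OF J Qi'(1), of L] K L(3) ideal_memD(1)[OF L(1)] by blast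
    also have "\<dots> \<subseteq> Q'" by (rule sum_subset[OF Qi'(1) subset_refl Qi'(2)])
    finally show "K = ?q ` Q'" using Q'(2)[OF rL] L(3) by simp
  qed
  with step have "\<exists>Q. minimal_reduction ?A ?I Q \<and> ideal_power ?A ?I (?r + 1) = ideal_prod ?A Q (ideal_power ?A ?I ?r)" by blast
  then show ?thesis unfolding reduction_number_def[of ?A] by (rule Least_le)
qed

end

section \<open>Chains of submodules\<close>

text \<open>Detached from modules, so that submodules of a cohomology module can be replaced by
  modules between coboundaries and cocycles, and families over different rings can be
  compared.\<close>

definition chain_length :: "'x set set \<Rightarrow> enat" where
  "chain_length \<S> = Sup {enat n | n. \<exists>N. (\<forall>i\<le>n. N i \<in> \<S>) \<and> (\<forall>i<n. N i \<subset> N (Suc i))}"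

lemma module_length_eq: "module_length R M = chain_length {N. submodule N R M}"
  by (simp add: module_length_def chain_length_def)

lemma weak_chain_length:
  assumes "\<And>i. i \<le> n \<Longrightarrow> T i \<in> \<T>" "\<And>i. i < n \<Longrightarrow> T i \<subseteq> T (Suc i)"
  shows "enat (card {i. i < n \<and> T i \<noteq> T (Suc i)}) \<le> chain_length \<T>"
proof -
  have "\<exists>N c. c = card {i. i < n \<and> T i \<noteq> T (Suc i)} \<and> (\<forall>i\<le>c. N i \<in> \<T>) \<and> (\<forall>i<c. N i \<subset> N (Suc i)) \<and> N c = T n"
    using assms
  proof (induction n)
    case 0 then show ?case by (intro exI[of _ T]) auto
  next
    case (Suc n)
    then obtain N c where N: "c = card {i. i < n \<and> T i \<noteq> T (Suc i)}" "\<forall>i\<le>c. N i \<in> \<T>" "\<forall>i<c. N i \<subset> N (Suc i)" "N c = T n"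
      by force
    show ?case
    proof (cases "T n = T (Suc n)")
      case True
      have "{i. i < Suc n \<and> T i \<noteq> T (Suc i)} = {i. i < n \<and> T i \<noteq> T (Suc i)}" using True less_Suc_eq by auto
      then show ?thesis using N True by auto
    next
      case False
      have "{i. i < Suc n \<and> T i \<noteq> T (Suc i)} = insert n {i. i < n \<and> T i \<noteq> T (Suc i)}" using False less_Suc_eq by auto
      then have c: "Suc c = card {i. i < Suc n \<and> T i \<noteq> T (Suc i)}" using N(1) by simp
      have lt: "T n \<subset> T (Suc n)" using Suc.prems(2)[of n] False by auto
      show ?thesis
      proof (intro exI conjI)
        let ?N = "\<lambda>i. if i \<le> c then N i else T (Suc n)"
        show "Suc c = card {i. i < Suc n \<and> T i \<noteq> T (Suc i)}" by (rule c)
        show "\<forall>i\<le>Suc c. ?N i \<in> \<T>" using N(2) Suc.prems(1) by auto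
        show "\<forall>i<Suc c. ?N i \<subset> ?N (Suc i)"
        proof (intro allI impI)
          fix i assume "i < Suc c"
          then consider "i < c" | "i = c" by linarith
          then show "?N i \<subset> ?N (Suc i)" using N(3,4) lt by cases auto
        qed
      qed simp
    qed
  qed
  then show ?thesis unfolding chain_length_def by (intro Sup_upper) blast
qed

text \<open>By \<open>inj\<close> each strict step of a chain in \<open>\<S>\<close> stays strict
  under \<open>p\<close> or under \<open>q\<close>. This is the subadditivity of length along an
  exact sequence, in a form that also covers infinite lengths.\<close>

lemma chain_length_le_add:
  assumes p: "\<And>L. L \<in> \<S> \<Longrightarrow> p L \<in> \<T>" "\<And>L L'. L \<in> \<S> \<Longrightarrow> L' \<in> \<S> \<Longrightarrow> L \<subseteq> L' \<Longrightarrow> p L \<subseteq> p L'"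
    and q: "\<And>L. L \<in> \<S> \<Longrightarrow> q L \<in> \<U>" "\<And>L L'. L \<in> \<S> \<Longrightarrow> L' \<in> \<S> \<Longrightarrow> L \<subseteq> L' \<Longrightarrow> q L \<subseteq> q L'"
    and inj: "\<And>L L'. L \<in> \<S> \<Longrightarrow> L' \<in> \<S> \<Longrightarrow> L \<subseteq> L' \<Longrightarrow> p L = p L' \<Longrightarrow> q L = q L' \<Longrightarrow> L' \<subseteq> L"
  shows "chain_length \<S> \<le> chain_length \<T> + chain_length \<U>"
  unfolding chain_length_def[of \<S>]
proof (rule Sup_least, clarify)
  fix n N assume N: "\<forall>i\<le>n. N i \<in> \<S>" "\<forall>i<n. N i \<subset> N (Suc i)"
  let ?P = "{i. i < n \<and> p (N i) \<noteq> p (N (Suc i))}" and ?Q = "{i. i < n \<and> q (N i) \<noteq> q (N (Suc i))}"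
  have "{..<n} \<subseteq> ?P \<union> ?Q"
  proof
    fix i assume i: "i \<in> {..<n}"
    then have "N i \<in> \<S>" "N (Suc i) \<in> \<S>" "N i \<subseteq> N (Suc i)" "\<not> N (Suc i) \<subseteq> N i" using N by auto
    then show "i \<in> ?P \<union> ?Q" using inj i by blast
  qed
  then have "card {..<n} \<le> card (?P \<union> ?Q)" by (intro card_mono) auto
  then have "n \<le> card ?P + card ?Q" using card_Un_le[of ?P ?Q] by auto
  then have "enat n \<le> enat (card ?P) + enat (card ?Q)" by simp
  also have "\<dots> \<le> chain_length \<T> + chain_length \<U>"
    by (intro add_mono weak_chain_length[where T = "\<lambda>i. p (N i)"] weak_chain_length[where T = "\<lambda>i. q (N i)"])
       (use N p q in \<open>auto simp: less_imp_le\<close>)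
  finally show "enat n \<le> chain_length \<T> + chain_length \<U>" .
qed

lemma chain_length_le:
  assumes p: "\<And>L. L \<in> \<S> \<Longrightarrow> p L \<in> \<T>" "\<And>L L'. L \<in> \<S> \<Longrightarrow> L' \<in> \<S> \<Longrightarrow> L \<subseteq> L' \<Longrightarrow> p L \<subseteq> p L'"
    and inj: "\<And>L L'. L \<in> \<S> \<Longrightarrow> L' \<in> \<S> \<Longrightarrow> L \<subseteq> L' \<Longrightarrow> p L = p L' \<Longrightarrow> L' \<subseteq> L"
  shows "chain_length \<S> \<le> chain_length \<T>"
proof -
  \<comment> \<open>A family with a single member has chains of length 0 only and serves as a
    trivial second term.\<close>
  have "chain_length \<S> \<le> chain_length \<T> + chain_length {{} :: nat set}"
  proof (rule chain_length_le_add[where p = p and q = "\<lambda>_. {}"])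
    show "p L \<in> \<T>" if "L \<in> \<S>" for L using that by (rule p(1))
    show "p L \<subseteq> p L'" if "L \<in> \<S>" "L' \<in> \<S>" "L \<subseteq> L'" for L L' using that by (rule p(2))
    show "L' \<subseteq> L" if "L \<in> \<S>" "L' \<in> \<S>" "L \<subseteq> L'" "p L = p L'" for L L' using that by (rule inj)
  qed simp_all
  moreover have "chain_length {{} :: nat set} \<le> 0" unfolding chain_length_def
  proof (rule Sup_least, clarify)
    fix n and N :: "nat \<Rightarrow> nat set" assume N: "\<forall>i\<le>n. N i \<in> {{}}" "\<forall>i<n. N i \<subset> N (Suc i)"
    have "n = 0"
    proof (rule ccontr)
      assume "n \<noteq> 0"
      then have "N 0 \<subset> N (Suc 0)" "N (Suc 0) = {}" using N by auto
      then show False by simp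
    qed
    then show "enat n \<le> 0" by (simp add: zero_enat_def)
  qed
  ultimately show ?thesis by (metis add.right_neutral le_zero_eq)
qed

section \<open>Modules and homomorphisms\<close>

lemma (in module) submodule_iff:
  "submodule L R M \<longleftrightarrow> L \<subseteq> carrier M \<and> \<zero>\<^bsub>M\<^esub> \<in> L \<and> (\<forall>u\<in>L. \<forall>v\<in>L. u \<oplus>\<^bsub>M\<^esub> v \<in> L) \<and>
    (\<forall>a\<in>carrier R. \<forall>v\<in>L. a \<odot>\<^bsub>M\<^esub> v \<in> L)"
proof
  assume L: "submodule L R M"
  note s = submoduleE[OF L]
  obtain u where "u \<in> L" using s(2) by auto
  then have "\<zero>\<^bsub>M\<^esub> \<in> L" using s(4)[of \<zero> u] s(1) by (auto simp: smult_l_null subset_iff)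
  then show "L \<subseteq> carrier M \<and> \<zero>\<^bsub>M\<^esub> \<in> L \<and> (\<forall>u\<in>L. \<forall>v\<in>L. u \<oplus>\<^bsub>M\<^esub> v \<in> L) \<and>
    (\<forall>a\<in>carrier R. \<forall>v\<in>L. a \<odot>\<^bsub>M\<^esub> v \<in> L)" using s by auto
next
  assume L: "L \<subseteq> carrier M \<and> \<zero>\<^bsub>M\<^esub> \<in> L \<and> (\<forall>u\<in>L. \<forall>v\<in>L. u \<oplus>\<^bsub>M\<^esub> v \<in> L) \<and>
    (\<forall>a\<in>carrier R. \<forall>v\<in>L. a \<odot>\<^bsub>M\<^esub> v \<in> L)"
  show "submodule L R M"
  proof (rule submoduleI)
    fix v assume v: "v \<in> L"
    then have "v \<in> carrier M" "(\<ominus> \<one>) \<odot>\<^bsub>M\<^esub> v \<in> L" using L by blast+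
    then show "\<ominus>\<^bsub>M\<^esub> v \<in> L" using smult_l_minus[OF one_closed, of v] by simp
  qed (use L in auto)
qed

lemma (in module) submoduleD:
  assumes "submodule L R M"
  shows "v \<in> L \<Longrightarrow> v \<in> carrier M" "\<zero>\<^bsub>M\<^esub> \<in> L" "u \<in> L \<Longrightarrow> v \<in> L \<Longrightarrow> u \<oplus>\<^bsub>M\<^esub> v \<in> L"
    "a \<in> carrier R \<Longrightarrow> v \<in> L \<Longrightarrow> a \<odot>\<^bsub>M\<^esub> v \<in> L" "v \<in> L \<Longrightarrow> \<ominus>\<^bsub>M\<^esub> v \<in> L"
    "u \<in> L \<Longrightarrow> v \<in> L \<Longrightarrow> u \<ominus>\<^bsub>M\<^esub> v \<in> L"
  using assms submoduleE(3)[OF assms] unfolding submodule_iff by (auto simp: a_minus_def)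

lemma module_hom_closed: "f \<in> module_hom R M N \<Longrightarrow> v \<in> carrier M \<Longrightarrow> f v \<in> carrier N"
  and module_hom_add: "f \<in> module_hom R M N \<Longrightarrow> u \<in> carrier M \<Longrightarrow> v \<in> carrier M \<Longrightarrow> f (u \<oplus>\<^bsub>M\<^esub> v) = f u \<oplus>\<^bsub>N\<^esub> f v"
  and module_hom_smult: "f \<in> module_hom R M N \<Longrightarrow> a \<in> carrier R \<Longrightarrow> v \<in> carrier M \<Longrightarrow> f (a \<odot>\<^bsub>M\<^esub> v) = a \<odot>\<^bsub>N\<^esub> f v"
  by (auto simp: module_hom_def)

lemma module_homI:
  assumes "\<And>v. v \<in> carrier M \<Longrightarrow> f v \<in> carrier N"
    "\<And>u v. u \<in> carrier M \<Longrightarrow> v \<in> carrier M \<Longrightarrow> f (u \<oplus>\<^bsub>M\<^esub> v) = f u \<oplus>\<^bsub>N\<^esub> f v"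
    "\<And>a v. a \<in> carrier R \<Longrightarrow> v \<in> carrier M \<Longrightarrow> f (a \<odot>\<^bsub>M\<^esub> v) = a \<odot>\<^bsub>N\<^esub> f v"
  shows "f \<in> module_hom R M N"
  using assms by (auto simp: module_hom_def)

lemma module_hom_zero:
  assumes "module R M" "module R N" "f \<in> module_hom R M N" shows "f \<zero>\<^bsub>M\<^esub> = \<zero>\<^bsub>N\<^esub>"
proof -
  interpret M: module R M by fact
  interpret N: module R N by fact
  have "f (\<zero>\<^bsub>R\<^esub> \<odot>\<^bsub>M\<^esub> \<zero>\<^bsub>M\<^esub>) = \<zero>\<^bsub>R\<^esub> \<odot>\<^bsub>N\<^esub> f \<zero>\<^bsub>M\<^esub>" by (rule module_hom_smult[OF assms(3)]) auto
  then show ?thesis using module_hom_closed[OF assms(3)] by simp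
qed

lemma module_hom_minus:
  assumes "module R M" "module R N" "f \<in> module_hom R M N" "u \<in> carrier M" "v \<in> carrier M"
  shows "f (u \<ominus>\<^bsub>M\<^esub> v) = f u \<ominus>\<^bsub>N\<^esub> f v"
proof -
  interpret M: module R M by fact
  interpret N: module R N by fact
  have fc: "f u \<in> carrier N" "f v \<in> carrier N" using module_hom_closed[OF assms(3)] assms by auto
  have "f (\<ominus>\<^bsub>M\<^esub> v) = f ((\<ominus>\<^bsub>R\<^esub> \<one>\<^bsub>R\<^esub>) \<odot>\<^bsub>M\<^esub> v)" using M.smult_l_minus[of "\<one>\<^bsub>R\<^esub>" v] assms by simp
  also have "\<dots> = \<ominus>\<^bsub>N\<^esub> f v" using module_hom_smult[OF assms(3), of "\<ominus>\<^bsub>R\<^esub> \<one>\<^bsub>R\<^esub>" v] N.smult_l_minus[of "\<one>\<^bsub>R\<^esub>" "f v"] fc assms by simp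
  finally show ?thesis using module_hom_add[OF assms(3,4), of "\<ominus>\<^bsub>M\<^esub> v"] assms by (simp add: M.minus_eq N.minus_eq)
qed

lemma module_hom_comp:
  "f \<in> module_hom R M N \<Longrightarrow> g \<in> module_hom R N K \<Longrightarrow> (\<lambda>v. g (f v)) \<in> module_hom R M K"
  by (auto simp: module_hom_def Pi_iff)

lemma module_hom_diff:
  assumes "module R M" "module R N" "f \<in> module_hom R M N" "g \<in> module_hom R M N"
  shows "(\<lambda>v. f v \<ominus>\<^bsub>N\<^esub> g v) \<in> module_hom R M N"
proof -
  interpret N: module R N by fact
  have m: "(a \<oplus>\<^bsub>N\<^esub> b) \<ominus>\<^bsub>N\<^esub> (c \<oplus>\<^bsub>N\<^esub> d) = (a \<ominus>\<^bsub>N\<^esub> c) \<oplus>\<^bsub>N\<^esub> (b \<ominus>\<^bsub>N\<^esub> d)"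
    if "a \<in> carrier N" "b \<in> carrier N" "c \<in> carrier N" "d \<in> carrier N" for a b c d
    using that by (simp add: N.minus_eq N.minus_add N.a_ac)
  note c = module_hom_closed[OF assms(3)] module_hom_closed[OF assms(4)]
  show ?thesis
  proof (rule module_homI)
    fix u v assume "u \<in> carrier M" "v \<in> carrier M"
    then show "f (u \<oplus>\<^bsub>M\<^esub> v) \<ominus>\<^bsub>N\<^esub> g (u \<oplus>\<^bsub>M\<^esub> v) = (f u \<ominus>\<^bsub>N\<^esub> g u) \<oplus>\<^bsub>N\<^esub> (f v \<ominus>\<^bsub>N\<^esub> g v)"
      using c m by (simp add: module_hom_add[OF assms(3)] module_hom_add[OF assms(4)])
  next
    fix a v assume "a \<in> carrier R" "v \<in> carrier M"
    then show "f (a \<odot>\<^bsub>M\<^esub> v) \<ominus>\<^bsub>N\<^esub> g (a \<odot>\<^bsub>M\<^esub> v) = a \<odot>\<^bsub>N\<^esub> (f v \<ominus>\<^bsub>N\<^esub> g v)"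
      using c by (simp add: module_hom_smult[OF assms(3)] module_hom_smult[OF assms(4)] N.minus_eq N.smult_r_distr N.smult_r_minus)
  qed (use c in simp)
qed

lemma (in module) diff_zero_iff: "u \<in> carrier M \<Longrightarrow> v \<in> carrier M \<Longrightarrow> u \<ominus>\<^bsub>M\<^esub> v = \<zero>\<^bsub>M\<^esub> \<longleftrightarrow> u = v"
  by (metis M.minus_eq M.r_neg M.minus_equality M.add.inv_closed M.minus_minus M.l_neg)

lemma (in module) diff_add_cancel: "u \<in> carrier M \<Longrightarrow> v \<in> carrier M \<Longrightarrow> (u \<ominus>\<^bsub>M\<^esub> v) \<oplus>\<^bsub>M\<^esub> v = u"
  by (simp add: M.minus_eq M.a_assoc M.l_neg)

lemma (in module) add_diff_cancel: "u \<in> carrier M \<Longrightarrow> v \<in> carrier M \<Longrightarrow> (u \<oplus>\<^bsub>M\<^esub> v) \<ominus>\<^bsub>M\<^esub> v = u"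
  by (simp add: M.minus_eq M.a_assoc M.r_neg)

lemma (in module) diff_closed: "u \<in> carrier M \<Longrightarrow> v \<in> carrier M \<Longrightarrow> u \<ominus>\<^bsub>M\<^esub> v \<in> carrier M"
  by simp

section \<open>Quotient modules\<close>

context module begin

lemma submodule_abelian: "submodule N R M \<Longrightarrow> abelian_subgroup N M"
  using submodule.axioms(1) abelian_subgroupI3 additive_subgroupI M.abelian_group_axioms by blast

lemma module_coset_iff:
  assumes N: "submodule N R M" and v: "v \<in> carrier M"
  shows "u \<in> N +>\<^bsub>M\<^esub> v \<longleftrightarrow> u \<in> carrier M \<and> u \<ominus>\<^bsub>M\<^esub> v \<in> N"
proof
  assume "u \<in> N +>\<^bsub>M\<^esub> v"
  then obtain n where n: "n \<in> N" "u = n \<oplus>\<^bsub>M\<^esub> v" by (auto simp: a_r_coset_def')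
  have nc: "n \<in> carrier M" using submoduleD(1)[OF N n(1)] .
  then show "u \<in> carrier M \<and> u \<ominus>\<^bsub>M\<^esub> v \<in> N" using n v add_diff_cancel[OF nc v] by auto
next
  assume u: "u \<in> carrier M \<and> u \<ominus>\<^bsub>M\<^esub> v \<in> N"
  then have "u = (u \<ominus>\<^bsub>M\<^esub> v) \<oplus>\<^bsub>M\<^esub> v" using diff_add_cancel v by simp
  then show "u \<in> N +>\<^bsub>M\<^esub> v" using u by (auto simp: a_r_coset_def')
qed

lemma module_coset_self: "submodule N R M \<Longrightarrow> v \<in> carrier M \<Longrightarrow> v \<in> N +>\<^bsub>M\<^esub> v"
  using module_coset_iff submoduleD(2) diff_zero_iff[of v v] by simp

lemma module_coset_eq_iff:
  assumes N: "submodule N R M" and u: "u \<in> carrier M" and v: "v \<in> carrier M"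
  shows "N +>\<^bsub>M\<^esub> u = N +>\<^bsub>M\<^esub> v \<longleftrightarrow> u \<ominus>\<^bsub>M\<^esub> v \<in> N"
proof
  assume "N +>\<^bsub>M\<^esub> u = N +>\<^bsub>M\<^esub> v"
  then show "u \<ominus>\<^bsub>M\<^esub> v \<in> N" using module_coset_self[OF N u] module_coset_iff[OF N v] by simp
next
  assume "u \<ominus>\<^bsub>M\<^esub> v \<in> N"
  then have "u \<in> N +>\<^bsub>M\<^esub> v" using module_coset_iff[OF N v] u by simp
  then show "N +>\<^bsub>M\<^esub> u = N +>\<^bsub>M\<^esub> v"
    using M.a_repr_independence[OF _ v submodule.axioms(1)[OF N], of u] by simp
qed

lemma module_coset_zero: "submodule N R M \<Longrightarrow> N +>\<^bsub>M\<^esub> \<zero>\<^bsub>M\<^esub> = N"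
  using M.a_coset_add_zero submoduleD(1) by blast

lemma coset_sum: "submodule N R M \<Longrightarrow> u \<in> carrier M \<Longrightarrow> v \<in> carrier M \<Longrightarrow>
    set_add M (N +>\<^bsub>M\<^esub> u) (N +>\<^bsub>M\<^esub> v) = N +>\<^bsub>M\<^esub> (u \<oplus>\<^bsub>M\<^esub> v)"
  by (rule abelian_subgroup.a_rcos_sum[OF submodule_abelian])

lemma quotient_abelian_group:
  assumes N: "submodule N R M"
    and Q: "carrier Q = (\<lambda>v. N +>\<^bsub>M\<^esub> v) ` carrier M" "add Q = set_add M" "zero Q = N"
  shows "abelian_group Q"
proof (rule abelian_groupI)
  have z: "zero Q = N +>\<^bsub>M\<^esub> \<zero>\<^bsub>M\<^esub>" unfolding Q module_coset_zero[OF N] ..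
  show "\<zero>\<^bsub>Q\<^esub> \<in> carrier Q" unfolding z Q(1) by auto
  fix X assume "X \<in> carrier Q"
  then obtain v where v: "v \<in> carrier M" "X = N +>\<^bsub>M\<^esub> v" unfolding Q by auto
  show "\<zero>\<^bsub>Q\<^esub> \<oplus>\<^bsub>Q\<^esub> X = X" unfolding v(2) z Q(2) using coset_sum[OF N M.zero_closed v(1)] v(1) by simp
  have "(N +>\<^bsub>M\<^esub> (\<ominus>\<^bsub>M\<^esub> v)) \<oplus>\<^bsub>Q\<^esub> X = \<zero>\<^bsub>Q\<^esub>"
    unfolding v(2) z Q(2) using coset_sum[OF N M.a_inv_closed[OF v(1)] v(1)] v(1) by (simp add: M.l_neg)
  then show "\<exists>y\<in>carrier Q. y \<oplus>\<^bsub>Q\<^esub> X = \<zero>\<^bsub>Q\<^esub>" using v(1) unfolding Q(1) by blast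
qed (auto simp: Q coset_sum[OF N] M.a_ac)

lemma quotient_module_carrier: "carrier (quotient_module R M N) = (\<lambda>v. N +>\<^bsub>M\<^esub> v) ` carrier M"
  by (auto simp: quotient_module_def A_RCOSETS_def')

lemma quotient_module_zero: "\<zero>\<^bsub>quotient_module R M N\<^esub> = N"
  by (simp add: quotient_module_def)

lemma quotient_module_add:
  "submodule N R M \<Longrightarrow> u \<in> carrier M \<Longrightarrow> v \<in> carrier M \<Longrightarrow>
    (N +>\<^bsub>M\<^esub> u) \<oplus>\<^bsub>quotient_module R M N\<^esub> (N +>\<^bsub>M\<^esub> v) = N +>\<^bsub>M\<^esub> (u \<oplus>\<^bsub>M\<^esub> v)"
  by (simp add: quotient_module_def coset_sum)

lemma coset_smult:
  assumes N: "submodule N R M" and a: "a \<in> carrier R" and v: "v \<in> carrier M" and u: "u \<in> N +>\<^bsub>M\<^esub> v"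
  shows "N +>\<^bsub>M\<^esub> (a \<odot>\<^bsub>M\<^esub> u) = N +>\<^bsub>M\<^esub> (a \<odot>\<^bsub>M\<^esub> v)"
proof -
  have uc: "u \<in> carrier M" "u \<ominus>\<^bsub>M\<^esub> v \<in> N" using u module_coset_iff[OF N v] by auto
  have "a \<odot>\<^bsub>M\<^esub> u \<ominus>\<^bsub>M\<^esub> a \<odot>\<^bsub>M\<^esub> v = a \<odot>\<^bsub>M\<^esub> (u \<ominus>\<^bsub>M\<^esub> v)" using a uc v by (simp add: M.minus_eq smult_r_distr smult_r_minus)
  then show ?thesis using module_coset_eq_iff[OF N, of "a \<odot>\<^bsub>M\<^esub> u" "a \<odot>\<^bsub>M\<^esub> v"] submoduleD(4)[OF N a uc(2)] a uc v by simp
qed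

lemma quotient_module_smult:
  assumes N: "submodule N R M" and a: "a \<in> carrier R" and v: "v \<in> carrier M"
  shows "a \<odot>\<^bsub>quotient_module R M N\<^esub> (N +>\<^bsub>M\<^esub> v) = N +>\<^bsub>M\<^esub> (a \<odot>\<^bsub>M\<^esub> v)"
  using UN_constant_eq[OF module_coset_self[OF N v], of "\<lambda>u. N +>\<^bsub>M\<^esub> (a \<odot>\<^bsub>M\<^esub> u)"] coset_smult[OF N a v]
  by (simp add: quotient_module_def)

lemma quotient_module_module:
  assumes N: "submodule N R M" shows "module R (quotient_module R M N)"
proof (rule moduleI)
  show "cring R" by (rule R.is_cring)
  show "abelian_group (quotient_module R M N)"
    by (rule quotient_abelian_group[OF N quotient_module_carrier]) (simp_all add: quotient_module_def)
qed (auto simp: quotient_module_carrier quotient_module_add[OF N] quotient_module_smult[OF N]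
    smult_l_distr smult_r_distr smult_assoc1)

lemma module_length_quotient:
  assumes N: "submodule N R M"
  shows "module_length R (quotient_module R M N) = chain_length {L. submodule L R M \<and> N \<subseteq> L}"
proof -
  let ?Q = "quotient_module R M N"
  interpret Q: module R ?Q by (rule quotient_module_module[OF N])
  note sub = submodule_iff Q.submodule_iff
  let ?p = "\<lambda>K. {v \<in> carrier M. N +>\<^bsub>M\<^esub> v \<in> K}" and ?q = "\<lambda>L. (\<lambda>v. N +>\<^bsub>M\<^esub> v) ` L"
  have pz: "N +>\<^bsub>M\<^esub> v = N" if "v \<in> N" for v
    by (rule M.a_coset_join2[OF submoduleD(1)[OF N that] submodule.axioms(1)[OF N] that])
  have 1: "chain_length {K. submodule K R ?Q} \<le> chain_length {L. submodule L R M \<and> N \<subseteq> L}"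
  proof (rule chain_length_le[where p = ?p])
    fix K assume "K \<in> {K. submodule K R ?Q}"
    then have K: "submodule K R ?Q" by simp
    note k = Q.submoduleD[OF K]
    show "?p K \<in> {L. submodule L R M \<and> N \<subseteq> L}"
      using k(2,3,4) submoduleD(1)[OF N] pz
      by (auto simp: sub quotient_module_zero module_coset_zero[OF N]) 
         (metis quotient_module_add[OF N], metis quotient_module_smult[OF N])
  next
    fix K K' assume h: "K \<in> {K. submodule K R ?Q}" "K' \<in> {K. submodule K R ?Q}" "?p K = ?p K'"
    show "K' \<subseteq> K"
    proof
      fix X assume X: "X \<in> K'"
      then have "X \<in> carrier ?Q" using h(2) Q.submoduleD(1) by blast
      then obtain v where v: "v \<in> carrier M" "X = N +>\<^bsub>M\<^esub> v" by (auto simp: quotient_module_carrier)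
      then have "v \<in> ?p K'" using X by simp
      then show "X \<in> K" using h(3) v by blast
    qed
  qed auto
  have 2: "chain_length {L. submodule L R M \<and> N \<subseteq> L} \<le> chain_length {K. submodule K R ?Q}"
  proof (rule chain_length_le[where p = ?q])
    fix L assume "L \<in> {L. submodule L R M \<and> N \<subseteq> L}"
    then have L: "submodule L R M" "N \<subseteq> L" by auto
    note l = submoduleD[OF L(1)]
    have "submodule (?q L) R ?Q" unfolding Q.submodule_iff
    proof (intro conjI ballI)
      show "?q L \<subseteq> carrier ?Q" using l(1) by (auto simp: quotient_module_carrier)
      show "\<zero>\<^bsub>?Q\<^esub> \<in> ?q L" using l(2) module_coset_zero[OF N] by (force simp: quotient_module_zero)
    next
      fix X Y assume "X \<in> ?q L" "Y \<in> ?q L"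
      then show "X \<oplus>\<^bsub>?Q\<^esub> Y \<in> ?q L" using l(1,3) by (auto simp: quotient_module_add[OF N])
    next
      fix a X assume "a \<in> carrier R" "X \<in> ?q L"
      then show "a \<odot>\<^bsub>?Q\<^esub> X \<in> ?q L" using l(1,4) by (auto simp: quotient_module_smult[OF N])
    qed
    then show "?q L \<in> {K. submodule K R ?Q}" by simp
  next
    fix L L' assume h: "L \<in> {L. submodule L R M \<and> N \<subseteq> L}" "L' \<in> {L. submodule L R M \<and> N \<subseteq> L}" "?q L = ?q L'"
    show "L' \<subseteq> L"
    proof
      fix v assume v: "v \<in> L'"
      then obtain u where u: "u \<in> L" "N +>\<^bsub>M\<^esub> v = N +>\<^bsub>M\<^esub> u" using h(3) by blast
      have c: "u \<in> carrier M" "v \<in> carrier M" using u(1) v h submoduleD(1) by auto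
      have "v \<ominus>\<^bsub>M\<^esub> u \<in> L" using module_coset_eq_iff[OF N c(2,1)] u h by auto
      then have "(v \<ominus>\<^bsub>M\<^esub> u) \<oplus>\<^bsub>M\<^esub> u \<in> L" using submoduleD(3) h u by blast
      then show "v \<in> L" using diff_add_cancel[OF c(2,1)] by simp
    qed
  qed auto
  show ?thesis unfolding module_length_eq using 1 2 by (rule antisym)
qed

end

section \<open>Free modules\<close>

context cring begin

lemma free_carrier: "v \<in> carrier (free_module R n) \<longleftrightarrow> (\<forall>i<n. v i \<in> carrier R) \<and> v \<in> extensional {..<n}"
  by (auto simp: free_module_def PiE_iff)

lemma free_eqI: "u \<in> carrier (free_module R n) \<Longrightarrow> v \<in> carrier (free_module R n) \<Longrightarrow> (\<And>i. i < n \<Longrightarrow> u i = v i) \<Longrightarrow> u = v"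
  by (rule extensionalityI[of u "{..<n}"]) (auto simp: free_carrier)

lemma free_simps:
  "\<zero>\<^bsub>free_module R n\<^esub> = (\<lambda>i\<in>{..<n}. \<zero>)"
  "u \<oplus>\<^bsub>free_module R n\<^esub> v = (\<lambda>i\<in>{..<n}. u i \<oplus> v i)"
  "a \<odot>\<^bsub>free_module R n\<^esub> v = (\<lambda>i\<in>{..<n}. a \<otimes> v i)"
  by (simp_all add: free_module_def)

lemma free_module_module: "module R (free_module R n)"
proof (rule moduleI)
  show "abelian_group (free_module R n)"
  proof (rule abelian_groupI)
    fix u assume u: "u \<in> carrier (free_module R n)"
    have c: "(\<lambda>i\<in>{..<n}. \<ominus> u i) \<in> carrier (free_module R n)" using u by (auto simp: free_carrier)
    have "(\<lambda>i\<in>{..<n}. \<ominus> u i) \<oplus>\<^bsub>free_module R n\<^esub> u = \<zero>\<^bsub>free_module R n\<^esub>"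
      using u by (auto simp: free_simps free_carrier l_neg intro!: restrict_ext)
    with c show "\<exists>v\<in>carrier (free_module R n). v \<oplus>\<^bsub>free_module R n\<^esub> u = \<zero>\<^bsub>free_module R n\<^esub>" by blast
    show "\<zero>\<^bsub>free_module R n\<^esub> \<oplus>\<^bsub>free_module R n\<^esub> u = u"
      by (rule free_eqI[OF _ u]) (use u in \<open>auto simp: free_simps free_carrier\<close>)
  qed (auto simp: free_simps free_carrier a_ac intro!: restrict_ext)
next
  fix u assume u: "u \<in> carrier (free_module R n)"
  show "\<one> \<odot>\<^bsub>free_module R n\<^esub> u = u"
    by (rule free_eqI[OF _ u]) (use u in \<open>auto simp: free_simps free_carrier\<close>)
qed (auto simp: free_simps free_carrier l_distr r_distr m_assoc is_cring intro!: restrict_ext)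

definition basis :: "nat \<Rightarrow> nat \<Rightarrow> nat \<Rightarrow> 'a" where
  "basis n i = (\<lambda>k\<in>{..<n}. if k = i then \<one> else \<zero>)"

lemma basis_closed: "basis n i \<in> carrier (free_module R n)"
  by (auto simp: free_carrier basis_def)

lemma hom_free_eq:
  assumes X: "module R X" and f: "f \<in> module_hom R (free_module R n) X" and v: "v \<in> carrier (free_module R n)"
  shows "f v = (\<Oplus>\<^bsub>X\<^esub>i\<in>{..<n}. v i \<odot>\<^bsub>X\<^esub> f (basis n i))"
proof -
  interpret X: module R X by fact
  interpret F: module R "free_module R n" by (rule free_module_module)
  define t where "t k = (\<lambda>i\<in>{..<n}. if i < k then v i else \<zero>)" for k
  have tc: "t k \<in> carrier (free_module R n)" for k using v by (auto simp: t_def free_carrier)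
  have fb: "f (basis n i) \<in> carrier X" for i using module_hom_closed[OF f basis_closed] .
  have "k \<le> n \<Longrightarrow> f (t k) = (\<Oplus>\<^bsub>X\<^esub>i\<in>{..<k}. v i \<odot>\<^bsub>X\<^esub> f (basis n i))" for k
  proof (induction k)
    case 0
    have "t 0 = \<zero>\<^bsub>free_module R n\<^esub>" by (auto simp: t_def free_simps)
    then show ?case using module_hom_zero[OF free_module_module X f] by simp
  next
    case (Suc k)
    have vk: "v k \<in> carrier R" using v Suc.prems by (auto simp: free_carrier)
    have "t (Suc k) = v k \<odot>\<^bsub>free_module R n\<^esub> basis n k \<oplus>\<^bsub>free_module R n\<^esub> t k"
      by (rule free_eqI[OF tc]) (use v vk tc basis_closed in \<open>auto simp: free_simps t_def basis_def free_carrier less_Suc_eq\<close>)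
    then have "f (t (Suc k)) = v k \<odot>\<^bsub>X\<^esub> f (basis n k) \<oplus>\<^bsub>X\<^esub> f (t k)"
      using module_hom_add[OF f _ tc] module_hom_smult[OF f vk basis_closed] vk basis_closed by simp
    moreover have "{..<Suc k} = insert k {..<k}" by auto
    moreover have "(\<lambda>i. v i \<odot>\<^bsub>X\<^esub> f (basis n i)) \<in> {..<k} \<rightarrow> carrier X"
      using v Suc.prems fb by (auto simp: free_carrier)
    ultimately show ?case using Suc vk fb by (simp add: X.finsum_insert)
  qed
  moreover have "t n = v" by (rule free_eqI[OF tc v]) (auto simp: t_def)
  ultimately show ?thesis by force
qed

definition lincomb where "lincomb X n w v = (\<Oplus>\<^bsub>X\<^esub>i\<in>{..<n}. v i \<odot>\<^bsub>X\<^esub> w i)"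

lemma lincomb_hom:
  assumes X: "module R X" and w: "\<And>i. i < n \<Longrightarrow> w i \<in> carrier X"
  shows "lincomb X n w \<in> module_hom R (free_module R n) X" "i < n \<Longrightarrow> lincomb X n w (basis n i) = w i"
proof -
  interpret X: module R X by fact
  show "lincomb X n w \<in> module_hom R (free_module R n) X"
  proof (rule module_homI)
    fix v assume v: "v \<in> carrier (free_module R n)"
    then have vw: "(\<lambda>i. v i \<odot>\<^bsub>X\<^esub> w i) \<in> {..<n} \<rightarrow> carrier X" using w by (auto simp: free_carrier)
    then show "lincomb X n w v \<in> carrier X" unfolding lincomb_def by (rule X.finsum_closed)
    {
      fix u assume u: "u \<in> carrier (free_module R n)"
      then have uw: "(\<lambda>i. u i \<odot>\<^bsub>X\<^esub> w i) \<in> {..<n} \<rightarrow> carrier X" using w by (auto simp: free_carrier)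
      have "lincomb X n w (v \<oplus>\<^bsub>free_module R n\<^esub> u) = (\<Oplus>\<^bsub>X\<^esub>i\<in>{..<n}. v i \<odot>\<^bsub>X\<^esub> w i \<oplus>\<^bsub>X\<^esub> u i \<odot>\<^bsub>X\<^esub> w i)"
        unfolding lincomb_def using u v w by (intro X.finsum_cong') (auto simp: free_simps free_carrier X.smult_l_distr)
      then show "lincomb X n w (v \<oplus>\<^bsub>free_module R n\<^esub> u) = lincomb X n w v \<oplus>\<^bsub>X\<^esub> lincomb X n w u"
        using X.finsum_addf[OF vw uw] by (simp add: lincomb_def)
    }
    fix a assume a: "a \<in> carrier R"
    have "lincomb X n w (a \<odot>\<^bsub>free_module R n\<^esub> v) = (\<Oplus>\<^bsub>X\<^esub>i\<in>{..<n}. a \<odot>\<^bsub>X\<^esub> (v i \<odot>\<^bsub>X\<^esub> w i))"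
      unfolding lincomb_def using a v w by (intro X.finsum_cong') (auto simp: free_simps free_carrier X.smult_assoc1)
    then show "lincomb X n w (a \<odot>\<^bsub>free_module R n\<^esub> v) = a \<odot>\<^bsub>X\<^esub> lincomb X n w v"
      using X.finsum_smult_ldistr[OF _ a vw] by (simp add: lincomb_def)
  qed
  assume i: "i < n"
  have "lincomb X n w (basis n i) = (\<Oplus>\<^bsub>X\<^esub>k\<in>{..<n}. if i = k then w k else \<zero>\<^bsub>X\<^esub>)"
    unfolding lincomb_def using w by (intro X.finsum_cong') (auto simp: basis_def)
  also have "\<dots> = w i" using X.finsum_singleton[of i "{..<n}" w] w i by auto
  finally show "lincomb X n w (basis n i) = w i" .
qed

lemma free_hom_ext:
  assumes "module R X" "f \<in> module_hom R (free_module R n) X" "g \<in> module_hom R (free_module R n) X"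
    "\<And>i. i < n \<Longrightarrow> f (basis n i) = g (basis n i)" "v \<in> carrier (free_module R n)"
  shows "f v = g v"
proof -
  interpret X: module R X by fact
  have "(\<Oplus>\<^bsub>X\<^esub>i\<in>{..<n}. v i \<odot>\<^bsub>X\<^esub> f (basis n i)) = (\<Oplus>\<^bsub>X\<^esub>i\<in>{..<n}. v i \<odot>\<^bsub>X\<^esub> g (basis n i))"
    using assms(4,5) module_hom_closed[OF assms(3) basis_closed] by (intro X.finsum_cong') (auto simp: free_carrier)
  then show ?thesis using hom_free_eq[OF assms(1,2,5)] hom_free_eq[OF assms(1,3,5)] by simp
qed

lemma free_projective:
  assumes "module R X" "module R Y" and p: "p \<in> module_hom R X Y"
    and f: "f \<in> module_hom R (free_module R n) Y" and im: "\<And>v. v \<in> carrier (free_module R n) \<Longrightarrow> f v \<in> p ` carrier X"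
  shows "\<exists>g\<in>module_hom R (free_module R n) X. \<forall>v\<in>carrier (free_module R n). p (g v) = f v"
proof -
  have "\<forall>i. \<exists>u\<in>carrier X. p u = f (basis n i)" using im[OF basis_closed] unfolding image_iff by metis
  then obtain w where w: "\<And>i. w i \<in> carrier X" "\<And>i. p (w i) = f (basis n i)" by metis
  note l = lincomb_hom[OF assms(1), of n w, OF w(1)]
  have "p (lincomb X n w v) = f v" if "v \<in> carrier (free_module R n)" for v
    by (rule free_hom_ext[OF assms(2) module_hom_comp[OF l(1) p] f _ that]) (simp add: l(2) w(2))
  then show ?thesis using l(1) by blast
qed

section \<open>The Hom complex\<close>

lemma Hom_simps:
  "carrier (Hom_module R M N) = module_hom R M N \<inter> extensional (carrier M)"
  "\<zero>\<^bsub>Hom_module R M N\<^esub> = (\<lambda>v\<in>carrier M. \<zero>\<^bsub>N\<^esub>)"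
  "f \<oplus>\<^bsub>Hom_module R M N\<^esub> g = (\<lambda>v\<in>carrier M. f v \<oplus>\<^bsub>N\<^esub> g v)"
  "a \<odot>\<^bsub>Hom_module R M N\<^esub> f = (\<lambda>v\<in>carrier M. a \<odot>\<^bsub>N\<^esub> f v)"
  by (simp_all add: Hom_module_def)

lemma Hom_restrict:
  assumes "module R M" "f \<in> module_hom R M N"
  shows "(\<lambda>v\<in>carrier M. f v) \<in> carrier (Hom_module R M N)"
proof -
  interpret M: module R M by fact
  show ?thesis using assms(2) by (auto simp: Hom_simps module_hom_def)
qed

lemma Hom_eqI:
  "f \<in> carrier (Hom_module R M N) \<Longrightarrow> g \<in> carrier (Hom_module R M N) \<Longrightarrow> (\<And>v. v \<in> carrier M \<Longrightarrow> f v = g v) \<Longrightarrow> f = g"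
  by (rule extensionalityI[of f "carrier M"]) (auto simp: Hom_simps)

lemma Hom_module_module:
  assumes M: "module R M" and N: "module R N" shows "module R (Hom_module R M N)"
proof -
  interpret M: module R M by fact
  interpret N: module R N by fact
  have hz: "(\<lambda>v\<in>carrier M. \<zero>\<^bsub>N\<^esub>) \<in> carrier (Hom_module R M N)"
    by (rule Hom_restrict[OF M]) (auto simp: module_hom_def)
  have ha: "(\<lambda>v\<in>carrier M. f v \<oplus>\<^bsub>N\<^esub> g v) \<in> carrier (Hom_module R M N)"
    if "f \<in> carrier (Hom_module R M N)" "g \<in> carrier (Hom_module R M N)" for f g
    by (rule Hom_restrict[OF M]) (use that in \<open>auto simp: module_hom_def Hom_simps Pi_iff N.smult_r_distr N.a_ac\<close>)
  have hs: "(\<lambda>v\<in>carrier M. a \<odot>\<^bsub>N\<^esub> f v) \<in> carrier (Hom_module R M N)"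
    if "f \<in> carrier (Hom_module R M N)" "a \<in> carrier R" for f a
    by (rule Hom_restrict[OF M])
      (use that in \<open>auto simp: module_hom_def Hom_simps Pi_iff N.smult_r_distr N.smult_assoc1[symmetric] m_comm\<close>)
  have hc: "f v \<in> carrier N" if "f \<in> carrier (Hom_module R M N)" "v \<in> carrier M" for f v
    using that by (auto simp: Hom_simps module_hom_def)
  show ?thesis
  proof (rule moduleI)
    show "abelian_group (Hom_module R M N)"
    proof (rule abelian_groupI)
      fix f assume f: "f \<in> carrier (Hom_module R M N)"
      have c: "(\<lambda>v\<in>carrier M. (\<ominus> \<one>) \<odot>\<^bsub>N\<^esub> f v) \<in> carrier (Hom_module R M N)" using hs[OF f] by simp
      have "(\<lambda>v\<in>carrier M. (\<ominus> \<one>) \<odot>\<^bsub>N\<^esub> f v) \<oplus>\<^bsub>Hom_module R M N\<^esub> f = \<zero>\<^bsub>Hom_module R M N\<^esub>"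
        unfolding Hom_simps using hc[OF f] by (intro restrict_ext) (simp add: N.smult_l_minus N.l_neg)
      with c show "\<exists>g\<in>carrier (Hom_module R M N). g \<oplus>\<^bsub>Hom_module R M N\<^esub> f = \<zero>\<^bsub>Hom_module R M N\<^esub>" by blast
      show "\<zero>\<^bsub>Hom_module R M N\<^esub> \<oplus>\<^bsub>Hom_module R M N\<^esub> f = f"
        by (rule Hom_eqI[OF _ f]) (use ha[OF hz f] hc[OF f] in \<open>auto simp: Hom_simps(2-4)\<close>)
    qed (use hz ha hc in \<open>auto simp: Hom_simps(2-4) N.a_ac intro!: restrict_ext\<close>)
  next
    fix f assume f: "f \<in> carrier (Hom_module R M N)"
    show "\<one> \<odot>\<^bsub>Hom_module R M N\<^esub> f = f"
      by (rule Hom_eqI[OF _ f]) (use hs[OF f] hc[OF f] in \<open>auto simp: Hom_simps(2-4)\<close>)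
  qed (use hs hc in \<open>auto simp: Hom_simps(2-4) N.smult_l_distr N.smult_r_distr N.smult_assoc1 is_cring intro!: restrict_ext\<close>)
qed

end

definition complex :: "('a, 'r) ring_scheme \<Rightarrow> (nat \<Rightarrow> nat) \<Rightarrow> (nat \<Rightarrow> (nat \<Rightarrow> 'a) \<Rightarrow> (nat \<Rightarrow> 'a)) \<Rightarrow> bool" where
  "complex R b D \<longleftrightarrow> (\<forall>i. D i \<in> module_hom R (free_module R (b (Suc i))) (free_module R (b i))) \<and>
    (\<forall>i. \<forall>v\<in>carrier (free_module R (b (Suc (Suc i)))). D i (D (Suc i) v) = \<zero>\<^bsub>free_module R (b i)\<^esub>)"

text \<open>The submodules of the cohomology module, viewed as modules between coboundaries and cocycles.\<close>

definition ext_subs where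
  "ext_subs R b D N j = {L. submodule L R (Hom_module R (free_module R (b j)) N) \<and>
    coboundaries R b D N j \<subseteq> L \<and> L \<subseteq> cocycles R b D N j}"

lemma ext_subsI:
  assumes N: "module R N" and "\<And>f. f \<in> L \<Longrightarrow> f \<in> cocycles R b D N j" "coboundaries R b D N j \<subseteq> L"
    and H: "H = Hom_module R (free_module R (b j)) N"
    and "\<And>f g. f \<in> L \<Longrightarrow> g \<in> L \<Longrightarrow> f \<oplus>\<^bsub>H\<^esub> g \<in> L" "\<zero>\<^bsub>H\<^esub> \<in> L" "\<And>a f. a \<in> carrier R \<Longrightarrow> f \<in> L \<Longrightarrow> a \<odot>\<^bsub>H\<^esub> f \<in> L"
  shows "L \<in> ext_subs R b D N j"
proof -
  interpret N: module R N by fact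
  interpret H: module R H unfolding H by (rule N.R.Hom_module_module[OF N.R.free_module_module N])
  have "submodule L R H" unfolding H.submodule_iff
    using assms(2,5,6,7) by (auto simp: cocycles_def H)
  then show ?thesis using assms(2,3) by (auto simp: ext_subs_def H)
qed

lemma cocycles_iff:
  "f \<in> cocycles R b D N j \<longleftrightarrow> f \<in> module_hom R (free_module R (b j)) N \<and> f \<in> extensional (carrier (free_module R (b j))) \<and>
    (\<forall>v\<in>carrier (free_module R (b (Suc j))). f (D j v) = \<zero>\<^bsub>N\<^esub>)"
  by (auto simp: cocycles_def Hom_module_def)

locale cochains = cring R + N: module R N for R (structure) and N +
  fixes b D
  assumes cplx: "complex R b D"
begin

abbreviation F where "F i \<equiv> free_module R (b i)"
abbreviation H where "H j \<equiv> Hom_module R (F j) N"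

lemma D_hom: "D i \<in> module_hom R (F (Suc i)) (F i)" and D_D: "v \<in> carrier (F (Suc (Suc i))) \<Longrightarrow> D i (D (Suc i) v) = \<zero>\<^bsub>F i\<^esub>"
  using cplx by (auto simp: complex_def)

lemma D_closed: "v \<in> carrier (F (Suc i)) \<Longrightarrow> D i v \<in> carrier (F i)"
  by (rule module_hom_closed[OF D_hom])

lemma F_module: "module R (F i)" by (rule free_module_module)
lemma H_module: "module R (H j)" by (rule Hom_module_module[OF F_module N.module_axioms])

lemma H_hom: "f \<in> carrier (H j) \<Longrightarrow> f \<in> module_hom R (F j) N" by (simp add: Hom_simps)

lemma coboundary_intro:
  "f \<in> module_hom R (F j) N \<Longrightarrow> (\<lambda>v\<in>carrier (F (Suc j)). f (D j v)) \<in> coboundaries R b D N (Suc j)"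
  using Hom_restrict[OF F_module] D_closed by (auto intro!: image_eqI[of _ _ "\<lambda>v\<in>carrier (F j). f v"] restrict_ext)

lemma coboundaries_subset: "coboundaries R b D N j \<subseteq> cocycles R b D N j"
proof (cases j)
  case 0
  interpret H: module R "H 0" by (rule H_module)
  have "\<zero>\<^bsub>H 0\<^esub> \<in> carrier (H 0)" by simp
  then show ?thesis using D_closed by (auto simp: 0 cocycles_def) (simp add: Hom_simps)
next
  case (Suc i)
  show ?thesis
  proof
    fix g assume "g \<in> coboundaries R b D N j"
    then obtain f where f: "f \<in> carrier (H i)" "g = (\<lambda>v\<in>carrier (F (Suc i)). f (D i v))" by (auto simp: Suc)
    note fh = H_hom[OF f(1)]
    have "g \<in> carrier (H (Suc i))" unfolding f(2)
      by (rule Hom_restrict[OF F_module module_hom_comp[OF D_hom fh]])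
    moreover have "g (D (Suc i) v) = \<zero>\<^bsub>N\<^esub>" if "v \<in> carrier (F (Suc (Suc i)))" for v
      using that f(2) D_closed[OF that] D_D[OF that] module_hom_zero[OF F_module N.module_axioms fh] by simp
    ultimately show "g \<in> cocycles R b D N j" by (simp add: cocycles_def Suc)
  qed
qed

lemma cocycles_submodule: "submodule (cocycles R b D N j) R (H j)"
proof -
  interpret H: module R "H j" by (rule H_module)
  have e: "f \<in> cocycles R b D N j \<longleftrightarrow> f \<in> carrier (H j) \<and> (\<forall>v\<in>carrier (F (Suc j)). f (D j v) = \<zero>\<^bsub>N\<^esub>)" for f
    by (simp add: cocycles_def)
  show ?thesis unfolding H.submodule_iff
  proof (intro conjI ballI)
    show "cocycles R b D N j \<subseteq> carrier (H j)" using e by auto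
    show "\<zero>\<^bsub>H j\<^esub> \<in> cocycles R b D N j" using D_closed by (auto simp: e) (simp add: Hom_simps)
  next
    fix f g assume "f \<in> cocycles R b D N j" "g \<in> cocycles R b D N j"
    then show "f \<oplus>\<^bsub>H j\<^esub> g \<in> cocycles R b D N j" using D_closed by (auto simp: e) (simp add: Hom_simps)
  next
    fix a f assume "a \<in> carrier R" "f \<in> cocycles R b D N j"
    then show "a \<odot>\<^bsub>H j\<^esub> f \<in> cocycles R b D N j" using D_closed by (auto simp: e) (simp add: Hom_simps)
  qed
qed

lemma coboundaries_submodule: "submodule (coboundaries R b D N j) R (H j)"
proof (cases j)
  case 0
  interpret H: module R "H 0" by (rule H_module)
  show ?thesis unfolding 0 H.submodule_iff by auto
next
  case (Suc i)
  interpret H: module R "H (Suc i)" by (rule H_module)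
  interpret Hi: module R "H i" by (rule H_module)
  have m: "\<exists>f\<in>carrier (H i). g = (\<lambda>v\<in>carrier (F (Suc i)). f (D i v))" if "g \<in> coboundaries R b D N (Suc i)" for g
    using that by auto
  have i: "(\<lambda>v\<in>carrier (F (Suc i)). f (D i v)) \<in> coboundaries R b D N (Suc i)" if "f \<in> carrier (H i)" for f
    using that by auto
  show ?thesis unfolding Suc H.submodule_iff
  proof (intro conjI ballI)
    show "coboundaries R b D N (Suc i) \<subseteq> carrier (H (Suc i))" using coboundaries_subset[of "Suc i"] by (auto simp: cocycles_def)
    have "\<zero>\<^bsub>H (Suc i)\<^esub> = (\<lambda>v\<in>carrier (F (Suc i)). \<zero>\<^bsub>H i\<^esub> (D i v))" using D_closed by (auto simp: Hom_simps intro!: restrict_ext)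
    then show "\<zero>\<^bsub>H (Suc i)\<^esub> \<in> coboundaries R b D N (Suc i)" using i[of "\<zero>\<^bsub>H i\<^esub>"] by simp
  next
    fix g g' assume "g \<in> coboundaries R b D N (Suc i)" "g' \<in> coboundaries R b D N (Suc i)"
    then obtain f f' where f: "f \<in> carrier (H i)" "g = (\<lambda>v\<in>carrier (F (Suc i)). f (D i v))"
      "f' \<in> carrier (H i)" "g' = (\<lambda>v\<in>carrier (F (Suc i)). f' (D i v))" using m by metis
    have "g \<oplus>\<^bsub>H (Suc i)\<^esub> g' = (\<lambda>v\<in>carrier (F (Suc i)). (f \<oplus>\<^bsub>H i\<^esub> f') (D i v))"
      unfolding f(2,4) using D_closed by (auto simp: Hom_simps intro!: restrict_ext)
    then show "g \<oplus>\<^bsub>H (Suc i)\<^esub> g' \<in> coboundaries R b D N (Suc i)" using i[of "f \<oplus>\<^bsub>H i\<^esub> f'"] f by simp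
  next
    fix a g assume a: "a \<in> carrier R" and "g \<in> coboundaries R b D N (Suc i)"
    then obtain f where f: "f \<in> carrier (H i)" "g = (\<lambda>v\<in>carrier (F (Suc i)). f (D i v))" using m by metis
    have "a \<odot>\<^bsub>H (Suc i)\<^esub> g = (\<lambda>v\<in>carrier (F (Suc i)). (a \<odot>\<^bsub>H i\<^esub> f) (D i v))"
      unfolding f(2) using D_closed by (auto simp: Hom_simps intro!: restrict_ext)
    then show "a \<odot>\<^bsub>H (Suc i)\<^esub> g \<in> coboundaries R b D N (Suc i)" using i[of "a \<odot>\<^bsub>H i\<^esub> f"] f a by simp
  qed
qed

lemma module_length_cohomology:
  "module_length R (cohomology_module R b D N j) = chain_length (ext_subs R b D N j)"
proof -
  let ?Z = "cocycles R b D N j" and ?B = "coboundaries R b D N j"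
  let ?X = "H j \<lparr>carrier := ?Z\<rparr>"
  interpret H: module R "H j" by (rule H_module)
  interpret X: module R ?X by (rule submodule.submodule_is_module[OF cocycles_submodule H_module])
  have Zc: "?Z \<subseteq> carrier (H j)" by (auto simp: cocycles_def)
  have sub: "submodule L R ?X \<longleftrightarrow> submodule L R (H j) \<and> L \<subseteq> ?Z" for L
    unfolding X.submodule_iff H.submodule_iff using Zc by auto
  have "submodule ?B R ?X" using sub coboundaries_submodule coboundaries_subset by simp
  then show ?thesis unfolding cohomology_module_def X.module_length_quotient sub ext_subs_def
    by (auto simp: X.module_length_quotient sub intro: arg_cong[where f = chain_length])
qed

end

section \<open>Free resolutions\<close>

lemma a_kernel_mem: "v \<in> a_kernel G H h \<longleftrightarrow> v \<in> carrier G \<and> h v = \<zero>\<^bsub>H\<^esub>"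
  by (simp add: a_kernel_def kernel_def)

lemma free_resolutionD:
  assumes "free_resolution R M b D e"
  shows "e \<in> module_hom R (free_module R (b 0)) M"
    "D i \<in> module_hom R (free_module R (b (Suc i))) (free_module R (b i))"
    "m \<in> carrier M \<Longrightarrow> \<exists>v\<in>carrier (free_module R (b 0)). e v = m"
    "v \<in> carrier (free_module R (b 0)) \<Longrightarrow> e v = \<zero>\<^bsub>M\<^esub> \<longleftrightarrow> v \<in> D 0 ` carrier (free_module R (b (Suc 0)))"
    "v \<in> carrier (free_module R (b (Suc i))) \<Longrightarrow>
      D i v = \<zero>\<^bsub>free_module R (b i)\<^esub> \<longleftrightarrow> v \<in> D (Suc i) ` carrier (free_module R (b (Suc (Suc i))))"
proof -
  let ?F = "\<lambda>i. free_module R (b i)"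
  note r = assms[unfolded free_resolution_def Let_def]
  show "e \<in> module_hom R (?F 0) M" "D i \<in> module_hom R (?F (Suc i)) (?F i)" using r by blast+
  have 1: "e ` carrier (?F 0) = carrier M" "D 0 ` carrier (?F 1) = a_kernel (?F 0) M e"
    "D (Suc i) ` carrier (?F (Suc (Suc i))) = a_kernel (?F (Suc i)) (?F i) (D i)" for i using r by blast+
  show "m \<in> carrier M \<Longrightarrow> \<exists>v\<in>carrier (?F 0). e v = m" using 1(1) by (metis imageE)
  show "v \<in> carrier (?F 0) \<Longrightarrow> e v = \<zero>\<^bsub>M\<^esub> \<longleftrightarrow> v \<in> D 0 ` carrier (?F (Suc 0))"
    using 1(2) a_kernel_mem[of v "?F 0" M e] by simp
  show "v \<in> carrier (?F (Suc i)) \<Longrightarrow> D i v = \<zero>\<^bsub>?F i\<^esub> \<longleftrightarrow> v \<in> D (Suc i) ` carrier (?F (Suc (Suc i)))"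
    using 1(3)[of i] a_kernel_mem[of v "?F (Suc i)" "?F i" "D i"] by simp
qed

lemma resolution_complex:
  assumes "free_resolution R M b D e" shows "complex R b D"
  unfolding complex_def
  using free_resolutionD(2)[OF assms] free_resolutionD(5)[OF assms] module_hom_closed[OF free_resolutionD(2)[OF assms]]
  by blast

lemma resolution_augmentation:
  assumes "free_resolution R M b D e" "v \<in> carrier (free_module R (b (Suc 0)))" shows "e (D 0 v) = \<zero>\<^bsub>M\<^esub>"
  using free_resolutionD(4)[OF assms(1)] assms(2) module_hom_closed[OF free_resolutionD(2)[OF assms(1)], of v 0] by auto

context module begin

lemma chain_map_exists:
  assumes r: "free_resolution R M b D e" and r': "free_resolution R M b' D' e'"
  shows "\<exists>\<alpha>. (\<forall>i. \<alpha> i \<in> module_hom R (free_module R (b i)) (free_module R (b' i))) \<and>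
    (\<forall>v\<in>carrier (free_module R (b 0)). e' (\<alpha> 0 v) = e v) \<and>
    (\<forall>i. \<forall>v\<in>carrier (free_module R (b (Suc i))). D' i (\<alpha> (Suc i) v) = \<alpha> i (D i v))"
proof -
  let ?F = "\<lambda>i. free_module R (b i)" and ?F' = "\<lambda>i. free_module R (b' i)"
  note d = free_resolutionD[OF r] and d' = free_resolutionD[OF r'] and m = R.free_module_module
  note cl = module_hom_closed
  \<comment> \<open>The last conjunct is the invariant that makes the next lift possible:
    \<open>a\<close> maps boundaries to boundaries.\<close>
  let ?P = "\<lambda>i a. a \<in> module_hom R (?F i) (?F' i) \<and> (i = 0 \<longrightarrow> (\<forall>v\<in>carrier (?F 0). e' (a v) = e v)) \<and>
    (\<forall>v\<in>carrier (?F (Suc i)). a (D i v) \<in> D' i ` carrier (?F' (Suc i)))"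
  let ?Q = "\<lambda>i a a'. \<forall>v\<in>carrier (?F (Suc i)). D' i (a' v) = a (D i v)"
  have "\<exists>\<alpha>. \<forall>i. ?P i (\<alpha> i) \<and> ?Q i (\<alpha> i) (\<alpha> (Suc i))"
  proof (rule dependent_nat_choice)
    have "\<exists>g\<in>module_hom R (?F 0) (?F' 0). \<forall>v\<in>carrier (?F 0). e' (g v) = e v"
    proof (rule R.free_projective[OF m module_axioms d'(1) d(1)])
      fix v assume "v \<in> carrier (?F 0)"
      then show "e v \<in> e' ` carrier (?F' 0)" using d'(3)[OF cl[OF d(1)]] by (metis imageI)
    qed
    then obtain a where a: "a \<in> module_hom R (?F 0) (?F' 0)" "\<forall>v\<in>carrier (?F 0). e' (a v) = e v" by blast
    have "a (D 0 v) \<in> D' 0 ` carrier (?F' (Suc 0))" if v: "v \<in> carrier (?F (Suc 0))" for v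
      using d'(4)[OF cl[OF a(1) cl[OF d(2) v]]] a(2) cl[OF d(2) v] resolution_augmentation[OF r v] by simp
    then show "\<exists>a. ?P 0 a" using a by blast
  next
    fix a i assume a: "?P i a"
    have fh: "(\<lambda>v. a (D i v)) \<in> module_hom R (?F (Suc i)) (?F' i)" by (rule module_hom_comp[OF d(2)]) (use a in blast)
    have "\<exists>g\<in>module_hom R (?F (Suc i)) (?F' (Suc i)). \<forall>v\<in>carrier (?F (Suc i)). D' i (g v) = a (D i v)"
      by (rule R.free_projective[OF m m d'(2) fh]) (use a in blast)
    then obtain g where g: "g \<in> module_hom R (?F (Suc i)) (?F' (Suc i))" "\<forall>v\<in>carrier (?F (Suc i)). D' i (g v) = a (D i v)" by blast
    have "g (D (Suc i) v) \<in> D' (Suc i) ` carrier (?F' (Suc (Suc i)))" if v: "v \<in> carrier (?F (Suc (Suc i)))" for v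
    proof -
      have Dv: "D (Suc i) v \<in> carrier (?F (Suc i))" by (rule cl[OF d(2) v])
      have "D' i (g (D (Suc i) v)) = a (D i (D (Suc i) v))" using g(2) Dv by simp
      also have "D i (D (Suc i) v) = \<zero>\<^bsub>?F i\<^esub>" using resolution_complex[OF r] v by (auto simp: complex_def)
      also have "a \<zero>\<^bsub>?F i\<^esub> = \<zero>\<^bsub>?F' i\<^esub>" by (rule module_hom_zero[OF m m]) (use a in blast)
      finally show ?thesis using d'(5)[OF cl[OF g(1) Dv]] by simp
    qed
    then show "\<exists>a'. ?P (Suc i) a' \<and> ?Q i a a'" using g by blast
  qed
  then obtain \<alpha> where A: "\<forall>i. ?P i (\<alpha> i) \<and> ?Q i (\<alpha> i) (\<alpha> (Suc i))" by (elim exE)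
  show ?thesis
  proof (intro exI[of _ \<alpha>] conjI)
    show "\<forall>i. \<alpha> i \<in> module_hom R (?F i) (?F' i)" using A by simp
    show "\<forall>v\<in>carrier (?F 0). e' (\<alpha> 0 v) = e v" using spec[OF A, of 0] by simp
    show "\<forall>i. \<forall>v\<in>carrier (?F (Suc i)). D' i (\<alpha> (Suc i) v) = \<alpha> i (D i v)" using A by simp
  qed
qed

lemma homotopy_exists:
  assumes r: "free_resolution R M b D e"
    and \<gamma>: "\<And>i. \<gamma> i \<in> module_hom R (free_module R (b i)) (free_module R (b i))"
    and \<gamma>0: "\<And>v. v \<in> carrier (free_module R (b 0)) \<Longrightarrow> e (\<gamma> 0 v) = e v"
    and \<gamma>D: "\<And>i v. v \<in> carrier (free_module R (b (Suc i))) \<Longrightarrow> D i (\<gamma> (Suc i) v) = \<gamma> i (D i v)"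
  shows "\<exists>h. (\<forall>i. h i \<in> module_hom R (free_module R (b i)) (free_module R (b (Suc i)))) \<and>
    (\<forall>v\<in>carrier (free_module R (b 0)). D 0 (h 0 v) = \<gamma> 0 v \<ominus>\<^bsub>free_module R (b 0)\<^esub> v) \<and>
    (\<forall>i. \<forall>v\<in>carrier (free_module R (b (Suc i))). D (Suc i) (h (Suc i) v) =
      (\<gamma> (Suc i) v \<ominus>\<^bsub>free_module R (b (Suc i))\<^esub> v) \<ominus>\<^bsub>free_module R (b (Suc i))\<^esub> h i (D i v))"
proof -
  let ?F = "\<lambda>i. free_module R (b i)"
  note d = free_resolutionD[OF r] and m = R.free_module_module
  note cl = module_hom_closed
  have idh: "(\<lambda>v. v) \<in> module_hom R (?F i) (?F i)" for i by (rule module_homI) auto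
  have \<delta>: "(\<lambda>v. \<gamma> i v \<ominus>\<^bsub>?F i\<^esub> v) \<in> module_hom R (?F i) (?F i)" for i
    by (rule module_hom_diff[OF m m \<gamma> idh])
  have DD: "D i (D (Suc i) v) = \<zero>\<^bsub>?F i\<^esub>" if "v \<in> carrier (?F (Suc (Suc i)))" for i v
    using resolution_complex[OF r] that by (auto simp: complex_def)
  \<comment> \<open>The last conjunct says that \<open>D i\<close> annihilates the right-hand side
    required of the next \<open>h\<close>, so that exactness and projectivity provide it.\<close>
  let ?P = "\<lambda>i h. h \<in> module_hom R (?F i) (?F (Suc i)) \<and>
    (i = 0 \<longrightarrow> (\<forall>v\<in>carrier (?F 0). D 0 (h v) = \<gamma> 0 v \<ominus>\<^bsub>?F 0\<^esub> v)) \<and>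
    (\<forall>v\<in>carrier (?F (Suc i)). D i (h (D i v)) = \<gamma> i (D i v) \<ominus>\<^bsub>?F i\<^esub> D i v)"
  let ?Q = "\<lambda>i h h'. \<forall>v\<in>carrier (?F (Suc i)). D (Suc i) (h' v) = (\<gamma> (Suc i) v \<ominus>\<^bsub>?F (Suc i)\<^esub> v) \<ominus>\<^bsub>?F (Suc i)\<^esub> h (D i v)"
  have "\<exists>h. \<forall>i. ?P i (h i) \<and> ?Q i (h i) (h (Suc i))"
  proof (rule dependent_nat_choice)
    have "\<exists>g\<in>module_hom R (?F 0) (?F (Suc 0)). \<forall>v\<in>carrier (?F 0). D 0 (g v) = \<gamma> 0 v \<ominus>\<^bsub>?F 0\<^esub> v"
    proof (rule R.free_projective[OF m m d(2) \<delta>])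
      fix v assume v: "v \<in> carrier (?F 0)"
      have "e (\<gamma> 0 v \<ominus>\<^bsub>?F 0\<^esub> v) = e (\<gamma> 0 v) \<ominus>\<^bsub>M\<^esub> e v"
        by (rule module_hom_minus[OF m module_axioms d(1) cl[OF \<gamma> v] v])
      also have "\<dots> = \<zero>\<^bsub>M\<^esub>" using \<gamma>0[OF v] cl[OF d(1) v] diff_zero_iff by simp
      finally show "\<gamma> 0 v \<ominus>\<^bsub>?F 0\<^esub> v \<in> D 0 ` carrier (?F (Suc 0))" using d(4)[OF cl[OF \<delta> v]] by simp
    qed
    then obtain g where g: "g \<in> module_hom R (?F 0) (?F (Suc 0))" "\<forall>v\<in>carrier (?F 0). D 0 (g v) = \<gamma> 0 v \<ominus>\<^bsub>?F 0\<^esub> v" by blast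
    then have "?P 0 g" using cl[OF d(2)] by blast
    then show "\<exists>h. ?P 0 h" by blast
  next
    fix h i assume h: "?P i h"
    interpret Fi: module R "?F i" by (rule m)
    interpret Fs: module R "?F (Suc i)" by (rule m)
    have hh: "h \<in> module_hom R (?F i) (?F (Suc i))" using h by blast
    have hD: "(\<lambda>v. h (D i v)) \<in> module_hom R (?F (Suc i)) (?F (Suc i))" by (rule module_hom_comp[OF d(2) hh])
    have f: "(\<lambda>v. (\<gamma> (Suc i) v \<ominus>\<^bsub>?F (Suc i)\<^esub> v) \<ominus>\<^bsub>?F (Suc i)\<^esub> h (D i v)) \<in> module_hom R (?F (Suc i)) (?F (Suc i))"
      by (rule module_hom_diff[OF m m \<delta> hD])
    have "\<exists>g\<in>module_hom R (?F (Suc i)) (?F (Suc (Suc i))). \<forall>v\<in>carrier (?F (Suc i)).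
        D (Suc i) (g v) = (\<gamma> (Suc i) v \<ominus>\<^bsub>?F (Suc i)\<^esub> v) \<ominus>\<^bsub>?F (Suc i)\<^esub> h (D i v)"
    proof (rule R.free_projective[OF m m d(2) f])
      fix v assume v: "v \<in> carrier (?F (Suc i))"
      have Dv: "D i v \<in> carrier (?F i)" by (rule cl[OF d(2) v])
      have c: "\<gamma> i (D i v) \<ominus>\<^bsub>?F i\<^esub> D i v \<in> carrier (?F i)" by (rule cl[OF \<delta> Dv])
      have "D i ((\<gamma> (Suc i) v \<ominus>\<^bsub>?F (Suc i)\<^esub> v) \<ominus>\<^bsub>?F (Suc i)\<^esub> h (D i v)) =
        D i (\<gamma> (Suc i) v \<ominus>\<^bsub>?F (Suc i)\<^esub> v) \<ominus>\<^bsub>?F i\<^esub> D i (h (D i v))"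
        by (rule module_hom_minus[OF m m d(2) cl[OF \<delta> v] cl[OF hD v]])
      also have "D i (\<gamma> (Suc i) v \<ominus>\<^bsub>?F (Suc i)\<^esub> v) = \<gamma> i (D i v) \<ominus>\<^bsub>?F i\<^esub> D i v"
        using module_hom_minus[OF m m d(2) cl[OF \<gamma> v] v] \<gamma>D[OF v] by simp
      also have "D i (h (D i v)) = \<gamma> i (D i v) \<ominus>\<^bsub>?F i\<^esub> D i v" using h v by blast
      finally have "D i ((\<gamma> (Suc i) v \<ominus>\<^bsub>?F (Suc i)\<^esub> v) \<ominus>\<^bsub>?F (Suc i)\<^esub> h (D i v)) = \<zero>\<^bsub>?F i\<^esub>" using c Fi.diff_zero_iff by simp
      then show "(\<gamma> (Suc i) v \<ominus>\<^bsub>?F (Suc i)\<^esub> v) \<ominus>\<^bsub>?F (Suc i)\<^esub> h (D i v) \<in> D (Suc i) ` carrier (?F (Suc (Suc i)))"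
        using d(5)[OF cl[OF f v]] by simp
    qed
    then obtain g where g: "g \<in> module_hom R (?F (Suc i)) (?F (Suc (Suc i)))" "\<And>v. v \<in> carrier (?F (Suc i)) \<Longrightarrow>
        D (Suc i) (g v) = (\<gamma> (Suc i) v \<ominus>\<^bsub>?F (Suc i)\<^esub> v) \<ominus>\<^bsub>?F (Suc i)\<^esub> h (D i v)" by blast
    have "D (Suc i) (g (D (Suc i) v)) = \<gamma> (Suc i) (D (Suc i) v) \<ominus>\<^bsub>?F (Suc i)\<^esub> D (Suc i) v" if v: "v \<in> carrier (?F (Suc (Suc i)))" for v
    proof -
      have Dv: "D (Suc i) v \<in> carrier (?F (Suc i))" by (rule cl[OF d(2) v])
      have "h (D i (D (Suc i) v)) = \<zero>\<^bsub>?F (Suc i)\<^esub>" using DD[OF v] module_hom_zero[OF m m hh] by simp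
      then show ?thesis using g(2)[OF Dv] cl[OF \<delta> Dv] by (simp add: Fs.minus_eq)
    qed
    then have "?P (Suc i) g \<and> ?Q i h g" using g by blast
    then show "\<exists>h'. ?P (Suc i) h' \<and> ?Q i h h'" by blast
  qed
  then obtain h where A: "\<forall>i. ?P i (h i) \<and> ?Q i (h i) (h (Suc i))" by (elim exE)
  show ?thesis
  proof (intro exI[of _ h] conjI)
    show "\<forall>i. h i \<in> module_hom R (?F i) (?F (Suc i))" using A by simp
    show "\<forall>v\<in>carrier (?F 0). D 0 (h 0 v) = \<gamma> 0 v \<ominus>\<^bsub>?F 0\<^esub> v" using spec[OF A, of 0] by simp
    show "\<forall>i. \<forall>v\<in>carrier (?F (Suc i)). D (Suc i) (h (Suc i) v) =
      (\<gamma> (Suc i) v \<ominus>\<^bsub>?F (Suc i)\<^esub> v) \<ominus>\<^bsub>?F (Suc i)\<^esub> h i (D i v)" using A by simp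
  qed
qed

text \<open>Pulling back along the chain map \<open>\<alpha>\<close> separates comparable
  submodules: composing a cocycle \<open>g\<close> with \<open>\<beta>\<close> and then with
  \<open>\<alpha>\<close> changes it only by a coboundary, which comes from the homotopy between
  \<open>\<gamma>\<close> and the identity. The opposite inequality is the same statement with the
  resolutions interchanged.\<close>

lemma ext_subs_resolution_le:
  assumes r: "free_resolution R M b D e" and r': "free_resolution R M b' D' e'" and N: "module R N"
  shows "chain_length (ext_subs R b D N j) \<le> chain_length (ext_subs R b' D' N j)"
proof -
  interpret N: module R N by (rule N)
  interpret C: cochains R N b D by (intro cochains.intro R.is_cring N cochains_axioms.intro resolution_complex[OF r])
  interpret C': cochains R N b' D' by (intro cochains.intro R.is_cring N cochains_axioms.intro resolution_complex[OF r'])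
  note m = R.free_module_module and cl = module_hom_closed
  interpret H: module R "C.H j" by (rule C.H_module)
  interpret H': module R "C'.H j" by (rule C'.H_module)
  obtain \<alpha> where \<alpha>: "\<And>i. \<alpha> i \<in> module_hom R (C.F i) (C'.F i)" "\<And>v. v \<in> carrier (C.F 0) \<Longrightarrow> e' (\<alpha> 0 v) = e v"
    "\<And>i v. v \<in> carrier (C.F (Suc i)) \<Longrightarrow> D' i (\<alpha> (Suc i) v) = \<alpha> i (D i v)" using chain_map_exists[OF r r'] by metis
  obtain \<beta> where \<beta>: "\<And>i. \<beta> i \<in> module_hom R (C'.F i) (C.F i)" "\<And>v. v \<in> carrier (C'.F 0) \<Longrightarrow> e (\<beta> 0 v) = e' v"
    "\<And>i v. v \<in> carrier (C'.F (Suc i)) \<Longrightarrow> D i (\<beta> (Suc i) v) = \<beta> i (D' i v)" using chain_map_exists[OF r' r] by metis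
  note ac = cl[OF \<alpha>(1)] and bc = cl[OF \<beta>(1)]
  define \<gamma> where "\<gamma> i v = \<beta> i (\<alpha> i v)" for i v
  have \<gamma>h: "\<gamma> i \<in> module_hom R (C.F i) (C.F i)" for i unfolding \<gamma>_def by (rule module_hom_comp[OF \<alpha>(1) \<beta>(1)])
  obtain h where h: "\<And>i. h i \<in> module_hom R (C.F i) (C.F (Suc i))"
    "\<And>v. v \<in> carrier (C.F 0) \<Longrightarrow> D 0 (h 0 v) = \<gamma> 0 v \<ominus>\<^bsub>C.F 0\<^esub> v"
    "\<And>i v. v \<in> carrier (C.F (Suc i)) \<Longrightarrow> D (Suc i) (h (Suc i) v) =
      (\<gamma> (Suc i) v \<ominus>\<^bsub>C.F (Suc i)\<^esub> v) \<ominus>\<^bsub>C.F (Suc i)\<^esub> h i (D i v)"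
    using homotopy_exists[OF r, of \<gamma>] \<gamma>h \<alpha> \<beta> ac by (simp add: \<gamma>_def) metis
  let ?c = "\<lambda>f. \<lambda>v\<in>carrier (C.F j). f (\<alpha> j v)"
  let ?p = "\<lambda>L. {f \<in> cocycles R b' D' N j. ?c f \<in> L}"
  have cH: "?c f \<in> carrier (C.H j)" if "f \<in> module_hom R (C'.F j) N" for f
    by (rule R.Hom_restrict[OF m module_hom_comp[OF \<alpha>(1) that]])
  show ?thesis
  proof (rule chain_length_le[where p = ?p])
    fix L assume "L \<in> ext_subs R b D N j"
    then have L: "submodule L R (C.H j)" "coboundaries R b D N j \<subseteq> L" by (auto simp: ext_subs_def)
    note l = H.submoduleD[OF L(1)]
    note z = C'.cocycles_submodule[of j]
    note z' = H'.submoduleD[OF z]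
    have zh: "f \<in> module_hom R (C'.F j) N" if "f \<in> cocycles R b' D' N j" for f using that by (simp add: cocycles_iff)
    show "?p L \<in> ext_subs R b' D' N j"
    proof (rule ext_subsI[OF N _ _ refl])
      have "\<zero>\<^bsub>C'.H j\<^esub> \<in> ?p L"
      proof -
        have "?c \<zero>\<^bsub>C'.H j\<^esub> = \<zero>\<^bsub>C.H j\<^esub>" using ac by (auto simp: R.Hom_simps intro!: restrict_ext)
        then show ?thesis using l(2) z'(2) by simp
      qed
      then show "\<zero>\<^bsub>C'.H j\<^esub> \<in> ?p L" .
      show "coboundaries R b' D' N j \<subseteq> ?p L"
      proof
        fix f assume f: "f \<in> coboundaries R b' D' N j"
        show "f \<in> ?p L"
        proof (cases j)
          case 0
          then show ?thesis using f \<open>\<zero>\<^bsub>C'.H j\<^esub> \<in> ?p L\<close> by simp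
        next
          case (Suc i)
          then obtain g where g: "g \<in> carrier (C'.H i)" "f = (\<lambda>v\<in>carrier (C'.F (Suc i)). g (D' i v))" using f by auto
          have "?c f = (\<lambda>v\<in>carrier (C.F (Suc i)). g (\<alpha> i (D i v)))"
            unfolding Suc g(2) using ac by (auto simp: \<alpha>(3) intro!: restrict_ext)
          also have "\<dots> \<in> coboundaries R b D N (Suc i)"
            by (rule C.coboundary_intro[OF module_hom_comp[OF \<alpha>(1) C'.H_hom[OF g(1)]]])
          finally have "?c f \<in> coboundaries R b D N j" unfolding Suc .
          then show ?thesis using subsetD[OF L(2)] subsetD[OF C'.coboundaries_subset f] by blast
        qed
      qed
    next
      fix f g assume fg: "f \<in> ?p L" "g \<in> ?p L"
      have "?c (f \<oplus>\<^bsub>C'.H j\<^esub> g) = ?c f \<oplus>\<^bsub>C.H j\<^esub> ?c g" using ac by (auto simp: R.Hom_simps intro!: restrict_ext)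
      then show "f \<oplus>\<^bsub>C'.H j\<^esub> g \<in> ?p L" using fg l(3) z'(3) by simp
    next
      fix a f assume a: "a \<in> carrier R" and f: "f \<in> ?p L"
      have "?c (a \<odot>\<^bsub>C'.H j\<^esub> f) = a \<odot>\<^bsub>C.H j\<^esub> ?c f" using ac by (auto simp: R.Hom_simps intro!: restrict_ext)
      then show "a \<odot>\<^bsub>C'.H j\<^esub> f \<in> ?p L" using f a l(4) z'(4) by simp
    qed simp
  next
    fix L L' assume "L \<in> ext_subs R b D N j" "L' \<in> ext_subs R b D N j" "L \<subseteq> L'" and eq: "?p L = ?p L'"
    then have L: "submodule L R (C.H j)" "coboundaries R b D N j \<subseteq> L" and L': "submodule L' R (C.H j)" "coboundaries R b D N j \<subseteq> L'"
      "L' \<subseteq> cocycles R b D N j" by (auto simp: ext_subs_def)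
    show "L' \<subseteq> L"
    proof
      fix g assume g: "g \<in> L'"
      then have gz: "g \<in> module_hom R (C.F j) N" "g \<in> extensional (carrier (C.F j))"
        "\<And>v. v \<in> carrier (C.F (Suc j)) \<Longrightarrow> g (D j v) = \<zero>\<^bsub>N\<^esub>" using L'(3) by (auto simp: cocycles_iff)
      have gH: "g \<in> carrier (C.H j)" using gz by (simp add: R.Hom_simps)
      define f where "f = (\<lambda>v\<in>carrier (C'.F j). g (\<beta> j v))"
      have fZ: "f \<in> cocycles R b' D' N j"
      proof -
        have "f \<in> carrier (C'.H j)" unfolding f_def by (rule R.Hom_restrict[OF m module_hom_comp[OF \<beta>(1) gz(1)]])
        moreover have "f (D' j v) = \<zero>\<^bsub>N\<^esub>" if v: "v \<in> carrier (C'.F (Suc j))" for v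
          using C'.D_closed[OF v] gz(3)[OF bc[OF v]] \<beta>(3)[OF v] by (simp add: f_def)
        ultimately show ?thesis by (simp add: cocycles_def)
      qed
      \<comment> \<open>The change of \<open>g\<close> under \<open>\<gamma>\<close>. As
        \<open>g\<close> kills boundaries, only the summand of the homotopy formula that factors
        through \<open>D\<close> remains, and it is a coboundary; for \<open>j = 0\<close> nothing
        remains.\<close>
      define c where "c = (\<lambda>v\<in>carrier (C.F j). g (\<gamma> j v \<ominus>\<^bsub>C.F j\<^esub> v))"
      have cc: "c \<in> coboundaries R b D N j"
      proof (cases j)
        case 0
        have "c = \<zero>\<^bsub>C.H 0\<^esub>" unfolding c_def 0 R.Hom_simps using h(2) gz(3) cl[OF h(1)] 0 by (intro restrict_ext) (metis)
        then show ?thesis by (simp add: 0)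
      next
        case (Suc i)
        interpret FS: module R "C.F (Suc i)" by (rule m)
        have "c = (\<lambda>v\<in>carrier (C.F (Suc i)). g (h i (D i v)))" unfolding c_def Suc
        proof (rule restrict_ext)
          fix v assume v: "v \<in> carrier (C.F (Suc i))"
          have hv: "h i (D i v) \<in> carrier (C.F (Suc i))" by (rule cl[OF h(1) C.D_closed[OF v]])
          have dv: "\<gamma> (Suc i) v \<ominus>\<^bsub>C.F (Suc i)\<^esub> v \<in> carrier (C.F (Suc i))" using cl[OF \<gamma>h v] v by simp
          have gh: "g \<in> module_hom R (C.F (Suc i)) N" using gz(1) Suc by simp
          have "g ((\<gamma> (Suc i) v \<ominus>\<^bsub>C.F (Suc i)\<^esub> v) \<ominus>\<^bsub>C.F (Suc i)\<^esub> h i (D i v)) = \<zero>\<^bsub>N\<^esub>"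
            using gz(3)[of "h (Suc i) v"] h(3)[OF v] cl[OF h(1) v] Suc by simp
          then have "g (\<gamma> (Suc i) v \<ominus>\<^bsub>C.F (Suc i)\<^esub> v) \<ominus>\<^bsub>N\<^esub> g (h i (D i v)) = \<zero>\<^bsub>N\<^esub>"
            using module_hom_minus[OF m N gh dv hv] by simp
          then show "g (\<gamma> (Suc i) v \<ominus>\<^bsub>C.F (Suc i)\<^esub> v) = g (h i (D i v))"
            using N.diff_zero_iff[OF cl[OF gh dv] cl[OF gh hv]] by simp
        qed
        also have "\<dots> \<in> coboundaries R b D N (Suc i)"
          by (rule C.coboundary_intro[OF module_hom_comp[OF h(1)]]) (use gz(1) Suc in simp)
        finally show ?thesis by (simp add: Suc)
      qed
      interpret Fj: module R "C.F j" by (rule m)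
      have cH': "c \<in> carrier (C.H j)" using cc C.coboundaries_subset by (auto simp: cocycles_def)
      have e: "?c f = g \<oplus>\<^bsub>C.H j\<^esub> c"
      proof (rule R.Hom_eqI[of _ "C.F j" N])
        show "?c f \<in> carrier (C.H j)" by (rule cH) (use fZ in \<open>simp add: cocycles_iff\<close>)
        show "g \<oplus>\<^bsub>C.H j\<^esub> c \<in> carrier (C.H j)" using gH cH' by simp
        fix v assume v: "v \<in> carrier (C.F j)"
        have gv: "\<gamma> j v \<in> carrier (C.F j)" by (rule cl[OF \<gamma>h v])
        have "g v \<oplus>\<^bsub>N\<^esub> g (\<gamma> j v \<ominus>\<^bsub>C.F j\<^esub> v) = g (\<gamma> j v)"
          using module_hom_add[OF gz(1) v, of "\<gamma> j v \<ominus>\<^bsub>C.F j\<^esub> v"] Fj.diff_add_cancel[OF gv v] gv v by (simp add: Fj.a_comm)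
        then show "?c f v = (g \<oplus>\<^bsub>C.H j\<^esub> c) v" using v ac[OF v] by (simp add: R.Hom_simps f_def c_def \<gamma>_def)
      qed
      have "?c f \<in> L'" unfolding e using H.submoduleD(3)[OF L'(1) g] cc L'(2) by auto
      then have "f \<in> ?p L" using fZ eq by blast
      then have "g \<oplus>\<^bsub>C.H j\<^esub> c \<in> L" using e by simp
      then have "(g \<oplus>\<^bsub>C.H j\<^esub> c) \<ominus>\<^bsub>C.H j\<^esub> c \<in> L" using H.submoduleD(6)[OF L(1)] cc L(2) by blast
      then show "g \<in> L" using H.add_diff_cancel[OF gH cH'] by simp
    qed
  qed auto
qed

text \<open>\<open>Ext\<close> uses a resolution picked by \<open>SOME\<close>; the comparison in
  both directions lets any resolution at hand compute the length.\<close>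

theorem module_length_Ext:
  assumes r: "free_resolution R M b D e" and N: "module R N"
  shows "module_length R (Ext R j M N) = chain_length (ext_subs R b D N j)"
proof -
  obtain b' D' e' where s: "(SOME (b, D, e). free_resolution R M b D e) = (b', D', e')" by (metis prod_cases3)
  have "case SOME (b, D, e). free_resolution R M b D e of (b, D, e) \<Rightarrow> free_resolution R M b D e"
    by (rule someI[of _ "(b, D, e)"]) (use r in simp)
  then have r': "free_resolution R M b' D' e'" unfolding s by simp
  interpret C': cochains R N b' D' by (intro cochains.intro R.is_cring N cochains_axioms.intro resolution_complex[OF r'])
  show ?thesis unfolding Ext_def s using ext_subs_resolution_le[OF r r' N] ext_subs_resolution_le[OF r' r N]
    by (auto simp: C'.module_length_cohomology intro!: antisym)
qed

end

section \<open>Finitely generated modules over Noetherian rings\<close>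

context module begin

text \<open>Finite generation of a submodule, phrased inside the ambient module instead of turning
  \<open>K\<close> into a module of its own.\<close>

definition finitely_spanned :: "'c set \<Rightarrow> bool" where
  "finitely_spanned K \<longleftrightarrow> (\<exists>S. finite S \<and> S \<subseteq> K \<and> (\<forall>T. submodule T R M \<longrightarrow> S \<subseteq> T \<longrightarrow> K \<subseteq> T))"

lemma finsum_submodule:
  assumes T: "submodule T R M" and "finite A" "\<And>i. i \<in> A \<Longrightarrow> f i \<in> T" shows "finsum M f A \<in> T"
  using assms(2,3)
proof (induction A rule: finite_induct)
  case (insert i A)
  have "f \<in> A \<rightarrow> carrier M" "f i \<in> carrier M" using insert submoduleD(1)[OF T] by auto
  then show ?case using insert submoduleD(3)[OF T] by (simp add: M.finsum_insert)
qed (use submoduleD(2)[OF T] in simp)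

lemma image_submodule:
  assumes X: "module R X" and f: "f \<in> module_hom R X M" shows "submodule (f ` carrier X) R M"
proof -
  interpret X: module R X by (rule X)
  show ?thesis unfolding submodule_iff
  proof (intro conjI ballI)
    show "f ` carrier X \<subseteq> carrier M" using module_hom_closed[OF f] by auto
    show "\<zero>\<^bsub>M\<^esub> \<in> f ` carrier X" using module_hom_zero[OF X module_axioms f] by (metis X.zero_closed imageI)
  next
    fix u v assume "u \<in> f ` carrier X" "v \<in> f ` carrier X"
    then show "u \<oplus>\<^bsub>M\<^esub> v \<in> f ` carrier X" using module_hom_add[OF f] by (auto simp: image_iff) (metis X.add.m_closed)
  next
    fix a v assume "a \<in> carrier R" "v \<in> f ` carrier X"
    then show "a \<odot>\<^bsub>M\<^esub> v \<in> f ` carrier X" using module_hom_smult[OF f] by (auto simp: image_iff) (metis X.smult_closed)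
  qed
qed

lemma vimage_submodule:
  assumes X: "module R X" and f: "f \<in> module_hom R X M" and T: "submodule T R M"
  shows "submodule {v \<in> carrier X. f v \<in> T} R X"
proof -
  interpret X: module R X by (rule X)
  show ?thesis unfolding X.submodule_iff
    using submoduleD[OF T] module_hom_zero[OF X module_axioms f] module_hom_add[OF f] module_hom_smult[OF f] by auto
qed

lemma finitely_spanned_hom:
  assumes K: "submodule K R M" and fs: "finitely_spanned K"
  shows "\<exists>m f. f \<in> module_hom R (free_module R m) M \<and> f ` carrier (free_module R m) = K"
proof -
  obtain S where S: "finite S" "S \<subseteq> K" "\<And>T. submodule T R M \<Longrightarrow> S \<subseteq> T \<Longrightarrow> K \<subseteq> T" using fs by (auto simp: finitely_spanned_def)
  obtain w m where w: "S = w ` {i::nat. i < m}" using finite_imp_nat_seg_image_inj_on[OF S(1)] by auto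
  have wK: "w i \<in> K" "w i \<in> S" if "i < m" for i using that w S(2) by auto
  have wc: "w i \<in> carrier M" if "i < m" for i using wK(1)[OF that] submoduleD(1)[OF K] by auto
  let ?f = "R.lincomb M m w"
  have l: "?f \<in> module_hom R (free_module R m) M" "i < m \<Longrightarrow> ?f (R.basis m i) = w i" for i
    using R.lincomb_hom[OF module_axioms wc] by auto
  have "?f ` carrier (free_module R m) \<subseteq> K"
  proof safe
    fix v assume v: "v \<in> carrier (free_module R m)"
    show "?f v \<in> K" unfolding R.lincomb_def
      by (rule finsum_submodule[OF K]) (use v wK submoduleD(4)[OF K] in \<open>auto simp: R.free_carrier\<close>)
  qed
  moreover have "S \<subseteq> ?f ` carrier (free_module R m)"
  proof
    fix s assume "s \<in> S"
    then obtain i where "i < m" "s = w i" using w by auto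
    then have "s = ?f (R.basis m i)" using l(2) by simp
    then show "s \<in> ?f ` carrier (free_module R m)" using R.basis_closed by (rule image_eqI)
  qed
  then have "K \<subseteq> ?f ` carrier (free_module R m)" by (rule S(3)[OF image_submodule[OF R.free_module_module l(1)]])
  ultimately show ?thesis using l(1) by blast
qed

lemma finitely_spanned_image:
  assumes X: "module R X" and f: "f \<in> module_hom R X M" "f ` carrier X = carrier M"
    and fs: "\<And>K. submodule K R X \<Longrightarrow> module.finitely_spanned R X K" and N: "submodule N R M"
  shows "finitely_spanned N"
proof -
  interpret X: module R X by (rule X)
  let ?K = "{v \<in> carrier X. f v \<in> N}"
  obtain S where S: "finite S" "S \<subseteq> ?K" "\<And>T. submodule T R X \<Longrightarrow> S \<subseteq> T \<Longrightarrow> ?K \<subseteq> T"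
    using fs[OF vimage_submodule[OF X f(1) N]] by (auto simp: X.finitely_spanned_def)
  have "N \<subseteq> T" if T: "submodule T R M" "f ` S \<subseteq> T" for T
  proof
    fix n assume n: "n \<in> N"
    then have "n \<in> f ` carrier X" using f(2) submoduleD(1)[OF N] by auto
    then obtain v where v: "v \<in> carrier X" "n = f v" by auto
    have "S \<subseteq> {v \<in> carrier X. f v \<in> T}" using S(2) T(2) by auto
    then have "?K \<subseteq> {v \<in> carrier X. f v \<in> T}" by (rule S(3)[OF vimage_submodule[OF X f(1) T(1)]])
    then show "n \<in> T" using v n by auto
  qed
  moreover have "finite (f ` S)" "f ` S \<subseteq> N" using S by auto
  ultimately show ?thesis unfolding finitely_spanned_def by blast
qed

lemma submodule_maximal_element:
  assumes fs: "\<And>K. submodule K R M \<Longrightarrow> finitely_spanned K" and "\<S> \<noteq> {}" "\<And>K. K \<in> \<S> \<Longrightarrow> submodule K R M"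
  shows "\<exists>K\<in>\<S>. \<forall>K'\<in>\<S>. K \<subseteq> K' \<longrightarrow> K' = K"
proof (rule subset_Zorn_nonempty[OF assms(2)])
  fix C assume C: "C \<noteq> {}" "subset.chain \<S> C"
  then have CS: "C \<subseteq> \<S>" by (auto simp: subset.chain_def)
  note sD = submoduleD[OF assms(3)]
  have ch: "c \<subseteq> c' \<or> c' \<subseteq> c" if "c \<in> C" "c' \<in> C" for c c' using C(2) that unfolding subset.chain_def by blast
  have "submodule (\<Union>C) R M" unfolding submodule_iff
  proof (intro conjI ballI)
    show "\<Union>C \<subseteq> carrier M" using sD(1) CS by blast
    show "\<zero>\<^bsub>M\<^esub> \<in> \<Union>C" using sD(2) CS C(1) by blast
  next
    fix u v assume "u \<in> \<Union>C" "v \<in> \<Union>C"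
    then obtain c where "c \<in> C" "u \<in> c" "v \<in> c" using ch by blast
    then show "u \<oplus>\<^bsub>M\<^esub> v \<in> \<Union>C" using sD(3) CS by blast
  next
    fix a v assume "a \<in> carrier R" "v \<in> \<Union>C"
    then show "a \<odot>\<^bsub>M\<^esub> v \<in> \<Union>C" using sD(4) CS by blast
  qed
  from fs[OF this] obtain S where S: "finite S" "S \<subseteq> \<Union>C" "\<forall>T. submodule T R M \<longrightarrow> S \<subseteq> T \<longrightarrow> \<Union>C \<subseteq> T"
    unfolding finitely_spanned_def by blast
  obtain c where c: "c \<in> C" "S \<subseteq> c"
    using finite_subset_Union_chain[OF S(1,2) C(1)] C(2) by blast
  then have "\<Union>C \<subseteq> c" using S(3) assms(3) CS by blast
  then have "\<Union>C = c" using c(1) by blast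
  then show "\<Union>C \<in> \<S>" using c(1) CS by auto
qed

end

context noetherian_cring begin

text \<open>Induction on the rank: the last coordinates of the elements of \<open>K\<close> form an
  ideal, which has finitely many generators, and the elements with last coordinate zero form a
  submodule of the free module of smaller rank.\<close>

lemma free_finitely_spanned:
  "submodule K R (free_module R n) \<Longrightarrow> module.finitely_spanned R (free_module R n) K"
proof (induction n arbitrary: K)
  case 0
  interpret F: module R "free_module R 0" by (rule free_module_module)
  have "K \<subseteq> T" if "submodule T R (free_module R 0)" for T
  proof
    fix v assume "v \<in> K"
    then have "v = \<zero>\<^bsub>free_module R 0\<^esub>" using F.submoduleD(1)[OF 0] by (intro free_eqI[of v 0]) auto
    then show "v \<in> T" using F.submoduleD(2)[OF that] by simp
  qed
  then show ?case unfolding F.finitely_spanned_def by (intro exI[of _ "{}"]) auto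
next
  case (Suc n)
  let ?F = "free_module R (Suc n)" and ?F' = "free_module R n"
  interpret F: module R ?F by (rule free_module_module)
  interpret F': module R ?F' by (rule free_module_module)
  note K = F.submoduleD[OF Suc.prems]
  have lead: "ideal ((\<lambda>v. v n) ` T) R" if T: "submodule T R ?F" for T
  proof (rule idealI')
    note t = F.submoduleD[OF T]
    show "(\<lambda>v. v n) ` T \<subseteq> carrier R" using t(1) by (auto simp: free_carrier)
    show "\<zero> \<in> (\<lambda>v. v n) ` T" using t(2) by (rule image_eqI[rotated]) (simp add: free_simps)
    fix a c assume "a \<in> (\<lambda>v. v n) ` T" "c \<in> (\<lambda>v. v n) ` T"
    then obtain u v where "u \<in> T" "v \<in> T" "a = u n" "c = v n" by auto
    then show "a \<oplus> c \<in> (\<lambda>v. v n) ` T" using t(3)[of u v] by (intro image_eqI[of _ _ "u \<oplus>\<^bsub>?F\<^esub> v"]) (auto simp: free_simps)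
  next
    note t = F.submoduleD[OF T]
    fix a c assume "a \<in> (\<lambda>v. v n) ` T" "c \<in> carrier R"
    then obtain u where "u \<in> T" "a = u n" by auto
    then show "c \<otimes> a \<in> (\<lambda>v. v n) ` T" using t(4)[OF \<open>c \<in> carrier R\<close>, of u] by (intro image_eqI[of _ _ "c \<odot>\<^bsub>?F\<^esub> u"]) (auto simp: free_simps)
  qed
  obtain A where A: "A \<subseteq> carrier R" "finite A" "(\<lambda>v. v n) ` K = Idl A" using finetely_gen[OF lead[OF Suc.prems]] by auto
  have "\<forall>a\<in>A. \<exists>v. v \<in> K \<and> v n = a"
  proof
    fix a assume "a \<in> A"
    then have "a \<in> (\<lambda>v. v n) ` K" using A(3) genideal_self[OF A(1)] by auto
    then show "\<exists>v. v \<in> K \<and> v n = a" by auto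
  qed
  from bchoice[OF this] obtain w where w: "\<And>a. a \<in> A \<Longrightarrow> w a \<in> K \<and> w a n = a" by auto
  define ext where "ext u = (\<lambda>i\<in>{..<Suc n}. if i < n then u i else \<zero>)" for u
  have ext_hom: "ext \<in> module_hom R ?F' ?F"
    by (rule module_homI) (auto simp: ext_def free_carrier free_simps intro!: restrict_ext)
  have ext_restrict: "ext (restrict v {..<n}) = v" if "v \<in> carrier ?F" "v n = \<zero>" for v
  proof (rule free_eqI[of _ "Suc n"])
    show "ext (restrict v {..<n}) \<in> carrier ?F" using that by (auto simp: ext_def free_carrier)
    fix i assume "i < Suc n"
    then show "ext (restrict v {..<n}) i = v i" using that by (auto simp: ext_def less_Suc_eq)
  qed (rule that)
  let ?K = "{u \<in> carrier ?F'. ext u \<in> K}"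
  have K': "submodule ?K R ?F'" by (rule F.vimage_submodule[OF free_module_module ext_hom Suc.prems])
  obtain S where S: "finite S" "S \<subseteq> ?K" "\<And>T. submodule T R ?F' \<Longrightarrow> S \<subseteq> T \<Longrightarrow> ?K \<subseteq> T"
    using Suc.IH[OF K'] unfolding F'.finitely_spanned_def by blast
  have "K \<subseteq> T" if T: "submodule T R ?F" "w ` A \<union> ext ` S \<subseteq> T" for T
  proof
    fix v assume v: "v \<in> K"
    note t = F.submoduleD[OF T(1)]
    \<comment> \<open>Working in \<open>K \<inter> T\<close> produces an element \<open>u\<close>
      with the last coordinate of \<open>v\<close> for which the difference still lies in
      \<open>K\<close>.\<close>
    have KT: "submodule (K \<inter> T) R ?F" unfolding F.submodule_iff using K t by auto
    have "A \<subseteq> (\<lambda>v. v n) ` (K \<inter> T)"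
    proof
      fix a assume "a \<in> A"
      then have "w a \<in> K \<inter> T" "w a n = a" using w T(2) by auto
      then show "a \<in> (\<lambda>v. v n) ` (K \<inter> T)" by (metis imageI)
    qed
    then have "Idl A \<subseteq> (\<lambda>v. v n) ` (K \<inter> T)" by (rule genideal_minimal[OF lead[OF KT]])
    then have "v n \<in> (\<lambda>v. v n) ` (K \<inter> T)" using v A(3) by blast
    then obtain u where u: "u \<in> K" "u \<in> T" "v n = u n" by auto
    have c: "u \<in> carrier ?F" "v \<in> carrier ?F" using K(1) u v by auto
    let ?d = "v \<ominus>\<^bsub>?F\<^esub> u"
    have d: "?d \<in> K" by (rule K(6)[OF v u(1)])
    have dc: "?d \<in> carrier ?F" using c by simp
    have vd: "v = ?d \<oplus>\<^bsub>?F\<^esub> u" using F.diff_add_cancel[OF c(2,1)] by simp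
    have "v n = ?d n \<oplus> u n" by (subst vd) (simp add: free_simps)
    moreover have "?d n \<in> carrier R" "u n \<in> carrier R" using dc c(1) by (auto simp: free_carrier)
    ultimately have dn: "?d n = \<zero>" using u(3) by (metis add.l_cancel_one' add.m_comm)
    have rc: "restrict ?d {..<n} \<in> carrier ?F'" using dc by (auto simp: free_carrier)
    have "restrict ?d {..<n} \<in> ?K" using rc ext_restrict[OF dc dn] d by simp
    moreover have "?K \<subseteq> {u \<in> carrier ?F'. ext u \<in> T}"
      by (rule S(3)[OF F.vimage_submodule[OF free_module_module ext_hom T(1)]]) (use S(2) T(2) in auto)
    ultimately have "?d \<in> T" using ext_restrict[OF dc dn] by auto
    then show "v \<in> T" by (subst vd) (rule t(3)[OF _ u(2)])
  qed
  moreover have "finite (w ` A \<union> ext ` S)" "w ` A \<union> ext ` S \<subseteq> K" using A S w by auto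
  ultimately show ?case unfolding F.finitely_spanned_def by blast
qed

lemma finitely_generated_cover:
  assumes M: "module R M" and fg: "finitely_generated R M"
  shows "\<exists>n e. e \<in> module_hom R (free_module R n) M \<and> e ` carrier (free_module R n) = carrier M"
proof -
  interpret M: module R M by (rule M)
  obtain A where A: "finite A" "A \<subseteq> carrier M" "module_span R M A = carrier M" using fg by (auto simp: finitely_generated_def)
  have "M.finitely_spanned (carrier M)" unfolding M.finitely_spanned_def
    using A unfolding module_span_def by (intro exI[of _ A]) auto
  then show ?thesis by (rule M.finitely_spanned_hom[OF M.carrier_is_submodule])
qed

lemma finitely_generated_finitely_spanned:
  assumes M: "module R M" and fg: "finitely_generated R M" and N: "submodule N R M"
  shows "module.finitely_spanned R M N"
proof -
  interpret M: module R M by (rule M)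
  from finitely_generated_cover[OF M fg] obtain n e where
    "e \<in> module_hom R (free_module R n) M" "e ` carrier (free_module R n) = carrier M" by blast
  then show ?thesis by (rule M.finitely_spanned_image[OF free_module_module _ _ free_finitely_spanned N])
qed

lemma kernel_cover:
  assumes M: "module R M" and f: "f \<in> module_hom R (free_module R n) M"
  shows "\<exists>m D. D \<in> module_hom R (free_module R m) (free_module R n) \<and>
    D ` carrier (free_module R m) = a_kernel (free_module R n) M f"
proof -
  interpret M: module R M by (rule M)
  interpret F: module R "free_module R n" by (rule free_module_module)
  have "submodule {\<zero>\<^bsub>M\<^esub>} R M" unfolding M.submodule_iff by auto
  from M.vimage_submodule[OF free_module_module f this]
  have k: "submodule (a_kernel (free_module R n) M f) R (free_module R n)"
    by (simp add: a_kernel_def kernel_def)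
  show ?thesis by (rule F.finitely_spanned_hom[OF k free_finitely_spanned[OF k]])
qed

theorem free_resolution_exists:
  assumes M: "module R M" and fg: "finitely_generated R M"
  shows "\<exists>b D e. free_resolution R M b D e"
proof -
  obtain n e where e: "e \<in> module_hom R (free_module R n) M" "e ` carrier (free_module R n) = carrier M"
    using finitely_generated_cover[OF M fg] by blast
  \<comment> \<open>A stage of the construction is a triple of source rank, target rank and
    differential; \<open>?Q\<close> glues consecutive stages by exactness.\<close>
  let ?D = "\<lambda>x :: nat \<times> nat \<times> ((nat \<Rightarrow> 'a) \<Rightarrow> (nat \<Rightarrow> 'a)). snd (snd x)" and ?src = "\<lambda>x. fst x" and ?tgt = "\<lambda>x. fst (snd x)"
  let ?P = "\<lambda>i x. ?D x \<in> module_hom R (free_module R (?src x)) (free_module R (?tgt x)) \<and>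
    (i = (0::nat) \<longrightarrow> ?tgt x = n \<and> ?D x ` carrier (free_module R (?src x)) = a_kernel (free_module R n) M e)"
  let ?Q = "\<lambda>(i::nat) x y. ?tgt y = ?src x \<and> ?D y ` carrier (free_module R (?src y)) =
    a_kernel (free_module R (?src x)) (free_module R (?tgt x)) (?D x)"
  have "\<exists>f. \<forall>i. ?P i (f i) \<and> ?Q i (f i) (f (Suc i))"
  proof (rule dependent_nat_choice)
    obtain m D where "D \<in> module_hom R (free_module R m) (free_module R n)"
      "D ` carrier (free_module R m) = a_kernel (free_module R n) M e" using kernel_cover[OF M e(1)] by blast
    then have "?P 0 (m, n, D)" by simp
    then show "\<exists>x. ?P 0 x" by blast
  next
    fix x i assume "?P i x"
    then obtain m D where "D \<in> module_hom R (free_module R m) (free_module R (?src x))"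
      "D ` carrier (free_module R m) = a_kernel (free_module R (?src x)) (free_module R (?tgt x)) (?D x)"
      using kernel_cover[OF free_module_module, of "?D x" "?src x" "?tgt x"] by blast
    then have "?P (Suc i) (m, ?src x, D) \<and> ?Q i x (m, ?src x, D)" by simp
    then show "\<exists>y. ?P (Suc i) y \<and> ?Q i x y" by blast
  qed
  then obtain f where f: "\<forall>i. ?P i (f i) \<and> ?Q i (f i) (f (Suc i))" by (elim exE)
  let ?b = "\<lambda>i. case i of 0 \<Rightarrow> n | Suc i \<Rightarrow> ?src (f i)" and ?d = "\<lambda>i. ?D (f i)"
  have tgt: "?tgt (f i) = ?b i" for i
    using spec[OF f, of 0] spec[OF f, of "i - 1"] by (cases i) auto
  have "free_resolution R M ?b ?d e" unfolding free_resolution_def Let_def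
  proof (intro conjI allI)
    show "e \<in> module_hom R (free_module R (?b 0)) M" "e ` carrier (free_module R (?b 0)) = carrier M" using e by auto
    show "?d i \<in> module_hom R (free_module R (?b (Suc i))) (free_module R (?b i))" for i
      using spec[OF f, of i] tgt[of i] by simp
    show "?d 0 ` carrier (free_module R (?b 1)) = a_kernel (free_module R (?b 0)) M e" using spec[OF f, of 0] by simp
    show "?d (Suc i) ` carrier (free_module R (?b (Suc (Suc i)))) =
        a_kernel (free_module R (?b (Suc i))) (free_module R (?b i)) (?d i)" for i
      using spec[OF f, of i] tgt[of i] by simp
  qed
  then show ?thesis by blast
qed

end

section \<open>Regular sequences and dimension\<close>

context module begin

lemma module_span_submodule:
  assumes "S \<subseteq> carrier M" shows "submodule (module_span R M S) R M"
  unfolding submodule_iff module_span_def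
  using carrier_is_submodule assms submoduleD by (auto simp: Inter_iff)

lemma module_span_minimal: "submodule T R M \<Longrightarrow> S \<subseteq> T \<Longrightarrow> module_span R M S \<subseteq> T"
  unfolding module_span_def by blast

lemma module_span_self: "S \<subseteq> module_span R M S"
  unfolding module_span_def by blast

lemma ideal_smult_submodule: "ideal J R \<Longrightarrow> submodule (ideal_smult R J M) R M"
  unfolding ideal_smult_def by (rule module_span_submodule) (auto simp: ideal.Icarr)

lemma ideal_smult_mem: "a \<in> J \<Longrightarrow> v \<in> carrier M \<Longrightarrow> a \<odot>\<^bsub>M\<^esub> v \<in> ideal_smult R J M"
  unfolding ideal_smult_def by (rule subsetD[OF module_span_self]) blast

lemma ideal_smult_minimal:
  "submodule T R M \<Longrightarrow> (\<And>a v. a \<in> J \<Longrightarrow> v \<in> carrier M \<Longrightarrow> a \<odot>\<^bsub>M\<^esub> v \<in> T) \<Longrightarrow> ideal_smult R J M \<subseteq> T"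
  unfolding ideal_smult_def by (rule module_span_minimal) auto

lemma ideal_smult_insert:
  assumes A: "A \<subseteq> carrier R" and x: "x \<in> carrier R" and v: "v \<in> ideal_smult R (Idl (insert x A)) M"
  shows "\<exists>n\<in>ideal_smult R (Idl A) M. \<exists>u\<in>carrier M. v = n \<oplus>\<^bsub>M\<^esub> x \<odot>\<^bsub>M\<^esub> u"
proof -
  let ?N = "ideal_smult R (Idl A) M"
  let ?T = "{n \<oplus>\<^bsub>M\<^esub> x \<odot>\<^bsub>M\<^esub> u | n u. n \<in> ?N \<and> u \<in> carrier M}"
  have N: "submodule ?N R M" by (rule ideal_smult_submodule[OF R.genideal_ideal[OF A]])
  note n = submoduleD[OF N]
  have "submodule ?T R M" unfolding submodule_iff
  proof (intro conjI ballI)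
    show "?T \<subseteq> carrier M" using n(1) x by auto
    show "\<zero>\<^bsub>M\<^esub> \<in> ?T" using n(2) x by (force intro: exI[of _ "\<zero>\<^bsub>M\<^esub>"])
  next
    fix s t assume "s \<in> ?T" "t \<in> ?T"
    then obtain a u a' u' where h: "a \<in> ?N" "u \<in> carrier M" "s = a \<oplus>\<^bsub>M\<^esub> x \<odot>\<^bsub>M\<^esub> u" "a' \<in> ?N" "u' \<in> carrier M"
      "t = a' \<oplus>\<^bsub>M\<^esub> x \<odot>\<^bsub>M\<^esub> u'" by auto
    have "s \<oplus>\<^bsub>M\<^esub> t = (a \<oplus>\<^bsub>M\<^esub> a') \<oplus>\<^bsub>M\<^esub> x \<odot>\<^bsub>M\<^esub> (u \<oplus>\<^bsub>M\<^esub> u')" using h n(1) x by (simp add: smult_r_distr M.a_ac)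
    then show "s \<oplus>\<^bsub>M\<^esub> t \<in> ?T" using h n(3) by blast
  next
    fix c s assume c: "c \<in> carrier R" and "s \<in> ?T"
    then obtain a u where h: "a \<in> ?N" "u \<in> carrier M" "s = a \<oplus>\<^bsub>M\<^esub> x \<odot>\<^bsub>M\<^esub> u" by auto
    have "c \<odot>\<^bsub>M\<^esub> s = c \<odot>\<^bsub>M\<^esub> a \<oplus>\<^bsub>M\<^esub> x \<odot>\<^bsub>M\<^esub> (c \<odot>\<^bsub>M\<^esub> u)"
      using h n(1) x c by (simp add: smult_r_distr smult_assoc1[symmetric] R.m_comm)
    then show "c \<odot>\<^bsub>M\<^esub> s \<in> ?T" using h n(4)[OF c] smult_closed[OF c] by blast
  qed
  then have "ideal_smult R (Idl (insert x A)) M \<subseteq> ?T"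
  proof (rule ideal_smult_minimal)
    fix a u assume a: "a \<in> Idl (insert x A)" and u: "u \<in> carrier M"
    obtain c j where c: "c \<in> carrier R" "j \<in> Idl A" "a = c \<otimes> x \<oplus> j" using R.mem_Idl_insert[OF x A] a by auto
    have jc: "j \<in> carrier R" using c(2) R.ideal_memD(1)[OF R.genideal_ideal[OF A]] by auto
    have "a \<odot>\<^bsub>M\<^esub> u = j \<odot>\<^bsub>M\<^esub> u \<oplus>\<^bsub>M\<^esub> x \<odot>\<^bsub>M\<^esub> (c \<odot>\<^bsub>M\<^esub> u)"
      unfolding c(3) using c(1) jc x u by (simp add: smult_l_distr smult_assoc1[symmetric] R.m_comm M.a_comm)
    then show "a \<odot>\<^bsub>M\<^esub> u \<in> ?T" using ideal_smult_mem[OF c(2) u] smult_closed[OF c(1) u] by blast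
  qed
  then show ?thesis using v by blast
qed

definition module_colon where "module_colon N b = {a \<in> carrier R. a \<odot>\<^bsub>M\<^esub> b \<in> N}"

lemma module_colon_ideal: "submodule N R M \<Longrightarrow> b \<in> carrier M \<Longrightarrow> ideal (module_colon N b) R"
  unfolding module_colon_def
  by (rule R.idealI') (auto simp: submoduleD smult_l_distr smult_assoc1)

end

section \<open>Primes annihilating module elements along a regular sequence\<close>

context noetherian_cring begin

text \<open>An annihilator that is maximal among those of nonzero classes modulo \<open>N\<close> is
  prime; here it is sought above the annihilator of \<open>b\<close>.\<close>

lemma module_colon_prime_above:
  assumes M: "module R M" and N: "submodule N R M" and b: "b \<in> carrier M" "b \<notin> N"
  shows "\<exists>P a. primeideal P R \<and> module.module_colon R M N b \<subseteq> P \<and> a \<in> carrier M \<and> a \<notin> N \<and> (\<forall>q\<in>P. q \<odot>\<^bsub>M\<^esub> a \<in> N)"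
proof -
  interpret M: module R M by (rule M)
  let ?\<S> = "{M.module_colon N c | c. c \<in> carrier M \<and> c \<notin> N \<and> M.module_colon N b \<subseteq> M.module_colon N c}"
  have "\<exists>K\<in>?\<S>. \<forall>J\<in>?\<S>. K \<subseteq> J \<longrightarrow> J = K"
  proof (rule ideal_maximal_element)
    show "?\<S> \<noteq> {}" using b by blast
    fix J assume "J \<in> ?\<S>"
    then show "ideal J R" using M.module_colon_ideal[OF N] by auto
  qed
  then obtain K where K: "K \<in> ?\<S>" "\<forall>J\<in>?\<S>. K \<subseteq> J \<longrightarrow> J = K" by (rule bexE)
  from K(1) obtain a where a: "a \<in> carrier M" "a \<notin> N" "M.module_colon N b \<subseteq> M.module_colon N a"
    and Ka: "K = M.module_colon N a" by auto
  have max: "M.module_colon N c = M.module_colon N a"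
    if "c \<in> carrier M" "c \<notin> N" "M.module_colon N a \<subseteq> M.module_colon N c" for c
    using bspec[OF K(2), of "M.module_colon N c"] that a(3) unfolding Ka by blast
  have mem: "q \<in> M.module_colon N c \<longleftrightarrow> q \<in> carrier R \<and> q \<odot>\<^bsub>M\<^esub> c \<in> N" for q c by (simp add: M.module_colon_def)
  have "primeideal (M.module_colon N a) R"
  proof (rule primeidealI'[OF M.module_colon_ideal[OF N a(1)]])
    show "\<one> \<notin> M.module_colon N a" using a by (simp add: mem)
    fix s t assume st: "s \<in> carrier R" "t \<in> carrier R" "s \<otimes> t \<in> M.module_colon N a"
    show "s \<in> M.module_colon N a \<or> t \<in> M.module_colon N a"
    proof (rule disjCI)
      assume t: "t \<notin> M.module_colon N a"
      have "M.module_colon N (t \<odot>\<^bsub>M\<^esub> a) = M.module_colon N a"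
      proof (rule max)
        show "t \<odot>\<^bsub>M\<^esub> a \<in> carrier M" using st a by simp
        show "t \<odot>\<^bsub>M\<^esub> a \<notin> N" using t st by (simp add: mem)
        show "M.module_colon N a \<subseteq> M.module_colon N (t \<odot>\<^bsub>M\<^esub> a)"
        proof
          fix q assume q: "q \<in> M.module_colon N a"
          then have qc: "q \<in> carrier R" by (simp add: mem)
          have "q \<odot>\<^bsub>M\<^esub> (t \<odot>\<^bsub>M\<^esub> a) = t \<odot>\<^bsub>M\<^esub> (q \<odot>\<^bsub>M\<^esub> a)"
            using M.smult_assoc1[OF qc st(2) a(1)] M.smult_assoc1[OF st(2) qc a(1)] m_comm[OF qc st(2)] by simp
          then show "q \<in> M.module_colon N (t \<odot>\<^bsub>M\<^esub> a)" using q M.submoduleD(4)[OF N st(2)] by (simp add: mem)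
        qed
      qed
      moreover have "s \<in> M.module_colon N (t \<odot>\<^bsub>M\<^esub> a)" using st a(1) by (simp add: mem M.smult_assoc1)
      ultimately show "s \<in> M.module_colon N a" by simp
    qed
  qed
  then show ?thesis using a mem by (intro exI[of _ "M.module_colon N a"] exI[of _ a]) auto
qed

end

context noetherian_local begin

text \<open>Among the elements outside \<open>?N\<close> that \<open>Q\<close> kills modulo
  \<open>?N\<close>, one that spans a maximal submodule together with \<open>?N\<close> stays
  nonzero modulo \<open>?N'\<close>. There it is killed by \<open>Q\<close> and by \<open>x\<close>,
  and a prime over its annihilator contains \<open>Q\<close> strictly, since regularity keeps
  \<open>x\<close> out of \<open>Q\<close>.\<close>

lemma regular_step:
  assumes M: "module R M" and fg: "finitely_generated R M"
    and A: "A \<subseteq> carrier R" and x: "x \<in> \<mm>"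
    and reg: "\<And>v. v \<in> carrier M \<Longrightarrow> x \<odot>\<^bsub>M\<^esub> v \<in> ideal_smult R (Idl A) M \<Longrightarrow> v \<in> ideal_smult R (Idl A) M"
    and Q: "primeideal Q R" and a: "a \<in> carrier M" "a \<notin> ideal_smult R (Idl A) M" "\<forall>q\<in>Q. q \<odot>\<^bsub>M\<^esub> a \<in> ideal_smult R (Idl A) M"
  shows "\<exists>Q' a'. primeideal Q' R \<and> Q \<subset> Q' \<and> a' \<in> carrier M \<and> a' \<notin> ideal_smult R (Idl (insert x A)) M \<and>
    (\<forall>q\<in>Q'. q \<odot>\<^bsub>M\<^esub> a' \<in> ideal_smult R (Idl (insert x A)) M)"
proof -
  interpret M: module R M by (rule M)
  let ?N = "ideal_smult R (Idl A) M" and ?N' = "ideal_smult R (Idl (insert x A)) M"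
  have xc: "x \<in> carrier R" using ideal_memD(1)[OF mm_ideal] x by auto
  have xA: "insert x A \<subseteq> carrier R" using xc A by auto
  have N: "submodule ?N R M" by (rule M.ideal_smult_submodule[OF genideal_ideal[OF A]])
  have N': "submodule ?N' R M" by (rule M.ideal_smult_submodule[OF genideal_ideal[OF xA]])
  note n = M.submoduleD[OF N]
  have "Idl A \<subseteq> Idl (insert x A)" by (rule genideal_minimal[OF genideal_ideal[OF xA]]) (use genideal_self[OF xA] in auto)
  then have NN': "?N \<subseteq> ?N'" by (intro M.ideal_smult_minimal[OF N'] M.ideal_smult_mem) auto
  have xN': "x \<odot>\<^bsub>M\<^esub> v \<in> ?N'" if "v \<in> carrier M" for v
    by (rule M.ideal_smult_mem[OF _ that]) (use genideal_self[OF xA] in auto)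
  have Qc: "q \<in> Q \<Longrightarrow> q \<in> carrier R" for q using ideal_memD(1)[OF primeideal_memD(1)[OF Q]] by auto
  define S where "S b = {k \<oplus>\<^bsub>M\<^esub> c \<odot>\<^bsub>M\<^esub> b | k c. k \<in> ?N \<and> c \<in> carrier R}" for b
  have S: "submodule (S b) R M" if b: "b \<in> carrier M" for b
    unfolding M.submodule_iff
  proof (intro conjI ballI)
    show "S b \<subseteq> carrier M" using n(1) b by (auto simp: S_def)
    have "\<zero>\<^bsub>M\<^esub> = \<zero>\<^bsub>M\<^esub> \<oplus>\<^bsub>M\<^esub> \<zero> \<odot>\<^bsub>M\<^esub> b" using b by simp
    then show "\<zero>\<^bsub>M\<^esub> \<in> S b" unfolding S_def using n(2) zero_closed by blast
  next
    fix s t assume "s \<in> S b" "t \<in> S b"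
    then obtain k c k' c' where h: "k \<in> ?N" "c \<in> carrier R" "s = k \<oplus>\<^bsub>M\<^esub> c \<odot>\<^bsub>M\<^esub> b" "k' \<in> ?N" "c' \<in> carrier R" "t = k' \<oplus>\<^bsub>M\<^esub> c' \<odot>\<^bsub>M\<^esub> b"
      by (auto simp: S_def)
    have "s \<oplus>\<^bsub>M\<^esub> t = (k \<oplus>\<^bsub>M\<^esub> k') \<oplus>\<^bsub>M\<^esub> (c \<oplus> c') \<odot>\<^bsub>M\<^esub> b" using h n(1) b by (simp add: M.smult_l_distr M.a_ac)
    then show "s \<oplus>\<^bsub>M\<^esub> t \<in> S b" unfolding S_def using h n(3) by blast
  next
    fix r s assume r: "r \<in> carrier R" and "s \<in> S b"
    then obtain k c where h: "k \<in> ?N" "c \<in> carrier R" "s = k \<oplus>\<^bsub>M\<^esub> c \<odot>\<^bsub>M\<^esub> b" by (auto simp: S_def)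
    have "r \<odot>\<^bsub>M\<^esub> s = r \<odot>\<^bsub>M\<^esub> k \<oplus>\<^bsub>M\<^esub> (r \<otimes> c) \<odot>\<^bsub>M\<^esub> b" using h n(1) b r by (simp add: M.smult_r_distr M.smult_assoc1)
    then show "r \<odot>\<^bsub>M\<^esub> s \<in> S b" unfolding S_def using h n(4)[OF r] r by blast
  qed
  have S_self: "b \<in> S b" if b: "b \<in> carrier M" for b
  proof -
    have "b = \<zero>\<^bsub>M\<^esub> \<oplus>\<^bsub>M\<^esub> \<one> \<odot>\<^bsub>M\<^esub> b" using b by simp
    then show ?thesis unfolding S_def using n(2) one_closed by blast
  qed
  let ?L = "{b \<in> carrier M. b \<notin> ?N \<and> (\<forall>q\<in>Q. q \<odot>\<^bsub>M\<^esub> b \<in> ?N)}"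
  have "\<exists>K\<in>S ` ?L. \<forall>K'\<in>S ` ?L. K \<subseteq> K' \<longrightarrow> K' = K"
  proof (rule M.submodule_maximal_element)
    show "M.finitely_spanned K" if "submodule K R M" for K by (rule finitely_generated_finitely_spanned[OF M fg that])
    show "S ` ?L \<noteq> {}" using a by auto
    show "submodule K R M" if "K \<in> S ` ?L" for K using that S by auto
  qed
  then obtain K where K: "K \<in> S ` ?L" "\<forall>K'\<in>S ` ?L. K \<subseteq> K' \<longrightarrow> K' = K" by (rule bexE)
  from K(1) obtain b0 where Kb: "K = S b0" and b0L: "b0 \<in> ?L" by (rule imageE)
  have b0: "b0 \<in> carrier M" "b0 \<notin> ?N" "q \<in> Q \<Longrightarrow> q \<odot>\<^bsub>M\<^esub> b0 \<in> ?N" for q using b0L by simp_all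
  have max: "S b = S b0" if "b \<in> ?L" "S b0 \<subseteq> S b" for b
    using bspec[OF K(2) imageI[OF that(1)]] that(2) unfolding Kb by simp
  \<comment> \<open>If \<open>b0\<close> is \<open>x\<close> times \<open>u\<close> modulo
    \<open>?N\<close>, regularity of \<open>x\<close> shows that \<open>Q\<close> kills
    \<open>u\<close> as well, and maximality makes \<open>u\<close> a multiple of \<open>b0\<close>
    modulo \<open>?N\<close>. Then \<open>\<one> \<ominus> c \<otimes> x\<close> sends
    \<open>u\<close> into \<open>?N\<close>, and this factor is a unit.\<close>
  have b0N': "b0 \<notin> ?N'"
  proof
    assume "b0 \<in> ?N'"
    then obtain k u where ku: "k \<in> ?N" "u \<in> carrier M" "b0 = k \<oplus>\<^bsub>M\<^esub> x \<odot>\<^bsub>M\<^esub> u" using M.ideal_smult_insert[OF A xc] by blast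
    have kc: "k \<in> carrier M" using n(1)[OF ku(1)] .
    have "q \<odot>\<^bsub>M\<^esub> u \<in> ?N" if q: "q \<in> Q" for q
    proof (rule reg)
      show "q \<odot>\<^bsub>M\<^esub> u \<in> carrier M" using Qc[OF q] ku by simp
      have "q \<odot>\<^bsub>M\<^esub> b0 = q \<odot>\<^bsub>M\<^esub> k \<oplus>\<^bsub>M\<^esub> q \<odot>\<^bsub>M\<^esub> (x \<odot>\<^bsub>M\<^esub> u)" using ku kc xc Qc[OF q] by (simp add: M.smult_r_distr)
      also have "q \<odot>\<^bsub>M\<^esub> (x \<odot>\<^bsub>M\<^esub> u) = x \<odot>\<^bsub>M\<^esub> (q \<odot>\<^bsub>M\<^esub> u)"
        using M.smult_assoc1[OF Qc[OF q] xc ku(2)] M.smult_assoc1[OF xc Qc[OF q] ku(2)] m_comm[OF xc Qc[OF q]] by simp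
      finally have e: "q \<odot>\<^bsub>M\<^esub> b0 = x \<odot>\<^bsub>M\<^esub> (q \<odot>\<^bsub>M\<^esub> u) \<oplus>\<^bsub>M\<^esub> q \<odot>\<^bsub>M\<^esub> k" using xc Qc[OF q] ku kc by (simp add: M.a_comm)
      have "(q \<odot>\<^bsub>M\<^esub> b0) \<ominus>\<^bsub>M\<^esub> (q \<odot>\<^bsub>M\<^esub> k) \<in> ?N" by (rule n(6)[OF b0(3)[OF q] n(4)[OF Qc[OF q] ku(1)]])
      then show "x \<odot>\<^bsub>M\<^esub> (q \<odot>\<^bsub>M\<^esub> u) \<in> ?N" unfolding e using M.add_diff_cancel xc Qc[OF q] ku kc by simp
    qed
    moreover have "u \<notin> ?N"
    proof
      assume "u \<in> ?N"
      then have "k \<oplus>\<^bsub>M\<^esub> x \<odot>\<^bsub>M\<^esub> u \<in> ?N" by (intro n(3)[OF ku(1)] n(4)[OF xc])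
      then show False using ku(3) b0(2) by simp
    qed
    ultimately have uL: "u \<in> ?L" using ku by auto
    have "S b0 \<subseteq> S u"
    proof
      fix s assume "s \<in> S b0"
      then obtain l c where l: "l \<in> ?N" "c \<in> carrier R" "s = l \<oplus>\<^bsub>M\<^esub> c \<odot>\<^bsub>M\<^esub> b0" by (auto simp: S_def)
      note us = M.submoduleD[OF S[OF ku(2)]]
      have NS: "?N \<subseteq> S u"
      proof
        fix y assume y: "y \<in> ?N"
        then have "y = y \<oplus>\<^bsub>M\<^esub> \<zero> \<odot>\<^bsub>M\<^esub> u" using n(1) ku(2) by simp
        then show "y \<in> S u" unfolding S_def using y zero_closed by blast
      qed
      have "b0 \<in> S u" unfolding ku(3) by (rule us(3)) (use NS ku(1) us(4)[OF xc S_self[OF ku(2)]] in auto)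
      then show "s \<in> S u" unfolding l(3) using NS l us(3,4) by blast
    qed
    from max[OF uL this] have "u \<in> S b0" using S_self[OF ku(2)] by simp
    then obtain l c where l: "l \<in> ?N" "c \<in> carrier R" "u = l \<oplus>\<^bsub>M\<^esub> c \<odot>\<^bsub>M\<^esub> b0" by (auto simp: S_def)
    have lc: "l \<in> carrier M" using n(1)[OF l(1)] .
    let ?y = "l \<oplus>\<^bsub>M\<^esub> c \<odot>\<^bsub>M\<^esub> k"
    have yN: "?y \<in> ?N" by (intro n(3)[OF l(1)] n(4)[OF l(2)] ku(1))
    have yc: "?y \<in> carrier M" using n(1)[OF yN] .
    have "u = l \<oplus>\<^bsub>M\<^esub> c \<odot>\<^bsub>M\<^esub> (k \<oplus>\<^bsub>M\<^esub> x \<odot>\<^bsub>M\<^esub> u)" using l(3) ku(3) by simp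
    also have "\<dots> = ?y \<oplus>\<^bsub>M\<^esub> (c \<otimes> x) \<odot>\<^bsub>M\<^esub> u" using lc kc xc l(2) ku(2) by (simp add: M.smult_r_distr M.smult_assoc1 M.a_assoc)
    finally have u: "u = ?y \<oplus>\<^bsub>M\<^esub> (c \<otimes> x) \<odot>\<^bsub>M\<^esub> u" .
    let ?g = "\<one> \<ominus> c \<otimes> x"
    have gc: "?g \<in> carrier R" using l(2) xc by simp
    have "?g \<odot>\<^bsub>M\<^esub> u \<oplus>\<^bsub>M\<^esub> (c \<otimes> x) \<odot>\<^bsub>M\<^esub> u = (?g \<oplus> c \<otimes> x) \<odot>\<^bsub>M\<^esub> u" using gc l(2) xc ku(2) by (simp add: M.smult_l_distr)
    also have "?g \<oplus> c \<otimes> x = \<one>" using l(2) xc by (algebra)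
    finally have "?g \<odot>\<^bsub>M\<^esub> u \<oplus>\<^bsub>M\<^esub> (c \<otimes> x) \<odot>\<^bsub>M\<^esub> u = ?y \<oplus>\<^bsub>M\<^esub> (c \<otimes> x) \<odot>\<^bsub>M\<^esub> u" using ku(2) u by simp
    then have gu: "?g \<odot>\<^bsub>M\<^esub> u \<in> ?N" using yN yc gc l(2) xc ku(2) by simp
    have "?g \<notin> \<mm>"
    proof
      assume "?g \<in> \<mm>"
      then have "?g \<oplus> c \<otimes> x \<in> \<mm>" using ideal_memD(3,6)[OF mm_ideal] x l(2) by auto
      moreover have "?g \<oplus> c \<otimes> x = \<one>" using l(2) xc by (algebra)
      ultimately show False using one_notin_mm by simp
    qed
    then obtain w where w: "w \<in> carrier R" "w \<otimes> ?g = \<one>" using unit_outside[OF gc] by auto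
    have "w \<odot>\<^bsub>M\<^esub> (?g \<odot>\<^bsub>M\<^esub> u) = u" using M.smult_assoc1[OF w(1) gc ku(2)] w(2) ku(2) by simp
    then have "u \<in> ?N" using n(4)[OF w(1) gu] by simp
    then show False using \<open>u \<notin> ?N\<close> by simp
  qed
  obtain P a' where P: "primeideal P R" "M.module_colon ?N' b0 \<subseteq> P" "a' \<in> carrier M" "a' \<notin> ?N'" "\<forall>q\<in>P. q \<odot>\<^bsub>M\<^esub> a' \<in> ?N'"
    using module_colon_prime_above[OF M N' b0(1) b0N'] by blast
  have "Q \<subseteq> P"
  proof
    fix q assume "q \<in> Q"
    then have "q \<in> M.module_colon ?N' b0" using Qc b0(3) NN' by (auto simp: M.module_colon_def)
    then show "q \<in> P" using P(2) by auto
  qed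
  moreover have "x \<in> P" using P(2) xN'[OF b0(1)] xc by (auto simp: M.module_colon_def)
  moreover have "x \<notin> Q" using reg[OF a(1)] a by auto
  ultimately show ?thesis using P by blast
qed

text \<open>Iterates \<open>regular_step\<close>. With \<open>k\<close> the length of the sequence
  this is the classical bound of the depth of \<open>M\<close> by the dimension of \<open>R\<close>
  modulo an associated prime.\<close>

lemma regular_sequence_prime_chain:
  assumes M: "module R M" and fg: "finitely_generated R M"
    and xs: "regular_sequence R M xs" "set xs \<subseteq> \<mm>"
    and Q: "primeideal Q R" and a: "a \<in> carrier M" "a \<noteq> \<zero>\<^bsub>M\<^esub>" "\<forall>q\<in>Q. q \<odot>\<^bsub>M\<^esub> a = \<zero>\<^bsub>M\<^esub>"
    and k: "k \<le> length xs"
  shows "\<exists>P a'. P 0 = Q \<and> (\<forall>i\<le>k. primeideal (P i) R) \<and> (\<forall>i<k. P i \<subset> P (Suc i)) \<and>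
    a' \<in> carrier M \<and> a' \<notin> ideal_smult R (Idl (set (take k xs))) M \<and>
    (\<forall>q\<in>P k. q \<odot>\<^bsub>M\<^esub> a' \<in> ideal_smult R (Idl (set (take k xs))) M)"
  using k
proof (induction k)
  case 0
  interpret M: module R M by (rule M)
  have Z: "submodule {\<zero>\<^bsub>M\<^esub>} R M" unfolding M.submodule_iff by auto
  have I0: "Idl {} \<subseteq> {\<zero>}" by (rule genideal_minimal[OF zeroideal]) auto
  have "ideal_smult R (Idl {}) M \<subseteq> {\<zero>\<^bsub>M\<^esub>}"
    by (rule M.ideal_smult_minimal[OF Z]) (use I0 in auto)
  moreover have "\<zero>\<^bsub>M\<^esub> \<in> ideal_smult R (Idl {}) M" by (rule M.submoduleD(2)[OF M.ideal_smult_submodule[OF genideal_ideal]]) simp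
  ultimately have e: "ideal_smult R (Idl {}) M = {\<zero>\<^bsub>M\<^esub>}" by blast
  show ?case by (rule exI[of _ "\<lambda>_. Q"], rule exI[of _ a]) (use Q a e in auto)
next
  case (Suc k)
  then obtain P a' where P: "P 0 = Q" "\<forall>i\<le>k. primeideal (P i) R" "\<forall>i<k. P i \<subset> P (Suc i)"
    and a': "a' \<in> carrier M" "a' \<notin> ideal_smult R (Idl (set (take k xs))) M"
      "\<forall>q\<in>P k. q \<odot>\<^bsub>M\<^esub> a' \<in> ideal_smult R (Idl (set (take k xs))) M" by (auto dest!: Suc.IH)
  have e: "set (take (Suc k) xs) = insert (xs ! k) (set (take k xs))" using Suc.prems by (simp add: take_Suc_conv_app_nth)
  have k: "k < length xs" using Suc.prems by simp
  have "\<exists>Q' a'. primeideal Q' R \<and> P k \<subset> Q' \<and> a' \<in> carrier M \<and> a' \<notin> ideal_smult R (Idl (insert (xs ! k) (set (take k xs)))) M \<and>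
    (\<forall>q\<in>Q'. q \<odot>\<^bsub>M\<^esub> a' \<in> ideal_smult R (Idl (insert (xs ! k) (set (take k xs)))) M)"
  proof (rule regular_step[OF M fg _ _ _ _ a'])
    show "set (take k xs) \<subseteq> carrier R" using xs(1) set_take_subset[of k xs] unfolding regular_sequence_def by blast
    show "xs ! k \<in> \<mm>" using xs(2) k by auto
    show "primeideal (P k) R" using P(2) by simp
    fix v assume "v \<in> carrier M" "(xs ! k) \<odot>\<^bsub>M\<^esub> v \<in> ideal_smult R (Idl (set (take k xs))) M"
    then show "v \<in> ideal_smult R (Idl (set (take k xs))) M" by (rule regular_sequenceD[OF xs(1) k])
  qed
  then obtain Q' a'' where Q': "primeideal Q' R" "P k \<subset> Q'"
    and a'': "a'' \<in> carrier M" "a'' \<notin> ideal_smult R (Idl (set (take (Suc k) xs))) M"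
      "\<forall>q\<in>Q'. q \<odot>\<^bsub>M\<^esub> a'' \<in> ideal_smult R (Idl (set (take (Suc k) xs))) M" unfolding e by (elim exE conjE)
  let ?P = "\<lambda>i. if i \<le> k then P i else Q'"
  have "?P i \<subset> ?P (Suc i)" if "i < Suc k" for i
  proof (cases "i = k")
    case True then show ?thesis using Q'(2) by simp
  next
    case False then show ?thesis using that P(3) by simp
  qed
  then show ?case using P(1,2) Q'(1) a'' by (intro exI[of _ ?P] exI[of _ a'']) auto
qed

theorem nonzerodivisor_regular_on_MCM:
  assumes M: "maximal_cohen_macaulay_module R M" and mm: "\<mm> = max_ideal R"
    and d: "krull_dim R = enat d" "d \<ge> 1"
    and x: "x \<in> carrier R" "\<And>a. a \<in> carrier R \<Longrightarrow> x \<otimes> a = \<zero> \<Longrightarrow> a = \<zero>"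
    and m: "m \<in> carrier M" "x \<odot>\<^bsub>M\<^esub> m = \<zero>\<^bsub>M\<^esub>"
  shows "m = \<zero>\<^bsub>M\<^esub>"
proof (rule ccontr)
  assume nz: "m \<noteq> \<zero>\<^bsub>M\<^esub>"
  have mod: "module R M" and fg: "finitely_generated R M" and dep: "module_depth R M = enat d"
    using M d by (auto simp: maximal_cohen_macaulay_module_def cohen_macaulay_module_def)
  interpret M: module R M by (rule mod)
  obtain xs where xs: "length xs \<ge> d" "set xs \<subseteq> max_ideal R" "regular_sequence R M xs"
    using module_depth_attained[of d R M] dep d(2) by auto
  have Z: "submodule {\<zero>\<^bsub>M\<^esub>} R M" unfolding M.submodule_iff by auto
  have "m \<notin> {\<zero>\<^bsub>M\<^esub>}" using nz by simp
  from module_colon_prime_above[OF mod Z m(1) this]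
  obtain P a where P: "primeideal P R" "M.module_colon {\<zero>\<^bsub>M\<^esub>} m \<subseteq> P" "a \<in> carrier M" "a \<noteq> \<zero>\<^bsub>M\<^esub>"
    "\<forall>q\<in>P. q \<odot>\<^bsub>M\<^esub> a = \<zero>\<^bsub>M\<^esub>" by auto
  have xP: "x \<in> P" using P(2) m x(1) by (auto simp: M.module_colon_def)
  have xm: "set xs \<subseteq> \<mm>" using xs(2) mm by simp
  from regular_sequence_prime_chain[OF mod fg xs(3) xm P(1,3,4,5) xs(1)]
  obtain C where C: "C 0 = P" "\<forall>i\<le>d. primeideal (C i) R" "\<forall>i<d. C i \<subset> C (Suc i)" by (elim exE conjE)
  have "{\<zero>} \<subseteq> P" using ideal_memD(2)[OF primeideal_memD(1)[OF P(1)]] by simp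
  from assoc_prime_below_prime[OF zeroideal P(1) this] obtain p where p: "assoc_prime {\<zero>} p" "p \<subseteq> P" by blast
  obtain c where c: "c \<in> carrier R" "p = colon {\<zero>} c" "primeideal p R" using p(1) by (auto simp: assoc_prime_def)
  have "x \<notin> p"
  proof
    assume "x \<in> p"
    then have "c = \<zero>" using c(1,2) x(2) by (auto simp: colon_def)
    then have "\<one> \<in> p" using c(2) by (simp add: colon_def)
    then show False using primeideal_memD(2)[OF c(3)] by simp
  qed
  \<comment> \<open>The associated prime \<open>p\<close> of zero omits the nonzerodivisor
    \<open>x\<close>, whereas \<open>P\<close> contains it; so \<open>p\<close> prolongs the chain
    of length \<open>d\<close> from \<open>P\<close> beyond the dimension.\<close>
  let ?C = "\<lambda>i. case i of 0 \<Rightarrow> p | Suc i \<Rightarrow> C i"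
  have "enat (Suc d) \<le> krull_dim R"
  proof (rule krull_dim_ge)
    show "\<forall>i\<le>Suc d. primeideal (?C i) R"
    proof (intro allI impI)
      fix i assume "i \<le> Suc d"
      then show "primeideal (?C i) R" using C(2) c(3) by (cases i) simp_all
    qed
    have "p \<subset> P" using p(2) xP \<open>x \<notin> p\<close> by blast
    show "\<forall>i<Suc d. ?C i \<subset> ?C (Suc i)"
    proof (intro allI impI)
      fix i assume "i < Suc d"
      then show "?C i \<subset> ?C (Suc i)" using C(1,3) \<open>p \<subset> P\<close> by (cases i) simp_all
    qed
  qed
  then show False using d(1) by simp
qed

end

section \<open>Change of rings\<close>

definition restrict_scalars :: "('a \<Rightarrow> 'c) \<Rightarrow> ('c, 'w, 'm) module_scheme \<Rightarrow> ('a, 'w) module" where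
  "restrict_scalars \<pi> W =
    \<lparr>carrier = carrier W, monoid.mult = monoid.mult W, one = one W, zero = zero W, add = add W,
     smult = (\<lambda>a w. \<pi> a \<odot>\<^bsub>W\<^esub> w)\<rparr>"

lemma restrict_scalars_simps:
  "carrier (restrict_scalars \<pi> W) = carrier W" "\<zero>\<^bsub>restrict_scalars \<pi> W\<^esub> = \<zero>\<^bsub>W\<^esub>"
  "add (restrict_scalars \<pi> W) = add W" "a \<odot>\<^bsub>restrict_scalars \<pi> W\<^esub> w = \<pi> a \<odot>\<^bsub>W\<^esub> w"
  by (simp_all add: restrict_scalars_def)

locale ring_surjection = cring R + A: cring A for R (structure) and A +
  fixes \<pi>
  assumes \<pi>_hom: "\<pi> \<in> ring_hom R A" and \<pi>_surj: "\<pi> ` carrier R = carrier A"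
begin

lemma \<pi>_simps:
  "a \<in> carrier R \<Longrightarrow> \<pi> a \<in> carrier A" "a \<in> carrier R \<Longrightarrow> c \<in> carrier R \<Longrightarrow> \<pi> (a \<oplus> c) = \<pi> a \<oplus>\<^bsub>A\<^esub> \<pi> c"
  "a \<in> carrier R \<Longrightarrow> c \<in> carrier R \<Longrightarrow> \<pi> (a \<otimes> c) = \<pi> a \<otimes>\<^bsub>A\<^esub> \<pi> c" "\<pi> \<one> = \<one>\<^bsub>A\<^esub>" "\<pi> \<zero> = \<zero>\<^bsub>A\<^esub>"
  using \<pi>_hom ring_hom_zero[OF \<pi>_hom ring_axioms A.ring_axioms]
  by (auto simp: ring_hom_closed ring_hom_add ring_hom_mult ring_hom_one)

lemma \<pi>_surjD: "a \<in> carrier A \<Longrightarrow> \<exists>r\<in>carrier R. a = \<pi> r"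
  using \<pi>_surj by auto

lemma restrict_scalars_module:
  assumes W: "module A W" shows "module R (restrict_scalars \<pi> W)"
proof -
  interpret W: module A W by (rule W)
  show ?thesis
  proof (rule moduleI)
    show "abelian_group (restrict_scalars \<pi> W)"
    proof (rule abelian_groupI)
      fix u assume u: "u \<in> carrier (restrict_scalars \<pi> W)"
      have "(\<ominus>\<^bsub>W\<^esub> u) \<oplus>\<^bsub>W\<^esub> u = \<zero>\<^bsub>W\<^esub>" using u by (simp add: restrict_scalars_simps W.l_neg)
      then show "\<exists>v\<in>carrier (restrict_scalars \<pi> W). v \<oplus>\<^bsub>restrict_scalars \<pi> W\<^esub> u = \<zero>\<^bsub>restrict_scalars \<pi> W\<^esub>"
        using u by (intro bexI[of _ "\<ominus>\<^bsub>W\<^esub> u"]) (simp_all add: restrict_scalars_simps)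
    qed (simp_all add: restrict_scalars_simps W.a_ac)
  qed (simp_all add: restrict_scalars_simps is_cring \<pi>_simps W.smult_l_distr W.smult_r_distr W.smult_assoc1)
qed

lemma restrict_scalars_hom: "f \<in> module_hom A W W' \<Longrightarrow> f \<in> module_hom R (restrict_scalars \<pi> W) (restrict_scalars \<pi> W')"
  by (auto simp: module_hom_def restrict_scalars_simps \<pi>_simps)

definition pi where "pi n v = (\<lambda>i\<in>{..<n}. \<pi> (v i))"

lemma pi_hom: "pi n \<in> module_hom R (free_module R n) (restrict_scalars \<pi> (free_module A n))"
  by (rule module_homI)
    (auto simp: restrict_scalars_simps pi_def free_carrier A.free_carrier free_simps A.free_simps \<pi>_simps intro!: restrict_ext)

lemma pi_closed: "v \<in> carrier (free_module R n) \<Longrightarrow> pi n v \<in> carrier (free_module A n)"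
  using module_hom_closed[OF pi_hom] by (simp add: restrict_scalars_simps)

lemma pi_basis: "i < n \<Longrightarrow> pi n (basis n i) = A.basis n i"
  by (auto simp: pi_def basis_def A.basis_def \<pi>_simps intro!: restrict_ext)

lemma pi_surj:
  assumes w: "w \<in> carrier (free_module A n)" shows "\<exists>v\<in>carrier (free_module R n). w = pi n v"
proof -
  have "\<forall>i\<in>{..<n}. \<exists>r. r \<in> carrier R \<and> w i = \<pi> r" using w \<pi>_surjD by (auto simp: A.free_carrier)
  from bchoice[OF this] obtain r where r: "\<And>i. i < n \<Longrightarrow> r i \<in> carrier R" "\<And>i. i < n \<Longrightarrow> w i = \<pi> (r i)" by auto
  have v: "(\<lambda>i\<in>{..<n}. r i) \<in> carrier (free_module R n)" using r by (simp add: free_carrier)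
  have "w = pi n (\<lambda>i\<in>{..<n}. r i)" by (rule A.free_eqI[OF w pi_closed[OF v]]) (use r in \<open>simp add: pi_def\<close>)
  then show ?thesis using v by blast
qed

text \<open>A map from a free \<open>R\<close>-module to an \<open>A\<close>-module is determined on
  the basis, so it factors through the reduction of coordinates.\<close>

lemma descend:
  assumes W: "module A W" and h: "h \<in> module_hom R (free_module R n) (restrict_scalars \<pi> W)"
  shows "\<exists>g\<in>module_hom A (free_module A n) W. \<forall>v\<in>carrier (free_module R n). g (pi n v) = h v"
proof -
  have hc: "h (basis n i) \<in> carrier W" for i using module_hom_closed[OF h basis_closed] by (simp add: restrict_scalars_simps)
  let ?g = "A.lincomb W n (\<lambda>i. h (basis n i))"
  have g: "?g \<in> module_hom A (free_module A n) W" "i < n \<Longrightarrow> ?g (A.basis n i) = h (basis n i)" for i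
    using A.lincomb_hom[OF W, of n "\<lambda>i. h (basis n i)"] hc by auto
  have "?g (pi n v) = h v" if v: "v \<in> carrier (free_module R n)" for v
    by (rule free_hom_ext[OF restrict_scalars_module[OF W] module_hom_comp[OF pi_hom restrict_scalars_hom[OF g(1)]] h _ v])
      (simp add: pi_basis g(2))
  then show ?thesis using g(1) by blast
qed

lemma descend_complex:
  assumes "complex R b D"
  shows "\<exists>D'. complex A b D' \<and> (\<forall>i. \<forall>v\<in>carrier (free_module R (b (Suc i))). D' i (pi (b (Suc i)) v) = pi (b i) (D i v))"
proof -
  have D: "D i \<in> module_hom R (free_module R (b (Suc i))) (free_module R (b i))"
    and DD: "v \<in> carrier (free_module R (b (Suc (Suc i)))) \<Longrightarrow> D i (D (Suc i) v) = \<zero>\<^bsub>free_module R (b i)\<^esub>" for i v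
    using assms by (auto simp: complex_def)
  have "\<exists>g. g \<in> module_hom A (free_module A (b (Suc i))) (free_module A (b i)) \<and>
    (\<forall>v\<in>carrier (free_module R (b (Suc i))). g (pi (b (Suc i)) v) = pi (b i) (D i v))" for i
    using descend[OF A.free_module_module module_hom_comp[OF D pi_hom]] by blast
  then have "\<exists>D'. \<forall>i. D' i \<in> module_hom A (free_module A (b (Suc i))) (free_module A (b i)) \<and>
    (\<forall>v\<in>carrier (free_module R (b (Suc i))). D' i (pi (b (Suc i)) v) = pi (b i) (D i v))" by (intro choice allI)
  then obtain D' where D': "\<And>i. D' i \<in> module_hom A (free_module A (b (Suc i))) (free_module A (b i))"
    "\<And>i v. v \<in> carrier (free_module R (b (Suc i))) \<Longrightarrow> D' i (pi (b (Suc i)) v) = pi (b i) (D i v)" by auto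
  have "complex A b D'" unfolding complex_def
  proof (intro conjI allI ballI)
    show "D' i \<in> module_hom A (free_module A (b (Suc i))) (free_module A (b i))" for i by (rule D')
    fix i w assume "w \<in> carrier (free_module A (b (Suc (Suc i))))"
    then obtain v where v: "v \<in> carrier (free_module R (b (Suc (Suc i))))" "w = pi (b (Suc (Suc i))) v" using pi_surj by blast
    have "D' i (D' (Suc i) w) = pi (b i) (D i (D (Suc i) v))"
      using v D'(2)[OF v(1)] D'(2)[OF module_hom_closed[OF D v(1)]] by simp
    also have "\<dots> = pi (b i) \<zero>\<^bsub>free_module R (b i)\<^esub>" using DD[OF v(1)] by simp
    also have "\<dots> = \<zero>\<^bsub>free_module A (b i)\<^esub>"
      using module_hom_zero[OF free_module_module restrict_scalars_module[OF A.free_module_module] pi_hom]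
      by (simp add: restrict_scalars_simps)
    finally show "D' i (D' (Suc i) w) = \<zero>\<^bsub>free_module A (b i)\<^esub>" .
  qed
  then show ?thesis using D'(2) by blast
qed

text \<open>The part \<open>Ext\<^sup>j(M, X\<^sub>1) \<rightarrow> Ext\<^sup>j(M, W) \<rightarrow> Ext\<^sup>j\<^sup>+\<^sup>1(M, X\<^sub>0)\<close> of the long exact sequence of
  \<open>0 \<rightarrow> X\<^sub>0 \<rightarrow> X\<^sub>1 \<rightarrow> W \<rightarrow> 0\<close>, stated for chains of submodules: a submodule \<open>L\<close> of the middle term is
  determined by its preimage \<open>?p L\<close> and its image \<open>?q L\<close>.\<close>

lemma chain_length_ext_subs_le:
  assumes cD: "complex R b D" and cD': "complex A b D'"
    and DD': "\<And>i v. v \<in> carrier (free_module R (b (Suc i))) \<Longrightarrow> D' i (pi (b (Suc i)) v) = pi (b i) (D i v)"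
    and X0: "module R X0" and X1: "module R X1" and W: "module A W"
    and mu: "\<mu> \<in> module_hom R X0 X1" "inj_on \<mu> (carrier X0)"
    and psi: "\<psi> \<in> module_hom R X1 (restrict_scalars \<pi> W)" "\<psi> ` carrier X1 = carrier W"
    and ex: "\<And>y. y \<in> carrier X1 \<Longrightarrow> \<psi> y = \<zero>\<^bsub>W\<^esub> \<longleftrightarrow> y \<in> \<mu> ` carrier X0"
  shows "chain_length (ext_subs A b D' W j) \<le> chain_length (ext_subs R b D X1 j) + chain_length (ext_subs R b D X0 (Suc j))"
proof -
  interpret C0: cochains R X0 b D by (intro cochains.intro is_cring X0 cochains_axioms.intro cD)
  interpret C1: cochains R X1 b D by (intro cochains.intro is_cring X1 cochains_axioms.intro cD)
  interpret C: cochains A W b D' by (intro cochains.intro A.is_cring W cochains_axioms.intro cD')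
  note rsW = restrict_scalars_module[OF W] and cl = module_hom_closed
  interpret rW: module R "restrict_scalars \<pi> W" by (rule rsW)
  interpret H: module A "C.H j" by (rule C.H_module)
  interpret H0: module R "C0.H (Suc j)" by (rule C0.H_module)
  interpret H1: module R "C1.H j" by (rule C1.H_module)
  let ?F = "free_module R (b j)" and ?F' = "free_module R (b (Suc j))" and ?\<pi> = "pi (b j)"
  \<comment> \<open>\<open>?rel f u\<close> means that \<open>u\<close> is a lift of
    \<open>f\<close> with values in \<open>X1\<close>; \<open>?rel' u g\<close> means that the
    coboundary of \<open>u\<close> comes from \<open>g\<close>. Together they make \<open>g\<close>
    a representative of the connecting map applied to \<open>f\<close>.\<close>
  let ?rel = "\<lambda>f u. \<forall>v\<in>carrier ?F. f (?\<pi> v) = \<psi> (u v)"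
  let ?rel' = "\<lambda>u g. \<forall>v\<in>carrier ?F'. u (D j v) = \<mu> (g v)"
  let ?p = "\<lambda>L. {u \<in> cocycles R b D X1 j. \<exists>f\<in>L. ?rel f u}"
  let ?q = "\<lambda>L. {g \<in> cocycles R b D X0 (Suc j). \<exists>f\<in>L. \<exists>u\<in>carrier (C1.H j). ?rel f u \<and> ?rel' u g}"
  note z1 = H1.submoduleD[OF C1.cocycles_submodule] and z0 = H0.submoduleD[OF C0.cocycles_submodule]
  have psi_simps: "\<psi> (y \<oplus>\<^bsub>X1\<^esub> y') = \<psi> y \<oplus>\<^bsub>W\<^esub> \<psi> y'" "a \<in> carrier R \<Longrightarrow> \<psi> (a \<odot>\<^bsub>X1\<^esub> y) = \<pi> a \<odot>\<^bsub>W\<^esub> \<psi> y" "\<psi> \<zero>\<^bsub>X1\<^esub> = \<zero>\<^bsub>W\<^esub>"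
    "\<psi> y \<in> carrier W"
    if "y \<in> carrier X1" "y' \<in> carrier X1" for y y' a
    using module_hom_add[OF psi(1) that] module_hom_smult[OF psi(1) _ that(1)] module_hom_zero[OF X1 rsW psi(1)] cl[OF psi(1) that(1)]
    by (simp_all add: restrict_scalars_simps)
  have u_cl: "u v \<in> carrier X1" if "u \<in> carrier (C1.H j)" "v \<in> carrier ?F" for u v by (rule cl[OF C1.H_hom[OF that(1)] that(2)])
  have f_cl: "f w \<in> carrier W" if "f \<in> carrier (C.H j)" "w \<in> carrier (free_module A (b j))" for f w by (rule cl[OF C.H_hom[OF that(1)] that(2)])
  have g_cl: "g v \<in> carrier X0" if "g \<in> carrier (C0.H (Suc j))" "v \<in> carrier ?F'" for g v by (rule cl[OF C0.H_hom[OF that(1)] that(2)])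
  have mu_zero: "\<mu> \<zero>\<^bsub>X0\<^esub> = \<zero>\<^bsub>X1\<^esub>" by (rule module_hom_zero[OF X0 X1 mu(1)])
  note mu_add = module_hom_add[OF mu(1)] and mu_smult = module_hom_smult[OF mu(1)]
  have rel_zero: "?rel \<zero>\<^bsub>C.H j\<^esub> \<zero>\<^bsub>C1.H j\<^esub>" using pi_closed psi_simps(3)[of "\<zero>\<^bsub>X1\<^esub>" "\<zero>\<^bsub>X1\<^esub>"] by (simp add: Hom_simps A.Hom_simps)
  have rel_add: "?rel (f \<oplus>\<^bsub>C.H j\<^esub> f') (u \<oplus>\<^bsub>C1.H j\<^esub> u')"
    if "?rel f u" "?rel f' u'" "u \<in> carrier (C1.H j)" "u' \<in> carrier (C1.H j)" for f f' u u'
    using that pi_closed u_cl by (simp add: Hom_simps(3) A.Hom_simps(3) psi_simps)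
  have rel_smult: "?rel (\<pi> a \<odot>\<^bsub>C.H j\<^esub> f) (a \<odot>\<^bsub>C1.H j\<^esub> u)"
    if "?rel f u" "u \<in> carrier (C1.H j)" "a \<in> carrier R" for f u a
    using that pi_closed u_cl by (simp add: Hom_simps(4) A.Hom_simps(4) psi_simps(2)[OF u_cl u_cl])
  have rel'_zero: "?rel' \<zero>\<^bsub>C1.H j\<^esub> \<zero>\<^bsub>C0.H (Suc j)\<^esub>" using C1.D_closed mu_zero by (simp add: Hom_simps)
  have rel'_add: "?rel' (u \<oplus>\<^bsub>C1.H j\<^esub> u') (g \<oplus>\<^bsub>C0.H (Suc j)\<^esub> g')"
    if "?rel' u g" "?rel' u' g'" "g \<in> carrier (C0.H (Suc j))" "g' \<in> carrier (C0.H (Suc j))" for u u' g g'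
    using that C1.D_closed g_cl by (simp add: Hom_simps(3) mu_add)
  have rel'_smult: "?rel' (a \<odot>\<^bsub>C1.H j\<^esub> u) (a \<odot>\<^bsub>C0.H (Suc j)\<^esub> g)"
    if "?rel' u g" "g \<in> carrier (C0.H (Suc j))" "a \<in> carrier R" for u g a
    using that C1.D_closed g_cl by (simp add: Hom_simps(4) mu_smult)
  have Z1: "u \<in> carrier (C1.H j)" if "u \<in> cocycles R b D X1 j" for u using that by (simp add: cocycles_def)
  have Z0: "g \<in> carrier (C0.H (Suc j))" if "g \<in> cocycles R b D X0 (Suc j)" for g using that by (simp add: cocycles_def)
  show ?thesis
  proof (rule chain_length_le_add[where p = ?p and q = ?q])
    fix L assume "L \<in> ext_subs A b D' W j"
    then have L: "submodule L A (C.H j)" "coboundaries A b D' W j \<subseteq> L" by (auto simp: ext_subs_def)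
    note l = H.submoduleD[OF L(1)]
    show "?p L \<in> ext_subs R b D X1 j"
    proof (rule ext_subsI[OF X1 _ _ refl])
      show p0: "\<zero>\<^bsub>C1.H j\<^esub> \<in> ?p L" using z1(2) l(2) rel_zero by blast
      show "coboundaries R b D X1 j \<subseteq> ?p L"
      proof
        fix u assume u: "u \<in> coboundaries R b D X1 j"
        show "u \<in> ?p L"
        proof (cases j)
          case 0
          then show ?thesis using u p0 by simp
        next
          case (Suc i)
          then obtain h where h: "h \<in> carrier (C1.H i)" "u = (\<lambda>v\<in>carrier ?F. h (D i v))" using u by auto
          note hh = C1.H_hom[OF h(1)]
          obtain f where f: "f \<in> module_hom A (free_module A (b i)) W" "\<And>v. v \<in> carrier (free_module R (b i)) \<Longrightarrow> f (pi (b i) v) = \<psi> (h v)"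
            using descend[OF W module_hom_comp[OF hh psi(1)]] by blast
          let ?f = "\<lambda>v\<in>carrier (free_module A (b (Suc i))). f (D' i v)"
          have "?f \<in> L" using C.coboundary_intro[OF f(1)] L(2) Suc by blast
          moreover have "?rel ?f u" using Suc f(2) pi_closed DD' C1.D_closed by (simp add: h(2))
          ultimately show ?thesis using C1.coboundaries_subset u by blast
        qed
      qed
    next
      fix u u' assume "u \<in> ?p L" "u' \<in> ?p L"
      then obtain f f' where "u \<in> cocycles R b D X1 j" "f \<in> L" "?rel f u" "u' \<in> cocycles R b D X1 j" "f' \<in> L" "?rel f' u'" by blast
      then show "u \<oplus>\<^bsub>C1.H j\<^esub> u' \<in> ?p L" using z1(3) l(3) rel_add[of f u f' u'] Z1 by blast
    next
      fix a u assume a: "a \<in> carrier R" and "u \<in> ?p L"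
      then obtain f where "u \<in> cocycles R b D X1 j" "f \<in> L" "?rel f u" by blast
      then show "a \<odot>\<^bsub>C1.H j\<^esub> u \<in> ?p L" using z1(4)[OF a] l(4)[OF \<pi>_simps(1)[OF a]] rel_smult[of f u a] Z1 a by blast
    qed simp
    show "?q L \<in> ext_subs R b D X0 (Suc j)"
    proof (rule ext_subsI[OF X0 _ _ refl])
      show "\<zero>\<^bsub>C0.H (Suc j)\<^esub> \<in> ?q L" using z0(2) l(2) rel_zero rel'_zero H1.zero_closed by blast
      show "coboundaries R b D X0 (Suc j) \<subseteq> ?q L"
      proof
        fix g assume g: "g \<in> coboundaries R b D X0 (Suc j)"
        then obtain h where h: "h \<in> carrier (C0.H j)" "g = (\<lambda>v\<in>carrier ?F'. h (D j v))" by auto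
        note hh = C0.H_hom[OF h(1)]
        let ?u = "\<lambda>v\<in>carrier ?F. \<mu> (h v)"
        have u: "?u \<in> carrier (C1.H j)" by (rule Hom_restrict[OF free_module_module module_hom_comp[OF hh mu(1)]])
        have "\<psi> (\<mu> (h v)) = \<zero>\<^bsub>W\<^esub>" if "v \<in> carrier ?F" for v
          using ex[of "\<mu> (h v)"] cl[OF hh that] cl[OF mu(1)] by blast
        then have "?rel \<zero>\<^bsub>C.H j\<^esub> ?u" using pi_closed by (simp add: A.Hom_simps)
        moreover have "?rel' ?u g" using C0.D_closed by (simp add: h(2))
        ultimately show "g \<in> ?q L" using u l(2) subsetD[OF C0.coboundaries_subset g] by blast
      qed
    next
      fix g g' assume "g \<in> ?q L" "g' \<in> ?q L"
      then obtain f u f' u' where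
        "g \<in> cocycles R b D X0 (Suc j)" "f \<in> L" "u \<in> carrier (C1.H j)" "?rel f u" "?rel' u g"
        "g' \<in> cocycles R b D X0 (Suc j)" "f' \<in> L" "u' \<in> carrier (C1.H j)" "?rel f' u'" "?rel' u' g'" by blast
      then show "g \<oplus>\<^bsub>C0.H (Suc j)\<^esub> g' \<in> ?q L"
        using z0(3)[of g g'] l(3)[of f f'] rel_add[of f u f' u'] rel'_add[of u g u' g'] Z0 H1.a_closed[of u u'] by blast
    next
      fix a g assume a: "a \<in> carrier R" and "g \<in> ?q L"
      then obtain f u where
        "g \<in> cocycles R b D X0 (Suc j)" "f \<in> L" "u \<in> carrier (C1.H j)" "?rel f u" "?rel' u g" by blast
      then show "a \<odot>\<^bsub>C0.H (Suc j)\<^esub> g \<in> ?q L"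
        using z0(4)[OF a, of g] l(4)[OF \<pi>_simps(1)[OF a], of f] rel_smult[of f u a] rel'_smult[of u g a] Z0 a H1.smult_closed[OF a, of u] by blast
    qed simp
  next
    fix L L' assume "L \<in> ext_subs A b D' W j" "L' \<in> ext_subs A b D' W j" "L \<subseteq> L'" and eqp: "?p L = ?p L'" and eqq: "?q L = ?q L'"
    then have L: "submodule L A (C.H j)" and L': "submodule L' A (C.H j)" "L' \<subseteq> cocycles A b D' W j" and LL: "L \<subseteq> L'"
      by (auto simp: ext_subs_def)
    note l = H.submoduleD[OF L] and l' = H.submoduleD[OF L'(1)]
    show "L' \<subseteq> L"
    proof
      fix f' assume f': "f' \<in> L'"
      have fh: "f' \<in> module_hom A (free_module A (b j)) W" using C.H_hom[OF l'(1)[OF f']] .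
      have fz: "f' (D' j w) = \<zero>\<^bsub>W\<^esub>" if "w \<in> carrier (free_module A (b (Suc j)))" for w
        using subsetD[OF L'(2) f'] that by (simp add: cocycles_def)
      \<comment> \<open>Diagram chase: lift \<open>f'\<close> to \<open>u'\<close>; its coboundary
        is killed by \<open>\<psi>\<close>, hence comes from a cocycle \<open>g\<close>, which
        belongs to \<open>?q L'\<close> and so to \<open>?q L\<close>.\<close>
      have "\<exists>u\<in>module_hom R ?F X1. \<forall>v\<in>carrier ?F. \<psi> (u v) = f' (?\<pi> v)"
      proof (rule free_projective[OF X1 rsW psi(1) module_hom_comp[OF pi_hom restrict_scalars_hom[OF fh]]])
        fix v assume "v \<in> carrier ?F"
        then show "f' (?\<pi> v) \<in> \<psi> ` carrier X1" using psi(2) cl[OF fh pi_closed] by simp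
      qed
      then obtain u' where u'h: "u' \<in> module_hom R ?F X1" and u'r: "\<And>v. v \<in> carrier ?F \<Longrightarrow> \<psi> (u' v) = f' (?\<pi> v)" by blast
      have uD: "u' (D j v) \<in> \<mu> ` carrier X0" if v: "v \<in> carrier ?F'" for v
      proof -
        have "\<psi> (u' (D j v)) = f' (D' j (pi (b (Suc j)) v))" using u'r[OF C1.D_closed[OF v]] DD'[OF v] by simp
        also have "\<dots> = \<zero>\<^bsub>W\<^esub>" by (rule fz[OF pi_closed[OF v]])
        finally show ?thesis using ex[OF cl[OF u'h C1.D_closed[OF v]]] by simp
      qed
      obtain g where gh: "g \<in> module_hom R ?F' X0" and g: "\<And>v. v \<in> carrier ?F' \<Longrightarrow> \<mu> (g v) = u' (D j v)"
        using free_projective[OF X0 X1 mu(1) module_hom_comp[OF C1.D_hom u'h] uD] by blast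
      let ?u = "\<lambda>v\<in>carrier ?F. u' v" and ?g = "\<lambda>v\<in>carrier ?F'. g v"
      have u: "?u \<in> carrier (C1.H j)" by (rule Hom_restrict[OF free_module_module u'h])
      have rel_u: "?rel f' ?u" using u'r by simp
      have gz: "?g \<in> cocycles R b D X0 (Suc j)" unfolding cocycles_def
      proof (intro CollectI conjI ballI)
        show "?g \<in> carrier (C0.H (Suc j))" by (rule Hom_restrict[OF free_module_module gh])
        fix v assume v: "v \<in> carrier (free_module R (b (Suc (Suc j))))"
        have Dv: "D (Suc j) v \<in> carrier ?F'" by (rule C1.D_closed[OF v])
        have "\<mu> (g (D (Suc j) v)) = u' (D j (D (Suc j) v))" by (rule g[OF Dv])
        also have "\<dots> = \<mu> \<zero>\<^bsub>X0\<^esub>" using C1.D_D[OF v] module_hom_zero[OF free_module_module X1 u'h] mu_zero by simp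
        finally have "g (D (Suc j) v) = \<zero>\<^bsub>X0\<^esub>" using inj_onD[OF mu(2)] cl[OF gh Dv] C0.N.zero_closed by blast
        then show "?g (D (Suc j) v) = \<zero>\<^bsub>X0\<^esub>" using Dv by simp
      qed
      have rel_g: "?rel' ?u ?g" using g C1.D_closed by simp
      have "?g \<in> ?q L'" using gz f' u rel_u rel_g by blast
      then have "?g \<in> ?q L" using eqq by simp
      then obtain f u where fu: "f \<in> L" "u \<in> carrier (C1.H j)" "?rel f u" "?rel' u ?g" by blast
      have fH: "f \<in> carrier (C.H j)" "f' \<in> carrier (C.H j)" using l(1)[OF fu(1)] l'(1)[OF f'] .
      \<comment> \<open>The lifts of \<open>f'\<close> and of \<open>f\<close> have the same
        coboundary, so their difference \<open>?du\<close> is a cocycle over the difference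
        \<open>?df\<close>, to which \<open>?p\<close> applies. Subtraction is written with the
        scalar \<open>\<ominus> \<one>\<close>, so that the rules for sums and multiples cover
        it.\<close>
      let ?m = "\<ominus>\<one>" and ?du = "?u \<oplus>\<^bsub>C1.H j\<^esub> (\<ominus> \<one>) \<odot>\<^bsub>C1.H j\<^esub> u" and ?df = "f' \<oplus>\<^bsub>C.H j\<^esub> \<pi> (\<ominus> \<one>) \<odot>\<^bsub>C.H j\<^esub> f"
      have m1: "?m \<in> carrier R" by simp
      have mu1: "?m \<odot>\<^bsub>C1.H j\<^esub> u \<in> carrier (C1.H j)" by (rule H1.smult_closed[OF m1 fu(2)])
      have mf: "\<pi> ?m \<odot>\<^bsub>C.H j\<^esub> f \<in> L" by (rule l(4)[OF \<pi>_simps(1)[OF m1] fu(1)])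
      have rel_d: "?rel ?df ?du" by (rule rel_add[OF rel_u rel_smult[OF fu(3,2) m1] u mu1])
      have duH: "?du \<in> carrier (C1.H j)" by (rule H1.a_closed[OF u mu1])
      have "?du (D j v) = \<zero>\<^bsub>X1\<^esub>" if v: "v \<in> carrier ?F'" for v
      proof -
        have Dv: "D j v \<in> carrier ?F" by (rule C1.D_closed[OF v])
        have "u (D j v) = ?u (D j v)" using fu(4) rel_g v by simp
        then have "?du (D j v) = u' (D j v) \<oplus>\<^bsub>X1\<^esub> ?m \<odot>\<^bsub>X1\<^esub> u' (D j v)" using Dv by (simp add: Hom_simps(3,4))
        also have "\<dots> = \<zero>\<^bsub>X1\<^esub>" using cl[OF u'h Dv] C1.N.smult_l_minus[OF one_closed, of "u' (D j v)"] by (simp add: C1.N.M.r_neg)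
        finally show ?thesis .
      qed
      then have "?du \<in> cocycles R b D X1 j" using duH by (simp add: cocycles_def)
      moreover have "?df \<in> L'" using l'(3)[OF f' subsetD[OF LL mf]] .
      ultimately have "?du \<in> ?p L'" using rel_d by blast
      then have "?du \<in> ?p L" using eqp by simp
      then obtain f2 where f2: "f2 \<in> L" "?rel f2 ?du" by blast
      have dfH: "?df \<in> carrier (C.H j)" using l'(1) \<open>?df \<in> L'\<close> by blast
      have "f2 = ?df"
      proof (rule A.Hom_eqI[OF l(1)[OF f2(1)] dfH])
        fix w assume "w \<in> carrier (free_module A (b j))"
        then obtain v where "v \<in> carrier ?F" "w = ?\<pi> v" using pi_surj by blast
        then show "f2 w = ?df w" using f2(2) rel_d by simp
      qed
      then have "?df \<in> L" using f2(1) by simp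
      then have "?df \<ominus>\<^bsub>C.H j\<^esub> (\<pi> ?m \<odot>\<^bsub>C.H j\<^esub> f) \<in> L" by (rule l(6)[OF _ mf])
      then show "f' \<in> L" using H.add_diff_cancel[OF fH(2) l(1)[OF mf]] by simp
    qed
  qed blast+
qed

end

locale reduction_by_nonzerodivisor = ring_surjection +
  fixes x
  assumes x_closed: "x \<in> carrier R" and x_regular: "a \<in> carrier R \<Longrightarrow> x \<otimes> a = \<zero> \<Longrightarrow> a = \<zero>"
    and \<pi>_kernel: "a \<in> carrier R \<Longrightarrow> \<pi> a = \<zero>\<^bsub>A\<^esub> \<longleftrightarrow> (\<exists>r\<in>carrier R. a = x \<otimes> r)"
begin

lemma pi_kernel:
  assumes v: "v \<in> carrier (free_module R n)" and z: "pi n v = \<zero>\<^bsub>free_module A n\<^esub>"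
  shows "\<exists>w\<in>carrier (free_module R n). v = x \<odot>\<^bsub>free_module R n\<^esub> w"
proof -
  have "\<forall>i\<in>{..<n}. \<exists>r. r \<in> carrier R \<and> v i = x \<otimes> r"
  proof
    fix i assume i: "i \<in> {..<n}"
    then have "\<pi> (v i) = \<zero>\<^bsub>A\<^esub>" using fun_cong[OF z, of i] by (simp add: pi_def A.free_simps)
    then show "\<exists>r. r \<in> carrier R \<and> v i = x \<otimes> r" using \<pi>_kernel[of "v i"] v i by (auto simp: free_carrier)
  qed
  from bchoice[OF this] obtain r where r: "\<And>i. i < n \<Longrightarrow> r i \<in> carrier R" "\<And>i. i < n \<Longrightarrow> v i = x \<otimes> r i" by auto
  have w: "(\<lambda>i\<in>{..<n}. r i) \<in> carrier (free_module R n)" using r by (simp add: free_carrier)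
  have "v = x \<odot>\<^bsub>free_module R n\<^esub> (\<lambda>i\<in>{..<n}. r i)"
    by (rule free_eqI[OF v]) (use r x_closed in \<open>auto simp: free_simps free_carrier\<close>)
  then show ?thesis using w by blast
qed

lemma free_regular:
  assumes v: "v \<in> carrier (free_module R n)" and z: "x \<odot>\<^bsub>free_module R n\<^esub> v = \<zero>\<^bsub>free_module R n\<^esub>"
  shows "v = \<zero>\<^bsub>free_module R n\<^esub>"
proof (rule free_eqI[OF v])
  show "\<zero>\<^bsub>free_module R n\<^esub> \<in> carrier (free_module R n)" by (simp add: free_simps free_carrier)
  fix i assume i: "i < n"
  then have "x \<otimes> v i = \<zero>" using fun_cong[OF z, of i] by (simp add: free_simps)
  then show "v i = \<zero>\<^bsub>free_module R n\<^esub> i" using x_regular[of "v i"] v i by (simp add: free_simps free_carrier)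
qed

lemma pi_smult_x:
  assumes v: "v \<in> carrier (free_module R n)" shows "pi n (x \<odot>\<^bsub>free_module R n\<^esub> v) = \<zero>\<^bsub>free_module A n\<^esub>"
proof -
  have "\<pi> x = \<zero>\<^bsub>A\<^esub>" using \<pi>_kernel[OF x_closed] x_closed by (metis one_closed r_one)
  moreover have "\<pi> (v i) \<in> carrier A" if "i < n" for i using v that by (simp add: free_carrier \<pi>_simps)
  ultimately show ?thesis using v x_closed by (auto simp: pi_def free_simps A.free_simps free_carrier \<pi>_simps intro!: restrict_ext)
qed

text \<open>Reducing a free resolution modulo an element regular on the ring and on the module keeps it exact,
  since \<open>D\<^sub>i v \<in> xF\<^sub>i\<close> forces \<open>D\<^sub>i v = x D\<^sub>i u\<close>.\<close>

lemma free_resolution_reduction: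
  assumes r: "free_resolution R M b D e" and M: "module R M" and MA: "module A MA"
    and M_regular: "\<And>m. m \<in> carrier M \<Longrightarrow> x \<odot>\<^bsub>M\<^esub> m = \<zero>\<^bsub>M\<^esub> \<Longrightarrow> m = \<zero>\<^bsub>M\<^esub>"
    and sigma: "\<sigma> \<in> module_hom R M (restrict_scalars \<pi> MA)" "\<sigma> ` carrier M = carrier MA"
    and ker: "\<And>m. m \<in> carrier M \<Longrightarrow> \<sigma> m = \<zero>\<^bsub>MA\<^esub> \<longleftrightarrow> (\<exists>m'\<in>carrier M. m = x \<odot>\<^bsub>M\<^esub> m')"
  shows "\<exists>D' e'. free_resolution A MA b D' e' \<and>
    (\<forall>i. \<forall>v\<in>carrier (free_module R (b (Suc i))). D' i (pi (b (Suc i)) v) = pi (b i) (D i v))"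
proof -
  interpret M: module R M by (rule M)
  interpret MA: module A MA by (rule MA)
  let ?F = "\<lambda>i. free_module R (b i)" and ?G = "\<lambda>i. free_module A (b i)"
  let ?\<pi> = "\<lambda>i. pi (b i)"
  note d = free_resolutionD[OF r] and cl = module_hom_closed and m = free_module_module
  have Dc: "D i v \<in> carrier (?F i)" if "v \<in> carrier (?F (Suc i))" for i v by (rule cl[OF d(2) that])
  obtain D' where D': "complex A b D'" "\<And>i v. v \<in> carrier (?F (Suc i)) \<Longrightarrow> D' i (?\<pi> (Suc i) v) = ?\<pi> i (D i v)"
    using descend_complex[OF resolution_complex[OF r]] by blast
  have D'h: "D' i \<in> module_hom A (?G (Suc i)) (?G i)" for i using D'(1) by (simp add: complex_def)
  have D'D': "D' i (D' (Suc i) w) = \<zero>\<^bsub>?G i\<^esub>" if "w \<in> carrier (?G (Suc (Suc i)))" for i w using D'(1) that by (simp add: complex_def)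
  obtain e' where e': "e' \<in> module_hom A (?G 0) MA" "\<And>v. v \<in> carrier (?F 0) \<Longrightarrow> e' (?\<pi> 0 v) = \<sigma> (e v)"
    using descend[OF MA module_hom_comp[OF d(1) sigma(1)]] by blast
  have pi_zero: "?\<pi> i \<zero>\<^bsub>?F i\<^esub> = \<zero>\<^bsub>?G i\<^esub>" for i
    using module_hom_zero[OF m restrict_scalars_module[OF A.free_module_module] pi_hom] by (simp add: restrict_scalars_simps)
  have sub: "?\<pi> i (u \<ominus>\<^bsub>?F i\<^esub> x \<odot>\<^bsub>?F i\<^esub> v) = ?\<pi> i u" if uv: "u \<in> carrier (?F i)" "v \<in> carrier (?F i)" for i u v
  proof -
    interpret F: module R "?F i" by (rule m)
    interpret G: module A "?G i" by (rule A.free_module_module)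
    have xv: "x \<odot>\<^bsub>?F i\<^esub> v \<in> carrier (?F i)" using uv x_closed by simp
    have "u = (u \<ominus>\<^bsub>?F i\<^esub> x \<odot>\<^bsub>?F i\<^esub> v) \<oplus>\<^bsub>?F i\<^esub> x \<odot>\<^bsub>?F i\<^esub> v" using F.diff_add_cancel[OF uv(1) xv] by simp
    then have "?\<pi> i u = ?\<pi> i (u \<ominus>\<^bsub>?F i\<^esub> x \<odot>\<^bsub>?F i\<^esub> v) \<oplus>\<^bsub>?G i\<^esub> ?\<pi> i (x \<odot>\<^bsub>?F i\<^esub> v)"
      using module_hom_add[OF pi_hom F.diff_closed[OF uv(1) xv] xv] by (simp add: restrict_scalars_simps)
    then show ?thesis using pi_smult_x[OF uv(2)] pi_closed[OF F.diff_closed[OF uv(1) xv]] by simp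
  qed
  have sub_hom: "f (u \<ominus>\<^bsub>?F i\<^esub> x \<odot>\<^bsub>?F i\<^esub> v) = \<zero>\<^bsub>Y\<^esub>"
    if Y: "module R Y" and f: "f \<in> module_hom R (?F i) Y" and uv: "u \<in> carrier (?F i)" "v \<in> carrier (?F i)"
      and e: "f u = x \<odot>\<^bsub>Y\<^esub> f v" for f i u v and Y :: "('a, 'y, 'n) module_scheme"
  proof -
    interpret F: module R "?F i" by (rule m)
    interpret Y: module R Y by (rule Y)
    have "f (u \<ominus>\<^bsub>?F i\<^esub> x \<odot>\<^bsub>?F i\<^esub> v) = f u \<ominus>\<^bsub>Y\<^esub> f (x \<odot>\<^bsub>?F i\<^esub> v)"
      by (rule module_hom_minus[OF m Y f uv(1)]) (use uv x_closed in simp)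
    then show ?thesis using module_hom_smult[OF f x_closed uv(2)] e cl[OF f uv(2)] x_closed by (simp add: Y.minus_eq Y.r_neg)
  qed
  have "free_resolution A MA b D' e'" unfolding free_resolution_def Let_def
  proof (intro conjI allI)
    show "e' \<in> module_hom A (?G 0) MA" by (rule e')
    show "D' i \<in> module_hom A (?G (Suc i)) (?G i)" for i by (rule D'h)
    show "e' ` carrier (?G 0) = carrier MA"
    proof
      show "e' ` carrier (?G 0) \<subseteq> carrier MA" using cl[OF e'(1)] by blast
      show "carrier MA \<subseteq> e' ` carrier (?G 0)"
      proof
        fix y assume "y \<in> carrier MA"
        then obtain m' where m': "m' \<in> carrier M" "y = \<sigma> m'" using sigma(2) by blast
        obtain v where v: "v \<in> carrier (?F 0)" "e v = m'" using d(3)[OF m'(1)] by blast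
        then have "y = e' (?\<pi> 0 v)" using e'(2) m'(2) by simp
        then show "y \<in> e' ` carrier (?G 0)" using pi_closed[OF v(1)] by blast
      qed
    qed
    show "D' 0 ` carrier (?G 1) = a_kernel (?G 0) MA e'"
    proof
      show "D' 0 ` carrier (?G 1) \<subseteq> a_kernel (?G 0) MA e'"
      proof
        fix y assume "y \<in> D' 0 ` carrier (?G 1)"
        then obtain w where w: "w \<in> carrier (?G (Suc 0))" "y = D' 0 w" by auto
        then obtain v where v: "v \<in> carrier (?F (Suc 0))" "w = ?\<pi> (Suc 0) v" using pi_surj by blast
        have "e' y = \<sigma> (e (D 0 v))" using w(2) v D'(2)[OF v(1)] e'(2)[OF Dc[OF v(1)]] by simp
        also have "\<dots> = \<zero>\<^bsub>MA\<^esub>" using resolution_augmentation[OF r v(1)] module_hom_zero[OF M restrict_scalars_module[OF MA] sigma(1)]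
          by (simp add: restrict_scalars_simps)
        finally show "y \<in> a_kernel (?G 0) MA e'" using cl[OF D'h w(1)] w(2) by (simp add: a_kernel_mem)
      qed
      show "a_kernel (?G 0) MA e' \<subseteq> D' 0 ` carrier (?G 1)"
      proof
        fix w assume "w \<in> a_kernel (?G 0) MA e'"
        then have w: "w \<in> carrier (?G 0)" "e' w = \<zero>\<^bsub>MA\<^esub>" by (simp_all add: a_kernel_mem)
        then obtain v where v: "v \<in> carrier (?F 0)" "w = ?\<pi> 0 v" using pi_surj by blast
        have "\<sigma> (e v) = \<zero>\<^bsub>MA\<^esub>" using e'(2)[OF v(1)] v(2) w(2) by simp
        then obtain m' where m': "m' \<in> carrier M" "e v = x \<odot>\<^bsub>M\<^esub> m'" using ker[OF cl[OF d(1) v(1)]] by blast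
        obtain u where u: "u \<in> carrier (?F 0)" "e u = m'" using d(3)[OF m'(1)] by blast
        interpret F: module R "?F 0" by (rule m)
        have c: "v \<ominus>\<^bsub>?F 0\<^esub> x \<odot>\<^bsub>?F 0\<^esub> u \<in> carrier (?F 0)" by (rule F.diff_closed[OF v(1) F.smult_closed[OF x_closed u(1)]])
        have "e (v \<ominus>\<^bsub>?F 0\<^esub> x \<odot>\<^bsub>?F 0\<^esub> u) = \<zero>\<^bsub>M\<^esub>" by (rule sub_hom[OF M d(1) v(1) u(1)]) (simp add: m'(2) u(2))
        then obtain t where t: "t \<in> carrier (?F (Suc 0))" "v \<ominus>\<^bsub>?F 0\<^esub> x \<odot>\<^bsub>?F 0\<^esub> u = D 0 t" using d(4)[OF c] by blast
        have "w = D' 0 (?\<pi> (Suc 0) t)" using sub[OF v(1) u(1)] v(2) t(2) D'(2)[OF t(1)] by simp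
        then show "w \<in> D' 0 ` carrier (?G 1)" using pi_closed[OF t(1)] by simp
      qed
    qed
    fix i
    show "D' (Suc i) ` carrier (?G (Suc (Suc i))) = a_kernel (?G (Suc i)) (?G i) (D' i)"
    proof
      show "D' (Suc i) ` carrier (?G (Suc (Suc i))) \<subseteq> a_kernel (?G (Suc i)) (?G i) (D' i)"
        using D'D' cl[OF D'h] by (auto simp: a_kernel_mem)
      show "a_kernel (?G (Suc i)) (?G i) (D' i) \<subseteq> D' (Suc i) ` carrier (?G (Suc (Suc i)))"
      proof
        fix w assume "w \<in> a_kernel (?G (Suc i)) (?G i) (D' i)"
        then have w: "w \<in> carrier (?G (Suc i))" "D' i w = \<zero>\<^bsub>?G i\<^esub>" by (simp_all add: a_kernel_mem)
        then obtain v where v: "v \<in> carrier (?F (Suc i))" "w = ?\<pi> (Suc i) v" using pi_surj by blast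
        have "?\<pi> i (D i v) = \<zero>\<^bsub>?G i\<^esub>" using D'(2)[OF v(1)] v(2) w(2) by simp
        then obtain u where u: "u \<in> carrier (?F i)" "D i v = x \<odot>\<^bsub>?F i\<^esub> u" using pi_kernel[OF Dc[OF v(1)]] by blast
        \<comment> \<open>The map following \<open>D i\<close> sends \<open>u\<close> to an element
          killed by \<open>x\<close>. The factor \<open>x\<close> cancels, in \<open>M\<close> by
          \<open>M_regular\<close> when \<open>i = 0\<close> and in a free module otherwise, and
          exactness makes \<open>u\<close> a boundary.\<close>
        have "u \<in> D i ` carrier (?F (Suc i))"
        proof (cases i)
          case 0
          have "x \<odot>\<^bsub>M\<^esub> e u = e (D 0 v)" using module_hom_smult[OF d(1) x_closed] u 0 by simp
          also have "\<dots> = \<zero>\<^bsub>M\<^esub>" using resolution_augmentation[OF r] v(1) 0 by simp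
          finally have "e u = \<zero>\<^bsub>M\<^esub>" using M_regular cl[OF d(1)] u(1) 0 by simp
          then show ?thesis using d(4) u(1) 0 by simp
        next
          case (Suc k)
          have uk: "u \<in> carrier (?F (Suc k))" using u(1) Suc by simp
          have "x \<odot>\<^bsub>?F k\<^esub> D k u = D k (D (Suc k) v)" using module_hom_smult[OF d(2) x_closed uk] u(2) Suc by simp
          also have "\<dots> = \<zero>\<^bsub>?F k\<^esub>" using resolution_complex[OF r] v(1) Suc by (simp add: complex_def)
          finally have "D k u = \<zero>\<^bsub>?F k\<^esub>" using free_regular[OF Dc[OF uk]] by simp
          then show ?thesis using d(5)[OF uk] Suc by simp
        qed
        then obtain s where s: "s \<in> carrier (?F (Suc i))" "D i s = u" by blast
        interpret F: module R "?F (Suc i)" by (rule m)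
        have c: "v \<ominus>\<^bsub>?F (Suc i)\<^esub> x \<odot>\<^bsub>?F (Suc i)\<^esub> s \<in> carrier (?F (Suc i))" by (rule F.diff_closed[OF v(1) F.smult_closed[OF x_closed s(1)]])
        have "D i (v \<ominus>\<^bsub>?F (Suc i)\<^esub> x \<odot>\<^bsub>?F (Suc i)\<^esub> s) = \<zero>\<^bsub>?F i\<^esub>" by (rule sub_hom[OF m d(2) v(1) s(1)]) (simp add: u(2) s(2))
        then obtain t where t: "t \<in> carrier (?F (Suc (Suc i)))" "v \<ominus>\<^bsub>?F (Suc i)\<^esub> x \<odot>\<^bsub>?F (Suc i)\<^esub> s = D (Suc i) t" using d(5)[OF c] by blast
        have "w = D' (Suc i) (?\<pi> (Suc (Suc i)) t)" using sub[OF v(1) s(1)] v(2) t(2) D'(2)[OF t(1)] by simp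
        then show "w \<in> D' (Suc i) ` carrier (?G (Suc (Suc i)))" using pi_closed[OF t(1)] by simp
      qed
    qed
  qed
  then show ?thesis using D'(2) by blast
qed

end

section \<open>Reduced modules and cyclic modules\<close>

context module begin

lemma ideal_smult_principal:
  assumes x: "x \<in> carrier R"
  shows "ideal_smult R (PIdl x) M = (\<lambda>v. x \<odot>\<^bsub>M\<^esub> v) ` carrier M"
proof
  have "submodule ((\<lambda>v. x \<odot>\<^bsub>M\<^esub> v) ` carrier M) R M"
    by (rule image_submodule[OF module_axioms], rule module_homI)
      (use x in \<open>simp_all add: smult_r_distr smult_assoc1[symmetric] R.m_comm\<close>)
  then show "ideal_smult R (PIdl x) M \<subseteq> (\<lambda>v. x \<odot>\<^bsub>M\<^esub> v) ` carrier M"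
  proof (rule ideal_smult_minimal)
    fix a v assume a: "a \<in> PIdl x" and v: "v \<in> carrier M"
    then obtain c where c: "c \<in> carrier R" "a = x \<otimes> c" using x by (auto simp: cgenideal_def R.m_comm)
    then have "a \<odot>\<^bsub>M\<^esub> v = x \<odot>\<^bsub>M\<^esub> (c \<odot>\<^bsub>M\<^esub> v)" using x v by (simp add: smult_assoc1)
    then show "a \<odot>\<^bsub>M\<^esub> v \<in> (\<lambda>v. x \<odot>\<^bsub>M\<^esub> v) ` carrier M" using c v by blast
  qed
  show "(\<lambda>v. x \<odot>\<^bsub>M\<^esub> v) ` carrier M \<subseteq> ideal_smult R (PIdl x) M"
    using ideal_smult_mem[OF R.cgenideal_self[OF x]] by blast
qed

lemma reduced_module_simps:
  "carrier (reduced_module R J M) = (\<lambda>v. ideal_smult R J M +>\<^bsub>M\<^esub> v) ` carrier M"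
  "add (reduced_module R J M) = set_add M" "\<zero>\<^bsub>reduced_module R J M\<^esub> = ideal_smult R J M"
  by (auto simp: reduced_module_def Let_def A_RCOSETS_def')

lemma reduced_module_add:
  assumes J: "ideal J R" and "u \<in> carrier M" "v \<in> carrier M"
  shows "(ideal_smult R J M +>\<^bsub>M\<^esub> u) \<oplus>\<^bsub>reduced_module R J M\<^esub> (ideal_smult R J M +>\<^bsub>M\<^esub> v) =
    ideal_smult R J M +>\<^bsub>M\<^esub> (u \<oplus>\<^bsub>M\<^esub> v)"
  unfolding reduced_module_simps by (rule coset_sum[OF ideal_smult_submodule[OF J] assms(2,3)])

lemma reduced_module_smult:
  assumes J: "ideal J R" and a: "a \<in> carrier R" and v: "v \<in> carrier M"
  shows "(J +> a) \<odot>\<^bsub>reduced_module R J M\<^esub> (ideal_smult R J M +>\<^bsub>M\<^esub> v) = ideal_smult R J M +>\<^bsub>M\<^esub> (a \<odot>\<^bsub>M\<^esub> v)"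
proof -
  let ?N = "ideal_smult R J M"
  have N: "submodule ?N R M" by (rule ideal_smult_submodule[OF J])
  have c: "?N +>\<^bsub>M\<^esub> (c \<odot>\<^bsub>M\<^esub> u) = ?N +>\<^bsub>M\<^esub> (a \<odot>\<^bsub>M\<^esub> v)" if "c \<in> J +> a" "u \<in> ?N +>\<^bsub>M\<^esub> v" for c u
  proof -
    have cc: "c \<in> carrier R" "c \<ominus> a \<in> J" using that(1) R.coset_mem_iff[OF J a] by auto
    have e: "c \<odot>\<^bsub>M\<^esub> v \<ominus>\<^bsub>M\<^esub> a \<odot>\<^bsub>M\<^esub> v = (c \<ominus> a) \<odot>\<^bsub>M\<^esub> v"
      using cc a v by (simp add: M.minus_eq R.minus_eq smult_l_distr smult_l_minus)
    have "c \<odot>\<^bsub>M\<^esub> v \<ominus>\<^bsub>M\<^esub> a \<odot>\<^bsub>M\<^esub> v \<in> ?N" unfolding e by (rule ideal_smult_mem[OF cc(2) v])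
    then have "?N +>\<^bsub>M\<^esub> (c \<odot>\<^bsub>M\<^esub> v) = ?N +>\<^bsub>M\<^esub> (a \<odot>\<^bsub>M\<^esub> v)" using module_coset_eq_iff[OF N] cc a v by simp
    then show ?thesis using coset_smult[OF N cc(1) v that(2)] by simp
  qed
  have "(J +> a) \<odot>\<^bsub>reduced_module R J M\<^esub> (?N +>\<^bsub>M\<^esub> v) = (\<Union>c\<in>J +> a. \<Union>u\<in>?N +>\<^bsub>M\<^esub> v. ?N +>\<^bsub>M\<^esub> (c \<odot>\<^bsub>M\<^esub> u))"
    by (simp add: reduced_module_def Let_def)
  also have "\<dots> = (\<Union>c\<in>J +> a. \<Union>u\<in>?N +>\<^bsub>M\<^esub> v. ?N +>\<^bsub>M\<^esub> (a \<odot>\<^bsub>M\<^esub> v))" by (intro SUP_cong refl c)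
  also have "\<dots> = ?N +>\<^bsub>M\<^esub> (a \<odot>\<^bsub>M\<^esub> v)" using R.coset_self[OF J a] module_coset_self[OF N v] by auto
  finally show ?thesis .
qed

lemma reduced_module_module:
  assumes J: "ideal J R" shows "module (R Quot J) (reduced_module R J M)"
proof (rule moduleI)
  show "cring (R Quot J)" by (rule ideal.quotient_is_cring[OF J R.is_cring])
  show "abelian_group (reduced_module R J M)"
    by (rule quotient_abelian_group[OF ideal_smult_submodule[OF J]]) (simp_all add: reduced_module_simps)
  have one: "\<one>\<^bsub>R Quot J\<^esub> = J +> \<one>" by (simp add: FactRing_def)
  note s = reduced_module_add[OF J] reduced_module_smult[OF J] R.quot_add[OF J] R.quot_mult[OF J]
  fix a v assume "a \<in> carrier (R Quot J)" "v \<in> carrier (reduced_module R J M)"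
  then obtain a' v' where av: "a' \<in> carrier R" "a = J +> a'" "v' \<in> carrier M" "v = ideal_smult R J M +>\<^bsub>M\<^esub> v'"
    by (auto simp: R.quotient_carrier reduced_module_simps)
  show "a \<odot>\<^bsub>reduced_module R J M\<^esub> v \<in> carrier (reduced_module R J M)" using av by (simp add: s reduced_module_simps(1))
  {
    fix c assume "c \<in> carrier (R Quot J)"
    then obtain c' where c: "c' \<in> carrier R" "c = J +> c'" by (auto simp: R.quotient_carrier)
    show "(a \<oplus>\<^bsub>R Quot J\<^esub> c) \<odot>\<^bsub>reduced_module R J M\<^esub> v = a \<odot>\<^bsub>reduced_module R J M\<^esub> v \<oplus>\<^bsub>reduced_module R J M\<^esub> c \<odot>\<^bsub>reduced_module R J M\<^esub> v"
      using av c by (simp add: s smult_l_distr)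
    show "(a \<otimes>\<^bsub>R Quot J\<^esub> c) \<odot>\<^bsub>reduced_module R J M\<^esub> v = a \<odot>\<^bsub>reduced_module R J M\<^esub> (c \<odot>\<^bsub>reduced_module R J M\<^esub> v)"
      using av c by (simp add: s smult_assoc1)
  }
  {
    fix u assume "u \<in> carrier (reduced_module R J M)"
    then obtain u' where u: "u' \<in> carrier M" "u = ideal_smult R J M +>\<^bsub>M\<^esub> u'" by (auto simp: reduced_module_simps)
    show "a \<odot>\<^bsub>reduced_module R J M\<^esub> (v \<oplus>\<^bsub>reduced_module R J M\<^esub> u) = a \<odot>\<^bsub>reduced_module R J M\<^esub> v \<oplus>\<^bsub>reduced_module R J M\<^esub> a \<odot>\<^bsub>reduced_module R J M\<^esub> u"
      using av u by (simp add: s smult_r_distr)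
  }
next
  have one: "\<one>\<^bsub>R Quot J\<^esub> = J +> \<one>" by (simp add: FactRing_def)
  fix v assume "v \<in> carrier (reduced_module R J M)"
  then obtain v' where v: "v' \<in> carrier M" "v = ideal_smult R J M +>\<^bsub>M\<^esub> v'" by (auto simp: reduced_module_simps)
  then show "\<one>\<^bsub>R Quot J\<^esub> \<odot>\<^bsub>reduced_module R J M\<^esub> v = v" by (simp add: one reduced_module_smult[OF J])
qed

end

context cring begin

lemma quotient_ring_surjection:
  assumes J: "ideal J R" shows "ring_surjection R (R Quot J) ((+>) J)"
  by (intro ring_surjection.intro ring_surjection_axioms.intro is_cring ideal.quotient_is_cring[OF J] ideal.rcos_ring_hom[OF J])
    (simp add: quotient_carrier)

lemma quotient_reduction:
  assumes x: "x \<in> carrier R" "\<And>a. a \<in> carrier R \<Longrightarrow> x \<otimes> a = \<zero> \<Longrightarrow> a = \<zero>"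
  shows "reduction_by_nonzerodivisor R (R Quot (PIdl x)) ((+>) (PIdl x)) x"
proof (intro reduction_by_nonzerodivisor.intro reduction_by_nonzerodivisor_axioms.intro quotient_ring_surjection)
  show J: "ideal (PIdl x) R" by (rule cgenideal_ideal[OF x(1)])
  fix a assume a: "a \<in> carrier R"
  have "(PIdl x +> a = \<zero>\<^bsub>R Quot (PIdl x)\<^esub>) = (PIdl x +> a = PIdl x +> \<zero>)"
    using a_rcos_zero[OF J ideal_memD(2)[OF J]] by (simp add: FactRing_def)
  also have "\<dots> = (a \<in> PIdl x)" using coset_eq_iff[OF J a zero_closed] a by (simp add: minus_eq)
  also have "\<dots> = (\<exists>r\<in>carrier R. a = x \<otimes> r)" using x(1) by (auto simp: cgenideal_def m_comm)
  finally show "(PIdl x +> a = \<zero>\<^bsub>R Quot (PIdl x)\<^esub>) = (\<exists>r\<in>carrier R. a = x \<otimes> r)" .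
qed (use x in auto)

definition cyclic_module where "cyclic_module K = quotient_module R (regular_module R) K"

lemma cyclic_module_simps:
  assumes K: "ideal K R"
  shows "carrier (cyclic_module K) = (+>) K ` carrier R" "\<zero>\<^bsub>cyclic_module K\<^esub> = K"
    "a \<in> carrier R \<Longrightarrow> c \<in> carrier R \<Longrightarrow> (K +> a) \<oplus>\<^bsub>cyclic_module K\<^esub> (K +> c) = K +> (a \<oplus> c)"
    "a \<in> carrier R \<Longrightarrow> c \<in> carrier R \<Longrightarrow> a \<odot>\<^bsub>cyclic_module K\<^esub> (K +> c) = K +> (a \<otimes> c)"
    "module R (cyclic_module K)"
proof -
  interpret X: module R "regular_module R" by (rule regular_module_module)
  have e: "a_r_coset (regular_module R) N a = N +> a" for N a by (simp add: a_r_coset_def' regular_module_simps)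
  have s: "submodule K R (regular_module R)" using K by (simp add: regular_submodule_iff)
  show "carrier (cyclic_module K) = (+>) K ` carrier R" unfolding cyclic_module_def X.quotient_module_carrier e by (simp add: regular_module_simps)
  show "\<zero>\<^bsub>cyclic_module K\<^esub> = K" unfolding cyclic_module_def by (rule X.quotient_module_zero)
  show "a \<in> carrier R \<Longrightarrow> c \<in> carrier R \<Longrightarrow> (K +> a) \<oplus>\<^bsub>cyclic_module K\<^esub> (K +> c) = K +> (a \<oplus> c)"
    unfolding cyclic_module_def using X.quotient_module_add[OF s, of a c] by (simp add: e regular_module_simps)
  show "a \<in> carrier R \<Longrightarrow> c \<in> carrier R \<Longrightarrow> a \<odot>\<^bsub>cyclic_module K\<^esub> (K +> c) = K +> (a \<otimes> c)"
    unfolding cyclic_module_def using X.quotient_module_smult[OF s, of a c] by (simp add: e regular_module_simps)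
  show "module R (cyclic_module K)" unfolding cyclic_module_def by (rule X.quotient_module_module[OF s])
qed

end

section \<open>The exact sequence of cyclic modules given by multiplication with
  \<open>x\<close>\<close>

context reduction_by_nonzerodivisor begin

lemma image_coset:
  assumes K: "ideal K R" and a: "a \<in> carrier R" shows "\<pi> ` (K +> a) = a_r_coset A (\<pi> ` K) (\<pi> a)"
  using a ideal_memD(1)[OF K] by (force simp: a_r_coset_def' \<pi>_simps)

text \<open>Because \<open>K'\<close> is the colon ideal of \<open>K\<close> by \<open>x\<close>,
  multiplication by \<open>x\<close> embeds \<open>R\<close> modulo \<open>K'\<close> into
  \<open>R\<close> modulo \<open>K\<close>; the cokernel is \<open>A\<close> modulo the image of
  \<open>K\<close>. The long exact sequence is applied to this.\<close>

lemma chain_length_ext_subs_cyclic_le: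
  assumes cD: "complex R b D" and cD': "complex A b D'"
    and DD': "\<And>i v. v \<in> carrier (free_module R (b (Suc i))) \<Longrightarrow> D' i (pi (b (Suc i)) v) = pi (b i) (D i v)"
    and K: "ideal K R" "ideal K' R" "ideal (\<pi> ` K) A" and KK': "\<And>a. a \<in> carrier R \<Longrightarrow> x \<otimes> a \<in> K \<longleftrightarrow> a \<in> K'"
  shows "chain_length (ext_subs A b D' (A.cyclic_module (\<pi> ` K)) j) \<le>
    chain_length (ext_subs R b D (cyclic_module K) j) + chain_length (ext_subs R b D (cyclic_module K') (Suc j))"
proof -
  note s = cyclic_module_simps[OF K(1)] and s' = cyclic_module_simps[OF K(2)] and sA = A.cyclic_module_simps[OF K(3)]
  \<comment> \<open>Multiplication by \<open>x\<close> on cosets, as a union over representatives;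
    all members of the union agree since \<open>x\<close> maps \<open>K'\<close> into
    \<open>K\<close>.\<close>
  define \<mu> where "\<mu> X = (\<Union>a\<in>X. K +> (x \<otimes> a))" for X
  have mu: "\<mu> (K' +> a) = K +> (x \<otimes> a)" if a: "a \<in> carrier R" for a
  proof -
    have "K +> (x \<otimes> c) = K +> (x \<otimes> a)" if "c \<in> K' +> a" for c
    proof -
      have c: "c \<in> carrier R" "c \<ominus> a \<in> K'" using that coset_mem_iff[OF K(2) a] by auto
      have e: "x \<otimes> c \<ominus> x \<otimes> a = x \<otimes> (c \<ominus> a)" using c(1) a x_closed by (algebra)
      have "x \<otimes> c \<ominus> x \<otimes> a \<in> K" unfolding e using KK' c a by simp
      then show ?thesis using coset_eq_iff[OF K(1)] c a x_closed by simp
    qed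
    then show ?thesis unfolding \<mu>_def by (intro UN_constant_eq[OF coset_self[OF K(2) a]]) simp
  qed
  have psi: "\<pi> ` (K +> a) = a_r_coset A (\<pi> ` K) (\<pi> a)" if "a \<in> carrier R" for a by (rule image_coset[OF K(1) that])
  show ?thesis
  proof (rule chain_length_ext_subs_le[OF cD cD' DD' s'(5) s(5) sA(5), where \<mu> = \<mu> and \<psi> = "(`) \<pi>"])
    show "\<mu> \<in> module_hom R (cyclic_module K') (cyclic_module K)"
      by (rule module_homI) (auto simp: s s' mu x_closed r_distr m_lcomm)
    show "inj_on \<mu> (carrier (cyclic_module K'))"
    proof (rule inj_onI)
      fix X Y assume "X \<in> carrier (cyclic_module K')" "Y \<in> carrier (cyclic_module K')" and e: "\<mu> X = \<mu> Y"
      then obtain a c where ac: "a \<in> carrier R" "X = K' +> a" "c \<in> carrier R" "Y = K' +> c" by (auto simp: s')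
      have "x \<otimes> a \<ominus> x \<otimes> c \<in> K" using e ac mu coset_eq_iff[OF K(1)] x_closed by simp
      moreover have "x \<otimes> a \<ominus> x \<otimes> c = x \<otimes> (a \<ominus> c)" using ac x_closed by (algebra)
      ultimately have "a \<ominus> c \<in> K'" using KK' ac by simp
      then show "X = Y" using ac coset_eq_iff[OF K(2)] by simp
    qed
    show "(`) \<pi> \<in> module_hom R (cyclic_module K) (restrict_scalars \<pi> (A.cyclic_module (\<pi> ` K)))"
    proof (rule module_homI)
      fix X assume "X \<in> carrier (cyclic_module K)"
      then obtain a where a: "a \<in> carrier R" "X = K +> a" by (auto simp: s)
      show "\<pi> ` X \<in> carrier (restrict_scalars \<pi> (A.cyclic_module (\<pi> ` K)))"
        unfolding a(2) psi[OF a(1)] restrict_scalars_simps sA(1) by (intro imageI \<pi>_simps a)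
      show "\<pi> ` (c \<odot>\<^bsub>cyclic_module K\<^esub> X) = c \<odot>\<^bsub>restrict_scalars \<pi> (A.cyclic_module (\<pi> ` K))\<^esub> (\<pi> ` X)" if c: "c \<in> carrier R" for c
        unfolding a(2) restrict_scalars_simps s(4)[OF c a(1)] psi[OF a(1)] psi[OF m_closed[OF c a(1)]]
          sA(4)[OF \<pi>_simps(1)[OF c] \<pi>_simps(1)[OF a(1)]] \<pi>_simps(3)[OF c a(1)] ..
      fix Y assume "Y \<in> carrier (cyclic_module K)"
      then obtain c where c: "c \<in> carrier R" "Y = K +> c" by (auto simp: s)
      show "\<pi> ` (X \<oplus>\<^bsub>cyclic_module K\<^esub> Y) = \<pi> ` X \<oplus>\<^bsub>restrict_scalars \<pi> (A.cyclic_module (\<pi> ` K))\<^esub> \<pi> ` Y"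
        unfolding a(2) c(2) restrict_scalars_simps s(3)[OF a(1) c(1)] psi[OF a(1)] psi[OF c(1)] psi[OF a_closed[OF a(1) c(1)]]
          sA(3)[OF \<pi>_simps(1)[OF a(1)] \<pi>_simps(1)[OF c(1)]] \<pi>_simps(2)[OF a(1) c(1)] ..
    qed
    have "(`) \<pi> ` carrier (cyclic_module K) = (\<lambda>a. a_r_coset A (\<pi> ` K) (\<pi> a)) ` carrier R"
      unfolding s(1) image_image using psi by (rule image_cong[OF refl])
    also have "\<dots> = carrier (A.cyclic_module (\<pi> ` K))" unfolding sA(1) \<pi>_surj[symmetric] image_image ..
    finally show "(`) \<pi> ` carrier (cyclic_module K) = carrier (A.cyclic_module (\<pi> ` K))" .
    fix Y assume "Y \<in> carrier (cyclic_module K)"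
    then obtain a where a: "a \<in> carrier R" "Y = K +> a" by (auto simp: s)
    have "\<pi> ` Y = \<zero>\<^bsub>A.cyclic_module (\<pi> ` K)\<^esub> \<longleftrightarrow> a_r_coset A (\<pi> ` K) (\<pi> a) = a_r_coset A (\<pi> ` K) \<zero>\<^bsub>A\<^esub>"
      using A.a_rcos_zero[OF K(3) A.ideal_memD(2)[OF K(3)]] psi[OF a(1)] a(2) sA(2) by simp
    also have "\<dots> \<longleftrightarrow> \<pi> a \<in> \<pi> ` K" using A.coset_eq_iff[OF K(3) \<pi>_simps(1)[OF a(1)] A.zero_closed] \<pi>_simps(1)[OF a(1)] by (simp add: A.minus_eq)
    also have "\<dots> \<longleftrightarrow> (\<exists>r\<in>carrier R. a \<ominus> x \<otimes> r \<in> K)"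
    proof
      assume "\<pi> a \<in> \<pi> ` K"
      then obtain k where k: "k \<in> K" "\<pi> a = \<pi> k" by auto
      have kc: "k \<in> carrier R" by (rule ideal_memD(1)[OF K(1) k(1)])
      have am: "a \<ominus> k \<in> carrier R" using a kc by simp
      have "\<pi> (a \<ominus> k) \<oplus>\<^bsub>A\<^esub> \<pi> k = \<pi> k" using \<pi>_simps(2)[OF am kc] k(2) a(1) kc by (simp add: minus_eq a_assoc l_neg)
      then have "\<pi> (a \<ominus> k) = \<zero>\<^bsub>A\<^esub>" using \<pi>_simps(1)[OF am] \<pi>_simps(1)[OF kc] by simp
      then obtain r where r: "r \<in> carrier R" "a \<ominus> k = x \<otimes> r" using \<pi>_kernel[OF am] by auto
      have "a \<ominus> x \<otimes> r = a \<ominus> (a \<ominus> k)" using r by simp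
      also have "\<dots> = k" using a(1) kc by (algebra)
      finally show "\<exists>r\<in>carrier R. a \<ominus> x \<otimes> r \<in> K" using r k by auto
    next
      assume "\<exists>r\<in>carrier R. a \<ominus> x \<otimes> r \<in> K"
      then obtain r where r: "r \<in> carrier R" "a \<ominus> x \<otimes> r \<in> K" by auto
      have "\<pi> (x \<otimes> r) = \<zero>\<^bsub>A\<^esub>" using \<pi>_kernel r x_closed by auto
      moreover have "a = (a \<ominus> x \<otimes> r) \<oplus> x \<otimes> r" using a(1) r x_closed by (algebra)
      ultimately have "\<pi> a = \<pi> (a \<ominus> x \<otimes> r)" using \<pi>_simps(2)[of "a \<ominus> x \<otimes> r" "x \<otimes> r"] \<pi>_simps(1)[of "a \<ominus> x \<otimes> r"] a(1) r(1) x_closed by simp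
      then show "\<pi> a \<in> \<pi> ` K" using r by blast
    qed
    also have "\<dots> \<longleftrightarrow> (\<exists>r\<in>carrier R. K +> a = \<mu> (K' +> r))"
      using mu coset_eq_iff[OF K(1) a(1)] x_closed by auto
    also have "\<dots> \<longleftrightarrow> Y \<in> \<mu> ` carrier (cyclic_module K')" unfolding a(2) s'(1) by auto
    finally show "\<pi> ` Y = \<zero>\<^bsub>A.cyclic_module (\<pi> ` K)\<^esub> \<longleftrightarrow> Y \<in> \<mu> ` carrier (cyclic_module K')" .
  qed
qed

end

section \<open>The weighted sums and the final inequality\<close>

lemma pascal_sum:
  fixes a :: "nat \<Rightarrow> enat"
  shows "(\<Sum>j\<in>{0..D}. of_nat (D choose j) * (a j + a (Suc j))) = (\<Sum>j\<in>{0..Suc D}. of_nat (Suc D choose j) * a j)"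
proof -
  have "(\<Sum>j\<in>{0..Suc D}. of_nat (Suc D choose j) * a j) =
      a 0 + (\<Sum>j\<in>{0..D}. of_nat (D choose Suc j) * a (Suc j)) + (\<Sum>j\<in>{0..D}. of_nat (D choose j) * a (Suc j))"
    unfolding sum.atLeast0_atMost_Suc_shift by (simp add: sum.distrib distrib_right add_ac comp_def)
  also have "a 0 + (\<Sum>j\<in>{0..D}. of_nat (D choose Suc j) * a (Suc j)) = (\<Sum>j\<in>{0..Suc D}. of_nat (D choose j) * a j)"
    unfolding sum.atLeast0_atMost_Suc_shift by (simp add: comp_def)
  \<comment> \<open>The top term has coefficient \<open>D choose Suc D = 0\<close>, which
    annihilates even an infinite length.\<close>
  also have "\<dots> = (\<Sum>j\<in>{0..D}. of_nat (D choose j) * a j)" by (simp add: zero_enat_def[symmetric])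
  finally show ?thesis by (simp add: sum.distrib distrib_left)
qed

text \<open>The bound for exponent \<open>n + 1 - j\<close> involves
  \<open>(n + 1 - j) - 1 = n + 1 - Suc j\<close>, also under truncation, so both of its terms belong
  to the same \<open>n\<close>. Upper bounds for the dimension and the reduction number of the
  quotient are enough, as the summands are nonnegative and binomials increase with the upper
  index.\<close>

lemma weighted_sum_le:
  fixes e E :: "nat \<Rightarrow> nat \<Rightarrow> enat"
  assumes le: "\<And>j k. e j k \<le> E j k + E (Suc j) (k - 1)" and D: "D' \<le> D" and r: "r' \<le> r"
  shows "(\<Sum>j\<in>{0..D'}. \<Sum>n\<in>{0..<r'}. of_nat (D' choose j) * e j (n + 1 - j)) \<le>
    (\<Sum>j\<in>{0..Suc D}. \<Sum>n\<in>{0..<r}. of_nat (Suc D choose j) * E j (n + 1 - j))"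
proof -
  define a where "a j = (\<Sum>n\<in>{0..<r}. E j (n + 1 - j))" for j
  have ea: "(\<Sum>n\<in>{0..<r'}. e j (n + 1 - j)) \<le> a j + a (Suc j)" for j
  proof -
    have "(\<Sum>n\<in>{0..<r'}. e j (n + 1 - j)) \<le> (\<Sum>n\<in>{0..<r}. e j (n + 1 - j))" using r by (intro sum_mono2) auto
    also have "\<dots> \<le> (\<Sum>n\<in>{0..<r}. E j (n + 1 - j) + E (Suc j) (n + 1 - Suc j))"
    proof (rule sum_mono)
      fix n
      show "e j (n + 1 - j) \<le> E j (n + 1 - j) + E (Suc j) (n + 1 - Suc j)" using le[of j "n + 1 - j"] by simp
    qed
    finally show ?thesis by (simp add: a_def sum.distrib)
  qed
  have "(\<Sum>j\<in>{0..D'}. \<Sum>n\<in>{0..<r'}. of_nat (D' choose j) * e j (n + 1 - j)) =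
      (\<Sum>j\<in>{0..D'}. of_nat (D' choose j) * (\<Sum>n\<in>{0..<r'}. e j (n + 1 - j)))" by (simp add: sum_distrib_left)
  also have "\<dots> \<le> (\<Sum>j\<in>{0..D'}. of_nat (D choose j) * (a j + a (Suc j)))"
    by (intro sum_mono mult_mono ea) (auto simp: of_nat_eq_enat binomial_right_mono[OF D])
  also have "\<dots> \<le> (\<Sum>j\<in>{0..D}. of_nat (D choose j) * (a j + a (Suc j)))" using D by (intro sum_mono2) auto
  also have "\<dots> = (\<Sum>j\<in>{0..Suc D}. of_nat (Suc D choose j) * a j)" by (rule pascal_sum)
  finally show ?thesis by (simp add: a_def sum_distrib_left)
qed

lemma (in graded_cm) Phi_reduction_le:
  fixes V :: "('a, 'c, 'n) module_scheme"
  assumes V: "maximal_cohen_macaulay_module R V" and mm: "\<mm> = max_ideal R"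
    and d: "krull_dim R = enat d" "d \<ge> 1" and x: "superficial R I x"
  shows "Phi (R Quot (PIdl x)) (image_ideal R (PIdl x) I) (reduced_module R (PIdl x) V) \<le> Phi R I V"
proof -
  have xI: "x \<in> I" using x by (simp add: superficial_def)
  have xc: "x \<in> carrier R" by (rule ideal_memD(1)[OF I_ideal xI])
  note nzd = superficial_nonzerodivisor[OF x]
  let ?J = "PIdl x"
  let ?A = "R Quot ?J" and ?V = "reduced_module R ?J V"
  have J: "ideal ?J R" by (rule cgenideal_ideal[OF xc])
  interpret red: reduction_by_nonzerodivisor R ?A "(+>) ?J" x by (rule quotient_reduction[OF xc nzd])
  have Mm: "module R V" and fg: "finitely_generated R V"
    using V by (auto simp: maximal_cohen_macaulay_module_def cohen_macaulay_module_def)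
  interpret V: module R V by (rule Mm)
  have MA: "module ?A ?V" by (rule V.reduced_module_module[OF J])
  interpret MA: module ?A ?V by (rule MA)
  \<comment> \<open>One resolution serves for both sides: reduced modulo \<open>x\<close>, it
    resolves the reduced module with the same ranks \<open>b\<close>.\<close>
  obtain b D e where r: "free_resolution R V b D e" using free_resolution_exists[OF Mm fg] by blast
  have N: "submodule (ideal_smult R ?J V) R V" by (rule V.ideal_smult_submodule[OF J])
  have "\<exists>D' e'. free_resolution ?A ?V b D' e' \<and>
    (\<forall>i. \<forall>v\<in>carrier (free_module R (b (Suc i))). D' i (red.pi (b (Suc i)) v) = red.pi (b i) (D i v))"
  proof (rule red.free_resolution_reduction[OF r Mm MA, where \<sigma> = "\<lambda>v. ideal_smult R ?J V +>\<^bsub>V\<^esub> v"])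
    show "m = \<zero>\<^bsub>V\<^esub>" if "m \<in> carrier V" "x \<odot>\<^bsub>V\<^esub> m = \<zero>\<^bsub>V\<^esub>" for m
      by (rule nonzerodivisor_regular_on_MCM[OF V mm d xc nzd that])
    show "(\<lambda>v. ideal_smult R ?J V +>\<^bsub>V\<^esub> v) \<in> module_hom R V (restrict_scalars ((+>) ?J) ?V)"
      by (rule module_homI)
        (simp_all add: restrict_scalars_simps V.reduced_module_add[OF J] V.reduced_module_smult[OF J], simp add: V.reduced_module_simps(1))
    show "(\<lambda>v. ideal_smult R ?J V +>\<^bsub>V\<^esub> v) ` carrier V = carrier ?V" by (simp add: V.reduced_module_simps(1))
    fix m assume m: "m \<in> carrier V"
    have "ideal_smult R ?J V +>\<^bsub>V\<^esub> m = \<zero>\<^bsub>?V\<^esub> \<longleftrightarrow> ideal_smult R ?J V +>\<^bsub>V\<^esub> m = ideal_smult R ?J V +>\<^bsub>V\<^esub> \<zero>\<^bsub>V\<^esub>"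
      by (simp add: V.module_coset_zero[OF N] V.reduced_module_simps(3))
    also have "\<dots> \<longleftrightarrow> m \<in> ideal_smult R ?J V" using V.module_coset_eq_iff[OF N m V.zero_closed] m V.diff_add_cancel[OF m V.zero_closed] V.diff_closed[OF m V.zero_closed] by simp
    also have "\<dots> \<longleftrightarrow> (\<exists>m'\<in>carrier V. m = x \<odot>\<^bsub>V\<^esub> m')" unfolding V.ideal_smult_principal[OF xc] by auto
    finally show "ideal_smult R ?J V +>\<^bsub>V\<^esub> m = \<zero>\<^bsub>?V\<^esub> \<longleftrightarrow> (\<exists>m'\<in>carrier V. m = x \<odot>\<^bsub>V\<^esub> m')" .
  qed
  then obtain D' e' where r': "free_resolution ?A ?V b D' e'"
    and DD': "\<And>i v. v \<in> carrier (free_module R (b (Suc i))) \<Longrightarrow> D' i (red.pi (b (Suc i)) v) = red.pi (b i) (D i v)" by blast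
  let ?I = "image_ideal R ?J I"
  have I': "ideal_power ?A ?I k = (+>) ?J ` ideal_power R I k" for k
    unfolding image_ideal_def by (rule quot_ideal_power[OF J I_ideal])
  have Ii: "ideal ?I ?A" unfolding image_ideal_def by (rule ring_ideal_imp_quot_ideal[OF J I_ideal])
  have pw: "ideal (ideal_power R I k) R" for k by (rule ideal_power_ideal[OF I_ideal])
  have pw': "ideal ((+>) ?J ` ideal_power R I k) ?A" for k unfolding I'[symmetric] by (rule red.A.ideal_power_ideal[OF Ii])
  let ?E = "\<lambda>j k. module_length R (Ext R j V (quotient_module R (regular_module R) (ideal_power R I k)))"
  let ?e = "\<lambda>j k. module_length ?A (Ext ?A j ?V (quotient_module ?A (regular_module ?A) (ideal_power ?A ?I k)))"
  have E: "?E j k = chain_length (ext_subs R b D (cyclic_module (ideal_power R I k)) j)" for j k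
    using V.module_length_Ext[OF r cyclic_module_simps(5)[OF pw]] unfolding cyclic_module_def .
  have e: "?e j k = chain_length (ext_subs ?A b D' (red.A.cyclic_module ((+>) ?J ` ideal_power R I k)) j)" for j k
    using MA.module_length_Ext[OF r' red.A.cyclic_module_simps(5)[OF pw']] unfolding red.A.cyclic_module_def I' .
  \<comment> \<open>The truncated \<open>k - 1\<close> is right for \<open>k = 0\<close>: both
    powers are the whole ring.\<close>
  have colon_power: "x \<otimes> a \<in> ideal_power R I k \<longleftrightarrow> a \<in> ideal_power R I (k - 1)" if a: "a \<in> carrier R" for a k
  proof (cases k)
    case 0
    then show ?thesis using a xc by (simp add: ideal_power_0)
  next
    case (Suc n)
    have "a \<otimes> x \<in> ideal_power R I (Suc n)" if "a \<in> ideal_power R I n"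
      unfolding ideal_power_Suc by (rule ideal_prod.prod[OF that xI])
    then show ?thesis using superficial_regular[OF x a] a xc Suc by (auto simp: m_comm)
  qed
  have le: "?e j k \<le> ?E j k + ?E (Suc j) (k - 1)" for j k
    unfolding e E
    by (rule red.chain_length_ext_subs_cyclic_le[OF resolution_complex[OF r] resolution_complex[OF r'] DD' pw pw pw' colon_power])
  have "krull_dim ?A \<le> enat (d - 1)" by (rule krull_dim_quotient_superficial[OF x d(1)])
  \<comment> \<open>The bound makes the dimension of \<open>?A\<close> finite, so
    \<open>the_enat\<close> returns its actual value.\<close>
  then have dA: "the_enat (krull_dim ?A) \<le> d - 1" by (cases "krull_dim ?A") auto
  have dS: "the_enat (krull_dim R) = Suc (d - 1)" using d by simp
  show ?thesis unfolding Phi_def Let_def dS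
    by (rule weighted_sum_le[where e = ?e and E = ?E, OF le dA reduction_number_quotient_le[OF x]])
qed

theorem proposition5p10:
  fixes R :: "('a, 'r) ring_scheme"
    and M :: "('a, 'b, 'm) module_scheme"
    and I :: "'a set" and x :: 'a and d :: nat
  assumes "gorenstein_local_ring R"
    and "krull_dim R = enat d" and "d \<ge> 1"
    and "infinite (carrier (R Quot max_ideal R))"
    and "primary_ideal R I" and "radical R I = max_ideal R"
    and "cohen_macaulay_ring (associated_graded R I)"
    and "maximal_cohen_macaulay_module R M"
    and "x \<in> I" and "x \<notin> ideal_power R I 2"
    and "superficial R I x"
  shows "Phi R I M \<ge>
    Phi (R Quot (PIdl\<^bsub>R\<^esub> x)) (image_ideal R (PIdl\<^bsub>R\<^esub> x) I) (reduced_module R (PIdl\<^bsub>R\<^esub> x) M)"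
  by (rule graded_cm.Phi_reduction_le[OF graded_cmI[OF assms(1-7)] assms(8) refl assms(2,3,11)])

end
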